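(* Let $N_0=1000$. There is a constant $\bar\epsilon>0$ such that the following holds. Let $(h,\psi)$ be a traveling wave solution of the gravity water waves system above a flat bottom on $\mathbb R^2$, $$\partial_t h=G(h)\psi,\qquad \partial_t\psi=-h-\tfrac12|\nabla\psi|^2+\frac{(G(h)\psi+\nabla h\cdot\nabla\psi)^2}{2(1+|\nabla h|^2)},$$ i.e. a solution of the form $h(t,x)=h_0(x-ct)$, $\psi(t,x)=\psi_0(x-ct)$ for some $c\in\mathbb R^2$, with $$\|h_0\|_{H^{N_0+1/2}}+\|\Lambda\psi_0\|_{H^{N_0}}+\|(h_0,\Lambda\psi_0)\|_{Z}+\|\mathcal F[(h_0,\Lambda\psi_0)](\xi)\|_{L^\infty_\xi}\le\bar\epsilon .$$ Then $h_0=0$ and $\Lambda\psi_0=0$; that is, there is no nontrivial traveling wave below the smallness level $\bar\epsilon$.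
   Context: Unknowns: $h,\psi:[0,\infty)\times\mathbb R^2\to\mathbb R$, with $(h,\Lambda\psi)\in C^0([0,\infty);H^{N_0}\times H^{N_0})$. Dirichlet--Neumann operator: given $h$ (small) and $\psi$, let $\phi$ solve $(\Delta_x+\partial_y^2)\phi=0$ in $\{(x,y):x\in\mathbb R^2,-1\le y\le h(x)\}$, $\phi(x,h(x))=\psi(x)$, $\partial_y\phi(x,-1)=0$; then $G(h)\psi=[\partial_y\phi-\nabla h\cdot\nabla_x\phi]\big|_{y=h(x)}$. $\Lambda:=\sqrt{|\nabla|\tanh|\nabla|}$. $\mathcal F f(\xi)=\int e^{-ix\cdot\xi}f(x)\,dx$. Fix an even smooth $\tilde\psi:\mathbb R\to[0,1]$ supported in $[-3/2,3/2]$, equal to $1$ on $[-5/4,5/4]$; $\psi_k(x)=\tilde\psi(|x|/2^k)-\tilde\psi(|x|/2^{k-1})$, $\psi_{\le k}(x)=\tilde\psi(|x|/2^k)$. $P_k$ is the Fourier multiplier with symbol $\psi_k(\xi)$; $k_-:=\min\{k,0\}$; $\varphi_j^k=\psi_{\le -k_-}$ if $j=-k_-$ and $\varphi_j^k=\psi_j$ if $j>-k_-$. With $\alpha=1/10$: $\|f\|_{B_{k,j}}:=2^{\alpha k}(1+2^{6k})2^{j}\|\varphi_j^k\cdot P_kf\|_{L^2}$, $\|f\|_Z:=\sup_{k\in\mathbb Z}\sum_{j\ge\max\{-k,0\}}\|f\|_{B_{k,j}}$. The norm of a pair is the sum of the norms of its components. *)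

theory Defs
  imports "HOL-Analysis.Analysis" "HOL-Probability.Essential_Supremum"
begin

subsection \<open>The Fourier transform on \<open>L\<^sup>2\<close> of the plane\<close>

type_synonym R2 = "real ^ 2"

definition square_integrable :: "(R2 \<Rightarrow> complex) \<Rightarrow> bool" where
  "square_integrable f \<longleftrightarrow>
     f \<in> borel_measurable lborel \<and> integrable lborel (\<lambda>x. (cmod (f x))\<^sup>2)"

definition L2_norm :: "(R2 \<Rightarrow> complex) \<Rightarrow> ennreal" where
  "L2_norm f =
     (if square_integrable f then ennreal (sqrt (LINT x|lborel. (cmod (f x))\<^sup>2)) else top)"

definition fourier_integral :: "(R2 \<Rightarrow> complex) \<Rightarrow> R2 \<Rightarrow> complex" where
  "fourier_integral f \<xi> = (LINT x|lborel. exp (- \<i> * complex_of_real (x \<bullet> \<xi>)) * f x)"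

text \<open>
  A function in \<open>L\<^sup>2\<close> need not be integrable, so its Fourier transform is the \<open>L\<^sup>2\<close> limit of the
  Fourier integrals of its truncations to balls (Plancherel); it is determined up to null sets.
\<close>

definition has_fourier_transform :: "(R2 \<Rightarrow> complex) \<Rightarrow> (R2 \<Rightarrow> complex) \<Rightarrow> bool" where
  "has_fourier_transform f g \<longleftrightarrow>
     square_integrable f \<and> square_integrable g \<and>
     ((\<lambda>R. \<integral>\<^sup>+\<xi>. ennreal ((cmod (fourier_integral (\<lambda>x. indicator (cball 0 R) x * f x) \<xi> - g \<xi>))\<^sup>2) \<partial>lborel)
        \<longlongrightarrow> 0) at_top"

text \<open>
  The next two constants are meaningful for square integrable arguments only; in the theorem this
  is guaranteed by the Sobolev norms, which are infinite outside \<open>L\<^sup>2\<close>.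
\<close>

definition fourier :: "(R2 \<Rightarrow> complex) \<Rightarrow> R2 \<Rightarrow> complex" where
  "fourier f = (SOME g. has_fourier_transform f g)"

definition inverse_fourier :: "(R2 \<Rightarrow> complex) \<Rightarrow> R2 \<Rightarrow> complex" where
  "inverse_fourier g x = fourier g (- x) / complex_of_real ((2 * pi)\<^sup>2)"

definition fourier_multiplier :: "(R2 \<Rightarrow> real) \<Rightarrow> (R2 \<Rightarrow> complex) \<Rightarrow> R2 \<Rightarrow> complex" where
  "fourier_multiplier m f = inverse_fourier (\<lambda>\<xi>. complex_of_real (m \<xi>) * fourier f \<xi>)"

text \<open>Used for \<open>s \<ge> 0\<close> only; the factor makes \<open>sobolev_norm 0\<close> the \<open>L\<^sup>2\<close> norm.\<close>

definition sobolev_norm :: "real \<Rightarrow> (R2 \<Rightarrow> complex) \<Rightarrow> ennreal" where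
  "sobolev_norm s f =
     (if square_integrable f
      then ennreal (1 / (2 * pi)) *
           L2_norm (\<lambda>\<xi>. complex_of_real ((1 + (norm \<xi>)\<^sup>2) powr (s / 2)) * fourier f \<xi>)
      else top)"

definition fourier_Linf_norm :: "(R2 \<Rightarrow> complex) \<Rightarrow> ennreal" where
  "fourier_Linf_norm f = esssup lborel (\<lambda>\<xi>. ennreal (cmod (fourier f \<xi>)))"


subsection \<open>Littlewood--Paley cutoffs and the \<open>Z\<close> norm\<close>

definition admissible_cutoff :: "(real \<Rightarrow> real) \<Rightarrow> bool" where
  "admissible_cutoff \<theta> \<longleftrightarrow>
     (\<forall>n x. (deriv ^^ n) \<theta> field_differentiable at x) \<and>
     (\<forall>x. \<theta> (- x) = \<theta> x) \<and>
     (\<forall>x. 0 \<le> \<theta> x \<and> \<theta> x \<le> 1) \<and>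
     (\<forall>x. \<bar>x\<bar> > 3 / 2 \<longrightarrow> \<theta> x = 0) \<and>
     (\<forall>x. \<bar>x\<bar> \<le> 5 / 4 \<longrightarrow> \<theta> x = 1)"

definition cutoff_le :: "(real \<Rightarrow> real) \<Rightarrow> int \<Rightarrow> R2 \<Rightarrow> real" where
  "cutoff_le \<theta> k x = \<theta> (norm x / 2 powi k)"

definition cutoff_at :: "(real \<Rightarrow> real) \<Rightarrow> int \<Rightarrow> R2 \<Rightarrow> real" where
  "cutoff_at \<theta> k x = \<theta> (norm x / 2 powi k) - \<theta> (norm x / 2 powi (k - 1))"

definition LP_proj :: "(real \<Rightarrow> real) \<Rightarrow> int \<Rightarrow> (R2 \<Rightarrow> complex) \<Rightarrow> R2 \<Rightarrow> complex" where
  "LP_proj \<theta> k = fourier_multiplier (cutoff_at \<theta> k)"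

definition space_cutoff :: "(real \<Rightarrow> real) \<Rightarrow> int \<Rightarrow> int \<Rightarrow> R2 \<Rightarrow> real" where
  "space_cutoff \<theta> k j =
     (if j = - min k 0 then cutoff_le \<theta> (- min k 0) else cutoff_at \<theta> j)"

definition B_norm :: "(real \<Rightarrow> real) \<Rightarrow> int \<Rightarrow> int \<Rightarrow> (R2 \<Rightarrow> complex) \<Rightarrow> ennreal" where
  "B_norm \<theta> k j f =
     ennreal (2 powr (1 / 10 * real_of_int k) * (1 + 2 powi (6 * k)) * 2 powi j) *
     L2_norm (\<lambda>x. complex_of_real (space_cutoff \<theta> k j x) * LP_proj \<theta> k f x)"

definition Z_norm :: "(real \<Rightarrow> real) \<Rightarrow> (R2 \<Rightarrow> complex) \<Rightarrow> ennreal" where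
  "Z_norm \<theta> f = (SUP k::int. \<Sum>\<^sub>\<infinity>j\<in>{max (- k) 0..}. B_norm \<theta> k j f)"


subsection \<open>The operator \<open>\<Lambda>\<close>\<close>

definition grad :: "(R2 \<Rightarrow> real) \<Rightarrow> R2 \<Rightarrow> R2" where
  "grad f x = (THE v. GDERIV f x :> v)"

definition Lambda_symbol :: "R2 \<Rightarrow> real" where
  "Lambda_symbol \<xi> = sqrt (norm \<xi> * tanh (norm \<xi>))"

text \<open>
  \<open>\<Lambda>\<psi> \<in> L\<^sup>2\<close> does not force \<open>\<psi> \<in> L\<^sup>2\<close>: \<open>\<Lambda>\<close> annihilates constants and its symbol vanishes like
  \<open>|\<xi>|\<close> at the origin. So the Fourier transform \<open>m\<close> of \<open>\<psi>\<close> is taken modulo constants, from the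
  requirement that \<open>\<i> \<xi> m(\<xi>)\<close> be the Fourier transform of \<open>\<nabla>\<psi> \<in> L\<^sup>2\<close>. Since \<open>|\<xi>| / Lambda_symbol \<xi>\<close>
  is bounded near the origin and grows like \<open>|\<xi>|\<^bsup>1/2\<^esup>\<close>, one has \<open>\<nabla>\<psi> \<in> L\<^sup>2\<close> as soon as
  \<open>\<Lambda>\<psi> \<in> H\<^bsup>1/2\<^esup>\<close>.
\<close>

definition has_fourier_mod_const :: "(R2 \<Rightarrow> real) \<Rightarrow> (R2 \<Rightarrow> complex) \<Rightarrow> bool" where
  "has_fourier_mod_const \<psi> m \<longleftrightarrow>
     m \<in> borel_measurable lborel \<and> \<psi> differentiable_on UNIV \<and>
     (\<forall>i. has_fourier_transform (\<lambda>x. complex_of_real (grad \<psi> x $ i))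
                                (\<lambda>\<xi>. \<i> * complex_of_real (\<xi> $ i) * m \<xi>))"

definition is_Lambda :: "(R2 \<Rightarrow> real) \<Rightarrow> (R2 \<Rightarrow> real) \<Rightarrow> bool" where
  "is_Lambda \<psi> f \<longleftrightarrow>
     (\<exists>m. has_fourier_mod_const \<psi> m \<and>
          has_fourier_transform (\<lambda>x. complex_of_real (f x))
                                (\<lambda>\<xi>. complex_of_real (Lambda_symbol \<xi>) * m \<xi>))"


subsection \<open>The Dirichlet--Neumann operator\<close>

definition fluid_domain :: "(R2 \<Rightarrow> real) \<Rightarrow> (R2 \<times> real) set" where
  "fluid_domain h = {(x, y). - 1 \<le> y \<and> y \<le> h x}"

text \<open>
  \<open>D\<close> is the full gradient \<open>(\<nabla>\<^sub>x\<phi>, \<partial>\<^sub>y\<phi>)\<close>, one-sided at the boundary; its divergence in the interior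
  is the Laplacian of \<open>\<phi>\<close>. Finiteness of the Dirichlet energy selects the solution: without a
  condition at infinity, \<open>\<phi>\<close> is not unique (for \<open>h = 0\<close> one could add
  \<open>exp (\<pi> x\<^sub>1 / 2) cos (\<pi> (y + 1) / 2)\<close>). For \<open>h = 0\<close> the energy equals \<open>\<parallel>\<Lambda>\<psi>\<parallel>\<^sup>2\<close> in \<open>L\<^sup>2\<close>.
\<close>

definition velocity_potential ::
    "(R2 \<Rightarrow> real) \<Rightarrow> (R2 \<Rightarrow> real) \<Rightarrow> (R2 \<times> real \<Rightarrow> real) \<Rightarrow> (R2 \<times> real \<Rightarrow> R2 \<times> real) \<Rightarrow> bool" where
  "velocity_potential h \<psi> \<phi> D \<longleftrightarrow>
     (\<forall>x. - 1 < h x) \<and>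
     continuous_on (fluid_domain h) D \<and>
     (\<forall>p\<in>fluid_domain h. (\<phi> has_derivative (\<lambda>v. D p \<bullet> v)) (at p within fluid_domain h)) \<and>
     (\<forall>x y. - 1 < y \<and> y < h x \<longrightarrow>
        (\<exists>H. (D has_derivative H) (at (x, y)) \<and> (\<Sum>b\<in>Basis. H b \<bullet> b) = 0)) \<and>
     (\<forall>x. \<phi> (x, h x) = \<psi> x) \<and>
     (\<forall>x. snd (D (x, - 1)) = 0) \<and>
     (\<integral>\<^sup>+p\<in>fluid_domain h. ennreal ((norm (D p))\<^sup>2) \<partial>lborel) < \<infinity>"

definition is_dirichlet_neumann :: "(R2 \<Rightarrow> real) \<Rightarrow> (R2 \<Rightarrow> real) \<Rightarrow> (R2 \<Rightarrow> real) \<Rightarrow> bool" where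
  "is_dirichlet_neumann h \<psi> g \<longleftrightarrow>
     (\<exists>\<phi> D. velocity_potential h \<psi> \<phi> D \<and>
        (\<forall>x. g x = snd (D (x, h x)) - grad h x \<bullet> fst (D (x, h x))))"


subsection \<open>The gravity water waves system\<close>

definition N0 :: nat where
  "N0 = 1000"

definition continuous_in_sobolev :: "real \<Rightarrow> (real \<Rightarrow> R2 \<Rightarrow> real) \<Rightarrow> bool" where
  "continuous_in_sobolev s u \<longleftrightarrow>
     (\<forall>t\<ge>0. sobolev_norm s (\<lambda>x. complex_of_real (u t x)) < \<infinity> \<and>
        ((\<lambda>t'. sobolev_norm s (\<lambda>x. complex_of_real (u t' x - u t x))) \<longlongrightarrow> 0)
          (at t within {0..}))"

definition water_waves_solution :: "(real \<Rightarrow> R2 \<Rightarrow> real) \<Rightarrow> (real \<Rightarrow> R2 \<Rightarrow> real) \<Rightarrow> bool" where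
  "water_waves_solution h \<psi> \<longleftrightarrow>
     continuous_in_sobolev (real N0) h \<and>
     (\<exists>f. (\<forall>t\<ge>0. is_Lambda (\<psi> t) (f t)) \<and> continuous_in_sobolev (real N0) f) \<and>
     (\<forall>t\<ge>0. h t differentiable_on UNIV \<and> \<psi> t differentiable_on UNIV \<and>
        (\<exists>g. is_dirichlet_neumann (h t) (\<psi> t) g \<and>
          (\<forall>x. ((\<lambda>s. h s x) has_real_derivative g x) (at t within {0..}) \<and>
               ((\<lambda>s. \<psi> s x) has_real_derivative
                  (- h t x - 1 / 2 * (norm (grad (\<psi> t) x))\<^sup>2
                   + (g x + grad (h t) x \<bullet> grad (\<psi> t) x)\<^sup>2
                       / (2 * (1 + (norm (grad (h t) x))\<^sup>2))))
                 (at t within {0..}))))"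

definition traveling_wave_solution ::
    "(R2 \<Rightarrow> real) \<Rightarrow> (R2 \<Rightarrow> real) \<Rightarrow> R2 \<Rightarrow> bool" where
  "traveling_wave_solution h\<^sub>0 \<psi>\<^sub>0 c \<longleftrightarrow>
     water_waves_solution (\<lambda>t x. h\<^sub>0 (x - t *\<^sub>R c)) (\<lambda>t x. \<psi>\<^sub>0 (x - t *\<^sub>R c))"

end

theory Submission
  imports Defs "HOL-Probability.Sinc_Integral"
begin

text \<open>The wave is excluded by Pohozaev identities. Write \<open>D\<close> for the gradient of the velocity
  potential and \<open>c\<close> for the speed. On the surface \<open>D \<bullet> n = c \<bullet> n\<close> and \<open>h + |D|\<^sup>2/2 = c \<bullet> D\<close>, so that
  \<open>h\<close> is bounded, and the momentum flux
  \<open>T\<^sub>k = D\<^sub>k D + (c \<bullet> D - |D|\<^sup>2/2 - y) e\<^sub>k - D\<^sub>k c\<close> (\<open>k = 1, 2\<close>) is divergence-free in the fluid and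
  tangential to its boundary. Testing it with \<open>x\<^sub>l\<close>, cut off at radius \<open>N \<longlonglongrightarrow> \<infinity>\<close>, yields the Pohozaev
  identities, with \<open>E\<^sub>k\<^sub>l = \<integral>\<integral>D\<^sub>k D\<^sub>l\<close>, \<open>E\<^sub>v = \<integral>\<integral>D\<^sub>y\<^sup>2\<close>, \<open>Q = \<integral>h \<nabla>\<psi>\<close>, \<open>V = \<integral>h\<^sup>2\<close>, \<open>K = tr E + E\<^sub>v\<close>,
  \<open>E\<^sub>k\<^sub>l - c\<^sub>l Q\<^sub>k + \<delta>\<^sub>k\<^sub>l (c \<bullet> Q - K/2 - V/2) = 0\<close>,
  while testing mass conservation with the potential yields \<open>K = c \<bullet> Q\<close>; so \<open>K = 0\<close> if \<open>c = 0\<close>. The trace gives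
  \<open>V = tr E\<close>, and contracting with \<open>c\<close> twice gives \<open>c \<bullet> E c = |c|\<^sup>2 (tr E + E\<^sub>v/2)\<close>. As
  \<open>c \<bullet> E c \<le> |c|\<^sup>2 tr E\<close>, for \<open>c \<noteq> 0\<close> the flow is parallel to \<open>c\<close> and independent of height, hence constant,
  hence zero, since the energy is finite and the volume is not.

  The surface is only known to be differentiable, so no integral may contain \<open>\<nabla>h\<close>. The divergence
  theorem is therefore proved by bisection, as in Goursat's lemma.\<close>

subsection \<open>Flux through boxes of a pointwise divergence-free field\<close>

text \<open>The obstacle is low regularity joined with missing decay. D is continuous up to the
  boundary but differentiable only inside the fluid, with no continuity of its derivative; and it is
  merely in L^2 over a set of infinite volume, so the mass flux \<open>M k\<close>, the column
  integral of D_k, need not be integrable over the plane. Up to the gradient of a function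
  \<open>w\<close>, however, \<open>M\<close> is h \<nabla>\<psi>, a product of two L^2 functions.
  In the momentum balance that gradient enters only through a null form, in the energy balance only
  through the gradient of \<eta> (w - m); both integrate to zero, which is why \<open>Q\<close> is
  built from h \<nabla>\<psi>. The potential is not known to decay either: it is normalised on each
  square separately, and a Poincare inequality pays for the gradient of the cutoff. Test functions
  depend on the horizontal variables alone, which keeps the conditions at top and bottom intact.
  Finally \<Lambda>\<psi> is tied to \<psi> only through the transform of \<nabla>\<psi>, so that
  passing from \<nabla>\<psi> = 0 to \<Lambda>\<psi> = 0 calls for injectivity of the Fourier
  transform on L^2.\<close>

lemma cbox_dyadic_subset:
  fixes p v :: "'a::euclidean_space"
  assumes "v \<in> cbox 0 One" "r > 0"
  shows "cbox (p + (r/2) *\<^sub>R v) (p + (r/2) *\<^sub>R v + (r/2) *\<^sub>R One) \<subseteq> cbox p (p + r *\<^sub>R One)"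
proof
  fix x assume x: "x \<in> cbox (p + (r/2) *\<^sub>R v) (p + (r/2) *\<^sub>R v + (r/2) *\<^sub>R One)"
  show "x \<in> cbox p (p + r *\<^sub>R One)"
    unfolding mem_box
  proof
    fix b :: 'a assume b: "b \<in> Basis"
    have v: "0 \<le> v \<bullet> b" "v \<bullet> b \<le> 1" using assms(1) b by (auto simp: mem_box)
    have "0 \<le> r * (v \<bullet> b)" "r * (v \<bullet> b) \<le> r * 1"
      using v assms(2) by (auto intro!: mult_left_mono)
    moreover have "p \<bullet> b + (r/2) * (v \<bullet> b) \<le> x \<bullet> b" "x \<bullet> b \<le> p \<bullet> b + (r/2) * (v \<bullet> b) + r/2"
      using x b by (auto simp: mem_box inner_simps)
    ultimately show "p \<bullet> b \<le> x \<bullet> b \<and> x \<bullet> b \<le> (p + r *\<^sub>R One) \<bullet> b"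
      using b by (simp add: inner_simps)
  qed
qed

text \<open>Goursat's argument with the geometry stripped off: a nonzero value at side r forces some
  subcube of half the side to keep the ratio of |\<Phi>| to the d-th power of the side above a fixed
  \<epsilon>, and the nested subcubes shrink to a point where \<open>loc\<close> is violated. The
  set \<open>V\<close> holds the lower corners of the subcubes in units of the half side. Only
  subadditivity of |\<Phi>| is demanded, and d is a scaling exponent, tied to the number of subcubes
  rather than to the dimension of the space.\<close>

lemma dyadic_bisection:
  fixes \<Phi> :: "'a::euclidean_space \<Rightarrow> real \<Rightarrow> real" and V :: "'a set"
  assumes V: "finite V" "card V \<le> 2 ^ d" "V \<subseteq> cbox 0 One"
    and add: "\<And>p r. r > 0 \<Longrightarrow> cbox p (p + r *\<^sub>R One) \<subseteq> K \<Longrightarrow>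
        \<bar>\<Phi> p r\<bar> \<le> (\<Sum>v\<in>V. \<bar>\<Phi> (p + (r/2) *\<^sub>R v) (r/2)\<bar>)"
    and loc: "\<And>x \<epsilon>. x \<in> K \<Longrightarrow> \<epsilon> > 0 \<Longrightarrow> \<exists>\<delta>>0. \<forall>p r. 0 < r \<longrightarrow> r < \<delta> \<longrightarrow>
        x \<in> cbox p (p + r *\<^sub>R One) \<longrightarrow> cbox p (p + r *\<^sub>R One) \<subseteq> K \<longrightarrow> \<bar>\<Phi> p r\<bar> \<le> \<epsilon> * r ^ d"
    and r: "r > 0" and pK: "cbox p (p + r *\<^sub>R One) \<subseteq> K"
  shows "\<Phi> p r = 0"
proof (rule ccontr)
  assume nz: "\<Phi> p r \<noteq> 0"
  \<comment> \<open>Half the initial ratio, so that the strict inequality in \<open>P\<close> holds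
    at the start.\<close>
  define \<epsilon> where "\<epsilon> = \<bar>\<Phi> p r\<bar> / (2 * r ^ d)"
  have \<epsilon>: "\<epsilon> > 0" using nz r by (simp add: \<epsilon>_def)
  define C where "C q s = cbox q (q + s *\<^sub>R One)" for q :: 'a and s
  define P where "P n q \<longleftrightarrow> C q (r / 2^n) \<subseteq> K \<and> \<epsilon> * (r / 2^n) ^ d < \<bar>\<Phi> q (r / 2^n)\<bar>" for n :: nat and q
  have P0: "P 0 p" using nz r pK by (simp add: P_def \<epsilon>_def C_def)
  have step: "\<exists>q'. P (Suc n) q' \<and> C q' (r / 2^Suc n) \<subseteq> C q (r / 2^n)" if "P n q" for n q
  proof -
    define s where "s = r / 2^n"
    have s: "s > 0" using r by (simp add: s_def)
    have sub: "C (q + (s/2) *\<^sub>R v) (s/2) \<subseteq> C q s" if "v \<in> V" for v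
      unfolding C_def using cbox_dyadic_subset[of v s q] that V(3) s by auto
    \<comment> \<open>Pigeonhole: otherwise at most 2^d subcubes, each contributing at most
      \<epsilon> (s/2)^d, would add up to at most \<epsilon> s^d.\<close>
    have "\<exists>v\<in>V. \<epsilon> * (s/2) ^ d < \<bar>\<Phi> (q + (s/2) *\<^sub>R v) (s/2)\<bar>"
    proof (rule ccontr)
      assume "\<not> ?thesis"
      then have "(\<Sum>v\<in>V. \<bar>\<Phi> (q + (s/2) *\<^sub>R v) (s/2)\<bar>) \<le> (\<Sum>v\<in>V. \<epsilon> * (s/2) ^ d)"
        by (intro sum_mono) (auto simp: not_less)
      also have "\<dots> = real (card V) * (\<epsilon> * (s/2) ^ d)" by simp
      also have "\<dots> \<le> 2 ^ d * (\<epsilon> * (s/2) ^ d)"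
      proof (rule mult_right_mono)
        show "real (card V) \<le> 2 ^ d" using V(2) by (metis of_nat_le_iff of_nat_numeral of_nat_power)
      qed (use \<epsilon> s in auto)
      also have "\<dots> = \<epsilon> * s ^ d" by (simp add: power_divide)
      finally have "(\<Sum>v\<in>V. \<bar>\<Phi> (q + (s/2) *\<^sub>R v) (s/2)\<bar>) \<le> \<epsilon> * s ^ d" .
      moreover have "\<bar>\<Phi> q s\<bar> \<le> (\<Sum>v\<in>V. \<bar>\<Phi> (q + (s/2) *\<^sub>R v) (s/2)\<bar>)"
        using add[OF s, of q] that by (simp add: P_def s_def C_def)
      ultimately show False using that by (simp add: P_def s_def)
    qed
    then obtain v where v: "v \<in> V" "\<epsilon> * (s/2) ^ d < \<bar>\<Phi> (q + (s/2) *\<^sub>R v) (s/2)\<bar>" by blast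
    have s2: "s / 2 = r / 2 ^ Suc n" by (simp add: s_def)
    show ?thesis
    proof (intro exI conjI)
      show "P (Suc n) (q + (s/2) *\<^sub>R v)"
        using v(2) sub[OF v(1)] that unfolding P_def s2[symmetric] by (auto simp: s_def)
      show "C (q + (s/2) *\<^sub>R v) (r / 2^Suc n) \<subseteq> C q (r / 2^n)"
        using sub[OF v(1)] unfolding s2[symmetric] by (simp add: s_def)
    qed
  qed
  obtain q where q: "\<And>n. P n (q n)" "\<And>n. C (q (Suc n)) (r / 2^Suc n) \<subseteq> C (q n) (r / 2^n)"
    using dependent_nat_choice[of P "\<lambda>n a b. C b (r / 2^Suc n) \<subseteq> C a (r / 2^n)"] P0 step by metis
  have ne: "q n \<in> C (q n) (r / 2^n)" for n
    using r by (auto simp: C_def mem_box inner_simps)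
  have "\<Inter>(range (\<lambda>n. C (q n) (r / 2^n))) \<noteq> {}"
  proof (rule compact_nest)
    show "C (q n) (r / 2^n) \<subseteq> C (q m) (r / 2^m)" if "m \<le> n" for m n
      using lift_Suc_antimono_le[of "\<lambda>n. C (q n) (r / 2^n)", OF _ that] q(2) by auto
  qed (use ne in \<open>auto simp: C_def\<close>)
  then obtain x where x: "\<And>n. x \<in> C (q n) (r / 2^n)" by auto
  have "x \<in> K" using x[of 0] q(1)[of 0] by (auto simp: P_def)
  from loc[OF this \<epsilon>] obtain \<delta> where \<delta>: "\<delta> > 0" and
    D: "\<And>p r. 0 < r \<Longrightarrow> r < \<delta> \<Longrightarrow> x \<in> C p r \<Longrightarrow> C p r \<subseteq> K \<Longrightarrow> \<bar>\<Phi> p r\<bar> \<le> \<epsilon> * r ^ d"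
    unfolding C_def by blast
  obtain n where n: "r / 2^n < \<delta>"
    using r \<delta> real_arch_pow[of 2 "r / \<delta>"] by (auto simp: field_simps)
  have "\<bar>\<Phi> (q n) (r/2^n)\<bar> \<le> \<epsilon> * (r/2^n) ^ d"
    using D[of "r/2^n" "q n"] n r x[of n] q(1)[of n] by (auto simp: P_def)
  then show False using q(1)[of n] by (simp add: P_def)
qed

section \<open>Iterated integrals of continuous functions on rectangles\<close>

abbreviation cont2 :: "(real \<Rightarrow> real \<Rightarrow> real) \<Rightarrow> bool" where
  "cont2 f \<equiv> continuous_on UNIV (\<lambda>z. f (fst z) (snd z))"

abbreviation cont3 :: "(real \<Rightarrow> real \<Rightarrow> real \<Rightarrow> real) \<Rightarrow> bool" where
  "cont3 f \<equiv> continuous_on UNIV (\<lambda>z. f (fst z) (fst (snd z)) (snd (snd z)))"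

abbreviation iterated :: "(real \<Rightarrow> real \<Rightarrow> real) \<Rightarrow> real \<Rightarrow> real \<Rightarrow> real \<Rightarrow> real \<Rightarrow> real" where
  "iterated f a a' b b' \<equiv> integral {a..a'} (\<lambda>s. integral {b..b'} (f s))"

lemma cont2_compose:
  assumes "cont2 f" "continuous_on S a" "continuous_on S b"
  shows "continuous_on S (\<lambda>x. f (a x) (b x))"
  using continuous_on_compose2[OF assms(1) continuous_on_Pair[OF assms(2,3)]] by simp

lemma cont3_compose:
  assumes "cont3 f" "continuous_on S a" "continuous_on S b" "continuous_on S c"
  shows "continuous_on S (\<lambda>x. f (a x) (b x) (c x))"
  using continuous_on_compose2[OF assms(1) continuous_on_Pair[OF assms(2) continuous_on_Pair[OF assms(3,4)]]]
  by simp

lemma continuous_on_integral_param: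
  fixes f :: "'a::topological_space \<Rightarrow> real \<Rightarrow> real"
  assumes "continuous_on UNIV (\<lambda>z. f (fst z) (snd z))"
  shows "continuous_on UNIV (\<lambda>x. integral {b..b'} (f x))"
  using integral_continuous_on_param[of UNIV b b' f] continuous_on_subset[OF assms]
  by (simp add: case_prod_unfold)

lemma cont2_integrable:
  assumes "cont2 f"
  shows "f s integrable_on {b..b'}" "(\<lambda>s. integral {b..b'} (f s)) integrable_on {a..a'}"
  by (auto intro!: integrable_continuous_real cont2_compose[OF assms] continuous_intros
      continuous_on_subset[OF continuous_on_integral_param[OF assms]])

lemma iterated_add:
  assumes "cont2 f" "cont2 g"
  shows "iterated (\<lambda>s t. f s t + g s t) a a' b b' = iterated f a a' b b' + iterated g a a' b b'"
  by (simp add: integral_add cont2_integrable[OF assms(1)] cont2_integrable[OF assms(2)])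

lemma iterated_split_fst:
  assumes "cont2 f" "a \<le> m" "m \<le> a'"
  shows "iterated f a a' b b' = iterated f a m b b' + iterated f m a' b b'"
  using Henstock_Kurzweil_Integration.integral_combine[OF assms(2,3) cont2_integrable(2)[OF assms(1)]] by simp

lemma iterated_split_snd:
  assumes "cont2 f" "b \<le> m" "m \<le> b'"
  shows "iterated f a a' b b' = iterated f a a' b m + iterated f a a' m b'"
  using Henstock_Kurzweil_Integration.integral_combine[OF assms(2,3) cont2_integrable(1)[OF assms(1)], symmetric]
  by (simp add: integral_add cont2_integrable[OF assms(1)])

lemma integral_approx_const:
  fixes g :: "real \<Rightarrow> real"
  assumes "continuous_on {a..b} g" "a \<le> b" "\<And>t. t \<in> {a..b} \<Longrightarrow> \<bar>g t - k\<bar> \<le> e"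
  shows "\<bar>integral {a..b} g - k * (b - a)\<bar> \<le> e * (b - a)"
proof -
  have "integral {a..b} (\<lambda>t. g t - k) = integral {a..b} g - k * (b - a)"
    using assms by (simp add: integral_diff integrable_continuous_real)
  moreover have "norm (integral {a..b} (\<lambda>t. g t - k)) \<le> e * (b - a)"
    using assms by (intro integral_bound continuous_intros) auto
  ultimately show ?thesis by simp
qed

lemma iterated_approx_const:
  assumes "cont2 f" "a \<le> a'" "b \<le> b'"
    and "\<And>s t. s \<in> {a..a'} \<Longrightarrow> t \<in> {b..b'} \<Longrightarrow> \<bar>f s t - k\<bar> \<le> e"
  shows "\<bar>iterated f a a' b b' - k * (b' - b) * (a' - a)\<bar> \<le> e * (b' - b) * (a' - a)"
proof (rule integral_approx_const)
  show "continuous_on {a..a'} (\<lambda>s. integral {b..b'} (f s))"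
    using continuous_on_integral_param[OF assms(1)] continuous_on_subset by blast
  show "\<bar>integral {b..b'} (f s) - k * (b' - b)\<bar> \<le> e * (b' - b)" if "s \<in> {a..a'}" for s
    using that assms by (intro integral_approx_const cont2_compose[OF assms(1)] continuous_intros) auto
qed (use assms in auto)

text \<open>Outward flux minus the integral of the prescribed divergence f. The volume integral is
  absorbed into the pair of horizontal faces, so that each of the three summands is an iterated
  integral of one continuous function of two variables and integrals over the solid box never
  occur.\<close>

definition box_flux ::
  "(real \<Rightarrow> real \<Rightarrow> real \<Rightarrow> real) \<Rightarrow> (real \<Rightarrow> real \<Rightarrow> real \<Rightarrow> real) \<Rightarrow> (real \<Rightarrow> real \<Rightarrow> real \<Rightarrow> real) \<Rightarrow>
   (real \<Rightarrow> real \<Rightarrow> real \<Rightarrow> real) \<Rightarrow> real \<Rightarrow> real \<Rightarrow> real \<Rightarrow> real \<Rightarrow> real \<Rightarrow> real \<Rightarrow> real" where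
  "box_flux F1 F2 F3 f a a' b b' c c' =
     iterated (\<lambda>t u. F1 a' t u - F1 a t u) b b' c c' +
     iterated (\<lambda>s u. F2 s b' u - F2 s b u) a a' c c' +
     iterated (\<lambda>s t. F3 s t c' - F3 s t c - integral {c..c'} (f s t)) a a' b b'"

text \<open>Continuity is asked on the whole space so that no face needs a domain check; fields
  living on the fluid domain are later brought into this form by clamping the height.\<close>

locale box_field =
  fixes F1 F2 F3 f :: "real \<Rightarrow> real \<Rightarrow> real \<Rightarrow> real"
  assumes cF1: "cont3 F1" and cF2: "cont3 F2" and cF3: "cont3 F3" and cf: "cont3 f"
begin

lemma cont2_integral_f: "continuous_on S (\<lambda>z. integral {c..c'} (f (fst z) (snd z)))"
  using continuous_on_integral_param[of "\<lambda>z. f (fst z) (snd z)"]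
  by (intro continuous_on_subset[where s=UNIV and t=S] continuous_on_integral_param)
     (auto intro!: cont3_compose[OF cf] continuous_intros)

lemma flux_cont:
  "cont2 (\<lambda>t u. F1 a' t u - F1 a t u)"
  "cont2 (\<lambda>s u. F2 s b' u - F2 s b u)"
  "cont2 (\<lambda>s t. F3 s t c' - F3 s t c - integral {c..c'} (f s t))"
  by (intro continuous_intros cont3_compose[OF cF1] cont3_compose[OF cF2] cont3_compose[OF cF3]
      cont2_integral_f)+

lemma box_flux_split1:
  assumes "a \<le> m" "m \<le> a'"
  shows "box_flux F1 F2 F3 f a a' b b' c c' =
    box_flux F1 F2 F3 f a m b b' c c' + box_flux F1 F2 F3 f m a' b b' c c'"
  unfolding box_flux_def iterated_split_fst[OF flux_cont(2) assms]
    iterated_split_fst[OF flux_cont(3) assms]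
  using iterated_add[OF flux_cont(1)[of m a] flux_cont(1)[of a' m], of b b' c c'] by simp

lemma box_flux_split2:
  assumes "b \<le> m" "m \<le> b'"
  shows "box_flux F1 F2 F3 f a a' b b' c c' =
    box_flux F1 F2 F3 f a a' b m c c' + box_flux F1 F2 F3 f a a' m b' c c'"
  unfolding box_flux_def iterated_split_fst[OF flux_cont(1) assms]
    iterated_split_snd[OF flux_cont(3) assms]
  using iterated_add[OF flux_cont(2)[of m b] flux_cont(2)[of b' m], of a a' c c'] by simp

lemma box_flux_split3:
  assumes "c \<le> m" "m \<le> c'"
  shows "box_flux F1 F2 F3 f a a' b b' c c' =
    box_flux F1 F2 F3 f a a' b b' c m + box_flux F1 F2 F3 f a a' b b' m c'"
proof -
  have i: "integral {c..c'} (f s t) = integral {c..m} (f s t) + integral {m..c'} (f s t)" for s t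
    by (rule Henstock_Kurzweil_Integration.integral_combine[symmetric, OF assms])
       (auto intro!: integrable_continuous_real cont3_compose[OF cf] continuous_intros)
  have e: "(\<lambda>t. (F3 s t m - F3 s t c - integral {c..m} (f s t)) + (F3 s t c' - F3 s t m - integral {m..c'} (f s t)))
     = (\<lambda>t. F3 s t c' - F3 s t c - integral {c..c'} (f s t))" for s
    by (simp add: i fun_eq_iff)
  show ?thesis
    unfolding box_flux_def iterated_split_snd[OF flux_cont(1) assms]
      iterated_split_snd[OF flux_cont(2) assms]
    using iterated_add[OF flux_cont(3)[of m c] flux_cont(3)[of c' m], of a a' b b', unfolded e]
    by linarith
qed

text \<open>The eight terms stand in the lexicographic order of the corners in {0, 1}^3, which lets
  the bisection match them with the sum over \<open>V\<close> term by term.\<close>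

lemma abs_box_flux_split8:
  assumes a: "a \<le> m" "m \<le> a'" and b: "b \<le> n" "n \<le> b'" and c: "c \<le> l" "l \<le> c'"
  shows "\<bar>box_flux F1 F2 F3 f a a' b b' c c'\<bar> \<le>
    \<bar>box_flux F1 F2 F3 f a m b n c l\<bar> + \<bar>box_flux F1 F2 F3 f a m b n l c'\<bar> +
    \<bar>box_flux F1 F2 F3 f a m n b' c l\<bar> + \<bar>box_flux F1 F2 F3 f a m n b' l c'\<bar> +
    \<bar>box_flux F1 F2 F3 f m a' b n c l\<bar> + \<bar>box_flux F1 F2 F3 f m a' b n l c'\<bar> +
    \<bar>box_flux F1 F2 F3 f m a' n b' c l\<bar> + \<bar>box_flux F1 F2 F3 f m a' n b' l c'\<bar>"
proof -
  have 3: "\<bar>box_flux F1 F2 F3 f x x' y y' c c'\<bar> \<le>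
      \<bar>box_flux F1 F2 F3 f x x' y y' c l\<bar> + \<bar>box_flux F1 F2 F3 f x x' y y' l c'\<bar>" for x x' y y'
    unfolding box_flux_split3[OF c] by (rule abs_triangle_ineq)
  have 2: "\<bar>box_flux F1 F2 F3 f x x' b b' c c'\<bar> \<le>
      \<bar>box_flux F1 F2 F3 f x x' b n c c'\<bar> + \<bar>box_flux F1 F2 F3 f x x' n b' c c'\<bar>" for x x'
    unfolding box_flux_split2[OF b] by (rule abs_triangle_ineq)
  have "\<bar>box_flux F1 F2 F3 f a a' b b' c c'\<bar> \<le>
      \<bar>box_flux F1 F2 F3 f a m b b' c c'\<bar> + \<bar>box_flux F1 F2 F3 f m a' b b' c c'\<bar>"
    unfolding box_flux_split1[OF a] by (rule abs_triangle_ineq)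
  from order_trans[OF this add_mono[OF order_trans[OF 2 add_mono[OF 3 3]] order_trans[OF 2 add_mono[OF 3 3]]]]
  show ?thesis by (simp only: add.assoc)
qed

end

section \<open>Vanishing flux of fields with a pointwise prescribed divergence\<close>

lemma One_prod: "(One :: 'a::euclidean_space \<times> 'b::euclidean_space) = (One, One)"
proof (rule euclidean_eqI)
  fix i :: "'a \<times> 'b" assume i: "i \<in> Basis"
  then have "One \<bullet> i = 1" by simp
  moreover have "(One :: 'a, One :: 'b) \<bullet> i = 1" using i by (auto simp: Basis_prod_def)
  ultimately show "One \<bullet> i = (One :: 'a, One :: 'b) \<bullet> i" by simp
qed

lemma mem_cbox_cube3:
  "(s, t, u) \<in> cbox p (p + r *\<^sub>R One) \<longleftrightarrow>
     fst p \<le> s \<and> s \<le> fst p + r \<and> fst (snd p) \<le> t \<and> t \<le> fst (snd p) + r \<and>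
     snd (snd p) \<le> u \<and> u \<le> snd (snd p) + (r::real)" for s t u :: real
  by (cases p; cases "snd p") (auto simp: One_prod cbox_Pair_eq)

lemma has_derivative_box_bound:
  fixes F :: "real \<Rightarrow> real \<Rightarrow> real \<Rightarrow> real"
  assumes der: "((\<lambda>z. F (fst z) (fst (snd z)) (snd (snd z))) has_derivative A) (at (s0, t0, u0))"
    and e: "e > 0" and k: "k > 0"
  shows "\<exists>\<delta>>0. \<forall>r s t u. 0 < r \<longrightarrow> r < \<delta> \<longrightarrow> \<bar>s - s0\<bar> \<le> r \<longrightarrow> \<bar>t - t0\<bar> \<le> r \<longrightarrow> \<bar>u - u0\<bar> \<le> k * r \<longrightarrow>
      \<bar>F s t u - F s0 t0 u0 - A (s - s0, t - t0, u - u0)\<bar> \<le> e * r"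
proof -
  \<comment> \<open>All points considered lie within (2 + k) r of the base point.\<close>
  define e' where "e' = e / (2 + k)"
  have e': "e' > 0" using e k by (simp add: e'_def)
  from der[unfolded has_derivative_at_alt] e' obtain d where d: "d > 0"
    and D: "\<And>z. norm (z - (s0, t0, u0)) < d \<Longrightarrow>
      norm (F (fst z) (fst (snd z)) (snd (snd z)) - F s0 t0 u0 - A (z - (s0, t0, u0))) \<le> e' * norm (z - (s0, t0, u0))"
    by (auto simp del: norm_Pair)
  show ?thesis
  proof (intro exI[of _ "d / (2 + k)"] conjI allI impI)
    show "d / (2 + k) > 0" using d k by simp
    fix r s t u :: real
    assume r: "0 < r" "r < d / (2 + k)" and b: "\<bar>s - s0\<bar> \<le> r" "\<bar>t - t0\<bar> \<le> r" "\<bar>u - u0\<bar> \<le> k * r"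
    have "norm ((s, t, u) - (s0, t0, u0)) \<le> norm (s - s0) + norm (t - t0, u - u0)"
      using norm_Pair_le[of "s - s0" "(t - t0, u - u0)"] by simp
    also have "\<dots> \<le> \<bar>s - s0\<bar> + (\<bar>t - t0\<bar> + \<bar>u - u0\<bar>)"
      using norm_Pair_le[of "t - t0" "u - u0"] by simp
    also have "\<dots> \<le> (2 + k) * r" using b by (simp add: algebra_simps)
    finally have n: "norm ((s, t, u) - (s0, t0, u0)) \<le> (2 + k) * r" .
    also have "\<dots> < d" using r k by (simp add: field_simps)
    finally have "norm (F s t u - F s0 t0 u0 - A ((s, t, u) - (s0, t0, u0))) \<le> e' * norm ((s, t, u) - (s0, t0, u0))"
      using D[of "(s,t,u)"] by simp
    also have "\<dots> \<le> e' * ((2 + k) * r)" using n e' by (intro mult_left_mono) auto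
    also have "\<dots> = e * r" using k by (simp add: e'_def)
    finally show "\<bar>F s t u - F s0 t0 u0 - A (s - s0, t - t0, u - u0)\<bar> \<le> e * r" by simp
  qed
qed

context box_field
begin

text \<open>On opposite faces the linearisations at the base point differ only by the shift across
  the box, so each pair of faces leaves a partial derivative times the volume. The sum is the
  divergence times the volume and cancels against f; the errors are o(r) per point of a face, hence
  o(r^3) in total. Differentiability at the single base point carries the estimate. The factor k
  keeps the aspect ratio free, since the boxes below a piece of surface are not cubes.\<close>

lemma box_flux_small:
  assumes k: "k > 0" and e: "e > 0"
    and der1: "((\<lambda>z. F1 (fst z) (fst (snd z)) (snd (snd z))) has_derivative A1) (at (s0, t0, u0))"
    and der2: "((\<lambda>z. F2 (fst z) (fst (snd z)) (snd (snd z))) has_derivative A2) (at (s0, t0, u0))"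
    and der3: "((\<lambda>z. F3 (fst z) (fst (snd z)) (snd (snd z))) has_derivative A3) (at (s0, t0, u0))"
    and div: "A1 (1, 0, 0) + A2 (0, 1, 0) + A3 (0, 0, 1) = f s0 t0 u0"
  shows "\<exists>\<delta>>0. \<forall>r a b c. 0 < r \<longrightarrow> r < \<delta> \<longrightarrow> a \<le> s0 \<longrightarrow> s0 \<le> a + r \<longrightarrow> b \<le> t0 \<longrightarrow> t0 \<le> b + r \<longrightarrow>
      c \<le> u0 \<longrightarrow> u0 \<le> c + k * r \<longrightarrow> \<bar>box_flux F1 F2 F3 f a (a + r) b (b + r) c (c + k * r)\<bar> \<le> e * r ^ 3"
proof -
  \<comment> \<open>The three pairs of faces contribute errors of \<open>2 * k\<close>,
    \<open>2 * k\<close> and \<open>2 + k\<close> times \<open>e' * r^3\<close>; their sum is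
    \<open>2 + 5 * k\<close>.\<close>
  define e' where "e' = e / (2 + 5 * k)"
  have e': "e' > 0" using e k by (simp add: e'_def)
  obtain d1 where d1: "d1 > 0" "\<And>r s t u. 0 < r \<Longrightarrow> r < d1 \<Longrightarrow> \<bar>s - s0\<bar> \<le> r \<Longrightarrow> \<bar>t - t0\<bar> \<le> r \<Longrightarrow> \<bar>u - u0\<bar> \<le> k * r \<Longrightarrow>
      \<bar>F1 s t u - F1 s0 t0 u0 - A1 (s - s0, t - t0, u - u0)\<bar> \<le> e' * r"
    using has_derivative_box_bound[OF der1 e' k] by blast
  obtain d2 where d2: "d2 > 0" "\<And>r s t u. 0 < r \<Longrightarrow> r < d2 \<Longrightarrow> \<bar>s - s0\<bar> \<le> r \<Longrightarrow> \<bar>t - t0\<bar> \<le> r \<Longrightarrow> \<bar>u - u0\<bar> \<le> k * r \<Longrightarrow>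
      \<bar>F2 s t u - F2 s0 t0 u0 - A2 (s - s0, t - t0, u - u0)\<bar> \<le> e' * r"
    using has_derivative_box_bound[OF der2 e' k] by blast
  obtain d3 where d3: "d3 > 0" "\<And>r s t u. 0 < r \<Longrightarrow> r < d3 \<Longrightarrow> \<bar>s - s0\<bar> \<le> r \<Longrightarrow> \<bar>t - t0\<bar> \<le> r \<Longrightarrow> \<bar>u - u0\<bar> \<le> k * r \<Longrightarrow>
      \<bar>F3 s t u - F3 s0 t0 u0 - A3 (s - s0, t - t0, u - u0)\<bar> \<le> e' * r"
    using has_derivative_box_bound[OF der3 e' k] by blast
  have "isCont (\<lambda>z. f (fst z) (fst (snd z)) (snd (snd z))) (s0, t0, u0)"
    using cf by (simp add: continuous_on_eq_continuous_at)
  then obtain d where d: "d > 0" "\<And>z. dist z (s0, t0, u0) < d \<Longrightarrow>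
      \<bar>f (fst z) (fst (snd z)) (snd (snd z)) - f s0 t0 u0\<bar> < e'"
    using e' unfolding continuous_at_eps_delta by (auto simp: dist_norm simp del: norm_Pair)
  show ?thesis
  proof (intro exI[of _ "min (min d1 d2) (min d3 (d / (2 + k)))"] conjI allI impI)
    show "min (min d1 d2) (min d3 (d / (2 + k))) > 0" using d1 d2 d3 d k by simp
    fix r a b c :: real
    assume r: "0 < r" "r < min (min d1 d2) (min d3 (d / (2 + k)))"
      and box: "a \<le> s0" "s0 \<le> a + r" "b \<le> t0" "t0 \<le> b + r" "c \<le> u0" "u0 \<le> c + k * r"
    have kr: "k * r > 0" using k r by simp
    have fb: "\<bar>f s t u - f s0 t0 u0\<bar> \<le> e'"
      if "s \<in> {a..a+r}" "t \<in> {b..b+r}" "u \<in> {c..c+k*r}" for s t u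
    proof -
      have "norm ((s, t, u) - (s0, t0, u0)) \<le> norm (s - s0) + norm (t - t0, u - u0)"
        using norm_Pair_le[of "s - s0" "(t - t0, u - u0)"] by simp
      also have "\<dots> \<le> \<bar>s - s0\<bar> + (\<bar>t - t0\<bar> + \<bar>u - u0\<bar>)"
        using norm_Pair_le[of "t - t0" "u - u0"] by simp
      also have "\<dots> \<le> r + (r + k * r)" using that box by (intro add_mono) (auto simp: abs_le_iff)
      also have "\<dots> = (2 + k) * r" by (simp add: algebra_simps)
      also have "\<dots> < d" using r k by (simp add: field_simps)
      finally show ?thesis using d(2)[of "(s, t, u)"] by (simp add: dist_norm)
    qed
    have dl1: "A1 (x, y, z) - A1 (x', y, z) = (x - x') * A1 (1, 0, 0)" for x x' y z
    proof -
      interpret linear A1 using der1 has_derivative_linear by blast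
      have "A1 ((x, y, z) - (x', y, z)) = A1 ((x - x') *\<^sub>R (1, 0, 0))"
        by (rule arg_cong[where f=A1]) (simp add: prod_eq_iff)
      then show ?thesis by (simp only: diff scaleR real_scaleR_def)
    qed
    have dl2: "A2 (x, y, z) - A2 (x, y', z) = (y - y') * A2 (0, 1, 0)" for x y y' z
    proof -
      interpret linear A2 using der2 has_derivative_linear by blast
      have "A2 ((x, y, z) - (x, y', z)) = A2 ((y - y') *\<^sub>R (0, 1, 0))"
        by (rule arg_cong[where f=A2]) (simp add: prod_eq_iff)
      then show ?thesis by (simp only: diff scaleR real_scaleR_def)
    qed
    have dl3: "A3 (x, y, z) - A3 (x, y, z') = (z - z') * A3 (0, 0, 1)" for x y z z'
    proof -
      interpret linear A3 using der3 has_derivative_linear by blast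
      have "A3 ((x, y, z) - (x, y, z')) = A3 ((z - z') *\<^sub>R (0, 0, 1))"
        by (rule arg_cong[where f=A3]) (simp add: prod_eq_iff)
      then show ?thesis by (simp only: diff scaleR real_scaleR_def)
    qed
    have "\<bar>iterated (\<lambda>t u. F1 (a+r) t u - F1 a t u) b (b+r) c (c+k*r) - (r * A1 (1,0,0)) * (c+k*r - c) * (b+r - b)\<bar>
        \<le> (2 * e' * r) * (c+k*r - c) * (b+r - b)"
    proof (rule iterated_approx_const[OF flux_cont(1)])
      fix t u assume tu: "t \<in> {b..b+r}" "u \<in> {c..c+k*r}"
      have "\<bar>F1 (a+r) t u - F1 s0 t0 u0 - A1 (a+r - s0, t - t0, u - u0)\<bar> \<le> e' * r"
        "\<bar>F1 a t u - F1 s0 t0 u0 - A1 (a - s0, t - t0, u - u0)\<bar> \<le> e' * r"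
        using tu box r by (auto intro!: d1(2))
      then show "\<bar>F1 (a+r) t u - F1 a t u - r * A1 (1,0,0)\<bar> \<le> 2 * e' * r"
        using dl1[of "a+r-s0" "t-t0" "u-u0" "a-s0"] by simp
    qed (use r kr in auto)
    then have I1: "\<bar>iterated (\<lambda>t u. F1 (a+r) t u - F1 a t u) b (b+r) c (c+k*r) - A1 (1,0,0) * k * r^3\<bar> \<le> 2 * e' * k * r^3"
      by (simp add: power3_eq_cube mult_ac)
    have "\<bar>iterated (\<lambda>s u. F2 s (b+r) u - F2 s b u) a (a+r) c (c+k*r) - (r * A2 (0,1,0)) * (c+k*r - c) * (a+r - a)\<bar>
        \<le> (2 * e' * r) * (c+k*r - c) * (a+r - a)"
    proof (rule iterated_approx_const[OF flux_cont(2)])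
      fix s u assume tu: "s \<in> {a..a+r}" "u \<in> {c..c+k*r}"
      have "\<bar>F2 s (b+r) u - F2 s0 t0 u0 - A2 (s - s0, b+r - t0, u - u0)\<bar> \<le> e' * r"
        "\<bar>F2 s b u - F2 s0 t0 u0 - A2 (s - s0, b - t0, u - u0)\<bar> \<le> e' * r"
        using tu box r by (auto intro!: d2(2))
      then show "\<bar>F2 s (b+r) u - F2 s b u - r * A2 (0,1,0)\<bar> \<le> 2 * e' * r"
        using dl2[of "s-s0" "b+r-t0" "u-u0" "b-t0"] by simp
    qed (use r kr in auto)
    then have I2: "\<bar>iterated (\<lambda>s u. F2 s (b+r) u - F2 s b u) a (a+r) c (c+k*r) - A2 (0,1,0) * k * r^3\<bar> \<le> 2 * e' * k * r^3"
      by (simp add: power3_eq_cube mult_ac)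
    have "\<bar>iterated (\<lambda>s t. F3 s t (c+k*r) - F3 s t c - integral {c..c+k*r} (f s t)) a (a+r) b (b+r)
          - (k * r * A3 (0,0,1) - f s0 t0 u0 * (k * r)) * (b+r - b) * (a+r - a)\<bar>
        \<le> (2 * e' * r + e' * (k * r)) * (b+r - b) * (a+r - a)"
    proof (rule iterated_approx_const[OF flux_cont(3)])
      fix s t assume st: "s \<in> {a..a+r}" "t \<in> {b..b+r}"
      have 1: "\<bar>F3 s t (c+k*r) - F3 s0 t0 u0 - A3 (s - s0, t - t0, c+k*r - u0)\<bar> \<le> e' * r"
        "\<bar>F3 s t c - F3 s0 t0 u0 - A3 (s - s0, t - t0, c - u0)\<bar> \<le> e' * r"
        using st box r kr by (auto intro!: d3(2))
      have "\<bar>integral {c..c+k*r} (f s t) - f s0 t0 u0 * (c+k*r - c)\<bar> \<le> e' * (c+k*r - c)"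
        using fb[OF st] kr
        by (intro integral_approx_const cont3_compose[OF cf] continuous_intros) auto
      then show "\<bar>F3 s t (c+k*r) - F3 s t c - integral {c..c+k*r} (f s t) - (k * r * A3 (0,0,1) - f s0 t0 u0 * (k * r))\<bar>
          \<le> 2 * e' * r + e' * (k * r)"
        using 1 dl3[of "s-s0" "t-t0" "c+k*r-u0" "c-u0"] by simp
    qed (use r in auto)
    then have I3: "\<bar>iterated (\<lambda>s t. F3 s t (c+k*r) - F3 s t c - integral {c..c+k*r} (f s t)) a (a+r) b (b+r)
          - (A3 (0,0,1) - f s0 t0 u0) * k * r^3\<bar> \<le> (2 + k) * e' * r^3"
      by (simp add: power3_eq_cube algebra_simps)
    have z: "A1 (1,0,0) * k * r^3 + A2 (0,1,0) * k * r^3 + (A3 (0,0,1) - f s0 t0 u0) * k * r^3 = 0"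
    proof -
      have "A1 (1,0,0) * k * r^3 + A2 (0,1,0) * k * r^3 + (A3 (0,0,1) - f s0 t0 u0) * k * r^3 =
          (A1 (1,0,0) + A2 (0,1,0) + A3 (0,0,1) - f s0 t0 u0) * k * r^3"
        by (simp only: distrib_right left_diff_distrib)
      then show ?thesis using div by simp
    qed
    have "\<bar>box_flux F1 F2 F3 f a (a + r) b (b + r) c (c + k * r)\<bar> \<le> 2 * e' * k * r^3 + 2 * e' * k * r^3 + (2 + k) * e' * r^3"
      unfolding box_flux_def using I1 I2 I3 z by linarith
    also have "\<dots> = (2 + 5 * k) * e' * r^3" by (simp add: algebra_simps)
    also have "\<dots> = e * r ^ 3" using k by (simp add: e'_def)
    finally show "\<bar>box_flux F1 F2 F3 f a (a + r) b (b + r) c (c + k * r)\<bar> \<le> e * r ^ 3" .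
  qed
qed

definition divergence_at :: "real \<Rightarrow> real \<Rightarrow> real \<Rightarrow> bool" where
  "divergence_at s t u \<longleftrightarrow> (\<exists>A1 A2 A3.
    ((\<lambda>z. F1 (fst z) (fst (snd z)) (snd (snd z))) has_derivative A1) (at (s, t, u)) \<and>
    ((\<lambda>z. F2 (fst z) (fst (snd z)) (snd (snd z))) has_derivative A2) (at (s, t, u)) \<and>
    ((\<lambda>z. F3 (fst z) (fst (snd z)) (snd (snd z))) has_derivative A3) (at (s, t, u)) \<and>
    A1 (1, 0, 0) + A2 (0, 1, 0) + A3 (0, 0, 1) = f s t u)"

lemma box_flux_eq_0:
  assumes r: "r > 0" and c: "c < c'"
    and div: "\<And>s t u. s \<in> {a..a+r} \<Longrightarrow> t \<in> {b..b+r} \<Longrightarrow> u \<in> {c..c'} \<Longrightarrow> divergence_at s t u"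
  shows "box_flux F1 F2 F3 f a (a + r) b (b + r) c c' = 0"
proof -
  \<comment> \<open>Dividing heights by this aspect ratio turns the box into a cube, as the
    bisection requires; \<open>\<Phi>\<close> undoes the rescaling.\<close>
  define k where "k = (c' - c) / r"
  have k: "k > 0" using r c by (simp add: k_def)
  define K where "K = cbox (a, b, c / k) ((a, b, c / k) + r *\<^sub>R One)"
  define \<Phi> where "\<Phi> p \<rho> = box_flux F1 F2 F3 f (fst p) (fst p + \<rho>) (fst (snd p)) (fst (snd p) + \<rho>)
     (k * snd (snd p)) (k * (snd (snd p) + \<rho>))" for p \<rho>
  define V where "V = {0, 1::real} \<times> {0, 1::real} \<times> {0, 1::real}"
  have "\<Phi> (a, b, c / k) r = 0"
  proof (rule dyadic_bisection[where \<Phi>=\<Phi> and V=V and d=3 and K=K])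
    show "finite V" "card V \<le> 2 ^ 3" by (auto simp: V_def card_cartesian_product)
    show "V \<subseteq> cbox 0 One"
      using mem_cbox_cube3[of _ _ _ "0" "1"] by (auto simp: V_def)
    show "\<bar>\<Phi> p \<rho>\<bar> \<le> (\<Sum>v\<in>V. \<bar>\<Phi> (p + (\<rho>/2) *\<^sub>R v) (\<rho>/2)\<bar>)" if "\<rho> > 0" for p :: "real \<times> real \<times> real" and \<rho>
    proof -
      obtain p1 p2 p3 where p: "p = (p1, p2, p3)" by (cases p) auto
      have h: "x + \<rho>/2 + \<rho>/2 = x + \<rho>" for x by simp
      have kk: "k * p3 \<le> k * (p3 + \<rho>/2)" "k * (p3 + \<rho>/2) \<le> k * (p3 + \<rho>)"
        using k that by (auto intro!: mult_left_mono)
      have s: "(\<Sum>v\<in>V. \<bar>\<Phi> (p + (\<rho>/2) *\<^sub>R v) (\<rho>/2)\<bar>) =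
         (\<Sum>i\<in>{0,1}. \<Sum>j\<in>{0,1}. \<Sum>l\<in>{0,1}. \<bar>\<Phi> (p + (\<rho>/2) *\<^sub>R (i, j, l)) (\<rho>/2)\<bar>)"
        by (simp only: V_def sum.cartesian_product' prod.case)
      let ?b = "box_flux F1 F2 F3 f"
      have "\<bar>\<Phi> p \<rho>\<bar> \<le>
          \<bar>?b p1 (p1 + \<rho>/2) p2 (p2 + \<rho>/2) (k * p3) (k * (p3 + \<rho>/2))\<bar> +
          \<bar>?b p1 (p1 + \<rho>/2) p2 (p2 + \<rho>/2) (k * (p3 + \<rho>/2)) (k * (p3 + \<rho>))\<bar> +
          \<bar>?b p1 (p1 + \<rho>/2) (p2 + \<rho>/2) (p2 + \<rho>) (k * p3) (k * (p3 + \<rho>/2))\<bar> +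
          \<bar>?b p1 (p1 + \<rho>/2) (p2 + \<rho>/2) (p2 + \<rho>) (k * (p3 + \<rho>/2)) (k * (p3 + \<rho>))\<bar> +
          \<bar>?b (p1 + \<rho>/2) (p1 + \<rho>) p2 (p2 + \<rho>/2) (k * p3) (k * (p3 + \<rho>/2))\<bar> +
          \<bar>?b (p1 + \<rho>/2) (p1 + \<rho>) p2 (p2 + \<rho>/2) (k * (p3 + \<rho>/2)) (k * (p3 + \<rho>))\<bar> +
          \<bar>?b (p1 + \<rho>/2) (p1 + \<rho>) (p2 + \<rho>/2) (p2 + \<rho>) (k * p3) (k * (p3 + \<rho>/2))\<bar> +
          \<bar>?b (p1 + \<rho>/2) (p1 + \<rho>) (p2 + \<rho>/2) (p2 + \<rho>) (k * (p3 + \<rho>/2)) (k * (p3 + \<rho>))\<bar>"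
        unfolding p \<Phi>_def fst_conv snd_conv
        by (rule abs_box_flux_split8[OF _ _ _ _ kk]) (use that in auto)
      also have "\<dots> = (\<Sum>i\<in>{0,1}. \<Sum>j\<in>{0,1}. \<Sum>l\<in>{0,1}. \<bar>\<Phi> (p + (\<rho>/2) *\<^sub>R (i, j, l)) (\<rho>/2)\<bar>)"
        by (simp add: \<Phi>_def p h add.assoc)
      finally show ?thesis unfolding s .
    qed
    fix x :: "real \<times> real \<times> real" and \<epsilon> :: real assume x: "x \<in> K" and e: "\<epsilon> > 0"
    obtain s0 t0 v0 where x': "x = (s0, t0, v0)" by (cases x) auto
    have xb: "a \<le> s0" "s0 \<le> a + r" "b \<le> t0" "t0 \<le> b + r" "c / k \<le> v0" "v0 \<le> c / k + r"
      using x unfolding K_def x' mem_cbox_cube3 by auto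
    have "divergence_at s0 t0 (k * v0)"
    proof (rule div)
      have "k * v0 \<le> k * (c / k + r)" using xb k by (intro mult_left_mono) auto
      also have "\<dots> = c + k * r" using k by (simp add: distrib_left)
      also have "k * r = c' - c" using r by (simp add: k_def)
      finally show "k * v0 \<in> {c..c'}" using xb k by (auto simp: field_simps)
    qed (use xb in auto)
    then obtain A1 A2 A3 where A: "((\<lambda>z. F1 (fst z) (fst (snd z)) (snd (snd z))) has_derivative A1) (at (s0, t0, k * v0))"
      "((\<lambda>z. F2 (fst z) (fst (snd z)) (snd (snd z))) has_derivative A2) (at (s0, t0, k * v0))"
      "((\<lambda>z. F3 (fst z) (fst (snd z)) (snd (snd z))) has_derivative A3) (at (s0, t0, k * v0))"
      "A1 (1, 0, 0) + A2 (0, 1, 0) + A3 (0, 0, 1) = f s0 t0 (k * v0)"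
      unfolding divergence_at_def by blast
    from box_flux_small[OF k e A] obtain \<delta> where \<delta>: "\<delta> > 0" and
      D: "\<And>r a b c. 0 < r \<Longrightarrow> r < \<delta> \<Longrightarrow> a \<le> s0 \<Longrightarrow> s0 \<le> a + r \<Longrightarrow> b \<le> t0 \<Longrightarrow> t0 \<le> b + r \<Longrightarrow>
      c \<le> k * v0 \<Longrightarrow> k * v0 \<le> c + k * r \<Longrightarrow> \<bar>box_flux F1 F2 F3 f a (a + r) b (b + r) c (c + k * r)\<bar> \<le> \<epsilon> * r ^ 3"
      by blast
    show "\<exists>\<delta>>0. \<forall>p r. 0 < r \<longrightarrow> r < \<delta> \<longrightarrow> x \<in> cbox p (p + r *\<^sub>R One) \<longrightarrow>
        cbox p (p + r *\<^sub>R One) \<subseteq> K \<longrightarrow> \<bar>\<Phi> p r\<bar> \<le> \<epsilon> * r ^ 3"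
    proof (intro exI[of _ \<delta>] conjI allI impI)
      fix p :: "real \<times> real \<times> real" and \<rho> :: real assume \<rho>: "0 < \<rho>" "\<rho> < \<delta>" and "x \<in> cbox p (p + \<rho> *\<^sub>R One)"
      then have m: "fst p \<le> s0" "s0 \<le> fst p + \<rho>" "fst (snd p) \<le> t0" "t0 \<le> fst (snd p) + \<rho>"
        "snd (snd p) \<le> v0" "v0 \<le> snd (snd p) + \<rho>"
        unfolding x' mem_cbox_cube3 by auto
      have "k * snd (snd p) \<le> k * v0" "k * v0 \<le> k * (snd (snd p) + \<rho>)"
        using m k by (auto intro!: mult_left_mono)
      then show "\<bar>\<Phi> p \<rho>\<bar> \<le> \<epsilon> * \<rho> ^ 3"
        using D[of \<rho> "fst p" "fst (snd p)" "k * snd (snd p)"] \<rho> m by (simp add: \<Phi>_def algebra_simps)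
    qed (rule \<delta>)
  next
    show "cbox (a, b, c / k) ((a, b, c / k) + r *\<^sub>R One) \<subseteq> K" by (simp add: K_def)
  qed (rule r)
  moreover have "k * (c / k) = c" using k by simp
  moreover have "k * (c / k + r) = c'"
  proof -
    have "k * r = c' - c" using r by (simp add: k_def)
    then show ?thesis using k by (simp add: distrib_left)
  qed
  ultimately show ?thesis by (simp add: \<Phi>_def)
qed

text \<open>On the bottom face only continuity is available. The flux through the box equals the
  flux through a slice of height l above the bottom; the side faces of the slice contribute O(l),
  and its two horizontal faces nearly cancel by uniform continuity, so that the flux is smaller than
  any positive number.\<close>

lemma box_flux_eq_0_bottom:
  assumes r: "r > 0" and c: "c < c'"
    and div: "\<And>s t u. s \<in> {a..a+r} \<Longrightarrow> t \<in> {b..b+r} \<Longrightarrow> u \<in> {c<..c'} \<Longrightarrow> divergence_at s t u"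
  shows "box_flux F1 F2 F3 f a (a + r) b (b + r) c c' = 0"
proof -
  let ?B = "\<lambda>l u. box_flux F1 F2 F3 f a (a + r) b (b + r) l u"
  define S where "S = {a..a+r} \<times> {b..b+r} \<times> {c..c'}"
  have S: "compact S" by (auto simp: S_def intro!: compact_Times)
  have bounded: "\<exists>C. \<forall>s\<in>{a..a+r}. \<forall>t\<in>{b..b+r}. \<forall>u\<in>{c..c'}. \<bar>g s t u\<bar> \<le> C" if "cont3 g" for g
  proof -
    have "compact ((\<lambda>z. g (fst z) (fst (snd z)) (snd (snd z))) ` S)"
      using that S by (intro compact_continuous_image) (auto intro: continuous_on_subset)
    then obtain C where "\<And>z. z \<in> S \<Longrightarrow> \<bar>g (fst z) (fst (snd z)) (snd (snd z))\<bar> \<le> C"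
      using compact_imp_bounded bounded_iff by (metis (no_types, lifting) image_eqI real_norm_def)
    then show ?thesis by (intro exI[of _ C]) (force simp: S_def)
  qed
  obtain C1 where C1: "\<And>s t u. s \<in> {a..a+r} \<Longrightarrow> t \<in> {b..b+r} \<Longrightarrow> u \<in> {c..c'} \<Longrightarrow> \<bar>F1 s t u\<bar> \<le> C1" using bounded[OF cF1] by blast
  obtain C2 where C2: "\<And>s t u. s \<in> {a..a+r} \<Longrightarrow> t \<in> {b..b+r} \<Longrightarrow> u \<in> {c..c'} \<Longrightarrow> \<bar>F2 s t u\<bar> \<le> C2" using bounded[OF cF2] by blast
  obtain C3 where C3: "\<And>s t u. s \<in> {a..a+r} \<Longrightarrow> t \<in> {b..b+r} \<Longrightarrow> u \<in> {c..c'} \<Longrightarrow> \<bar>f s t u\<bar> \<le> C3" using bounded[OF cf] by blast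
  have C: "C1 \<ge> 0" "C2 \<ge> 0" "C3 \<ge> 0"
    using C1[of a b c] C2[of a b c] C3[of a b c] r c by auto
  have uc: "uniformly_continuous_on S (\<lambda>z. F3 (fst z) (fst (snd z)) (snd (snd z)))"
    using S cF3 by (intro compact_uniformly_continuous) (auto intro: continuous_on_subset)
  have est: "\<bar>?B c c'\<bar> \<le> e * (2 * C1 * r + 2 * C2 * r + (1 + C3) * r * r)" if e: "e > 0" for e
  proof -
    from uc[unfolded uniformly_continuous_on_def, rule_format, OF e]
    obtain d where d: "d > 0" and D: "\<And>z w. z \<in> S \<Longrightarrow> w \<in> S \<Longrightarrow> dist w z < d \<Longrightarrow>
       dist (F3 (fst w) (fst (snd w)) (snd (snd w))) (F3 (fst z) (fst (snd z)) (snd (snd z))) < e"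
      by blast
    \<comment> \<open>The bound \<open>d/2\<close> gives uniform continuity of \<open>F3\<close>
      across the slice, \<open>e\<close> makes the lateral terms and the source small, and
      \<open>c' - c\<close> keeps the slice inside the box.\<close>
    define l where "l = min (min (d/2) e) (c' - c)"
    have l: "l > 0" "l < d" "l \<le> e" "c + l \<le> c'" using d e c by (auto simp: l_def)
    have "?B c c' = ?B c (c + l)"
    proof (cases "c + l = c'")
      case False
      then have "?B (c + l) c' = 0"
        using l by (intro box_flux_eq_0[OF r] div) auto
      then show ?thesis using box_flux_split3[of c "c + l" c'] l by simp
    qed simp
    moreover have "\<bar>iterated (\<lambda>t u. F1 (a+r) t u - F1 a t u) b (b+r) c (c+l) - 0 * (c+l - c) * (b+r - b)\<bar>
        \<le> (2 * C1) * (c+l - c) * (b+r - b)"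
    proof (rule iterated_approx_const[OF flux_cont(1)])
      fix t u assume "t \<in> {b..b+r}" "u \<in> {c..c+l}"
      then show "\<bar>F1 (a+r) t u - F1 a t u - 0\<bar> \<le> 2 * C1"
        using C1[of "a+r" t u] C1[of a t u] l r by auto
    qed (use r l in auto)
    moreover have "\<bar>iterated (\<lambda>s u. F2 s (b+r) u - F2 s b u) a (a+r) c (c+l) - 0 * (c+l - c) * (a+r - a)\<bar>
        \<le> (2 * C2) * (c+l - c) * (a+r - a)"
    proof (rule iterated_approx_const[OF flux_cont(2)])
      fix s u assume "s \<in> {a..a+r}" "u \<in> {c..c+l}"
      then show "\<bar>F2 s (b+r) u - F2 s b u - 0\<bar> \<le> 2 * C2"
        using C2[of s "b+r" u] C2[of s b u] l r by auto
    qed (use r l in auto)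
    moreover have "\<bar>iterated (\<lambda>s t. F3 s t (c+l) - F3 s t c - integral {c..c+l} (f s t)) a (a+r) b (b+r) - 0 * (b+r - b) * (a+r - a)\<bar>
        \<le> (e + C3 * l) * (b+r - b) * (a+r - a)"
    proof (rule iterated_approx_const[OF flux_cont(3)])
      fix s t assume st: "s \<in> {a..a+r}" "t \<in> {b..b+r}"
      have "dist (s, t, c + l) (s, t, c) < d" using l by (simp add: dist_norm)
      then have "\<bar>F3 s t (c+l) - F3 s t c\<bar> < e"
        using D[of "(s,t,c)" "(s,t,c+l)"] st l by (auto simp: S_def dist_norm)
      moreover have "\<bar>integral {c..c+l} (f s t) - 0 * (c+l - c)\<bar> \<le> C3 * (c+l - c)"
        using C3[OF st] l
        by (intro integral_approx_const cont3_compose[OF cf] continuous_intros) auto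
      ultimately show "\<bar>F3 s t (c+l) - F3 s t c - integral {c..c+l} (f s t) - 0\<bar> \<le> e + C3 * l"
        by simp
    qed (use r l in auto)
    ultimately have "\<bar>?B c c'\<bar> \<le> (2 * C1) * l * r + (2 * C2) * l * r + (e + C3 * l) * r * r"
      unfolding box_flux_def by simp
    also have "\<dots> \<le> (2 * C1) * e * r + (2 * C2) * e * r + (e + C3 * e) * r * r"
      using l C r by (intro add_mono mult_right_mono mult_left_mono) auto
    finally show ?thesis by (simp add: algebra_simps)
  qed
  show ?thesis
  proof (rule ccontr)
    assume nz: "?B c c' \<noteq> 0"
    define M where "M = 2 * C1 * r + 2 * C2 * r + (1 + C3) * r * r"
    have M: "M > 0" using C r by (auto simp: M_def intro!: add_nonneg_pos)
    have "\<bar>?B c c'\<bar> \<le> (\<bar>?B c c'\<bar> / (2 * M)) * M"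
      using est[of "\<bar>?B c c'\<bar> / (2 * M)"] nz M by (simp add: M_def)
    then show False using nz M by simp
  qed
qed

end

subsection \<open>Columns below a merely differentiable surface\<close>

lemma integral_rescale_unit:
  fixes g :: "real \<Rightarrow> real"
  assumes "continuous_on {c..k} g" "c < k"
  shows "integral {c..k} g = (k - c) * integral {0..1} (\<lambda>l. g (c + l * (k - c)))"
proof -
  have m: "k - c > 0" using assms by simp
  have "(g has_integral integral {c..k} g) (cbox c k)"
    using assms integrable_continuous_real by auto
  from has_integral_affinity'[OF this m, of c]
  have "((\<lambda>l. g (c + l * (k - c))) has_integral integral {c..k} g / (k - c)) {0..1}"
  proof -
    have "(c - c) /\<^sub>R (k - c) = 0" "(k - c) /\<^sub>R (k - c) = 1" using m by simp_all
    then show ?thesis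
      using \<open>((\<lambda>x. g ((k - c) *\<^sub>R x + c)) has_integral _) _\<close>
      by (simp add: mult.commute add.commute divide_inverse)
  qed
  then show ?thesis using m by (simp add: integral_unique)
qed

text \<open>Substituting y = c + l (k x - c) moves the dependence on x from the limit of integration
  into the integrand over the fixed interval [0, 1], where continuity under the integral sign
  applies.\<close>

lemma continuous_on_integral_upper:
  fixes g :: "'a::topological_space \<Rightarrow> real \<Rightarrow> real"
  assumes g: "continuous_on UNIV (\<lambda>z. g (fst z) (snd z))" and k: "continuous_on UNIV k" "\<And>x. c < k x"
  shows "continuous_on UNIV (\<lambda>x. integral {c..k x} (g x))"
proof -
  have "continuous_on S (g x)" for S x
    using continuous_on_compose2[OF g, of S "\<lambda>y. (x, y)"] by (simp add: continuous_intros)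
  then have "integral {c..k x} (g x) = (k x - c) * integral {0..1} (\<lambda>l. g x (c + l * (k x - c)))" for x
    using k(2) by (intro integral_rescale_unit) auto
  moreover have "continuous_on UNIV (\<lambda>x. (k x - c) * integral {0..1} (\<lambda>l. g x (c + l * (k x - c))))"
  proof (intro continuous_intros continuous_on_integral_param k(1))
    have "continuous_on UNIV (\<lambda>z :: 'a \<times> real. (fst z, c + snd z * (k (fst z) - c)))"
      by (intro continuous_intros continuous_on_compose2[OF k(1)]) auto
    from continuous_on_compose2[OF g this]
    show "continuous_on UNIV (\<lambda>z. g (fst z) (c + snd z * (k (fst z) - c)))" by simp
  qed
  ultimately show ?thesis by simp
qed

section \<open>Horizontal flux of column integrals through squares of the base plane\<close>

definition rect_flux ::
  "(real \<Rightarrow> real \<Rightarrow> real) \<Rightarrow> (real \<Rightarrow> real \<Rightarrow> real) \<Rightarrow> (real \<Rightarrow> real \<Rightarrow> real) \<Rightarrow>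
    real \<Rightarrow> real \<Rightarrow> real \<Rightarrow> real \<Rightarrow> real" where
  "rect_flux M1 M2 G a a' b b' =
     integral {b..b'} (\<lambda>t. M1 a' t - M1 a t) + integral {a..a'} (\<lambda>s. M2 s b' - M2 s b) -
     iterated G a a' b b'"

locale rect_field =
  fixes M1 M2 G :: "real \<Rightarrow> real \<Rightarrow> real"
  assumes cM1: "cont2 M1" and cM2: "cont2 M2" and cG: "cont2 G"
begin

lemma diff_cont:
  "continuous_on S (\<lambda>t. M1 a' t - M1 a t)" "continuous_on S (\<lambda>s. M2 s b' - M2 s b)"
  by (intro continuous_intros cont2_compose[OF cM1] cont2_compose[OF cM2])+

lemma rect_flux_split1:
  assumes "a \<le> m" "m \<le> a'"
  shows "rect_flux M1 M2 G a a' b b' = rect_flux M1 M2 G a m b b' + rect_flux M1 M2 G m a' b b'"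
proof -
  have "integral {b..b'} (\<lambda>t. M1 m t - M1 a t) + integral {b..b'} (\<lambda>t. M1 a' t - M1 m t) =
      integral {b..b'} (\<lambda>t. M1 a' t - M1 a t)"
    by (subst integral_add[symmetric]) (auto intro!: integrable_continuous_real diff_cont)
  moreover have "integral {a..m} (\<lambda>s. M2 s b' - M2 s b) + integral {m..a'} (\<lambda>s. M2 s b' - M2 s b) =
      integral {a..a'} (\<lambda>s. M2 s b' - M2 s b)"
    by (intro Henstock_Kurzweil_Integration.integral_combine[OF assms] integrable_continuous_real diff_cont)
  ultimately show ?thesis unfolding rect_flux_def iterated_split_fst[OF cG assms] by simp
qed

lemma rect_flux_split2:
  assumes "b \<le> m" "m \<le> b'"
  shows "rect_flux M1 M2 G a a' b b' = rect_flux M1 M2 G a a' b m + rect_flux M1 M2 G a a' m b'"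
proof -
  have "integral {a..a'} (\<lambda>s. M2 s m - M2 s b) + integral {a..a'} (\<lambda>s. M2 s b' - M2 s m) =
      integral {a..a'} (\<lambda>s. M2 s b' - M2 s b)"
    by (subst integral_add[symmetric]) (auto intro!: integrable_continuous_real diff_cont)
  moreover have "integral {b..m} (\<lambda>t. M1 a' t - M1 a t) + integral {m..b'} (\<lambda>t. M1 a' t - M1 a t) =
      integral {b..b'} (\<lambda>t. M1 a' t - M1 a t)"
    by (intro Henstock_Kurzweil_Integration.integral_combine[OF assms] integrable_continuous_real diff_cont)
  ultimately show ?thesis unfolding rect_flux_def iterated_split_snd[OF cG assms] by simp
qed

text \<open>A second bisection. A column with a curved top is not a box, so it is split only over
  its base; the surface enters solely through the local estimate \<open>loc\<close>.\<close>

lemma rect_flux_eq_0: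
  assumes loc: "\<And>s0 t0 e. e > 0 \<Longrightarrow> \<exists>\<delta>>0. \<forall>r a b. 0 < r \<longrightarrow> r < \<delta> \<longrightarrow> a \<le> s0 \<longrightarrow> s0 \<le> a + r \<longrightarrow>
      b \<le> t0 \<longrightarrow> t0 \<le> b + r \<longrightarrow> \<bar>rect_flux M1 M2 G a (a + r) b (b + r)\<bar> \<le> e * r ^ 2"
    and r: "r > 0"
  shows "rect_flux M1 M2 G a (a + r) b (b + r) = 0"
proof -
  define \<Phi> where "\<Phi> p \<rho> = rect_flux M1 M2 G (fst p) (fst p + \<rho>) (snd p) (snd p + \<rho>)" for p \<rho>
  define V where "V = {0, 1::real} \<times> {0, 1::real}"
  have mem: "(s, t) \<in> cbox p (p + r *\<^sub>R One) \<longleftrightarrow>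
     fst p \<le> s \<and> s \<le> fst p + r \<and> snd p \<le> t \<and> t \<le> snd p + r" for s t r :: real and p
    by (cases p) (auto simp: One_prod cbox_Pair_eq)
  have "\<Phi> (a, b) r = 0"
  proof (rule dyadic_bisection[where \<Phi>=\<Phi> and V=V and d=2 and K=UNIV])
    show "finite V" "card V \<le> 2 ^ 2" by (auto simp: V_def card_cartesian_product)
    show "V \<subseteq> cbox 0 One"
      using mem[of _ _ "0" "1"] by (auto simp: V_def)
    show "\<bar>\<Phi> p \<rho>\<bar> \<le> (\<Sum>v\<in>V. \<bar>\<Phi> (p + (\<rho>/2) *\<^sub>R v) (\<rho>/2)\<bar>)" if "\<rho> > 0" for p :: "real \<times> real" and \<rho>
    proof -
      obtain p1 p2 where p: "p = (p1, p2)" by (cases p) auto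
      have h: "x + \<rho>/2 + \<rho>/2 = x + \<rho>" for x by simp
      have s: "(\<Sum>v\<in>V. \<bar>\<Phi> (p + (\<rho>/2) *\<^sub>R v) (\<rho>/2)\<bar>) =
         (\<Sum>i\<in>{0,1}. \<Sum>j\<in>{0,1}. \<bar>\<Phi> (p + (\<rho>/2) *\<^sub>R (i, j)) (\<rho>/2)\<bar>)"
        by (simp only: V_def sum.cartesian_product' prod.case)
      let ?b = "rect_flux M1 M2 G"
      have "?b p1 (p1 + \<rho>) p2 (p2 + \<rho>) =
          ?b p1 (p1 + \<rho>/2) p2 (p2 + \<rho>/2) + ?b p1 (p1 + \<rho>/2) (p2 + \<rho>/2) (p2 + \<rho>) +
          (?b (p1 + \<rho>/2) (p1 + \<rho>) p2 (p2 + \<rho>/2) + ?b (p1 + \<rho>/2) (p1 + \<rho>) (p2 + \<rho>/2) (p2 + \<rho>))"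
        using that rect_flux_split1[of p1 "p1 + \<rho>/2" "p1 + \<rho>"] rect_flux_split2[of p2 "p2 + \<rho>/2" "p2 + \<rho>"]
        by simp
      then have "\<bar>\<Phi> p \<rho>\<bar> \<le>
          \<bar>?b p1 (p1 + \<rho>/2) p2 (p2 + \<rho>/2)\<bar> + \<bar>?b p1 (p1 + \<rho>/2) (p2 + \<rho>/2) (p2 + \<rho>)\<bar> +
          (\<bar>?b (p1 + \<rho>/2) (p1 + \<rho>) p2 (p2 + \<rho>/2)\<bar> + \<bar>?b (p1 + \<rho>/2) (p1 + \<rho>) (p2 + \<rho>/2) (p2 + \<rho>)\<bar>)"
        unfolding p \<Phi>_def fst_conv snd_conv by linarith
      also have "\<dots> = (\<Sum>i\<in>{0,1}. \<Sum>j\<in>{0,1}. \<bar>\<Phi> (p + (\<rho>/2) *\<^sub>R (i, j)) (\<rho>/2)\<bar>)"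
        by (simp add: \<Phi>_def p h add.assoc)
      finally show ?thesis unfolding s .
    qed
    fix x :: "real \<times> real" and \<epsilon> :: real assume e: "\<epsilon> > 0"
    obtain s0 t0 where x': "x = (s0, t0)" by (cases x) auto
    from loc[OF e, of s0 t0]
    show "\<exists>\<delta>>0. \<forall>p r. 0 < r \<longrightarrow> r < \<delta> \<longrightarrow> x \<in> cbox p (p + r *\<^sub>R One) \<longrightarrow>
        cbox p (p + r *\<^sub>R One) \<subseteq> UNIV \<longrightarrow> \<bar>\<Phi> p r\<bar> \<le> \<epsilon> * r ^ 2"
      unfolding x' mem \<Phi>_def by blast
  qed (use r in auto)
  then show ?thesis by (simp add: \<Phi>_def)
qed

end

text \<open>The conditions \<open>surface\<close> and \<open>bottom\<close> express that the field
  is tangential to the top and the bottom of the layer: F . (- \<nabla>h, 1) = 0 above, no vertical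
  component below. The divergence is prescribed in the open layer only.\<close>

locale column_field = box_field +
  fixes h hs ht :: "real \<Rightarrow> real \<Rightarrow> real"
  assumes h_deriv: "\<And>s t. ((\<lambda>z. h (fst z) (snd z)) has_derivative (\<lambda>v. hs s t * fst v + ht s t * snd v)) (at (s, t))"
    and h_gt: "\<And>s t. - 1 < h s t"
    and div: "\<And>s t u. - 1 < u \<Longrightarrow> u < h s t \<Longrightarrow> divergence_at s t u"
    and bottom: "\<And>s t. F3 s t (- 1) = 0"
    and surface: "\<And>s t. F3 s t (h s t) = hs s t * F1 s t (h s t) + ht s t * F2 s t (h s t)"
begin

lemma cont_h: "cont2 h"
  using h_deriv has_derivative_continuous by (fastforce simp: continuous_on_eq_continuous_at)

definition column :: "(real \<Rightarrow> real \<Rightarrow> real \<Rightarrow> real) \<Rightarrow> real \<Rightarrow> real \<Rightarrow> real" where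
  "column g s t = integral {- 1..h s t} (g s t)"

lemma cont_column: assumes "cont3 g" shows "cont2 (column g)"
  unfolding column_def
  by (intro continuous_on_integral_upper[where g="\<lambda>z. g (fst z) (snd z)"] cont3_compose[OF assms]
      continuous_intros cont_h h_gt)

sublocale rect: rect_field "column F1" "column F2" "column f"
  by standard (intro cont_column cF1 cF2 cf)+

text \<open>
  A column of width \<open>r\<close> is cut at depth \<open>L r\<close> below the surface. The lower part is a box with zero
  flux; in the upper part \<open>F\<close> is nearly constant and the surface nearly its tangent plane, so that
  tangentiality makes the flux \<open>o(r\<^sup>2)\<close>.
\<close>

lemma rect_flux_small:
  assumes e: "e > 0"
  shows "\<exists>\<delta>>0. \<forall>r a b. 0 < r \<longrightarrow> r < \<delta> \<longrightarrow> a \<le> s0 \<longrightarrow> s0 \<le> a + r \<longrightarrow>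
      b \<le> t0 \<longrightarrow> t0 \<le> b + r \<longrightarrow> \<bar>rect_flux (column F1) (column F2) (column f) a (a + r) b (b + r)\<bar> \<le> e * r ^ 2"
proof -
  define h0 p q where "h0 = h s0 t0" and "p = hs s0 t0" and "q = ht s0 t0"
  \<comment> \<open>Over a square of side r around the base point the surface stays within (L - 1) r
    of its height there, so a cut at depth L r lies at least r below it.\<close>
  define L where "L = \<bar>p\<bar> + \<bar>q\<bar> + 2"
  define X1 X2 X3 where "X1 = F1 s0 t0 h0" and "X2 = F2 s0 t0 h0" and "X3 = F3 s0 t0 h0"
  \<comment> \<open>The error constants of the two side fluxes,
    \<open>4 * L + 2 * \<bar>X1\<bar>\<close> and \<open>4 * L + 2 * \<bar>X2\<bar>\<close>, plus 2
    for the flux through the cut together with the source above it.\<close>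
  define K where "K = 8 * L + 2 * \<bar>X1\<bar> + 2 * \<bar>X2\<bar> + 2"
  define e' where "e' = min 1 (e / K)"
  have L: "L \<ge> 2" by (simp add: L_def)
  have K: "K > 0" using L by (simp add: K_def)
  have e': "e' > 0" "e' \<le> 1" "e' * K \<le> e" using e K by (auto simp: e'_def min_def field_simps)
  define Cf where "Cf = \<bar>f s0 t0 h0\<bar> + 1"
  have near: "\<exists>d>0. \<forall>s t u. \<bar>s - s0\<bar> + \<bar>t - t0\<bar> + \<bar>u - h0\<bar> < d \<longrightarrow> \<bar>g s t u - g s0 t0 h0\<bar> \<le> e'" if "cont3 g" for g
  proof -
    have "isCont (\<lambda>z. g (fst z) (fst (snd z)) (snd (snd z))) (s0, t0, h0)"
      using that by (simp add: continuous_on_eq_continuous_at)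
    then obtain d where d: "d > 0" "\<And>z. dist z (s0, t0, h0) < d \<Longrightarrow>
        \<bar>g (fst z) (fst (snd z)) (snd (snd z)) - g s0 t0 h0\<bar> < e'"
      using e' unfolding continuous_at_eps_delta by (auto simp: dist_norm simp del: norm_Pair)
    have "\<bar>g s t u - g s0 t0 h0\<bar> \<le> e'" if "\<bar>s - s0\<bar> + \<bar>t - t0\<bar> + \<bar>u - h0\<bar> < d" for s t u
    proof -
      have "norm ((s, t, u) - (s0, t0, h0)) \<le> norm (s - s0) + norm (t - t0, u - h0)"
        using norm_Pair_le[of "s - s0" "(t - t0, u - h0)"] by simp
      also have "\<dots> \<le> \<bar>s - s0\<bar> + (\<bar>t - t0\<bar> + \<bar>u - h0\<bar>)"
        using norm_Pair_le[of "t - t0" "u - h0"] by simp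
      finally show ?thesis using d(2)[of "(s, t, u)"] that by (simp add: dist_norm)
    qed
    then show ?thesis using d(1) by blast
  qed
  obtain d1 where d1: "d1 > 0" "\<And>s t u. \<bar>s - s0\<bar> + \<bar>t - t0\<bar> + \<bar>u - h0\<bar> < d1 \<Longrightarrow> \<bar>F1 s t u - X1\<bar> \<le> e'"
    using near[OF cF1] unfolding X1_def by blast
  obtain d2 where d2: "d2 > 0" "\<And>s t u. \<bar>s - s0\<bar> + \<bar>t - t0\<bar> + \<bar>u - h0\<bar> < d2 \<Longrightarrow> \<bar>F2 s t u - X2\<bar> \<le> e'"
    using near[OF cF2] unfolding X2_def by blast
  obtain d3 where d3: "d3 > 0" "\<And>s t u. \<bar>s - s0\<bar> + \<bar>t - t0\<bar> + \<bar>u - h0\<bar> < d3 \<Longrightarrow> \<bar>F3 s t u - X3\<bar> \<le> e'"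
    using near[OF cF3] unfolding X3_def by blast
  obtain d4 where d4: "d4 > 0" "\<And>s t u. \<bar>s - s0\<bar> + \<bar>t - t0\<bar> + \<bar>u - h0\<bar> < d4 \<Longrightarrow> \<bar>f s t u\<bar> \<le> Cf"
    using near[OF cf] e' unfolding Cf_def by (metis abs_triangle_ineq2 add.commute diff_le_eq order_trans)
  from h_deriv[of s0 t0, unfolded has_derivative_at_alt] e'
  obtain d5 where d5: "d5 > 0" "\<And>z. norm (z - (s0, t0)) < d5 \<Longrightarrow>
     norm (h (fst z) (snd z) - h0 - (p * (fst z - s0) + q * (snd z - t0))) \<le> e' / 2 * norm (z - (s0, t0))"
    unfolding h0_def p_def q_def by (metis (no_types, lifting) fst_conv snd_conv fst_diff snd_diff half_gt_zero)
  define d where "d = min (min d1 d2) (min d3 d4)"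
  \<comment> \<open>In order: the fields are controlled everywhere above the cut, the surface is
    within \<open>e' * r\<close> of its tangent plane, the cut stays above the bottom, and the
    source integrated above the cut is below \<open>e'\<close>.\<close>
  define \<delta> where "\<delta> = min (min (d / (2 + L)) (d5 / 2)) (min ((h0 + 1) / L) (e' / (2 * L * Cf)))"
  have d: "d > 0" using d1 d2 d3 d4 by (simp add: d_def)
  have Cf: "Cf > 0" by (simp add: Cf_def)
  have h0: "h0 > - 1" unfolding h0_def by (rule h_gt)
  have "\<delta> > 0" using d L d5 h0 e' Cf by (simp add: \<delta>_def)
  moreover have "\<bar>rect_flux (column F1) (column F2) (column f) a (a + r) b (b + r)\<bar> \<le> e * r ^ 2"
    if r: "0 < r" "r < \<delta>" and box: "a \<le> s0" "s0 \<le> a + r" "b \<le> t0" "t0 \<le> b + r" for r a b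
  proof -
    define y where "y = h0 - L * r"
    have "r < d / (2 + L)" "r < d5 / 2" "r < (h0 + 1) / L" "r < e' / (2 * L * Cf)"
      using r unfolding \<delta>_def by auto
    then have rb: "(2 + L) * r < d" "2 * r < d5" "L * r < h0 + 1" "Cf * (2 * L * r) < e'"
      using L Cf by (simp_all add: field_simps)
    have y: "- 1 < y" using rb by (simp add: y_def)
    have hlin: "\<bar>h s t - h0 - (p * (s - s0) + q * (t - t0))\<bar> \<le> e' * r"
      if "s \<in> {a..a+r}" "t \<in> {b..b+r}" for s t
    proof -
      have "norm ((s, t) - (s0, t0)) \<le> \<bar>s - s0\<bar> + \<bar>t - t0\<bar>"
        using norm_Pair_le[of "s - s0" "t - t0"] by simp
      also have "\<dots> \<le> r + r" using that box by (intro add_mono) (auto simp: abs_le_iff)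
      finally have n: "norm ((s, t) - (s0, t0)) \<le> 2 * r" by simp
      then have "norm (h s t - h0 - (p * (s - s0) + q * (t - t0))) \<le> e' / 2 * norm ((s, t) - (s0, t0))"
        using d5(2)[of "(s, t)"] rb by simp
      also have "\<dots> \<le> e' / 2 * (2 * r)" using n e' by (intro mult_left_mono) auto
      finally show ?thesis by simp
    qed
    have hb: "\<bar>h s t - h0\<bar> \<le> (L - 1) * r" if st: "s \<in> {a..a+r}" "t \<in> {b..b+r}" for s t
    proof -
      have "\<bar>p * (s - s0)\<bar> \<le> \<bar>p\<bar> * r" "\<bar>q * (t - t0)\<bar> \<le> \<bar>q\<bar> * r"
        using st box unfolding abs_mult by (intro mult_left_mono; simp add: abs_le_iff)+
      moreover have "e' * r \<le> 1 * r" using e' r by (intro mult_right_mono) auto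
      ultimately have "\<bar>h s t - h0\<bar> \<le> \<bar>p\<bar> * r + \<bar>q\<bar> * r + r" using hlin[OF st] by linarith
      then show ?thesis by (simp add: L_def algebra_simps)
    qed
    have hy: "y < h s t" "h s t - y \<le> 2 * L * r" if st: "s \<in> {a..a+r}" "t \<in> {b..b+r}" for s t
      using hb[OF st] r by (auto simp: y_def abs_le_iff algebra_simps)
    have small: "\<bar>s - s0\<bar> + \<bar>t - t0\<bar> + \<bar>u - h0\<bar> < d"
      if st: "s \<in> {a..a+r}" "t \<in> {b..b+r}" and u: "u \<in> {y..h s t}" for s t u
    proof -
      have "u - h0 \<le> L * r" "h0 - u \<le> L * r" using u hb[OF st] r by (auto simp: y_def abs_le_iff algebra_simps)
      then have "\<bar>s - s0\<bar> + \<bar>t - t0\<bar> + \<bar>u - h0\<bar> \<le> r + r + L * r"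
        using st box by (intro add_mono) (auto simp: abs_le_iff)
      then show ?thesis using rb by (simp add: algebra_simps)
    qed
    \<comment> \<open>The part above the cut is written as a difference rather than as an integral
      from y upwards, which makes its continuity in (s, t) immediate.\<close>
    define S where "S g s t = column g s t - integral {-1..y} (g s t)" for g s t
    have S_eq: "S g s t = integral {y..h s t} (g s t)" if "cont3 g" "s \<in> {a..a+r}" "t \<in> {b..b+r}" for g s t
    proof -
      have "integral {-1..y} (g s t) + integral {y..h s t} (g s t) = integral {-1..h s t} (g s t)"
        using y hy[OF that(2,3)]
        by (intro Henstock_Kurzweil_Integration.integral_combine integrable_continuous_real
            cont3_compose[OF that(1)] continuous_intros) auto
      then show ?thesis by (simp add: S_def column_def)
    qed
    have S_approx: "\<bar>S g s t - k * (h s t - y)\<bar> \<le> m * (2 * L * r)"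
      if "cont3 g" and st: "s \<in> {a..a+r}" "t \<in> {b..b+r}" and m: "m \<ge> 0"
        and g: "\<And>u. u \<in> {y..h s t} \<Longrightarrow> \<bar>g s t u - k\<bar> \<le> m" for g s t k m
    proof -
      have "\<bar>integral {y..h s t} (g s t) - k * (h s t - y)\<bar> \<le> m * (h s t - y)"
        using hy[OF st] g by (intro integral_approx_const cont3_compose[OF that(1)] continuous_intros) auto
      also have "\<dots> \<le> m * (2 * L * r)" using hy[OF st] m by (intro mult_left_mono) auto
      finally show ?thesis using S_eq[OF that(1) st] by simp
    qed
    have cS: "cont2 (S g)" if "cont3 g" for g
      unfolding S_def using cont_column[OF that]
      by (intro continuous_intros continuous_on_integral_param cont3_compose[OF that] | assumption)+
    have I1: "\<bar>integral {b..b+r} (\<lambda>t. S F1 (a+r) t - S F1 a t) - (X1 * (p * r)) * (b + r - b)\<bar> \<le>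
        ((4 * L + 2 * \<bar>X1\<bar>) * e' * r) * (b + r - b)"
    proof (rule integral_approx_const)
      show "continuous_on {b..b+r} (\<lambda>t. S F1 (a+r) t - S F1 a t)"
        by (intro continuous_intros cont2_compose[OF cS[OF cF1]])
      fix t assume t: "t \<in> {b..b+r}"
      have a: "a \<in> {a..a+r}" "a + r \<in> {a..a+r}" using r by auto
      have "\<bar>S F1 (a+r) t - X1 * (h (a+r) t - y)\<bar> \<le> e' * (2 * L * r)"
        using a t d1(2) small e' by (intro S_approx cF1) (auto simp: d_def)
      moreover have "\<bar>S F1 a t - X1 * (h a t - y)\<bar> \<le> e' * (2 * L * r)"
        using a t d1(2) small e' by (intro S_approx cF1) (auto simp: d_def)
      moreover have "\<bar>X1 * (h (a+r) t - h a t - p * r)\<bar> \<le> \<bar>X1\<bar> * (2 * e' * r)"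
        unfolding abs_mult using hlin[OF a(2) t] hlin[OF a(1) t]
        by (intro mult_left_mono) (auto simp: algebra_simps)
      ultimately show "\<bar>S F1 (a+r) t - S F1 a t - X1 * (p * r)\<bar> \<le> (4 * L + 2 * \<bar>X1\<bar>) * e' * r"
        by (simp add: algebra_simps)
    qed (use r in auto)
    have I2: "\<bar>integral {a..a+r} (\<lambda>s. S F2 s (b+r) - S F2 s b) - (X2 * (q * r)) * (a + r - a)\<bar> \<le>
        ((4 * L + 2 * \<bar>X2\<bar>) * e' * r) * (a + r - a)"
    proof (rule integral_approx_const)
      show "continuous_on {a..a+r} (\<lambda>s. S F2 s (b+r) - S F2 s b)"
        by (intro continuous_intros cont2_compose[OF cS[OF cF2]])
      fix s assume s: "s \<in> {a..a+r}"
      have b: "b \<in> {b..b+r}" "b + r \<in> {b..b+r}" using r by auto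
      have "\<bar>S F2 s (b+r) - X2 * (h s (b+r) - y)\<bar> \<le> e' * (2 * L * r)"
        using b s d2(2) small e' by (intro S_approx cF2) (auto simp: d_def)
      moreover have "\<bar>S F2 s b - X2 * (h s b - y)\<bar> \<le> e' * (2 * L * r)"
        using b s d2(2) small e' by (intro S_approx cF2) (auto simp: d_def)
      moreover have "\<bar>X2 * (h s (b+r) - h s b - q * r)\<bar> \<le> \<bar>X2\<bar> * (2 * e' * r)"
        unfolding abs_mult using hlin[OF s b(2)] hlin[OF s b(1)]
        by (intro mult_left_mono) (auto simp: algebra_simps)
      ultimately show "\<bar>S F2 s (b+r) - S F2 s b - X2 * (q * r)\<bar> \<le> (4 * L + 2 * \<bar>X2\<bar>) * e' * r"
        by (simp add: algebra_simps)
    qed (use r in auto)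
    have c3: "cont2 (\<lambda>s t. S f s t + F3 s t y)"
      by (intro continuous_intros cS[OF cf] cont3_compose[OF cF3])
    have I3: "\<bar>iterated (\<lambda>s t. S f s t + F3 s t y) a (a+r) b (b+r) - X3 * (b+r - b) * (a+r - a)\<bar>
        \<le> (2 * e') * (b+r - b) * (a+r - a)"
    proof (rule iterated_approx_const[OF c3])
      fix s t assume st: "s \<in> {a..a+r}" "t \<in> {b..b+r}"
      have "\<bar>S f s t - 0 * (h s t - y)\<bar> \<le> Cf * (2 * L * r)"
        using st d4(2) small Cf by (intro S_approx cf) (auto simp: d_def)
      moreover have "\<bar>F3 s t y - X3\<bar> \<le> e'"
        using small[OF st, of y] hy[OF st] by (intro d3(2)) (auto simp: d_def)
      ultimately show "\<bar>S f s t + F3 s t y - X3\<bar> \<le> 2 * e'" using rb by simp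
    qed (use r in auto)
    have "box_flux F1 F2 F3 f a (a + r) b (b + r) (-1) y = 0"
    proof (rule box_flux_eq_0_bottom[OF r(1) y])
      fix s t u assume "s \<in> {a..a+r}" "t \<in> {b..b+r}" "u \<in> {-1<..y}"
      then show "divergence_at s t u" using hy(1)[of s t] by (intro div) auto
    qed
    \<comment> \<open>Subtracting the vanishing flux of the lower box leaves the sides above the
      cut, the source there and the flux through the cut.\<close>
    then have "rect_flux (column F1) (column F2) (column f) a (a + r) b (b + r) =
      rect_flux (column F1) (column F2) (column f) a (a + r) b (b + r) - box_flux F1 F2 F3 f a (a + r) b (b + r) (-1) y"
      by simp
    also have "\<dots> = integral {b..b+r} (\<lambda>t. S F1 (a+r) t - S F1 a t) + integral {a..a+r} (\<lambda>s. S F2 s (b+r) - S F2 s b)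
       - iterated (\<lambda>s t. S f s t + F3 s t y) a (a+r) b (b+r)"
    proof -
      have 1: "integral {b..b+r} (\<lambda>t. column F1 (a+r) t - column F1 a t) =
        integral {b..b+r} (\<lambda>t. S F1 (a+r) t - S F1 a t) + iterated (\<lambda>t u. F1 (a+r) t u - F1 a t u) b (b+r) (-1) y"
      proof -
        have "integral {-1..y} (\<lambda>u. F1 (a+r) t u - F1 a t u) = integral {-1..y} (F1 (a+r) t) - integral {-1..y} (F1 a t)" for t
          by (intro integral_diff integrable_continuous_real cont3_compose[OF cF1] continuous_intros)
        then have "column F1 (a+r) t - column F1 a t = (S F1 (a+r) t - S F1 a t) + integral {-1..y} (\<lambda>u. F1 (a+r) t u - F1 a t u)" for t
          by (simp add: S_def)
        moreover have "(\<lambda>t. S F1 (a+r) t - S F1 a t) integrable_on {b..b+r}"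
          by (intro integrable_continuous_real continuous_intros cont2_compose[OF cS[OF cF1]])
        ultimately show ?thesis
          by (simp add: integral_add cont2_integrable[OF flux_cont(1)])
      qed
      have 2: "integral {a..a+r} (\<lambda>s. column F2 s (b+r) - column F2 s b) =
        integral {a..a+r} (\<lambda>s. S F2 s (b+r) - S F2 s b) + iterated (\<lambda>s u. F2 s (b+r) u - F2 s b u) a (a+r) (-1) y"
      proof -
        have "integral {-1..y} (\<lambda>u. F2 s (b+r) u - F2 s b u) = integral {-1..y} (F2 s (b+r)) - integral {-1..y} (F2 s b)" for s
          by (intro integral_diff integrable_continuous_real cont3_compose[OF cF2] continuous_intros)
        then have "column F2 s (b+r) - column F2 s b = (S F2 s (b+r) - S F2 s b) + integral {-1..y} (\<lambda>u. F2 s (b+r) u - F2 s b u)" for s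
          by (simp add: S_def)
        moreover have "(\<lambda>s. S F2 s (b+r) - S F2 s b) integrable_on {a..a+r}"
          by (intro integrable_continuous_real continuous_intros cont2_compose[OF cS[OF cF2]])
        ultimately show ?thesis
          by (simp add: integral_add cont2_integrable[OF flux_cont(2)])
      qed
      have 3: "iterated (column f) a (a+r) b (b+r) = iterated (\<lambda>s t. S f s t + F3 s t y) a (a+r) b (b+r)
        - iterated (\<lambda>s t. F3 s t y - F3 s t (-1) - integral {-1..y} (f s t)) a (a+r) b (b+r)"
      proof -
        have e: "(\<lambda>t. (S f s t + F3 s t y)) = (\<lambda>t. column f s t + (F3 s t y - F3 s t (-1) - integral {-1..y} (f s t)))" for s
          by (simp add: S_def bottom fun_eq_iff)
        show ?thesis unfolding e
          using iterated_add[OF cont_column[OF cf] flux_cont(3)[of y "-1"], of a "a+r" b "b+r"] by linarith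
      qed
      show ?thesis unfolding rect_flux_def box_flux_def 1 2 3 by simp
    qed
    finally have eq: "rect_flux (column F1) (column F2) (column f) a (a + r) b (b + r) = \<dots>" .
    \<comment> \<open>Tangency at the base point: with it the leading parts of the three fluxes,
      each of order r^2, cancel.\<close>
    have X: "X3 = p * X1 + q * X2"
      using surface[of s0 t0] by (simp add: X1_def X2_def X3_def p_def q_def h0_def)
    have "\<bar>rect_flux (column F1) (column F2) (column f) a (a + r) b (b + r)\<bar> \<le>
       ((4 * L + 2 * \<bar>X1\<bar>) * e' * r) * r + ((4 * L + 2 * \<bar>X2\<bar>) * e' * r) * r + (2 * e') * r * r"
    proof -
      have "X1 * (p * r) * r + X2 * (q * r) * r - X3 * r * r = 0" unfolding X by (simp add: algebra_simps)
      then show ?thesis unfolding eq using I1 I2 I3 by simp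
    qed
    also have "\<dots> = (e' * K) * r^2" by (simp add: K_def power2_eq_square algebra_simps)
    also have "\<dots> \<le> e * r^2" using e' by (intro mult_right_mono) auto
    finally show ?thesis .
  qed
  ultimately show ?thesis by blast
qed

text \<open>The fields vanish on the sides of the square of half side R, so only the source survives
  in \<open>rect_flux\<close>.\<close>

theorem integral_column_divergence:
  assumes R: "R > 0"
    and supp: "\<And>s t u. R \<le> \<bar>s\<bar> \<or> R \<le> \<bar>t\<bar> \<Longrightarrow> F1 s t u = 0 \<and> F2 s t u = 0"
  shows "iterated (column f) (- R) R (- R) R = 0"
proof -
  have "rect_flux (column F1) (column F2) (column f) (- R) (- R + 2 * R) (- R) (- R + 2 * R) = 0"
    using R by (intro rect.rect_flux_eq_0 rect_flux_small) auto
  moreover have "column F1 R t = 0" "column F1 (- R) t = 0" "column F2 s R = 0" "column F2 s (- R) = 0" for s t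
  proof -
    have "F1 R t = (\<lambda>u. 0)" "F1 (- R) t = (\<lambda>u. 0)" "F2 s R = (\<lambda>u. 0)" "F2 s (- R) = (\<lambda>u. 0)"
      using supp R by (auto simp: fun_eq_iff)
    then show "column F1 R t = 0" "column F1 (- R) t = 0" "column F2 s R = 0" "column F2 s (- R) = 0"
      by (simp_all add: column_def)
  qed
  ultimately show ?thesis by (simp add: rect_flux_def)
qed

end

subsection \<open>Transfer to the plane\<close>

abbreviation plane_point :: "real \<Rightarrow> real \<Rightarrow> R2" where
  "plane_point s t \<equiv> s *\<^sub>R axis 1 1 + t *\<^sub>R axis 2 1"

lemma axis_R2_nth [simp]:
  "(axis 1 1 :: R2) $ 1 = 1" "(axis 1 1 :: R2) $ 2 = 0"
  "(axis 2 1 :: R2) $ 1 = 0" "(axis 2 1 :: R2) $ 2 = 1"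
  by (simp_all add: axis_def)

lemma plane_point_nth [simp]: "plane_point s t $ 1 = s" "plane_point s t $ 2 = t"
  by (simp_all add: axis_def)

lemma plane_point_eta: "plane_point (x $ 1) (x $ 2) = x"
  by (simp add: vec_eq_iff forall_2 axis_def)

lemma Basis_R2: "(Basis :: R2 set) = {axis 1 1, axis 2 1}"
  unfolding Basis_vec_def by (auto simp: UNIV_2)

lemma axis_R2_neq: "(axis 1 1 :: R2) \<noteq> axis 2 1"
  by (simp add: axis_eq_axis)

lemma inner_R2: "(x :: R2) \<bullet> y = x $ 1 * y $ 1 + x $ 2 * y $ 2"
  by (simp add: inner_vec_def UNIV_2)

text \<open>Lebesgue measure is determined by its values on boxes, and a box of
  \<open>real ^ 2\<close> corresponds to a product of two intervals; this makes Fubini available in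
  vector coordinates.\<close>

lemma lborel_R2: "(lborel :: R2 measure) = distr (lborel \<Otimes>\<^sub>M lborel) borel (\<lambda>z. plane_point (fst z) (snd z))"
proof (rule lborel_eqI)
  have [measurable]: "(\<lambda>z. plane_point (fst z) (snd z)) \<in> borel_measurable (lborel \<Otimes>\<^sub>M lborel)"
    by measurable
  fix l u :: R2 assume le: "\<And>b. b \<in> Basis \<Longrightarrow> l \<bullet> b \<le> u \<bullet> b"
  have le': "l $ 1 \<le> u $ 1" "l $ 2 \<le> u $ 2"
    using le[of "axis 1 1"] le[of "axis 2 1"] by (auto simp: Basis_R2 inner_axis)
  have vim: "(\<lambda>z. plane_point (fst z) (snd z)) -` box l u \<inter> space (lborel \<Otimes>\<^sub>M lborel) =
      {l$1<..<u$1} \<times> {l$2<..<u$2}"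
    by (auto simp: space_pair_measure mem_box Basis_R2 inner_axis)
  have "emeasure (distr (lborel \<Otimes>\<^sub>M lborel) borel (\<lambda>z. plane_point (fst z) (snd z))) (box l u) =
      emeasure (lborel \<Otimes>\<^sub>M lborel) ({l$1<..<u$1} \<times> {l$2<..<u$2})"
    by (subst emeasure_distr) (auto simp: vim)
  also have "\<dots> = ennreal ((u$1 - l$1) * (u$2 - l$2))"
    using le' by (subst lborel.emeasure_pair_measure_Times) (auto simp: ennreal_mult)
  also have "(u$1 - l$1) * (u$2 - l$2) = (\<Prod>b\<in>Basis. (u - l) \<bullet> b)"
    by (simp add: Basis_R2 axis_R2_neq inner_axis)
  finally show "emeasure (distr (lborel \<Otimes>\<^sub>M lborel) borel (\<lambda>z. plane_point (fst z) (snd z))) (box l u) =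
      (\<Prod>b\<in>Basis. (u - l) \<bullet> b)" .
qed simp

lemma plane_point_measurable: "(\<lambda>z. plane_point (fst z) (snd z)) \<in> lborel \<Otimes>\<^sub>M lborel \<rightarrow>\<^sub>M borel"
  by measurable

lemma nn_integral_R2:
  assumes "f \<in> borel_measurable (borel :: R2 measure)"
  shows "(\<integral>\<^sup>+x. f x \<partial>lborel) = (\<integral>\<^sup>+s. \<integral>\<^sup>+t. f (plane_point s t) \<partial>lborel \<partial>lborel)"
    and "(\<integral>\<^sup>+x. f x \<partial>lborel) = (\<integral>\<^sup>+t. \<integral>\<^sup>+s. f (plane_point s t) \<partial>lborel \<partial>lborel)"
proof -
  have m: "(\<lambda>z. f (plane_point (fst z) (snd z))) \<in> borel_measurable (lborel \<Otimes>\<^sub>M lborel)"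
    using measurable_compose[OF plane_point_measurable assms] .
  have "(\<integral>\<^sup>+x. f x \<partial>lborel) = (\<integral>\<^sup>+z. f (plane_point (fst z) (snd z)) \<partial>(lborel \<Otimes>\<^sub>M lborel))"
    by (subst lborel_R2, subst nn_integral_distr[OF plane_point_measurable]) (use assms in simp_all)
  moreover have "\<dots> = (\<integral>\<^sup>+s. \<integral>\<^sup>+t. f (plane_point s t) \<partial>lborel \<partial>lborel)"
    using lborel.nn_integral_fst[OF m] by simp
  moreover have "\<dots> = (\<integral>\<^sup>+t. \<integral>\<^sup>+s. f (plane_point s t) \<partial>lborel \<partial>lborel)"
    using lborel_pair.Fubini[OF m] by simp
  ultimately show "(\<integral>\<^sup>+x. f x \<partial>lborel) = (\<integral>\<^sup>+s. \<integral>\<^sup>+t. f (plane_point s t) \<partial>lborel \<partial>lborel)"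
    "(\<integral>\<^sup>+x. f x \<partial>lborel) = (\<integral>\<^sup>+t. \<integral>\<^sup>+s. f (plane_point s t) \<partial>lborel \<partial>lborel)"
    by simp_all
qed

lemma integral_R2:
  fixes f :: "R2 \<Rightarrow> 'a::{banach, second_countable_topology}"
  assumes "integrable lborel f"
  shows "AE s in lborel. integrable lborel (\<lambda>t. f (plane_point s t))"
    and "AE t in lborel. integrable lborel (\<lambda>s. f (plane_point s t))"
    and "(LINT x|lborel. f x) = (LINT s|lborel. LINT t|lborel. f (plane_point s t))"
    and "(LINT x|lborel. f x) = (LINT t|lborel. LINT s|lborel. f (plane_point s t))"
proof -
  have fm: "f \<in> borel_measurable borel" using assms by auto
  have i: "integrable (lborel \<Otimes>\<^sub>M lborel) (\<lambda>z. f (plane_point (fst z) (snd z)))"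
    using assms by (subst (asm) lborel_R2) (subst (asm) integrable_distr_eq[OF plane_point_measurable fm])
  have e: "(LINT x|lborel. f x) = (LINT z|(lborel \<Otimes>\<^sub>M lborel). f (plane_point (fst z) (snd z)))"
    by (subst lborel_R2) (rule integral_distr[OF plane_point_measurable fm])
  show "AE s in lborel. integrable lborel (\<lambda>t. f (plane_point s t))"
    using lborel_pair.AE_integrable_fst'[OF i] by simp
  show "(LINT x|lborel. f x) = (LINT s|lborel. LINT t|lborel. f (plane_point s t))"
    using lborel_pair.integral_fst'[OF i] e by simp
  have i2: "integrable (lborel \<Otimes>\<^sub>M lborel) (\<lambda>z. f (plane_point (snd z) (fst z)))"
    using lborel_pair.integrable_product_swap[OF i] by (simp add: case_prod_unfold)
  show "AE t in lborel. integrable lborel (\<lambda>s. f (plane_point s t))"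
    using lborel_pair.AE_integrable_fst'[OF i2] by simp
  have "(LINT z|(lborel \<Otimes>\<^sub>M lborel). f (plane_point (fst z) (snd z))) = (LINT z|(lborel \<Otimes>\<^sub>M lborel). f (plane_point (snd z) (fst z)))"
    using lborel_pair.integral_product_swap[of "\<lambda>z. f (plane_point (fst z) (snd z))"] i
    by (simp add: case_prod_unfold)
  then show "(LINT x|lborel. f x) = (LINT t|lborel. LINT s|lborel. f (plane_point s t))"
    using lborel_pair.integral_fst'[OF i2] e by simp
qed

lemma compact_square: "compact {x :: R2. \<bar>x $ 1\<bar> \<le> R \<and> \<bar>x $ 2\<bar> \<le> R}"
proof -
  have "{x :: R2. \<bar>x $ 1\<bar> \<le> R \<and> \<bar>x $ 2\<bar> \<le> R} = cbox (plane_point (- R) (- R)) (plane_point R R)"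
    by (auto simp: mem_box Basis_R2 inner_axis abs_le_iff)
  then show ?thesis by simp
qed

lemma integrable_square_support:
  fixes g :: "R2 \<Rightarrow> real"
  assumes "continuous_on UNIV g" "\<And>x. R \<le> \<bar>x $ 1\<bar> \<or> R \<le> \<bar>x $ 2\<bar> \<Longrightarrow> g x = 0"
  shows "integrable lborel g"
proof -
  let ?S = "{x :: R2. \<bar>x $ 1\<bar> \<le> R \<and> \<bar>x $ 2\<bar> \<le> R}"
  have "integrable lborel (\<lambda>x. indicator ?S x *\<^sub>R g x)"
    using assms(1) by (intro borel_integrable_compact compact_square) (auto intro: continuous_on_subset)
  moreover have "(\<lambda>x. indicator ?S x *\<^sub>R g x) = g"
  proof
    show "indicator ?S x *\<^sub>R g x = g x" for x
      using assms(2)[of x] by (cases "x \<in> ?S") auto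
  qed
  ultimately show ?thesis by simp
qed

lemma lborel_integral_interval:
  fixes g :: "real \<Rightarrow> real"
  assumes "continuous_on UNIV g" "\<And>x. R \<le> \<bar>x\<bar> \<Longrightarrow> g x = 0"
  shows "(LINT x|lborel. g x) = integral {-R..R} g"
proof -
  have e: "(\<lambda>x. indicator {-R..R} x *\<^sub>R g x) = g"
  proof
    show "indicator {-R..R} x *\<^sub>R g x = g x" for x
      using assms(2)[of x] by (cases "x \<in> {-R..R}") (auto simp: abs_le_iff)
  qed
  have "integrable lborel (\<lambda>x. indicator {-R..R} x *\<^sub>R g x)"
    using assms(1) by (intro borel_integrable_compact) (auto intro: continuous_on_subset)
  then have "set_integrable lborel {-R..R} g" by (simp add: set_integrable_def)
  from set_borel_integral_eq_integral(2)[OF this]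
  show ?thesis using e by (simp add: set_lebesgue_integral_def)
qed

lemma lborel_integral_iterated:
  fixes g :: "R2 \<Rightarrow> real"
  assumes g: "continuous_on UNIV g" and supp: "\<And>x. R \<le> \<bar>x $ 1\<bar> \<or> R \<le> \<bar>x $ 2\<bar> \<Longrightarrow> g x = 0"
  shows "(LINT x|lborel. g x) = iterated (\<lambda>s t. g (plane_point s t)) (- R) R (- R) R"
proof -
  have c: "cont2 (\<lambda>s t. g (plane_point s t))"
    by (intro continuous_on_compose2[OF g] continuous_intros) auto
  have inner: "(LINT t|lborel. g (plane_point s t)) = integral {-R..R} (\<lambda>t. g (plane_point s t))" for s
    using supp by (intro lborel_integral_interval continuous_on_compose2[OF g] continuous_intros) auto
  have "(LINT x|lborel. g x) = (LINT s|lborel. LINT t|lborel. g (plane_point s t))"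
    by (rule integral_R2(3)[OF integrable_square_support[OF g supp]])
  also have "\<dots> = (LINT s|lborel. integral {-R..R} (\<lambda>t. g (plane_point s t)))" by (simp add: inner)
  also have "\<dots> = iterated (\<lambda>s t. g (plane_point s t)) (- R) R (- R) R"
  proof (rule lborel_integral_interval)
    show "continuous_on UNIV (\<lambda>s. integral {-R..R} (\<lambda>t. g (plane_point s t)))"
      by (rule continuous_on_integral_param[OF c])
    show "integral {-R..R} (\<lambda>t. g (plane_point s t)) = 0" if "R \<le> \<bar>s\<bar>" for s
      using supp that by simp
  qed
  finally show ?thesis .
qed

text \<open>The component of the gradient is merely integrable, not continuous. Along every
  coordinate line the gauge integral of a derivative is the difference of the end values, which
  vanish; on almost every line, by Fubini, the Lebesgue integral exists and agrees with the gauge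
  integral.\<close>

lemma integral_partial_derivative_eq_0:
  fixes w :: "R2 \<Rightarrow> real"
  assumes der: "\<And>x. (w has_derivative (\<lambda>v. gw x \<bullet> v)) (at x)"
    and int: "integrable lborel (\<lambda>x. gw x $ i)"
    and supp: "\<And>x. R \<le> \<bar>x $ 1\<bar> \<or> R \<le> \<bar>x $ 2\<bar> \<Longrightarrow> w x = 0 \<and> gw x = 0"
  shows "(LINT x|lborel. gw x $ i) = 0"
proof -
  \<comment> \<open>No sign of R is assumed, whereas the interval of integration must be
    nonempty.\<close>
  define A where "A = max R 0"
  have A: "- A \<le> A" by (simp add: A_def)
  have line: "(LINT r|lborel. gw (a + r *\<^sub>R axis i 1) $ i) = 0"
    if int: "integrable lborel (\<lambda>r. gw (a + r *\<^sub>R axis i 1) $ i)" and "a $ i = 0" for a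
  proof -
    have comp: "(a + r *\<^sub>R axis i 1) $ i = r" for r using that by (simp add: axis_def)
    then have out: "w (a + r *\<^sub>R axis i 1) = 0 \<and> gw (a + r *\<^sub>R axis i 1) = 0" if "A \<le> \<bar>r\<bar>" for r
      using supp[of "a + r *\<^sub>R axis i 1"] that exhaust_2[of i] by (auto simp: A_def)
    have "((\<lambda>r. gw (a + r *\<^sub>R axis i 1) $ i) has_integral (w (a + A *\<^sub>R axis i 1) - w (a + (- A) *\<^sub>R axis i 1))) {- A..A}"
    proof (rule fundamental_theorem_of_calculus[OF A])
      fix r
      have "((\<lambda>r. a + r *\<^sub>R axis i 1) has_derivative (\<lambda>v. v *\<^sub>R axis i 1)) (at r within {-A..A})"
        by (auto intro!: derivative_eq_intros)
      from has_derivative_compose[OF this der]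
      show "((\<lambda>r. w (a + r *\<^sub>R axis i 1)) has_vector_derivative gw (a + r *\<^sub>R axis i 1) $ i) (at r within {-A..A})"
        by (simp add: has_vector_derivative_def inner_axis)
    qed
    moreover have "w (a + A *\<^sub>R axis i 1) = 0" "w (a + (- A) *\<^sub>R axis i 1) = 0"
      using out[of A] out[of "- A"] by (auto simp: A_def)
    ultimately have "((\<lambda>r. gw (a + r *\<^sub>R axis i 1) $ i) has_integral 0) {- A..A}" by simp
    then have "((\<lambda>r. if r \<in> {-A..A} then gw (a + r *\<^sub>R axis i 1) $ i else 0) has_integral 0) UNIV"
      by (subst has_integral_restrict_UNIV)
    moreover have "(\<lambda>r. if r \<in> {-A..A} then gw (a + r *\<^sub>R axis i 1) $ i else 0) = (\<lambda>r. gw (a + r *\<^sub>R axis i 1) $ i)"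
      using out by (auto simp: fun_eq_iff)
    ultimately have "((\<lambda>r. gw (a + r *\<^sub>R axis i 1) $ i) has_integral 0) UNIV" by simp
    from has_integral_unique[OF this has_integral_integral_lborel[OF int]] show ?thesis by simp
  qed
  have "i = 1 \<or> i = 2" by (rule exhaust_2)
  then show ?thesis
  proof
    assume i: "i = 1"
    have "AE t in lborel. (LINT s|lborel. gw (plane_point s t) $ i) = 0"
      using integral_R2(2)[OF int]
    proof eventually_elim
      case (elim t)
      then show ?case using line[of "t *\<^sub>R axis 2 1"] by (simp add: i add.commute)
    qed
    then have "(LINT t|lborel. LINT s|lborel. gw (plane_point s t) $ i) = 0"
      by (rule integral_eq_zero_AE)
    then show ?thesis using integral_R2(4)[OF int] by simp
  next
    assume i: "i = 2"
    have "AE s in lborel. (LINT t|lborel. gw (plane_point s t) $ i) = 0"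
      using integral_R2(1)[OF int]
    proof eventually_elim
      case (elim s)
      then show ?case using line[of "s *\<^sub>R axis 1 1"] by (simp add: i)
    qed
    then have "(LINT s|lborel. LINT t|lborel. gw (plane_point s t) $ i) = 0"
      by (rule integral_eq_zero_AE)
    then show ?thesis using integral_R2(3)[OF int] by simp
  qed
qed

text \<open>Clamping the height to the column extends F and f continuously to all of space without
  changing them in the fluid, which reduces the claim to fields of three real variables. In the open
  layer clamping is locally the identity, so derivatives survive.\<close>

lemma integral_column_divergence_eq_0:
  fixes h :: "R2 \<Rightarrow> real" and F :: "R2 \<times> real \<Rightarrow> R2 \<times> real" and f :: "R2 \<times> real \<Rightarrow> real"
  assumes h_deriv: "\<And>x. (h has_derivative (\<lambda>v. gh x \<bullet> v)) (at x)" and h_gt: "\<And>x. - 1 < h x"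
    and contF: "continuous_on (fluid_domain h) F" and contf: "continuous_on (fluid_domain h) f"
    and div: "\<And>x y. - 1 < y \<Longrightarrow> y < h x \<Longrightarrow>
        \<exists>F'. (F has_derivative F') (at (x, y)) \<and> (\<Sum>b\<in>Basis. F' b \<bullet> b) = f (x, y)"
    and bottom: "\<And>x. snd (F (x, - 1)) = 0"
    and surface: "\<And>x. snd (F (x, h x)) = gh x \<bullet> fst (F (x, h x))"
    and R: "R > 0" and supp: "\<And>x y. R \<le> \<bar>x $ 1\<bar> \<or> R \<le> \<bar>x $ 2\<bar> \<Longrightarrow> F (x, y) = 0 \<and> f (x, y) = 0"
  shows "(LINT x|lborel. integral {- 1..h x} (\<lambda>y. f (x, y))) = 0"
proof -
  have cont_h: "continuous_on UNIV h"
    using h_deriv has_derivative_continuous by (fastforce simp: continuous_on_eq_continuous_at)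
  define clamp where "clamp x y = max (- 1) (min y (h x))" for x y
  have clamp_mem: "(x, clamp x y) \<in> fluid_domain h" for x y
    using h_gt[of x] by (auto simp: clamp_def fluid_domain_def)
  have cont_clamp: "continuous_on UNIV (\<lambda>z. (plane_point (fst z) (fst (snd z)), clamp (plane_point (fst z) (fst (snd z))) (snd (snd z))))"
    unfolding clamp_def by (intro continuous_intros continuous_on_compose2[OF cont_h]) auto
  define F1 where "F1 s t u = fst (F (plane_point s t, clamp (plane_point s t) u)) $ 1" for s t u
  define F2 where "F2 s t u = fst (F (plane_point s t, clamp (plane_point s t) u)) $ 2" for s t u
  define F3 where "F3 s t u = snd (F (plane_point s t, clamp (plane_point s t) u))" for s t u
  define g where "g s t u = f (plane_point s t, clamp (plane_point s t) u)" for s t u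
  have cF: "continuous_on UNIV (\<lambda>z. F (plane_point (fst z) (fst (snd z)), clamp (plane_point (fst z) (fst (snd z))) (snd (snd z))))"
    by (rule continuous_on_compose2[OF contF cont_clamp]) (auto simp: clamp_mem)
  have cg: "continuous_on UNIV (\<lambda>z. f (plane_point (fst z) (fst (snd z)), clamp (plane_point (fst z) (fst (snd z))) (snd (snd z))))"
    by (rule continuous_on_compose2[OF contf cont_clamp]) (auto simp: clamp_mem)
  interpret box_field F1 F2 F3 g
    by standard (unfold F1_def F2_def F3_def g_def, (intro continuous_intros cF cg)+)
  have clamp_id: "clamp x y = y" if "- 1 \<le> y" "y \<le> h x" for x y
    using that by (simp add: clamp_def)
  interpret column_field F1 F2 F3 g "\<lambda>s t. h (plane_point s t)" "\<lambda>s t. gh (plane_point s t) $ 1" "\<lambda>s t. gh (plane_point s t) $ 2"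
  proof
    fix s t :: real
    have "((\<lambda>z. plane_point (fst z) (snd z)) has_derivative (\<lambda>v. plane_point (fst v) (snd v))) (at (s, t))"
      by (auto intro!: derivative_eq_intros)
    from has_derivative_compose[OF this h_deriv]
    show "((\<lambda>z. h (plane_point (fst z) (snd z))) has_derivative
       (\<lambda>v. gh (plane_point s t) $ 1 * fst v + gh (plane_point s t) $ 2 * snd v)) (at (s, t))"
      by (simp add: inner_R2 axis_def)
    show "- 1 < h (plane_point s t)" by (rule h_gt)
    show "F3 s t (- 1) = 0" using bottom h_gt[of "plane_point s t"] by (simp add: F3_def clamp_id less_imp_le)
    show "F3 s t (h (plane_point s t)) = gh (plane_point s t) $ 1 * F1 s t (h (plane_point s t)) +
        gh (plane_point s t) $ 2 * F2 s t (h (plane_point s t))"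
      using surface h_gt[of "plane_point s t"] unfolding F1_def F2_def F3_def by (simp add: clamp_id less_imp_le inner_R2)
    fix u assume u: "- 1 < u" "u < h (plane_point s t)"
    from div[OF u] obtain F' where F': "(F has_derivative F') (at (plane_point s t, u))"
      and tr: "(\<Sum>b\<in>Basis. F' b \<bullet> b) = f (plane_point s t, u)" by blast
    define E :: "real \<times> real \<times> real \<Rightarrow> R2 \<times> real" where "E z = (plane_point (fst z) (fst (snd z)), snd (snd z))" for z
    have dE: "(E has_derivative E) (at (s, t, u))" unfolding E_def by (auto intro!: derivative_eq_intros)
    have dFE: "((\<lambda>z. F (E z)) has_derivative (\<lambda>v. F' (E v))) (at (s, t, u))"
      by (rule has_derivative_compose[OF dE]) (simp add: E_def F')
    define U where "U = {z :: real \<times> real \<times> real. - 1 < snd (snd z) \<and> snd (snd z) < h (plane_point (fst z) (fst (snd z)))}"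
    have U: "open U" unfolding U_def
      by (intro open_Collect_conj open_Collect_less continuous_intros continuous_on_compose2[OF cont_h]) auto
    have dF: "((\<lambda>z. F (plane_point (fst z) (fst (snd z)), clamp (plane_point (fst z) (fst (snd z))) (snd (snd z)))) has_derivative (\<lambda>v. F' (E v))) (at (s, t, u))"
      by (rule has_derivative_transform_within_open[OF dFE U])
         (auto simp: U_def u clamp_id less_imp_le E_def)
    have bl: "bounded_linear (\<lambda>v :: R2 \<times> real. fst v $ i)" for i :: 2
      by (intro bounded_linear_compose[OF bounded_linear_vec_nth bounded_linear_fst])
    have d1: "((\<lambda>z. F1 (fst z) (fst (snd z)) (snd (snd z))) has_derivative (\<lambda>v. fst (F' (E v)) $ 1)) (at (s, t, u))"
      unfolding F1_def by (rule bounded_linear.has_derivative[OF bl dF])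
    have d2: "((\<lambda>z. F2 (fst z) (fst (snd z)) (snd (snd z))) has_derivative (\<lambda>v. fst (F' (E v)) $ 2)) (at (s, t, u))"
      unfolding F2_def by (rule bounded_linear.has_derivative[OF bl dF])
    have d3: "((\<lambda>z. F3 (fst z) (fst (snd z)) (snd (snd z))) has_derivative (\<lambda>v. snd (F' (E v)))) (at (s, t, u))"
      unfolding F3_def by (rule bounded_linear.has_derivative[OF bounded_linear_snd dF])
    have "(\<Sum>b\<in>Basis. F' b \<bullet> b) = fst (F' (axis 1 1, 0)) $ 1 + fst (F' (axis 2 1, 0)) $ 2 + snd (F' (0, 1))"
      unfolding Basis_prod_def Basis_R2
      by (simp add: axis_R2_neq inner_prod_def inner_axis)
    moreover have "g s t u = f (plane_point s t, u)" using u by (simp add: g_def clamp_id)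
    ultimately show "divergence_at s t u"
      unfolding divergence_at_def
      by (intro exI[of _ "\<lambda>v. fst (F' (E v)) $ 1"] exI[of _ "\<lambda>v. fst (F' (E v)) $ 2"] exI[of _ "\<lambda>v. snd (F' (E v))"] conjI d1 d2 d3)
         (simp add: E_def tr)
  qed
  have "iterated (column g) (- R) R (- R) R = 0"
    using R supp by (intro integral_column_divergence) (auto simp: F1_def F2_def)
  moreover have col: "column g s t = integral {- 1..h (plane_point s t)} (\<lambda>y. f (plane_point s t, y))" for s t
    unfolding column_def by (intro integral_cong) (simp add: g_def clamp_id)
  moreover have "(LINT x|lborel. integral {- 1..h x} (\<lambda>y. f (x, y))) =
      iterated (\<lambda>s t. integral {- 1..h (plane_point s t)} (\<lambda>y. f (plane_point s t, y))) (- R) R (- R) R"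
  proof (rule lborel_integral_iterated)
    have "cont2 (column g)" by (rule cont_column[OF cf])
    then have "continuous_on UNIV (\<lambda>x :: R2. column g (x $ 1) (x $ 2))"
      by (rule cont2_compose) (intro continuous_intros)+
    then show "continuous_on UNIV (\<lambda>x. integral {- 1..h x} (\<lambda>y. f (x, y)))"
      by (simp add: col plane_point_eta)
    show "integral {- 1..h x} (\<lambda>y. f (x, y)) = 0" if "R \<le> \<bar>x $ 1\<bar> \<or> R \<le> \<bar>x $ 2\<bar>" for x
      using supp[OF that] by simp
  qed
  ultimately show ?thesis by (simp cong: integral_cong)
qed

subsection \<open>Steady waves\<close>

text \<open>Differentiability of the gradient at the single point \<open>p\<close> suffices.\<close>

lemma second_derivative_symmetric:
  fixes \<phi> :: "'a::real_inner \<Rightarrow> real"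
  assumes U: "open U" "p \<in> U"
    and grad: "\<And>x. x \<in> U \<Longrightarrow> (\<phi> has_derivative (\<lambda>v. D x \<bullet> v)) (at x)"
    and H: "(D has_derivative H) (at p)"
  shows "H v \<bullet> w = H w \<bullet> v"
proof -
  interpret H: bounded_linear H using H by (rule has_derivative_bounded_linear)
  define N where "N v w = norm v * (2 * norm v + norm w)" for v w :: 'a
  \<comment> \<open>The second difference is symmetric in v and w, while the mean value theorem
    along v turns it into t^2 (H w . v) up to o(t^2); comparing the two orders yields the
    symmetry.\<close>
  define S where "S v w t = \<phi> (p + t *\<^sub>R v + t *\<^sub>R w) - \<phi> (p + t *\<^sub>R v) - \<phi> (p + t *\<^sub>R w) + \<phi> p" for v w t
  have est: "\<exists>d>0. \<forall>t. 0 < t \<longrightarrow> t < d \<longrightarrow> \<bar>S v w t - t\<^sup>2 * (H w \<bullet> v)\<bar> \<le> e * N v w * t\<^sup>2"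
    if e: "e > 0" for v w e
  proof -
    obtain d1 where d1: "d1 > 0" "ball p d1 \<subseteq> U" using U open_contains_ball by blast
    from H[unfolded has_derivative_at_alt] e obtain d2 where d2: "d2 > 0"
      "\<And>x. norm (x - p) < d2 \<Longrightarrow> norm (D x - D p - H (x - p)) \<le> e * norm (x - p)" by blast
    define d where "d = min d1 d2 / (norm v + norm w + 1)"
    have pos: "norm v + norm w + 1 > 0" using norm_ge_zero[of v] norm_ge_zero[of w] by linarith
    have "\<bar>S v w t - t\<^sup>2 * (H w \<bullet> v)\<bar> \<le> e * N v w * t\<^sup>2" if t: "0 < t" "t < d" for t
    proof -
      have td: "t * (norm v + norm w + 1) < min d1 d2" using t pos by (simp add: d_def field_simps)
      have n1: "norm (s *\<^sub>R v + r *\<^sub>R w) \<le> t * norm v + r * norm w" if "0 \<le> s" "s \<le> t" "0 \<le> r" for s r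
      proof -
        have "norm (s *\<^sub>R v + r *\<^sub>R w) \<le> s * norm v + r * norm w"
          using norm_triangle_ineq[of "s *\<^sub>R v" "r *\<^sub>R w"] that by simp
        also have "\<dots> \<le> t * norm v + r * norm w" using that by (intro add_mono mult_right_mono) auto
        finally show ?thesis .
      qed
      have small: "norm (s *\<^sub>R v + r *\<^sub>R w) < min d1 d2" if "0 \<le> s" "s \<le> t" "0 \<le> r" "r \<le> t" for s r
      proof -
        have "norm (s *\<^sub>R v + r *\<^sub>R w) \<le> t * norm v + r * norm w" using n1 that by blast
        also have "r * norm w \<le> t * norm w" using that by (intro mult_right_mono) auto
        finally show ?thesis using td t by (simp add: algebra_simps)
      qed
      have inU: "p + s *\<^sub>R v + r *\<^sub>R w \<in> U" if "0 \<le> s" "s \<le> t" "0 \<le> r" "r \<le> t" for s r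
      proof -
        have "dist p (p + s *\<^sub>R v + r *\<^sub>R w) = norm (s *\<^sub>R v + r *\<^sub>R w)"
          unfolding dist_commute[of p] by (simp add: dist_norm add.assoc)
        then show ?thesis using small[OF that] d1 by (auto simp: subset_iff)
      qed
      define g where "g s = \<phi> (p + s *\<^sub>R v + t *\<^sub>R w) - \<phi> (p + s *\<^sub>R v)" for s
      have der: "(g has_derivative (\<lambda>h. h * ((D (p + s *\<^sub>R v + t *\<^sub>R w) - D (p + s *\<^sub>R v)) \<bullet> v))) (at s within {0..t})"
        if "s \<in> {0..t}" for s
      proof -
        have "((\<lambda>s. p + s *\<^sub>R v + r *\<^sub>R w) has_derivative (\<lambda>h. h *\<^sub>R v)) (at s within {0..t})" for r
          by (auto intro!: derivative_eq_intros)
        from has_derivative_compose[OF this grad[OF inU[of s t]]] has_derivative_compose[OF this[of 0] grad[OF inU[of s 0]]]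
        have "((\<lambda>s. \<phi> (p + s *\<^sub>R v + t *\<^sub>R w)) has_derivative (\<lambda>h. h * (D (p + s *\<^sub>R v + t *\<^sub>R w) \<bullet> v))) (at s within {0..t})"
          "((\<lambda>s. \<phi> (p + s *\<^sub>R v)) has_derivative (\<lambda>h. h * (D (p + s *\<^sub>R v) \<bullet> v))) (at s within {0..t})"
          using that t by simp_all
        from has_derivative_diff[OF this]
        show ?thesis by (simp add: g_def[abs_def] inner_diff_left right_diff_distrib)
      qed
      have "\<exists>x\<in>{0<..<t}. g t - g 0 = (t - 0) * ((D (p + x *\<^sub>R v + t *\<^sub>R w) - D (p + x *\<^sub>R v)) \<bullet> v)"
        by (rule mvt_simple[OF t(1)], rule der, auto)
      then obtain x where x: "0 < x" "x < t"
        and gx: "g t - g 0 = t * ((D (p + x *\<^sub>R v + t *\<^sub>R w) - D (p + x *\<^sub>R v)) \<bullet> v)" by auto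
      have "norm (D (p + x *\<^sub>R v + t *\<^sub>R w) - D p - H (x *\<^sub>R v + t *\<^sub>R w)) \<le> e * norm (x *\<^sub>R v + t *\<^sub>R w)"
        using d2(2)[of "p + x *\<^sub>R v + t *\<^sub>R w"] small[of x t] x by (simp add: add.assoc)
      also have "\<dots> \<le> e * (t * norm v + t * norm w)" using n1[of x t] x e by (intro mult_left_mono) auto
      finally have a: "norm (D (p + x *\<^sub>R v + t *\<^sub>R w) - D p - H (x *\<^sub>R v + t *\<^sub>R w)) \<le> e * (t * norm v + t * norm w)" .
      have "norm (D (p + x *\<^sub>R v) - D p - H (x *\<^sub>R v)) \<le> e * norm (x *\<^sub>R v)"
        using d2(2)[of "p + x *\<^sub>R v"] small[of x 0] x t by simp
      also have "\<dots> \<le> e * (t * norm v)" using x e by (intro mult_left_mono) (auto intro!: mult_right_mono)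
      finally have b: "norm (D (p + x *\<^sub>R v) - D p - H (x *\<^sub>R v)) \<le> e * (t * norm v)" .
      have "(D (p + x *\<^sub>R v + t *\<^sub>R w) - D (p + x *\<^sub>R v)) - t *\<^sub>R H w =
         (D (p + x *\<^sub>R v + t *\<^sub>R w) - D p - H (x *\<^sub>R v + t *\<^sub>R w)) - (D (p + x *\<^sub>R v) - D p - H (x *\<^sub>R v))"
        by (simp add: H.add H.scaleR)
      also have "norm \<dots> \<le> e * (t * norm v + t * norm w) + e * (t * norm v)"
        by (rule order_trans[OF norm_triangle_ineq4 add_mono[OF a b]])
      finally have "norm ((D (p + x *\<^sub>R v + t *\<^sub>R w) - D (p + x *\<^sub>R v)) - t *\<^sub>R H w) \<le>
         e * (t * norm v + t * norm w) + e * (t * norm v)" .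
      then have c: "norm ((D (p + x *\<^sub>R v + t *\<^sub>R w) - D (p + x *\<^sub>R v)) - t *\<^sub>R H w) \<le> e * t * (2 * norm v + norm w)"
        by (simp add: algebra_simps)
      have "S v w t = t * ((D (p + x *\<^sub>R v + t *\<^sub>R w) - D (p + x *\<^sub>R v)) \<bullet> v)"
        using gx by (simp add: S_def g_def)
      then have "S v w t - t\<^sup>2 * (H w \<bullet> v) = t * (((D (p + x *\<^sub>R v + t *\<^sub>R w) - D (p + x *\<^sub>R v)) - t *\<^sub>R H w) \<bullet> v)"
        by (simp add: inner_diff_left power2_eq_square algebra_simps)
      also have "\<bar>\<dots>\<bar> \<le> t * (norm ((D (p + x *\<^sub>R v + t *\<^sub>R w) - D (p + x *\<^sub>R v)) - t *\<^sub>R H w) * norm v)"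
        using t Cauchy_Schwarz_ineq2 by (simp add: abs_mult)
      also have "\<dots> \<le> t * (e * t * (2 * norm v + norm w) * norm v)"
        using t c by (intro mult_left_mono mult_right_mono) auto
      also have "\<dots> = e * N v w * t\<^sup>2" by (simp add: N_def power2_eq_square mult_ac)
      finally show ?thesis .
    qed
    moreover have "d > 0" using d1 d2 pos by (simp add: d_def)
    ultimately show ?thesis by blast
  qed
  have S_sym: "S v w t = S w v t" for t by (simp add: S_def add_ac)
  have bound: "\<bar>H v \<bullet> w - H w \<bullet> v\<bar> \<le> e * (N v w + N w v)" if e: "e > 0" for e
  proof -
    obtain d where d: "d > 0" "\<And>t. 0 < t \<Longrightarrow> t < d \<Longrightarrow> \<bar>S v w t - t\<^sup>2 * (H w \<bullet> v)\<bar> \<le> e * N v w * t\<^sup>2" using est[OF e] by blast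
    obtain d' where d': "d' > 0" "\<And>t. 0 < t \<Longrightarrow> t < d' \<Longrightarrow> \<bar>S w v t - t\<^sup>2 * (H v \<bullet> w)\<bar> \<le> e * N w v * t\<^sup>2" using est[OF e] by blast
    define t where "t = min d d' / 2"
    have t: "0 < t" "t < d" "t < d'" using d d' by (auto simp: t_def)
    have "\<bar>t\<^sup>2 * (H v \<bullet> w) - t\<^sup>2 * (H w \<bullet> v)\<bar> \<le> e * N v w * t\<^sup>2 + e * N w v * t\<^sup>2"
      using d(2)[OF t(1,2)] d'(2)[OF t(1,3)] S_sym[of t] by linarith
    then have "\<bar>t\<^sup>2 * (H v \<bullet> w - H w \<bullet> v)\<bar> \<le> t\<^sup>2 * (e * (N v w + N w v))"
      by (simp add: algebra_simps)
    then have "t\<^sup>2 * \<bar>H v \<bullet> w - H w \<bullet> v\<bar> \<le> t\<^sup>2 * (e * (N v w + N w v))"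
      by (simp add: abs_mult)
    then show ?thesis using t by simp
  qed
  have "\<bar>H v \<bullet> w - H w \<bullet> v\<bar> \<le> 0"
  proof (rule field_le_epsilon)
    fix e :: real assume e: "e > 0"
    define M where "M = N v w + N w v + 1"
    have M: "M > 0" "N v w + N w v \<le> M" by (auto simp: M_def N_def intro!: add_nonneg_pos)
    have "\<bar>H v \<bullet> w - H w \<bullet> v\<bar> \<le> e / M * (N v w + N w v)" using bound[of "e / M"] e M by simp
    also have "\<dots> \<le> e / M * M" using M e by (intro mult_left_mono) auto
    finally show "\<bar>H v \<bullet> w - H w \<bullet> v\<bar> \<le> 0 + e" using M by simp
  qed
  then show ?thesis by simp
qed

text \<open>\<open>grad\<close> is a definite description: existence comes from the Riesz vector of
  the derivative, uniqueness from nondegeneracy of the inner product.\<close>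

lemma differentiable_imp_grad:
  assumes "f differentiable at x"
  shows "(f has_derivative (\<lambda>v. grad f x \<bullet> v)) (at x)"
proof -
  from assms obtain f' where f': "(f has_derivative f') (at x)" by (auto simp: differentiable_def)
  interpret bounded_linear f' using f' by (rule has_derivative_bounded_linear)
  define g where "g = (\<Sum>b\<in>Basis. f' b *\<^sub>R b)"
  have "f' v = g \<bullet> v" for v
  proof -
    have "f' v = f' (\<Sum>b\<in>Basis. (v \<bullet> b) *\<^sub>R b)" by (simp add: euclidean_representation)
    also have "\<dots> = (\<Sum>b\<in>Basis. (v \<bullet> b) * f' b)" by (simp add: sum scaleR)
    also have "\<dots> = v \<bullet> g" by (simp add: g_def inner_sum_right mult.commute)
    also have "\<dots> = g \<bullet> v" by (rule inner_commute)
    finally show ?thesis .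
  qed
  then have g: "(f has_derivative (\<lambda>v. g \<bullet> v)) (at x)" using f' by (metis (no_types, lifting) has_derivative_eq_rhs ext)
  have "GDERIV f x :> g" using g by (simp add: gderiv_def inner_commute)
  moreover have "g' = g" if "GDERIV f x :> g'" for g'
  proof -
    have "(f has_derivative (\<lambda>v. g' \<bullet> v)) (at x)" using that by (simp add: gderiv_def inner_commute)
    from has_derivative_unique[OF this g] have "g' \<bullet> v = g \<bullet> v" for v by meson
    then show ?thesis by (metis inner_commute vector_eq_ldot)
  qed
  ultimately have "grad f x = g" unfolding grad_def by (rule the_equality)
  then show ?thesis using g by simp
qed

text \<open>Solutions start at time 0, where only a one-sided derivative is given; the right-hand
  filter is nontrivial, so limits along it are still unique.\<close>

lemma has_real_derivative_unique_at_0: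
  assumes "(f has_real_derivative a) (at 0 within {0..})" "(f has_real_derivative b) (at 0 within {0..})"
  shows "a = b"
  using assms unfolding has_field_derivative_iff
  by (rule tendsto_unique[rotated]) (simp add: at_within_Ici_at_right)

locale fluid_layer =
  fixes h :: "R2 \<Rightarrow> real" and gh :: "R2 \<Rightarrow> R2"
  assumes h_deriv: "\<And>x. (h has_derivative (\<lambda>v. gh x \<bullet> v)) (at x)"
    and h_gt: "\<And>x. - 1 < h x"

text \<open>The system in the frame of the wave with G(h)\<psi> eliminated: \<open>kinematic\<close>
  says that D - (c, 0) is tangential to the surface, \<open>bernoulli\<close> is the pressure
  condition there. The surface gradient \<open>g\<psi>\<close> is only measurable and square
  integrable, hence it cannot be handled as a continuous integrand.\<close>

locale steady_wave = fluid_layer h gh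
  for h :: "R2 \<Rightarrow> real" and gh :: "R2 \<Rightarrow> R2" +
  fixes \<psi> :: "R2 \<Rightarrow> real" and g\<psi> :: "R2 \<Rightarrow> R2" and \<phi> :: "R2 \<times> real \<Rightarrow> real"
    and D :: "R2 \<times> real \<Rightarrow> R2 \<times> real" and c :: R2
  assumes \<psi>_deriv: "\<And>x. (\<psi> has_derivative (\<lambda>v. g\<psi> x \<bullet> v)) (at x)"
    and cont_D: "continuous_on (fluid_domain h) D"
    and \<phi>_deriv: "\<And>p. p \<in> fluid_domain h \<Longrightarrow> (\<phi> has_derivative (\<lambda>v. D p \<bullet> v)) (at p within fluid_domain h)"
    and harmonic: "\<And>x y. - 1 < y \<Longrightarrow> y < h x \<Longrightarrow>
        \<exists>H. (D has_derivative H) (at (x, y)) \<and> (\<Sum>b\<in>Basis. H b \<bullet> b) = 0"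
    and trace: "\<And>x. \<phi> (x, h x) = \<psi> x"
    and bottom: "\<And>x. snd (D (x, - 1)) = 0"
    and energy: "(\<integral>\<^sup>+p\<in>fluid_domain h. ennreal ((norm (D p))\<^sup>2) \<partial>lborel) < \<infinity>"
    and kinematic: "\<And>x. snd (D (x, h x)) = gh x \<bullet> (fst (D (x, h x)) - c)"
    and bernoulli: "\<And>x. h x + (norm (D (x, h x)))\<^sup>2 / 2 = c \<bullet> fst (D (x, h x))"
    and h_L2: "integrable lborel (\<lambda>x. (h x)\<^sup>2)"
    and g\<psi>_measurable: "\<And>i. (\<lambda>x. g\<psi> x $ i) \<in> borel_measurable borel"
    and g\<psi>_L2: "\<And>i. integrable lborel (\<lambda>x. (g\<psi> x $ i)\<^sup>2)"

text \<open>The map from x to (x, h x) sends the plane into the fluid domain, so the chain rule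
  works with the one-sided derivative of \<phi>.\<close>

lemma surface_gradient:
  assumes h_deriv: "(h has_derivative (\<lambda>v. gh \<bullet> v)) (at x)"
    and \<psi>_deriv: "(\<psi> has_derivative (\<lambda>v. g\<psi> \<bullet> v)) (at x)"
    and h_gt: "\<And>x. - 1 < h x"
    and \<phi>_deriv: "(\<phi> has_derivative (\<lambda>v. D \<bullet> v)) (at (x, h x) within fluid_domain h)"
    and trace: "\<And>x. \<phi> (x, h x) = \<psi> x"
  shows "g\<psi> = fst D + snd D *\<^sub>R gh"
proof -
  have "((\<lambda>x. (x, h x)) has_derivative (\<lambda>v. (v, gh \<bullet> v))) (at x)"
    by (intro has_derivative_Pair has_derivative_ident h_deriv)
  moreover have "range (\<lambda>x. (x, h x)) \<subseteq> fluid_domain h"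
    using h_gt by (auto simp: fluid_domain_def less_imp_le)
  ultimately have "((\<lambda>x. \<phi> (x, h x)) has_derivative (\<lambda>v. D \<bullet> (v, gh \<bullet> v))) (at x)"
    using has_derivative_in_compose[of "\<lambda>x. (x, h x)" "\<lambda>v. (v, gh \<bullet> v)" x UNIV \<phi> "\<lambda>v. D \<bullet> v"] \<phi>_deriv
    by (auto intro: has_derivative_subset)
  then have "(\<psi> has_derivative (\<lambda>v. D \<bullet> (v, gh \<bullet> v))) (at x)" by (simp add: trace)
  from has_derivative_unique[OF this \<psi>_deriv] have "g\<psi> \<bullet> v = D \<bullet> (v, gh \<bullet> v)" for v
    by (rule fun_cong[symmetric])
  then have "g\<psi> \<bullet> v = (fst D + snd D *\<^sub>R gh) \<bullet> v" for v
    by (cases D) (simp add: inner_add_left)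
  then show ?thesis by (metis inner_commute vector_eq_ldot)
qed

text \<open>At time 0 the translated profile has time derivative - c . \<nabla>. With a and b the
  horizontal and vertical parts of D at the surface, \<nabla>\<psi> = a + b \<nabla>h, so the
  squared numerator of the quotient is the square of b (1 + |\<nabla>h|^2) and the denominator
  cancels once; the kinematic condition then removes the remaining gradients of h. That
  \<nabla>\<psi> lies in L^2 is read off from the Fourier data behind \<Lambda>\<psi>.\<close>

lemma steady_wave_of_solution:
  assumes sol: "traveling_wave_solution h \<psi> c" and Lam: "is_Lambda \<psi> L"
    and h_L2: "square_integrable (\<lambda>x. complex_of_real (h x))"
  shows "\<exists>\<phi> D. steady_wave h (grad h) \<psi> (grad \<psi>) \<phi> D c"
proof -
  from sol have *: "h differentiable_on UNIV \<and> \<psi> differentiable_on UNIV \<and>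
        (\<exists>g. is_dirichlet_neumann h \<psi> g \<and>
          (\<forall>x. ((\<lambda>s. h (x - s *\<^sub>R c)) has_real_derivative g x) (at 0 within {0..}) \<and>
               ((\<lambda>s. \<psi> (x - s *\<^sub>R c)) has_real_derivative
                  (- h x - 1 / 2 * (norm (grad \<psi> x))\<^sup>2
                   + (g x + grad h x \<bullet> grad \<psi> x)\<^sup>2
                       / (2 * (1 + (norm (grad h x))\<^sup>2))))
                 (at 0 within {0..})))"
    unfolding traveling_wave_solution_def water_waves_solution_def by (auto dest!: spec[of _ "0::real"])
  then obtain g where dn: "is_dirichlet_neumann h \<psi> g"
    and ht: "\<And>x. ((\<lambda>s. h (x - s *\<^sub>R c)) has_real_derivative g x) (at 0 within {0..})"
    and \<psi>t: "\<And>x. ((\<lambda>s. \<psi> (x - s *\<^sub>R c)) has_real_derivative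
                  (- h x - 1 / 2 * (norm (grad \<psi> x))\<^sup>2
                   + (g x + grad h x \<bullet> grad \<psi> x)\<^sup>2 / (2 * (1 + (norm (grad h x))\<^sup>2)))) (at 0 within {0..})"
    by blast
  from * have hd: "(h has_derivative (\<lambda>v. grad h x \<bullet> v)) (at x)"
    and \<psi>d: "(\<psi> has_derivative (\<lambda>v. grad \<psi> x \<bullet> v)) (at x)" for x
    by (auto intro!: differentiable_imp_grad simp: differentiable_on_def)
  from dn obtain \<phi> D where vp: "velocity_potential h \<psi> \<phi> D"
    and g: "\<And>x. g x = snd (D (x, h x)) - grad h x \<bullet> fst (D (x, h x))"
    unfolding is_dirichlet_neumann_def by blast
  note vp' = vp[unfolded velocity_potential_def]
  have h_gt: "- 1 < h x" for x using vp' by blast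
  have mem: "(x, h x) \<in> fluid_domain h" for x using h_gt[of x] by (simp add: fluid_domain_def)
  have trans: "((\<lambda>s. f (x - s *\<^sub>R c)) has_real_derivative - (gf \<bullet> c)) (at 0 within {0..})"
    if "(f has_derivative (\<lambda>v. gf \<bullet> v)) (at x)" for f gf x
  proof -
    have "((\<lambda>s. x - s *\<^sub>R c) has_derivative (\<lambda>s. - (s *\<^sub>R c))) (at 0 within {0..})"
      by (auto intro!: derivative_eq_intros)
    from has_derivative_compose[OF this, of f "\<lambda>v. gf \<bullet> v"] that
    have "((\<lambda>s. f (x - s *\<^sub>R c)) has_derivative (\<lambda>s. - (s * (gf \<bullet> c)))) (at 0 within {0..})" by simp
    moreover have "(\<lambda>s. - (s * (gf \<bullet> c))) = (*) (- (gf \<bullet> c))" by (simp add: fun_eq_iff)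
    ultimately show ?thesis by (simp add: has_field_derivative_def)
  qed
  have gK: "g x = - (grad h x \<bullet> c)" for x
    using has_real_derivative_unique_at_0[OF ht trans[OF hd]] .
  have kin: "snd (D (x, h x)) = grad h x \<bullet> (fst (D (x, h x)) - c)" for x
    using g[of x] gK[of x] by (simp add: inner_diff_right)
  have B: "- (grad \<psi> x \<bullet> c) = - h x - 1 / 2 * (norm (grad \<psi> x))\<^sup>2
                   + (g x + grad h x \<bullet> grad \<psi> x)\<^sup>2 / (2 * (1 + (norm (grad h x))\<^sup>2))" for x
    using has_real_derivative_unique_at_0[OF trans[OF \<psi>d] \<psi>t] .
  have bern: "h x + (norm (D (x, h x)))\<^sup>2 / 2 = c \<bullet> fst (D (x, h x))" for x
  proof -
    define a b where "a = fst (D (x, h x))" and "b = snd (D (x, h x))"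
    define k where "k = grad h x"
    have gp: "grad \<psi> x = a + b *\<^sub>R k" unfolding a_def b_def k_def
      by (rule surface_gradient[OF hd \<psi>d h_gt]) (use vp' mem in auto)
    have b: "b = k \<bullet> a - k \<bullet> c" using kin[of x] by (simp add: a_def b_def k_def inner_diff_right)
    have pos: "1 + (norm k)\<^sup>2 > 0" by (simp add: add_pos_nonneg)
    have "g x + k \<bullet> grad \<psi> x = b * (1 + (norm k)\<^sup>2)"
      by (simp add: gp g[folded k_def, of x, folded a_def b_def] k_def[symmetric] inner_add_right power2_norm_eq_inner algebra_simps)
    moreover have "(b * q)\<^sup>2 / (2 * q) = b\<^sup>2 * q / 2" if "q > 0" for q
      using that by (simp add: power2_eq_square)
    ultimately have "(g x + k \<bullet> grad \<psi> x)\<^sup>2 / (2 * (1 + (norm k)\<^sup>2)) = b\<^sup>2 * (1 + (norm k)\<^sup>2) / 2"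
      using pos by presburger
    then have B': "- ((a + b *\<^sub>R k) \<bullet> c) = - h x - 1 / 2 * (norm (a + b *\<^sub>R k))\<^sup>2 + b\<^sup>2 * (1 + (norm k)\<^sup>2) / 2"
      using B[of x] by (simp add: k_def[symmetric] gp)
    have n: "(norm (a + b *\<^sub>R k))\<^sup>2 = (norm a)\<^sup>2 + 2 * b * (k \<bullet> a) + b\<^sup>2 * (norm k)\<^sup>2"
      unfolding power2_norm_eq_inner by (simp add: inner_add_left inner_add_right inner_commute power2_eq_square algebra_simps)
    have nD: "(norm (D (x, h x)))\<^sup>2 = (norm a)\<^sup>2 + b\<^sup>2"
      by (simp add: a_def b_def norm_prod_def)
    have "- (a \<bullet> c) - b * (k \<bullet> c) = - h x - (norm a)\<^sup>2 / 2 - b * (k \<bullet> a) + b\<^sup>2 / 2"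
      using B' unfolding n by (simp add: inner_add_left algebra_simps add_divide_distrib)
    \<comment> \<open>The kinematic condition multiplied by b; it trades the two products with
      \<nabla>h for the square of b.\<close>
    moreover have "b * (k \<bullet> a) - b * (k \<bullet> c) = b\<^sup>2"
      unfolding right_diff_distrib[symmetric] b[symmetric] by (simp add: power2_eq_square)
    ultimately have "h x + ((norm a)\<^sup>2 + b\<^sup>2) / 2 = a \<bullet> c" by (simp add: field_simps)
    then show ?thesis unfolding nD by (simp add: a_def inner_commute)
  qed
  obtain m where m: "\<And>i. has_fourier_transform (\<lambda>x. complex_of_real (grad \<psi> x $ i)) (\<lambda>\<xi>. \<i> * complex_of_real (\<xi> $ i) * m \<xi>)"
    using Lam unfolding is_Lambda_def has_fourier_mod_const_def by blast
  then have sq: "square_integrable (\<lambda>x. complex_of_real (grad \<psi> x $ i))" for i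
    unfolding has_fourier_transform_def by blast
  have re: "f \<in> borel_measurable borel \<and> integrable lborel (\<lambda>x. (f x)\<^sup>2)"
    if "square_integrable (\<lambda>x. complex_of_real (f x))" for f
  proof -
    from that have "(\<lambda>x. complex_of_real (f x)) \<in> borel_measurable borel" by (simp add: square_integrable_def)
    then have "(\<lambda>x. Re (complex_of_real (f x))) \<in> borel_measurable borel" by (rule measurable_compose) measurable
    then show ?thesis using that by (simp add: square_integrable_def)
  qed
  have "steady_wave h (grad h) \<psi> (grad \<psi>) \<phi> D c"
  proof
    show "\<exists>H. (D has_derivative H) (at (x, y)) \<and> (\<Sum>b\<in>Basis. H b \<bullet> b) = 0" if "- 1 < y" "y < h x" for x y
      using vp' that by blast
  qed (use vp' hd \<psi>d kin bern re[OF h_L2] re[OF sq] in blast)+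
  then show ?thesis by blast
qed

subsection \<open>Stress and energy identities\<close>

context fluid_layer
begin

definition column :: "(R2 \<times> real \<Rightarrow> real) \<Rightarrow> R2 \<Rightarrow> real" where
  "column g x = integral {- 1..h x} (\<lambda>y. g (x, y))"

lemma cont_h: "continuous_on S h"
  using h_deriv has_derivative_continuous continuous_at_imp_continuous_on by metis

lemma fluid_domain_iff: "(x, y) \<in> fluid_domain h \<longleftrightarrow> - 1 \<le> y \<and> y \<le> h x"
  by (simp add: fluid_domain_def)

lemma cont_slice:
  assumes "continuous_on (fluid_domain h) g"
  shows "continuous_on {- 1..h x} (\<lambda>y. g (x, y))"
  by (rule continuous_on_compose2[OF assms]) (auto intro!: continuous_intros simp: fluid_domain_iff)

lemma slice_integrable:
  fixes g :: "R2 \<times> real \<Rightarrow> real"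
  assumes "continuous_on (fluid_domain h) g"
  shows "(\<lambda>y. g (x, y)) integrable_on {- 1..h x}"
  using cont_slice[OF assms] by (rule integrable_continuous_real)

lemma continuous_column:
  assumes "continuous_on (fluid_domain h) g"
  shows "continuous_on S (column g)"
proof -
  define clamp where "clamp x y = max (- 1) (min y (h x))" for x y
  have "continuous_on UNIV (\<lambda>z. (fst z, clamp (fst z) (snd z)))"
    unfolding clamp_def by (intro continuous_intros continuous_on_compose2[OF cont_h[of UNIV]]) auto
  then have "continuous_on UNIV (\<lambda>z. g (fst z, clamp (fst z) (snd z)))"
    by (rule continuous_on_compose2[OF assms])
       (auto simp: fluid_domain_iff clamp_def max_def min_def intro: less_imp_le[OF h_gt])
  then have "continuous_on UNIV (\<lambda>x. integral {- 1..h x} (\<lambda>y. g (x, clamp x y)))"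
    by (intro continuous_on_integral_upper cont_h h_gt) simp
  also have "(\<lambda>x. integral {- 1..h x} (\<lambda>y. g (x, clamp x y))) = column g"
    unfolding column_def by (intro ext integral_cong) (simp add: clamp_def)
  finally show ?thesis by (rule continuous_on_subset) simp
qed

lemma column_add:
  assumes "continuous_on (fluid_domain h) f" "continuous_on (fluid_domain h) g"
  shows "column (\<lambda>p. f p + g p) x = column f x + column g x"
  unfolding column_def using assms by (intro integral_add slice_integrable)

lemma column_diff:
  assumes "continuous_on (fluid_domain h) f" "continuous_on (fluid_domain h) g"
  shows "column (\<lambda>p. f p - g p) x = column f x - column g x"
  unfolding column_def using assms by (intro integral_diff slice_integrable)

lemma column_cmult: "column (\<lambda>p. k (fst p) * g p) x = k x * column g x"
  unfolding column_def by simp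

lemma column_mono:
  assumes "continuous_on (fluid_domain h) f" "continuous_on (fluid_domain h) g"
    and "\<And>y. - 1 \<le> y \<Longrightarrow> y \<le> h x \<Longrightarrow> f (x, y) \<le> g (x, y)"
  shows "column f x \<le> column g x"
  unfolding column_def using assms by (intro integral_le slice_integrable) auto

lemma column_nonneg:
  assumes "continuous_on (fluid_domain h) f" "\<And>y. - 1 \<le> y \<Longrightarrow> y \<le> h x \<Longrightarrow> 0 \<le> f (x, y)"
  shows "0 \<le> column f x"
  using column_mono[of "\<lambda>_. 0" f x] assms by (simp add: column_def)

lemma column_const: "column (\<lambda>p. k) x = k * (h x + 1)"
  using h_gt[of x] by (simp add: column_def)

lemma column_snd: "column snd x = ((h x)\<^sup>2 - 1) / 2"
proof -
  have "((\<lambda>y. y) has_integral ((h x)\<^sup>2 / 2 - (- 1)\<^sup>2 / 2)) {- 1..h x}"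
    using h_gt[of x] by (intro fundamental_theorem_of_calculus)
      (auto intro!: derivative_eq_intros simp flip: has_real_derivative_iff_has_vector_derivative)
  from integral_unique[OF this] show ?thesis by (simp add: column_def diff_divide_distrib)
qed

lemma interior_point:
  assumes "- 1 < y" "y < h x"
  shows "(x, y) \<in> interior (fluid_domain h)"
proof (rule interiorI[where T="{z. - 1 < snd z \<and> snd z < h (fst z)}"])
  show "open {z :: R2 \<times> real. - 1 < snd z \<and> snd z < h (fst z)}"
    by (intro open_Collect_conj open_Collect_less continuous_intros continuous_on_compose2[OF cont_h[of UNIV]]) auto
qed (use assms in \<open>auto simp: fluid_domain_def\<close>)

text \<open>The test function does not depend on the height, so multiplication by it preserves
  tangency at top and bottom, and the vertical component of F drops out of the integrated identity.
  What remains is an identity on the plane between column integrals.\<close>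

lemma weak_divergence:
  fixes F :: "R2 \<times> real \<Rightarrow> R2 \<times> real"
  assumes contF: "continuous_on (fluid_domain h) F" and contf: "continuous_on (fluid_domain h) f"
    and div: "\<And>x y. - 1 < y \<Longrightarrow> y < h x \<Longrightarrow>
        \<exists>F'. (F has_derivative F') (at (x, y)) \<and> (\<Sum>b\<in>Basis. F' b \<bullet> b) = f (x, y)"
    and bottom: "\<And>x. snd (F (x, - 1)) = 0"
    and surface: "\<And>x. snd (F (x, h x)) = gh x \<bullet> fst (F (x, h x))"
    and test: "\<And>x. (\<eta> has_derivative (\<lambda>v. g\<eta> x \<bullet> v)) (at x)" "continuous_on UNIV g\<eta>"
    and R: "R > 0" and supp: "\<And>x. R \<le> \<bar>x $ 1\<bar> \<or> R \<le> \<bar>x $ 2\<bar> \<Longrightarrow> \<eta> x = 0 \<and> g\<eta> x = 0"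
  shows "(LINT x|lborel. \<eta> x * column f x + (g\<eta> x $ 1 * column (\<lambda>p. fst (F p) $ 1) x +
      g\<eta> x $ 2 * column (\<lambda>p. fst (F p) $ 2) x)) = 0"
proof -
  have c\<eta>: "continuous_on UNIV \<eta>"
    using test(1) has_derivative_continuous continuous_at_imp_continuous_on by metis
  have c1: "continuous_on (fluid_domain h) (\<lambda>p. \<eta> (fst p))"
    by (intro continuous_on_compose2[OF c\<eta>] continuous_intros) auto
  have c2: "continuous_on (fluid_domain h) (\<lambda>p. g\<eta> (fst p))"
    by (intro continuous_on_compose2[OF test(2)] continuous_intros) auto
  define f' where "f' p = \<eta> (fst p) * f p + g\<eta> (fst p) \<bullet> fst (F p)" for p
  have "(LINT x|lborel. integral {- 1..h x} (\<lambda>y. f' (x, y))) = 0"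
  proof (rule integral_column_divergence_eq_0[OF h_deriv h_gt _ _ _ _ _ R, where F="\<lambda>p. \<eta> (fst p) *\<^sub>R F p"])
    show "continuous_on (fluid_domain h) (\<lambda>p. \<eta> (fst p) *\<^sub>R F p)" "continuous_on (fluid_domain h) f'"
      unfolding f'_def by (intro continuous_intros c1 c2 contF contf)+
    show "snd (\<eta> (fst (x, - 1::real)) *\<^sub>R F (x, - 1)) = 0" for x by (simp add: bottom)
    show "snd (\<eta> (fst (x, h x)) *\<^sub>R F (x, h x)) = gh x \<bullet> fst (\<eta> (fst (x, h x)) *\<^sub>R F (x, h x))" for x
      by (simp add: surface)
    show "\<eta> (fst (x, y)) *\<^sub>R F (x, y) = 0 \<and> f' (x, y) = 0" if "R \<le> \<bar>x $ 1\<bar> \<or> R \<le> \<bar>x $ 2\<bar>" for x y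
      using supp[OF that] by (simp add: f'_def)
    fix x y assume y: "- 1 < y" "y < h x"
    from div[OF y] obtain F' where F': "(F has_derivative F') (at (x, y))" and tr: "(\<Sum>b\<in>Basis. F' b \<bullet> b) = f (x, y)"
      by blast
    have "((\<lambda>p. \<eta> (fst p)) has_derivative (\<lambda>v. g\<eta> x \<bullet> fst v)) (at (x, y))"
      using has_derivative_compose[OF has_derivative_fst[OF has_derivative_ident], of \<eta> "\<lambda>v. g\<eta> x \<bullet> v" "(x, y)" UNIV] test(1)[of x]
      by simp
    from has_derivative_scaleR[OF this F']
    have "((\<lambda>p. \<eta> (fst p) *\<^sub>R F p) has_derivative (\<lambda>v. \<eta> x *\<^sub>R F' v + (g\<eta> x \<bullet> fst v) *\<^sub>R F (x, y))) (at (x, y))"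
      by simp
    moreover have "(\<Sum>b\<in>Basis. (\<eta> x *\<^sub>R F' b + (g\<eta> x \<bullet> fst b) *\<^sub>R F (x, y)) \<bullet> b) = f' (x, y)"
    proof -
      have "(\<Sum>b\<in>Basis. (\<eta> x *\<^sub>R F' b + (g\<eta> x \<bullet> fst b) *\<^sub>R F (x, y)) \<bullet> b) =
          \<eta> x * (\<Sum>b\<in>Basis. F' b \<bullet> b) + (\<Sum>b\<in>Basis. ((g\<eta> x, 0) \<bullet> b) * (F (x, y) \<bullet> b))"
      proof -
        have "g\<eta> x \<bullet> fst b = (g\<eta> x, 0) \<bullet> b" for b :: "R2 \<times> real" by (simp add: inner_prod_def)
        then show ?thesis by (simp add: inner_add_left sum.distrib sum_distrib_left)
      qed
      also have "(\<Sum>b\<in>Basis. ((g\<eta> x, 0) \<bullet> b) * (F (x, y) \<bullet> b)) = (g\<eta> x, 0) \<bullet> F (x, y)"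
        by (rule euclidean_inner[symmetric])
      also have "(g\<eta> x, 0) \<bullet> F (x, y) = g\<eta> x \<bullet> fst (F (x, y))" by (simp add: inner_prod_def)
      finally show ?thesis by (simp only: tr f'_def fst_conv)
    qed
    ultimately show "\<exists>F'. ((\<lambda>p. \<eta> (fst p) *\<^sub>R F p) has_derivative F') (at (x, y)) \<and> (\<Sum>b\<in>Basis. F' b \<bullet> b) = f' (x, y)"
      by blast
  qed
  also have "(\<lambda>x. integral {- 1..h x} (\<lambda>y. f' (x, y))) = column f'" by (simp add: column_def fun_eq_iff)
  also have "column f' = (\<lambda>x. \<eta> x * column f x + (g\<eta> x $ 1 * column (\<lambda>p. fst (F p) $ 1) x +
      g\<eta> x $ 2 * column (\<lambda>p. fst (F p) $ 2) x))"
  proof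
    fix x
    have cc: "continuous_on (fluid_domain h) (\<lambda>p. fst (F p) $ i)" for i by (intro continuous_intros contF)
    have f'_eq: "f' = (\<lambda>p. \<eta> (fst p) * f p + (g\<eta> (fst p) $ 1 * (fst (F p) $ 1) + g\<eta> (fst p) $ 2 * (fst (F p) $ 2)))"
      by (simp add: f'_def fun_eq_iff inner_R2)
    have k: "continuous_on (fluid_domain h) (\<lambda>p. g\<eta> (fst p) $ i * (fst (F p) $ i))" for i
      by (intro continuous_intros c2 cc)
    have k': "continuous_on (fluid_domain h) (\<lambda>p. \<eta> (fst p) * f p)"
      by (intro continuous_intros c1 contf)
    show "column f' x = \<eta> x * column f x + (g\<eta> x $ 1 * column (\<lambda>p. fst (F p) $ 1) x +
        g\<eta> x $ 2 * column (\<lambda>p. fst (F p) $ 2) x)"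
      unfolding f'_eq
      by (simp only: column_add[OF k' continuous_on_add[OF k k]] column_add[OF k k])
         (simp only: column_cmult column_cmult[where k="\<lambda>x. g\<eta> x $ 1"] column_cmult[where k="\<lambda>x. g\<eta> x $ 2"])
  qed
  finally show ?thesis .
qed

end

context steady_wave
begin

definition M :: "2 \<Rightarrow> R2 \<Rightarrow> real" where "M k = column (\<lambda>p. fst (D p) $ k)"
definition E :: "2 \<Rightarrow> 2 \<Rightarrow> R2 \<Rightarrow> real" where "E k l = column (\<lambda>p. fst (D p) $ k * fst (D p) $ l)"
definition Ev :: "R2 \<Rightarrow> real" where "Ev = column (\<lambda>p. (snd (D p))\<^sup>2)"
definition kinetic :: "R2 \<Rightarrow> real" where "kinetic x = E 1 1 x + E 2 2 x + Ev x"

lemma cont_E: "continuous_on S (E k l)" and cont_Ev: "continuous_on S Ev" and cont_M: "continuous_on S (M k)"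
  unfolding E_def Ev_def M_def by (intro continuous_column continuous_intros cont_D)+

lemma kinetic_eq: "kinetic x = column (\<lambda>p. (norm (D p))\<^sup>2) x"
proof -
  have "(\<lambda>p. (norm (D p))\<^sup>2) = (\<lambda>p. (fst (D p) $ 1 * fst (D p) $ 1 + fst (D p) $ 2 * fst (D p) $ 2) + (snd (D p))\<^sup>2)"
    by (simp add: fun_eq_iff power2_norm_eq_inner inner_prod_def inner_R2) (simp add: power2_eq_square)
  then show ?thesis
    unfolding kinetic_def E_def Ev_def
    by (simp add: column_add continuous_intros cont_D)
qed

text \<open>In the interior the one-sided derivative of \<phi> is a full derivative, which is what
  symmetry of the Hessian requires.\<close>

lemma D_interior:
  assumes "- 1 < y" "y < h x"
  shows "\<exists>H. (D has_derivative H) (at (x, y)) \<and> (\<Sum>b\<in>Basis. H b \<bullet> b) = 0 \<and>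
    (\<forall>v w. H v \<bullet> w = H w \<bullet> v) \<and> (\<phi> has_derivative (\<lambda>v. D (x, y) \<bullet> v)) (at (x, y))"
proof -
  from harmonic[OF assms] obtain H where H: "(D has_derivative H) (at (x, y))" "(\<Sum>b\<in>Basis. H b \<bullet> b) = 0" by blast
  have grad: "(\<phi> has_derivative (\<lambda>v. D p \<bullet> v)) (at p)" if "p \<in> interior (fluid_domain h)" for p
  proof -
    have "p \<in> fluid_domain h" using that interior_subset by blast
    from \<phi>_deriv[OF this] show ?thesis by (simp only: at_within_interior[OF that])
  qed
  have "H v \<bullet> w = H w \<bullet> v" for v w
    by (rule second_derivative_symmetric[OF open_interior interior_point[OF assms] grad H(1)])
  then show ?thesis using H grad[OF interior_point[OF assms]] by blast
qed

text \<open>Conservation of horizontal momentum. In the divergence of F the term with the trace of H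
  vanishes, H e . (D - c') cancels against (H c' - H D) . e by symmetry of H, and gravity is
  vertical while e is horizontal. At the surface Bernoulli's law makes s vanish and the kinematic
  condition makes D - c' tangential. The terms (1 - h^2)/2 are the column integral of - y.\<close>

lemma stress_identity:
  assumes test: "\<And>x. (\<eta> has_derivative (\<lambda>v. g\<eta> x \<bullet> v)) (at x)" "continuous_on UNIV g\<eta>"
    and R: "R > 0" and supp: "\<And>x. R \<le> \<bar>x $ 1\<bar> \<or> R \<le> \<bar>x $ 2\<bar> \<Longrightarrow> \<eta> x = 0 \<and> g\<eta> x = 0"
  shows "(LINT x|lborel. (\<Sum>j\<in>UNIV. g\<eta> x $ j * (E k j x - c $ j * M k x)) +
      g\<eta> x $ k * (c $ 1 * M 1 x + c $ 2 * M 2 x - kinetic x / 2 - (h x)\<^sup>2 / 2 + 1 / 2)) = 0"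
proof -
  define e c' :: "R2 \<times> real" where "e = (axis k 1, 0)" and "c' = (c, 0)"
  define s where "s p = c' \<bullet> D p - (norm (D p))\<^sup>2 / 2 - snd p" for p
  define F where "F p = (D p \<bullet> e) *\<^sub>R (D p - c') + s p *\<^sub>R e" for p
  have cs: "continuous_on (fluid_domain h) s" unfolding s_def by (intro continuous_intros cont_D) auto
  have De: "v \<bullet> e = fst v $ k" for v by (simp add: e_def inner_prod_def inner_axis)
  have I: "(LINT x|lborel. \<eta> x * column (\<lambda>_. 0) x + (g\<eta> x $ 1 * column (\<lambda>p. fst (F p) $ 1) x +
      g\<eta> x $ 2 * column (\<lambda>p. fst (F p) $ 2) x)) = 0"
  proof (rule weak_divergence[OF _ _ _ _ _ test R supp])
    show "continuous_on (fluid_domain h) F" unfolding F_def by (intro continuous_intros cs cont_D)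
    show "snd (F (x, - 1)) = 0" for x by (simp add: F_def bottom e_def c'_def)
    have "s (x, h x) = 0" for x using bernoulli[of x] by (simp add: s_def c'_def inner_prod_def)
    then show "snd (F (x, h x)) = gh x \<bullet> fst (F (x, h x))" for x
      using kinematic[of x] by (simp add: F_def c'_def)
    fix x y assume y: "- 1 < y" "y < h x"
    obtain H where H: "(D has_derivative H) (at (x, y))" and tr: "(\<Sum>b\<in>Basis. H b \<bullet> b) = 0"
      and sym: "\<And>v w. H v \<bullet> w = H w \<bullet> v" and "(\<phi> has_derivative (\<lambda>v. D (x, y) \<bullet> v)) (at (x, y))"
      using D_interior[OF y] by blast
    let ?D = "D (x, y)"
    have dn: "((\<lambda>p. (norm (D p))\<^sup>2) has_derivative (\<lambda>v. 2 * (?D \<bullet> H v))) (at (x, y))"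
      unfolding power2_norm_eq_inner
      by (rule has_derivative_eq_rhs[OF has_derivative_inner[OF H H]]) (simp add: inner_commute)
    define F' where "F' v = (?D \<bullet> e) *\<^sub>R H v + (H v \<bullet> e) *\<^sub>R (?D - c') + (c' \<bullet> H v - ?D \<bullet> H v - snd v) *\<^sub>R e" for v
    have "(F has_derivative F') (at (x, y))"
      unfolding F_def s_def F'_def
      by (rule derivative_eq_intros H dn refl | simp)+
    moreover have "(\<Sum>b\<in>Basis. F' b \<bullet> b) = 0"
    proof -
      have ei: "(\<Sum>b\<in>Basis. (v \<bullet> b) * (w \<bullet> b)) = v \<bullet> w" for v w :: "R2 \<times> real"
        by (rule euclidean_inner[symmetric])
      have "F' b \<bullet> b = (?D \<bullet> e) * (H b \<bullet> b) + (H e \<bullet> b) * ((?D - c') \<bullet> b) +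
          (H c' \<bullet> b - H ?D \<bullet> b - (0, 1) \<bullet> b) * (e \<bullet> b)" for b
        unfolding F'_def using sym[of b e] sym[of b c'] sym[of b ?D]
        by (simp add: inner_add_left inner_commute[of c'] inner_commute[of ?D "H b"]) (simp add: inner_prod_def)
      then have "(\<Sum>b\<in>Basis. F' b \<bullet> b) = (?D \<bullet> e) * (\<Sum>b\<in>Basis. H b \<bullet> b) + H e \<bullet> (?D - c') +
          (H c' - H ?D - (0, 1)) \<bullet> e"
        by (simp add: sum.distrib sum_distrib_left[symmetric] ei inner_diff_left[symmetric])
      also have "\<dots> = 0" using sym[of e ?D] sym[of e c']
        by (simp add: tr inner_diff_left inner_diff_right) (simp add: e_def)
      finally show ?thesis .
    qed
    ultimately show "\<exists>F'. (F has_derivative F') (at (x, y)) \<and> (\<Sum>b\<in>Basis. F' b \<bullet> b) = 0" by blast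
  qed auto
  have colF: "column (\<lambda>p. fst (F p) $ j) x = E k j x - c $ j * M k x +
      (if j = k then c $ 1 * M 1 x + c $ 2 * M 2 x - kinetic x / 2 - (h x)\<^sup>2 / 2 + 1 / 2 else 0)" for j x
  proof -
    have c1: "continuous_on (fluid_domain h) (\<lambda>p. fst (D p) $ i)" for i by (intro continuous_intros cont_D)
    have c2: "continuous_on (fluid_domain h) (\<lambda>p. fst (D p) $ i * fst (D p) $ j)" for i j by (intro continuous_intros cont_D)
    have c3: "continuous_on (fluid_domain h) (\<lambda>p. (norm (D p))\<^sup>2)" by (intro continuous_intros cont_D)
    have cm: "column (\<lambda>p. r * g p) x = r * column g x" for r g using column_cmult[of "\<lambda>_. r"] by simp
    have cs': "column s x = c $ 1 * M 1 x + c $ 2 * M 2 x - kinetic x / 2 - (h x)\<^sup>2 / 2 + 1 / 2"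
    proof -
      have "s = (\<lambda>p. c $ 1 * fst (D p) $ 1 + c $ 2 * fst (D p) $ 2 - (1/2) * (norm (D p))\<^sup>2 - snd p)"
        by (simp add: s_def c'_def fun_eq_iff inner_prod_def inner_R2)
      then show ?thesis
        by (simp only: M_def kinetic_eq column_add column_diff cm c1 c2 c3 continuous_intros column_snd)
           (simp add: field_simps)
    qed
    have "(\<lambda>p. fst (F p) $ j) = (\<lambda>p. fst (D p) $ k * fst (D p) $ j - c $ j * fst (D p) $ k + (if j = k then 1 else 0) * s p)"
      unfolding F_def De by (auto simp: fun_eq_iff c'_def e_def axis_def algebra_simps)
    then have "column (\<lambda>p. fst (F p) $ j) x = E k j x - c $ j * M k x + (if j = k then 1 else 0) * column s x"
      by (simp only: M_def E_def column_add column_diff cm c1 c2 cs continuous_intros)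
    then show ?thesis using cs' by simp
  qed
  have "\<eta> x * column (\<lambda>_. 0) x + (g\<eta> x $ 1 * column (\<lambda>p. fst (F p) $ 1) x + g\<eta> x $ 2 * column (\<lambda>p. fst (F p) $ 2) x) =
      (\<Sum>j\<in>UNIV. g\<eta> x $ j * (E k j x - c $ j * M k x)) +
      g\<eta> x $ k * (c $ 1 * M 1 x + c $ 2 * M 2 x - kinetic x / 2 - (h x)\<^sup>2 / 2 + 1 / 2)" for x
    unfolding colF using exhaust_2[of k] by (auto simp: column_def sum_2 distrib_left)
  with I show ?thesis by (simp only:)
qed

text \<open>The relative velocity D - c' is divergence-free and tangential, so its product with
  \<phi> - m has divergence D . (D - c'). The constant m is kept free in order to be chosen anew for
  each cutoff radius.\<close>

lemma energy_identity:
  assumes test: "\<And>x. (\<eta> has_derivative (\<lambda>v. g\<eta> x \<bullet> v)) (at x)" "continuous_on UNIV g\<eta>"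
    and R: "R > 0" and supp: "\<And>x. R \<le> \<bar>x $ 1\<bar> \<or> R \<le> \<bar>x $ 2\<bar> \<Longrightarrow> \<eta> x = 0 \<and> g\<eta> x = 0"
  shows "(LINT x|lborel. \<eta> x * (kinetic x - c $ 1 * M 1 x - c $ 2 * M 2 x) +
      (g\<eta> x $ 1 * (column (\<lambda>p. (\<phi> p - m) * fst (D p) $ 1) x - c $ 1 * column (\<lambda>p. \<phi> p - m) x) +
       g\<eta> x $ 2 * (column (\<lambda>p. (\<phi> p - m) * fst (D p) $ 2) x - c $ 2 * column (\<lambda>p. \<phi> p - m) x))) = 0"
proof -
  define c' :: "R2 \<times> real" where "c' = (c, 0)"
  define F where "F p = (\<phi> p - m) *\<^sub>R (D p - c')" for p
  define f where "f p = (norm (D p))\<^sup>2 - c $ 1 * fst (D p) $ 1 - c $ 2 * fst (D p) $ 2" for p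
  have c\<phi>: "continuous_on (fluid_domain h) \<phi>"
    using \<phi>_deriv has_derivative_continuous by (force simp: continuous_on_eq_continuous_within)
  have c1: "continuous_on (fluid_domain h) (\<lambda>p. fst (D p) $ i)" for i by (intro continuous_intros cont_D)
  have c3: "continuous_on (fluid_domain h) (\<lambda>p. (norm (D p))\<^sup>2)" by (intro continuous_intros cont_D)
  have f_eq: "f p = D p \<bullet> (D p - c')" for p
    by (simp add: f_def c'_def inner_diff_right power2_norm_eq_inner) (simp add: inner_prod_def inner_R2 algebra_simps)
  have cm: "column (\<lambda>p. r * g p) x = r * column g x" for r g x using column_cmult[of "\<lambda>_. r"] by simp
  have "(LINT x|lborel. \<eta> x * column f x + (g\<eta> x $ 1 * column (\<lambda>p. fst (F p) $ 1) x +
      g\<eta> x $ 2 * column (\<lambda>p. fst (F p) $ 2) x)) = 0"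
  proof (rule weak_divergence[OF _ _ _ _ _ test R supp])
    show "continuous_on (fluid_domain h) F" unfolding F_def by (intro continuous_intros c\<phi> cont_D)
    show "continuous_on (fluid_domain h) f" unfolding f_def by (intro continuous_intros cont_D)
    show "snd (F (x, - 1)) = 0" for x by (simp add: F_def bottom c'_def)
    show "snd (F (x, h x)) = gh x \<bullet> fst (F (x, h x))" for x
      using kinematic[of x] by (simp add: F_def c'_def)
    fix x y assume y: "- 1 < y" "y < h x"
    obtain H where H: "(D has_derivative H) (at (x, y))" and tr: "(\<Sum>b\<in>Basis. H b \<bullet> b) = 0"
      and "\<And>v w. H v \<bullet> w = H w \<bullet> v" and \<phi>d: "(\<phi> has_derivative (\<lambda>v. D (x, y) \<bullet> v)) (at (x, y))"
      using D_interior[OF y] by blast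
    let ?D = "D (x, y)"
    have "(F has_derivative (\<lambda>v. (\<phi> (x, y) - m) *\<^sub>R H v + (?D \<bullet> v) *\<^sub>R (?D - c'))) (at (x, y))"
      unfolding F_def by (rule derivative_eq_intros H \<phi>d refl | simp)+
    moreover have "(\<Sum>b\<in>Basis. ((\<phi> (x, y) - m) *\<^sub>R H b + (?D \<bullet> b) *\<^sub>R (?D - c')) \<bullet> b) = f (x, y)"
    proof -
      have "(\<Sum>b\<in>Basis. ((\<phi> (x, y) - m) *\<^sub>R H b + (?D \<bullet> b) *\<^sub>R (?D - c')) \<bullet> b) =
         (\<phi> (x, y) - m) * (\<Sum>b\<in>Basis. H b \<bullet> b) + (\<Sum>b\<in>Basis. (?D \<bullet> b) * ((?D - c') \<bullet> b))"
        by (simp add: inner_add_left sum.distrib sum_distrib_left)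
      also have "\<dots> = ?D \<bullet> (?D - c')" by (simp add: tr euclidean_inner[symmetric])
      finally show ?thesis by (simp add: f_eq)
    qed
    ultimately show "\<exists>F'. (F has_derivative F') (at (x, y)) \<and> (\<Sum>b\<in>Basis. F' b \<bullet> b) = f (x, y)" by blast
  qed auto
  moreover have "column f x = kinetic x - c $ 1 * M 1 x - c $ 2 * M 2 x" for x
    unfolding f_def M_def kinetic_eq by (simp only: column_diff cm c1 c3 continuous_intros)
  moreover have "column (\<lambda>p. fst (F p) $ j) x =
      column (\<lambda>p. (\<phi> p - m) * fst (D p) $ j) x - c $ j * column (\<lambda>p. \<phi> p - m) x" for j x
  proof -
    have "(\<lambda>p. fst (F p) $ j) = (\<lambda>p. (\<phi> p - m) * fst (D p) $ j - c $ j * (\<phi> p - m))"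
      by (auto simp: F_def c'_def fun_eq_iff algebra_simps)
    moreover have "continuous_on (fluid_domain h) (\<lambda>p. (\<phi> p - m) * fst (D p) $ j)"
      "continuous_on (fluid_domain h) (\<lambda>p. c $ j * (\<phi> p - m))"
      by (intro continuous_intros c\<phi> cont_D)+
    ultimately show ?thesis by (simp only: column_diff cm)
  qed
  ultimately show ?thesis by (simp only:)
qed

end

section \<open>Gradient of the column potential\<close>

lemma norm_fst_component_le: "norm (fst z) \<le> norm z"
  by (cases z) (simp add: norm_fst_le)

lemma (in fluid_layer) closed_fluid_domain: "closed (fluid_domain h)"
proof -
  have "fluid_domain h = {p. - 1 \<le> snd p} \<inter> {p. snd p \<le> h (fst p)}" by (auto simp: fluid_domain_def)
  then show ?thesis
    by (auto intro!: closed_Int closed_Collect_le continuous_intros continuous_on_compose2[OF cont_h[of UNIV]])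
qed

context steady_wave
begin

lemma cont_\<phi>: "continuous_on (fluid_domain h) \<phi>"
  using \<phi>_deriv has_derivative_continuous by (force simp: continuous_on_eq_continuous_within)

text \<open>Leibniz rule with an upper limit that is merely differentiable. The column is cut at
  depth L r below the surface. Below the cut, horizontal segments stay in the fluid, and the mean
  value theorem with uniform continuity of D produces \<open>M\<close>. Above the cut the thickness
  is O(r) and \<phi> is close to its surface value, so the change there is that value times the
  change of h.\<close>

lemma column_potential_has_derivative:
  "(column \<phi> has_derivative (\<lambda>v. M 1 x0 * v $ 1 + M 2 x0 * v $ 2 + \<psi> x0 * (gh x0 \<bullet> v))) (at x0)"
  unfolding has_derivative_at_alt
proof (intro conjI allI impI)
  show "bounded_linear (\<lambda>v. M 1 x0 * v $ 1 + M 2 x0 * v $ 2 + \<psi> x0 * (gh x0 \<bullet> v))"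
    by (intro bounded_linear_intros bounded_linear_compose[OF bounded_linear_mult_right] bounded_linear_vec_nth)
  fix e :: real assume e: "e > 0"
  from continuous_attains_sup[OF compact_cball[of x0 1] _ cont_h] obtain xm where
    xm: "\<forall>x\<in>cball x0 1. h x \<le> h xm" by auto
  define Hmax where "Hmax = h xm"
  have Hmax: "h x \<le> Hmax" if "x \<in> cball x0 1" for x using xm that by (simp add: Hmax_def)
  define K where "K = fluid_domain h \<inter> (cball x0 1 \<times> {- 1..Hmax})"
  have K: "compact K" unfolding K_def
    by (intro closed_Int_compact closed_fluid_domain compact_Times compact_cball compact_Icc)
  have KI: "(x, y) \<in> K" if "dist x0 x \<le> 1" "- 1 \<le> y" "y \<le> h x" for x y
    using that Hmax[of x] by (auto simp: K_def fluid_domain_iff)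
  have cDK: "continuous_on K D" using cont_D by (rule continuous_on_subset) (auto simp: K_def)
  have "bounded (D ` K)" by (intro compact_imp_bounded compact_continuous_image cDK K)
  then obtain B where B: "B \<ge> 0" "\<And>p. p \<in> K \<Longrightarrow> norm (D p) \<le> B"
    unfolding bounded_iff using norm_ge_zero by (metis image_eqI linear order_trans)
  have uc: "uniformly_continuous_on K D" by (intro compact_uniformly_continuous cDK K)
  define h0 G L where "h0 = h x0" and "G = norm (gh x0)" and "L = norm (gh x0) + 2"
  have L: "L \<ge> 2" "G = L - 2" by (simp_all add: L_def G_def)
  have h0: "h0 > - 1" unfolding h0_def by (rule h_gt)
  \<comment> \<open>Sum of the error constants: h0 + 1 from below the cut, B L from the strip above
    the cut that \<open>M\<close> also counts, 3 L from the top layers at x and at x0, and |\<psi>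
    x0| from the linearisation of h.\<close>
  define K0 where "K0 = h0 + 1 + B * L + 3 * L + \<bar>\<psi> x0\<bar>"
  have "B * L \<ge> 0" using B L by simp
  then have K0: "K0 > 0" using h0 L by (auto simp: K0_def)
  define e1 where "e1 = min 1 (e / K0)"
  have e1: "e1 > 0" "e1 \<le> 1" "e1 * K0 \<le> e" using e K0 by (auto simp: e1_def min_def field_simps)
  from uc[unfolded uniformly_continuous_on_def, rule_format, OF e1(1)] obtain d1 where d1: "d1 > 0"
    "\<And>p q. p \<in> K \<Longrightarrow> q \<in> K \<Longrightarrow> dist q p < d1 \<Longrightarrow> dist (D q) (D p) < e1" by blast
  have "continuous (at (x0, h0) within fluid_domain h) \<phi>"
    using cont_\<phi> h0 by (simp add: continuous_on_eq_continuous_within fluid_domain_iff h0_def)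
  from this[unfolded continuous_within_eps_delta, rule_format, OF e1(1)] obtain d2 where d2: "d2 > 0"
    "\<And>p. p \<in> fluid_domain h \<Longrightarrow> dist p (x0, h0) < d2 \<Longrightarrow> dist (\<phi> p) (\<phi> (x0, h0)) < e1" by blast
  from h_deriv[of x0, unfolded has_derivative_at_alt] e1(1) obtain d3 where d3: "d3 > 0"
    "\<And>x. norm (x - x0) < d3 \<Longrightarrow> norm (h x - h x0 - gh x0 \<bullet> (x - x0)) \<le> e1 * norm (x - x0)" by blast
  \<comment> \<open>The entry \<open>(h0 + 1) / L\<close> keeps the cut above the bottom; the entry
    \<open>e1\<close> turns the quadratic error B L r^2 into B L e1 r.\<close>
  define d where "d = Min {d1, d2 / (1 + L), d3, (h0 + 1) / L, e1, 1}"
  have d: "d > 0" using d1 d2 d3 e1 L h0 by (simp add: d_def)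
  show "\<exists>d>0. \<forall>x. norm (x - x0) < d \<longrightarrow>
      norm (column \<phi> x - column \<phi> x0 - (M 1 x0 * (x - x0) $ 1 + M 2 x0 * (x - x0) $ 2 + \<psi> x0 * (gh x0 \<bullet> (x - x0)))) \<le>
      e * norm (x - x0)"
  proof (intro exI[of _ d] conjI allI impI d)
    fix x assume "norm (x - x0) < d"
    define v r where "v = x - x0" and "r = norm (x - x0)"
    have r: "r < d1" "(1 + L) * r < d2" "r < d3" "L * r < h0 + 1" "r < e1" "r < 1"
    proof -
      have "r < d" using \<open>norm (x - x0) < d\<close> by (simp only: r_def)
      then have "r < d1" "r < d2 / (1 + L)" "r < d3" "r < (h0 + 1) / L" "r < e1" "r < 1"
        by (simp_all only: d_def Min_less_iff Min_gr_iff finite.intros insert_not_empty not_False_eq_True ball_simps)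
      moreover have "1 + L > 0" "L > 0" using L by simp_all
      ultimately show "r < d1" "(1 + L) * r < d2" "r < d3" "L * r < h0 + 1" "r < e1" "r < 1"
        by (simp_all add: pos_less_divide_eq mult.commute)
    qed
    have r0: "r \<ge> 0" "norm v = r" by (simp_all add: r_def v_def)
    define y0 where "y0 = h0 - L * r"
    have y0: "- 1 < y0" "y0 \<le> h0" using r r0 L by (auto simp: y0_def)
    define z where "z t = x0 + t *\<^sub>R v" for t
    have z1: "z 1 = x" "z 0 = x0" by (simp_all add: z_def v_def)
    have hz: "\<bar>h (z t) - h0\<bar> \<le> (L - 1) * r" "\<bar>h (z t) - h0 - t * (gh x0 \<bullet> v)\<bar> \<le> e1 * r" "norm (z t - x0) \<le> r"
      if t: "0 \<le> t" "t \<le> 1" for t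
    proof -
      have zt: "z t - x0 = t *\<^sub>R v" by (simp add: z_def)
      have tr: "t * r \<le> r" using t r0 mult_right_mono[of t 1 r] by simp
      show n: "norm (z t - x0) \<le> r" using t r0 tr by (simp add: zt)
      then have "norm (h (z t) - h x0 - gh x0 \<bullet> (z t - x0)) \<le> e1 * norm (z t - x0)" using d3(2) r by simp
      also have "\<dots> \<le> e1 * r" using n e1 by (intro mult_left_mono) auto
      finally show a: "\<bar>h (z t) - h0 - t * (gh x0 \<bullet> v)\<bar> \<le> e1 * r" by (simp add: zt h0_def)
      have "\<bar>t * (gh x0 \<bullet> v)\<bar> \<le> 1 * (G * r)"
        unfolding abs_mult using t Cauchy_Schwarz_ineq2[of "gh x0" v] by (intro mult_mono) (auto simp: G_def r0)
      moreover have "e1 * r \<le> 1 * r" using e1 r0 by (intro mult_right_mono) auto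
      ultimately have "\<bar>h (z t) - h0\<bar> \<le> G * r + r" using a by linarith
      also have "\<dots> = (L - 1) * r" by (simp add: L algebra_simps)
      finally show "\<bar>h (z t) - h0\<bar> \<le> (L - 1) * r" .
    qed
    have yz: "y0 \<le> h (z t)" "h (z t) - y0 \<le> 2 * L * r" if t: "0 \<le> t" "t \<le> 1" for t
      using hz(1)[OF t] r0 by (auto simp: y0_def abs_le_iff algebra_simps)
    have memK: "(z t, y) \<in> K" if "0 \<le> t" "t \<le> 1" "- 1 \<le> y" "y \<le> h (z t)" for t y
      using that hz(3)[of t] r by (intro KI) (auto simp: dist_norm norm_minus_commute)
    have split: "integral {-1..h (z t)} (\<lambda>y. g (z t, y)) = integral {-1..y0} (\<lambda>y. g (z t, y)) + integral {y0..h (z t)} (\<lambda>y. g (z t, y))"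
      if "0 \<le> t" "t \<le> 1" "continuous_on (fluid_domain h) g" for t and g :: "R2 \<times> real \<Rightarrow> real"
      using that y0 yz by (intro Henstock_Kurzweil_Integration.integral_combine[symmetric] slice_integrable) auto
    have cont_low: "continuous_on {-1..y0} (\<lambda>y. g (z t, y))" "continuous_on {y0..h (z t)} (\<lambda>y. g (z t, y))"
      if "0 \<le> t" "t \<le> 1" "continuous_on (fluid_domain h) g" for t and g :: "R2 \<times> real \<Rightarrow> real"
      using cont_slice[OF that(3), of "z t"] yz[OF that(1,2)] y0 by (auto elim: continuous_on_subset)
    have cDv: "continuous_on (fluid_domain h) (\<lambda>p. fst (D p) \<bullet> v)" by (intro continuous_intros cont_D)
    have low: "\<bar>integral {-1..y0} (\<lambda>y. \<phi> (x, y)) - integral {-1..y0} (\<lambda>y. \<phi> (x0, y)) - integral {-1..y0} (\<lambda>y. fst (D (x0, y)) \<bullet> v)\<bar>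
        \<le> e1 * r * (h0 + 1)"
    proof -
      have c: "continuous_on {-1..y0} (\<lambda>y. \<phi> (x, y))" "continuous_on {-1..y0} (\<lambda>y. \<phi> (x0, y))"
        "continuous_on {-1..y0} (\<lambda>y. fst (D (x0, y)) \<bullet> v)"
        using cont_low(1)[of 1, OF _ _ cont_\<phi>] cont_low(1)[of 0, OF _ _ cont_\<phi>] cont_low(1)[of 0, OF _ _ cDv]
        by (simp_all add: z1)
      have "\<bar>integral {-1..y0} (\<lambda>y. \<phi> (x, y) - \<phi> (x0, y) - fst (D (x0, y)) \<bullet> v) - 0 * (y0 - - 1)\<bar> \<le> (e1 * r) * (y0 - - 1)"
      proof (rule integral_approx_const)
        show "continuous_on {-1..y0} (\<lambda>y. \<phi> (x, y) - \<phi> (x0, y) - fst (D (x0, y)) \<bullet> v)"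
          by (intro continuous_intros c)
        fix y assume y: "y \<in> {-1..y0}"
        have "\<exists>t\<in>{0<..<1}. \<phi> (z 1, y) - \<phi> (z 0, y) = (1 - 0) * (fst (D (z t, y)) \<bullet> v)"
        proof (rule mvt_simple)
          fix t :: real assume t: "0 \<le> t" "t \<le> 1"
          have 1: "((\<lambda>t. (z t, y)) has_derivative (\<lambda>s. (s *\<^sub>R v, 0))) (at t within {0..1})"
            unfolding z_def by (auto intro!: derivative_eq_intros)
          have 2: "(\<lambda>t. (z t, y)) ` {0..1} \<subseteq> fluid_domain h"
          proof (rule image_subsetI)
            show "(z t, y) \<in> fluid_domain h" if "t \<in> {0..1}" for t
              using y yz(1)[of t] that by (auto simp: fluid_domain_iff)
          qed
          have "((\<lambda>t. \<phi> (z t, y)) has_derivative (\<lambda>s. D (z t, y) \<bullet> (s *\<^sub>R v, 0))) (at t within {0..1})"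
            by (rule has_derivative_in_compose2[OF \<phi>_deriv 2 _ 1]) (use t in auto)
          then show "((\<lambda>t. \<phi> (z t, y)) has_derivative (\<lambda>s. s * (fst (D (z t, y)) \<bullet> v))) (at t within {0..1})"
            by (simp add: inner_prod_def)
        qed simp
        then obtain t where t: "0 < t" "t < 1" and eq: "\<phi> (x, y) - \<phi> (x0, y) = fst (D (z t, y)) \<bullet> v"
          by (auto simp: z1)
        have "dist (D (z t, y)) (D (x0, y)) < e1"
        proof (rule d1(2))
          show "(x0, y) \<in> K" using memK[of 0 y] y yz(1)[of 0] by (auto simp: z1)
          show "(z t, y) \<in> K" using memK[of t y] y yz(1)[of t] t by auto
          show "dist (z t, y) (x0, y) < d1" using hz(3)[of t] t r by (simp add: dist_Pair_Pair dist_norm)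
        qed
        then have "norm (D (z t, y) - D (x0, y)) \<le> e1" by (simp only: dist_norm less_imp_le)
        then have "norm (fst (D (z t, y) - D (x0, y))) \<le> e1" by (rule order_trans[OF norm_fst_component_le])
        then have "\<bar>fst (D (z t, y) - D (x0, y)) \<bullet> v\<bar> \<le> e1 * r"
          using Cauchy_Schwarz_ineq2[of "fst (D (z t, y) - D (x0, y))" v] r0
            mult_right_mono[of "norm (fst (D (z t, y) - D (x0, y)))" e1 r] by simp
        then show "\<bar>\<phi> (x, y) - \<phi> (x0, y) - fst (D (x0, y)) \<bullet> v - 0\<bar> \<le> e1 * r"
          by (simp add: eq inner_diff_left)
      qed (use y0 in auto)
      also have "(e1 * r) * (y0 - - 1) \<le> (e1 * r) * (h0 + 1)"
        using e1 r0 y0 by (intro mult_left_mono) auto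
      finally show ?thesis
        using c by (simp add: integral_diff integrable_continuous_real continuous_intros)
    qed
    \<comment> \<open>\<open>M\<close> integrates over the whole column, hence also over the strip
      of thickness L r between cut and surface; its contribution is O(r^2).\<close>
    have mid: "\<bar>integral {y0..h0} (\<lambda>y. fst (D (x0, y)) \<bullet> v)\<bar> \<le> B * L * r * r"
    proof -
      have "\<bar>integral {y0..h0} (\<lambda>y. fst (D (x0, y)) \<bullet> v) - 0 * (h0 - y0)\<bar> \<le> (B * r) * (h0 - y0)"
      proof (rule integral_approx_const)
        show "continuous_on {y0..h0} (\<lambda>y. fst (D (x0, y)) \<bullet> v)"
          using cont_low(2)[of 0, OF _ _ cDv] by (simp add: z1 h0_def)
        fix y assume "y \<in> {y0..h0}"
        then have "(x0, y) \<in> K" using memK[of 0 y] y0 by (simp add: z1 h0_def)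
        then have "norm (fst (D (x0, y))) \<le> B" using B(2) norm_fst_component_le order_trans by blast
        then show "\<bar>fst (D (x0, y)) \<bullet> v - 0\<bar> \<le> B * r"
          using Cauchy_Schwarz_ineq2[of "fst (D (x0, y))" v] r0 mult_right_mono[of "norm (fst (D (x0, y)))" B r] by simp
      qed (use y0 in auto)
      then show ?thesis by (simp add: y0_def mult_ac)
    qed
    have top: "\<bar>integral {y0..h (z t)} (\<lambda>y. \<phi> (z t, y)) - \<psi> x0 * (h (z t) - y0)\<bar> \<le> e1 * (2 * L * r)"
      if t: "0 \<le> t" "t \<le> 1" for t
    proof -
      have "\<bar>integral {y0..h (z t)} (\<lambda>y. \<phi> (z t, y)) - \<psi> x0 * (h (z t) - y0)\<bar> \<le> e1 * (h (z t) - y0)"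
      proof (rule integral_approx_const[OF cont_low(2)[OF t cont_\<phi>] yz(1)[OF t]])
        fix y assume y: "y \<in> {y0..h (z t)}"
        have "\<bar>y - h0\<bar> \<le> L * r"
        proof -
          have "(L - 1) * r \<le> L * r" using r0 by (intro mult_right_mono) auto
          then show ?thesis using y hz(1)[OF t] by (simp add: y0_def abs_le_iff)
        qed
        then have "dist (z t, y) (x0, h0) \<le> r + L * r"
          using hz(3)[OF t] norm_Pair_le[of "z t - x0" "y - h0"] by (simp add: dist_norm)
        then have "dist (z t, y) (x0, h0) < d2" using r by (simp add: algebra_simps)
        then have "dist (\<phi> (z t, y)) (\<phi> (x0, h0)) < e1"
          using y y0 by (intro d2(2)) (auto simp: fluid_domain_iff)
        then show "\<bar>\<phi> (z t, y) - \<psi> x0\<bar> \<le> e1" by (simp add: dist_norm h0_def trace)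
      qed
      also have "\<dots> \<le> e1 * (2 * L * r)" using yz(2)[OF t] e1 by (intro mult_left_mono) auto
      finally show ?thesis .
    qed
    have MD: "integral {-1..y0} (\<lambda>y. fst (D (x0, y)) \<bullet> v) + integral {y0..h0} (\<lambda>y. fst (D (x0, y)) \<bullet> v) = M 1 x0 * v $ 1 + M 2 x0 * v $ 2"
    proof -
      have c1: "continuous_on (fluid_domain h) (\<lambda>p. r * fst (D p) $ i)" for i r by (intro continuous_intros cont_D)
      have cm: "column (\<lambda>p. r * g p) x = r * column g x" for r g x using column_cmult[of "\<lambda>_. r"] by simp
      have "(\<lambda>p. fst (D p) \<bullet> v) = (\<lambda>p. v $ 1 * fst (D p) $ 1 + v $ 2 * fst (D p) $ 2)"
        by (simp add: inner_R2 mult.commute)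
      then have "column (\<lambda>p. fst (D p) \<bullet> v) x0 = v $ 1 * M 1 x0 + v $ 2 * M 2 x0"
        by (simp only: M_def column_add[OF c1 c1] cm)
      then show ?thesis using split[of 0, OF _ _ cDv] by (simp add: z1 column_def h0_def mult.commute)
    qed
    have hx: "\<bar>\<psi> x0 * (h x - h0 - gh x0 \<bullet> v)\<bar> \<le> \<bar>\<psi> x0\<bar> * (e1 * r)"
      unfolding abs_mult using hz(2)[of 1] by (intro mult_left_mono) (auto simp: z1)
    have "column \<phi> x - column \<phi> x0 =
       (integral {-1..y0} (\<lambda>y. \<phi> (x, y)) - integral {-1..y0} (\<lambda>y. \<phi> (x0, y))) +
       (integral {y0..h x} (\<lambda>y. \<phi> (x, y)) - integral {y0..h0} (\<lambda>y. \<phi> (x0, y)))"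
      using split[of 1, OF _ _ cont_\<phi>] split[of 0, OF _ _ cont_\<phi>] by (simp add: z1 column_def h0_def)
    note dec = this
    have t1: "\<bar>integral {y0..h x} (\<lambda>y. \<phi> (x, y)) - \<psi> x0 * (h x - y0)\<bar> \<le> e1 * (2 * L * r)"
      using top[of 1] by (simp add: z1)
    have t0: "\<bar>integral {y0..h0} (\<lambda>y. \<phi> (x0, y)) - \<psi> x0 * (h0 - y0)\<bar> \<le> e1 * (L * r)"
    proof -
      have "\<bar>integral {y0..h0} (\<lambda>y. \<phi> (x0, y)) - \<psi> x0 * (h0 - y0)\<bar> \<le> e1 * (h0 - y0)"
      proof (rule integral_approx_const)
        show "continuous_on {y0..h0} (\<lambda>y. \<phi> (x0, y))" using cont_low(2)[of 0, OF _ _ cont_\<phi>] by (simp add: z1 h0_def)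
        fix y assume y: "y \<in> {y0..h0}"
        then have "dist (x0, y) (x0, h0) \<le> L * r" by (auto simp: dist_Pair_Pair y0_def dist_norm)
        also have "\<dots> < d2" using r r0 by (simp add: algebra_simps)
        finally have "dist (\<phi> (x0, y)) (\<phi> (x0, h0)) < e1"
          using y y0 by (intro d2(2)) (auto simp: fluid_domain_iff h0_def)
        then show "\<bar>\<phi> (x0, y) - \<psi> x0\<bar> \<le> e1" by (simp add: dist_norm h0_def trace)
      qed (rule y0)
      then show ?thesis by (simp add: y0_def)
    qed
    have "\<bar>column \<phi> x - column \<phi> x0 - (M 1 x0 * v $ 1 + M 2 x0 * v $ 2 + \<psi> x0 * (gh x0 \<bullet> v))\<bar> \<le>
       e1 * r * (h0 + 1) + B * L * r * r + e1 * (2 * L * r) + e1 * (L * r) + \<bar>\<psi> x0\<bar> * (e1 * r)"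
      unfolding dec MD[symmetric]
      by (rule abs_leI; insert low[THEN abs_le_D1] low[THEN abs_le_D2] mid[THEN abs_le_D1] mid[THEN abs_le_D2]
          t1[THEN abs_le_D1] t1[THEN abs_le_D2] t0[THEN abs_le_D1] t0[THEN abs_le_D2]
          hx[THEN abs_le_D1] hx[THEN abs_le_D2], unfold right_diff_distrib, linarith)
    also have "B * L * r * r \<le> B * L * r * e1" using r r0 B L by (intro mult_left_mono) auto
    finally have "\<bar>column \<phi> x - column \<phi> x0 - (M 1 x0 * v $ 1 + M 2 x0 * v $ 2 + \<psi> x0 * (gh x0 \<bullet> v))\<bar> \<le> (e1 * K0) * r"
      by (simp add: K0_def algebra_simps)
    also have "\<dots> \<le> e * r" using e1 r0 by (intro mult_right_mono) auto
    finally show "norm (column \<phi> x - column \<phi> x0 - (M 1 x0 * (x - x0) $ 1 + M 2 x0 * (x - x0) $ 2 + \<psi> x0 * (gh x0 \<bullet> (x - x0)))) \<le>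
      e * norm (x - x0)" unfolding v_def[symmetric] by (simp add: r0(2))
  qed
qed

text \<open>Subtracting \<open>\<psi> h\<close> removes \<open>\<nabla>h\<close>, which need not be integrable, from the gradient of \<open>column \<phi>\<close>.\<close>

definition w :: "R2 \<Rightarrow> real" where "w x = column \<phi> x - \<psi> x * h x"

definition gw :: "R2 \<Rightarrow> R2" where "gw x = (\<chi> k. M k x - h x * g\<psi> x $ k)"

lemma gw_nth [simp]: "gw x $ k = M k x - h x * g\<psi> x $ k" by (simp add: gw_def)

lemma w_deriv: "(w has_derivative (\<lambda>v. gw x \<bullet> v)) (at x)"
proof -
  have "(w has_derivative (\<lambda>v. (M 1 x * v $ 1 + M 2 x * v $ 2 + \<psi> x * (gh x \<bullet> v)) - (\<psi> x * (gh x \<bullet> v) + (g\<psi> x \<bullet> v) * h x))) (at x)"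
    unfolding w_def by (intro has_derivative_diff has_derivative_mult column_potential_has_derivative \<psi>_deriv h_deriv)
  then show ?thesis by (rule has_derivative_eq_rhs) (simp add: fun_eq_iff inner_R2 algebra_simps)
qed

end

section \<open>Test functions and integration by parts\<close>

lemma integrable_mult_L2:
  fixes f g :: "'a \<Rightarrow> real"
  assumes f: "f \<in> borel_measurable N" "integrable N (\<lambda>x. (f x)\<^sup>2)"
    and g: "g \<in> borel_measurable N" "integrable N (\<lambda>x. (g x)\<^sup>2)"
  shows "integrable N (\<lambda>x. f x * g x)"
proof (rule Bochner_Integration.integrable_bound[OF Bochner_Integration.integrable_add[OF f(2) g(2)]])
  show "(\<lambda>x. f x * g x) \<in> borel_measurable N" using f g by simp
  show "AE x in N. norm (f x * g x) \<le> norm ((f x)\<^sup>2 + (g x)\<^sup>2)"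
  proof (rule AE_I2)
    fix x
    have "0 \<le> (\<bar>f x\<bar> - \<bar>g x\<bar>)\<^sup>2" by simp
    then have "2 * (\<bar>f x\<bar> * \<bar>g x\<bar>) \<le> (f x)\<^sup>2 + (g x)\<^sup>2" by (simp add: power2_diff)
    then have "\<bar>f x\<bar> * \<bar>g x\<bar> \<le> (f x)\<^sup>2 + (g x)\<^sup>2" by (smt (verit) abs_ge_zero mult_nonneg_nonneg)
    then show "norm (f x * g x) \<le> norm ((f x)\<^sup>2 + (g x)\<^sup>2)" by (simp add: abs_mult)
  qed
qed

text \<open>Second derivatives and their symmetry belong to the data because the mass flux is
  removed by moving a derivative from \<open>w\<close> onto \<open>g\<eta>\<close>.\<close>

locale test_function =
  fixes \<eta> :: "R2 \<Rightarrow> real" and g\<eta> :: "R2 \<Rightarrow> R2" and H\<eta> :: "2 \<Rightarrow> R2 \<Rightarrow> R2" and R :: real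
  assumes \<eta>_deriv: "\<And>x. (\<eta> has_derivative (\<lambda>v. g\<eta> x \<bullet> v)) (at x)"
    and g\<eta>_deriv: "\<And>k x. ((\<lambda>x. g\<eta> x $ k) has_derivative (\<lambda>v. H\<eta> k x \<bullet> v)) (at x)"
    and cont_H\<eta>: "\<And>k. continuous_on UNIV (H\<eta> k)"
    and H\<eta>_sym: "\<And>j k x. H\<eta> j x $ k = H\<eta> k x $ j"
    and R_pos: "R > 0"
    and supp: "\<And>k x. R \<le> \<bar>x $ 1\<bar> \<or> R \<le> \<bar>x $ 2\<bar> \<Longrightarrow> \<eta> x = 0 \<and> g\<eta> x = 0 \<and> H\<eta> k x = 0"
begin

lemma cont_\<eta>: "continuous_on S \<eta>"
  using \<eta>_deriv has_derivative_continuous continuous_at_imp_continuous_on by metis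

lemma cont_g\<eta>_nth: "continuous_on S (\<lambda>x. g\<eta> x $ k)"
  using g\<eta>_deriv has_derivative_continuous continuous_at_imp_continuous_on by metis

lemma cont_g\<eta>: "continuous_on S g\<eta>"
  using continuous_on_vec_lambda[of S "\<lambda>k x. g\<eta> x $ k"] cont_g\<eta>_nth by simp

lemma integral_g\<eta>: "(LINT x|lborel. g\<eta> x $ k) = 0"
  by (rule integral_partial_derivative_eq_0[where w=\<eta> and R=R])
     (use \<eta>_deriv supp in \<open>auto intro!: integrable_square_support[where R=R] cont_g\<eta>_nth\<close>)

end

context steady_wave
begin

lemma cont_w: "continuous_on S w"
  using w_deriv has_derivative_continuous continuous_at_imp_continuous_on by metis

lemma integrable_test_gw:
  assumes "continuous_on UNIV u" "\<And>x. R \<le> \<bar>x $ 1\<bar> \<or> R \<le> \<bar>x $ 2\<bar> \<Longrightarrow> u x = 0"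
  shows "integrable lborel (\<lambda>x. u x * (h x * g\<psi> x $ k))" "integrable lborel (\<lambda>x. u x * gw x $ k)"
proof -
  have [measurable]: "u \<in> borel_measurable borel" "h \<in> borel_measurable borel"
    using assms(1) cont_h by (auto intro: borel_measurable_continuous_onI)
  have "integrable lborel (\<lambda>x. (u x * h x) * g\<psi> x $ k)"
  proof (rule integrable_mult_L2)
    show "integrable lborel (\<lambda>x. (u x * h x)\<^sup>2)"
      by (rule integrable_square_support[where R=R]) (use assms in \<open>auto intro!: continuous_intros cont_h\<close>)
  qed (use g\<psi>_measurable g\<psi>_L2 in auto)
  then show 1: "integrable lborel (\<lambda>x. u x * (h x * g\<psi> x $ k))" by (simp add: mult.assoc)
  have "integrable lborel (\<lambda>x. u x * M k x)"
    by (rule integrable_square_support[where R=R]) (use assms in \<open>auto intro!: continuous_intros cont_M\<close>)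
  from Bochner_Integration.integrable_diff[OF this 1]
  show "integrable lborel (\<lambda>x. u x * gw x $ k)" by (simp add: right_diff_distrib)
qed

text \<open>\<open>gw\<close> contains \<open>g\<psi>\<close> and need not be continuous; the
  product rule holds pointwise, and the vanishing of an integrated derivative asks only for
  integrability.\<close>

lemma integrate_by_parts_w:
  assumes u: "\<And>x. (u has_derivative (\<lambda>v. gu x \<bullet> v)) (at x)" "continuous_on UNIV gu"
    and supp: "\<And>x. R \<le> \<bar>x $ 1\<bar> \<or> R \<le> \<bar>x $ 2\<bar> \<Longrightarrow> u x = 0 \<and> gu x = 0"
  shows "(LINT x|lborel. u x * gw x $ k) = - (LINT x|lborel. gu x $ k * w x)"
proof -
  have cu: "continuous_on UNIV u"
    using u(1) has_derivative_continuous continuous_at_imp_continuous_on by metis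
  have i1: "integrable lborel (\<lambda>x. u x * gw x $ k)" using integrable_test_gw(2)[OF cu] supp by blast
  have i2: "integrable lborel (\<lambda>x. gu x $ k * w x)"
    by (rule integrable_square_support[where R=R]) (use supp in \<open>auto intro!: continuous_intros cont_w u(2)\<close>)
  have "(LINT x|lborel. (u x *\<^sub>R gw x + w x *\<^sub>R gu x) $ k) = 0"
  proof (rule integral_partial_derivative_eq_0[where w="\<lambda>x. u x * w x" and R=R])
    show "((\<lambda>x. u x * w x) has_derivative (\<lambda>v. (u x *\<^sub>R gw x + w x *\<^sub>R gu x) \<bullet> v)) (at x)" for x
      by (rule has_derivative_eq_rhs[OF has_derivative_mult[OF u(1) w_deriv]])
         (simp add: fun_eq_iff inner_add_left mult.commute)
    show "integrable lborel (\<lambda>x. (u x *\<^sub>R gw x + w x *\<^sub>R gu x) $ k)"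
      using i1 i2 by (simp add: mult.commute del: gw_nth)
  qed (use supp in auto)
  then show ?thesis using i1 i2 by (simp add: mult.commute del: gw_nth)
qed

end

locale tested_wave = steady_wave h gh \<psi> g\<psi> \<phi> D c + test_function \<eta> g\<eta> H\<eta> R
  for h gh \<psi> g\<psi> \<phi> D c \<eta> g\<eta> H\<eta> R
begin

text \<open>Both sides equal minus the integral of a mixed second derivative of \<eta> times
  \<open>w\<close>: the weak form of the fact that a gradient has no curl.\<close>

lemma null_form: "(LINT x|lborel. g\<eta> x $ k * gw x $ j) = (LINT x|lborel. g\<eta> x $ j * gw x $ k)"
  using integrate_by_parts_w[OF g\<eta>_deriv cont_H\<eta>, of R k j] integrate_by_parts_w[OF g\<eta>_deriv cont_H\<eta>, of R j k]
    supp H\<eta>_sym by simp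

text \<open>Replacing \<open>M\<close> by h \<nabla>\<psi> makes every coefficient of
  \<open>g\<eta>\<close> integrable over the whole plane, which prepares the removal of the cutoff.
  The difference \<open>gw\<close> occurs only in null forms weighted by the components of c, and
  the constant 1/2 only against a derivative of \<eta>; all of these integrate to zero.\<close>

lemma pohozaev:
  "(LINT x|lborel. (\<Sum>j\<in>UNIV. g\<eta> x $ j * (E k j x - c $ j * (h x * g\<psi> x $ k))) +
      g\<eta> x $ k * (h x * (c \<bullet> g\<psi> x) - kinetic x / 2 - (h x)\<^sup>2 / 2)) = 0"
proof -
  have s1: "\<And>x. R \<le> \<bar>x $ 1\<bar> \<or> R \<le> \<bar>x $ 2\<bar> \<Longrightarrow> g\<eta> x $ i = 0" for i using supp by simp
  define A where "A x = (\<Sum>j\<in>UNIV. g\<eta> x $ j * (E k j x - c $ j * (h x * g\<psi> x $ k))) +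
      g\<eta> x $ k * (h x * (c \<bullet> g\<psi> x) - kinetic x / 2 - (h x)\<^sup>2 / 2)" for x
  define N where "N j x = g\<eta> x $ k * gw x $ j - g\<eta> x $ j * gw x $ k" for j x
  have iN: "integrable lborel (N j)" for j
    unfolding N_def by (intro Bochner_Integration.integrable_diff integrable_test_gw(2)[OF cont_g\<eta>_nth s1])
  have N0: "(LINT x|lborel. N j x) = 0" for j
    unfolding N_def using null_form[of k j] integrable_test_gw(2)[OF cont_g\<eta>_nth s1]
    by (subst Bochner_Integration.integral_diff) auto
  have ik: "integrable lborel (\<lambda>x. g\<eta> x $ k / 2)"
    by (rule integrable_square_support[where R=R]) (use s1 in \<open>auto intro!: continuous_intros cont_g\<eta>_nth\<close>)
  have iA: "integrable lborel A"
  proof -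
    have cA: "integrable lborel (\<lambda>x. (\<Sum>j\<in>UNIV. g\<eta> x $ j * E k j x) - g\<eta> x $ k * (kinetic x / 2 + (h x)\<^sup>2 / 2))"
      unfolding kinetic_def
      by (rule integrable_square_support[where R=R])
         (use s1 in \<open>auto intro!: continuous_intros cont_g\<eta>_nth cont_E cont_Ev cont_h\<close>)
    have "integrable lborel (\<lambda>x. ((\<Sum>j\<in>UNIV. g\<eta> x $ j * E k j x) - g\<eta> x $ k * (kinetic x / 2 + (h x)\<^sup>2 / 2)) +
       (c $ 1 * (g\<eta> x $ k * (h x * g\<psi> x $ 1)) + c $ 2 * (g\<eta> x $ k * (h x * g\<psi> x $ 2)) -
        c $ 1 * (g\<eta> x $ 1 * (h x * g\<psi> x $ k)) - c $ 2 * (g\<eta> x $ 2 * (h x * g\<psi> x $ k))))"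
      by (intro Bochner_Integration.integrable_add Bochner_Integration.integrable_diff cA
          integrable_mult_right impI integrable_test_gw(1)[OF cont_g\<eta>_nth s1])
    then show ?thesis by (simp add: A_def[abs_def] sum_2 inner_R2 algebra_simps)
  qed
  have "(\<Sum>j\<in>UNIV. g\<eta> x $ j * (E k j x - c $ j * M k x)) +
      g\<eta> x $ k * (c $ 1 * M 1 x + c $ 2 * M 2 x - kinetic x / 2 - (h x)\<^sup>2 / 2 + 1 / 2) =
      A x + (c $ 1 * N 1 x + (c $ 2 * N 2 x + g\<eta> x $ k / 2))" for x
    by (simp add: A_def N_def sum_2 inner_R2 algebra_simps)
  then have "(LINT x|lborel. A x + (c $ 1 * N 1 x + (c $ 2 * N 2 x + g\<eta> x $ k / 2))) = 0"
    using stress_identity[OF \<eta>_deriv cont_g\<eta> R_pos, of k] supp by simp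
  then have "(LINT x|lborel. A x) = 0"
    using iA iN ik N0 integral_g\<eta>[of k] by simp
  then show ?thesis unfolding A_def .
qed

text \<open>As the column integral of \<phi> - m is w - m + (\<psi> - m) h, replacing
  \<open>M\<close> by h \<nabla>\<psi> leaves exactly the gradient of \<eta> (w - m), contracted
  with c, and that integrates to zero.\<close>

lemma energy_balance:
  "(LINT x|lborel. \<eta> x * (kinetic x - h x * (c \<bullet> g\<psi> x)) +
      (g\<eta> x $ 1 * (column (\<lambda>p. (\<phi> p - m) * fst (D p) $ 1) x - c $ 1 * ((\<psi> x - m) * h x)) +
       g\<eta> x $ 2 * (column (\<lambda>p. (\<phi> p - m) * fst (D p) $ 2) x - c $ 2 * ((\<psi> x - m) * h x)))) = 0"
proof -
  define A where "A x = \<eta> x * (kinetic x - h x * (c \<bullet> g\<psi> x)) +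
      (g\<eta> x $ 1 * (column (\<lambda>p. (\<phi> p - m) * fst (D p) $ 1) x - c $ 1 * ((\<psi> x - m) * h x)) +
       g\<eta> x $ 2 * (column (\<lambda>p. (\<phi> p - m) * fst (D p) $ 2) x - c $ 2 * ((\<psi> x - m) * h x)))" for x
  define N where "N j x = \<eta> x * gw x $ j + g\<eta> x $ j * (w x - m)" for j x
  have s0: "\<And>x. R \<le> \<bar>x $ 1\<bar> \<or> R \<le> \<bar>x $ 2\<bar> \<Longrightarrow> \<eta> x = 0" using supp by simp
  have s1: "\<And>x. R \<le> \<bar>x $ 1\<bar> \<or> R \<le> \<bar>x $ 2\<bar> \<Longrightarrow> g\<eta> x $ i = 0" for i using supp by simp
  have i1: "integrable lborel (\<lambda>x. g\<eta> x $ j * w x)" "integrable lborel (\<lambda>x. g\<eta> x $ j * m)" for j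
    by (rule integrable_square_support[where R=R]; use s1 in \<open>auto intro!: continuous_intros cont_g\<eta>_nth cont_w\<close>)+
  have iN: "integrable lborel (N j)" for j
    unfolding N_def right_diff_distrib
    by (intro Bochner_Integration.integrable_add Bochner_Integration.integrable_diff i1 integrable_test_gw(2)[OF cont_\<eta> s0])
  have N0: "(LINT x|lborel. N j x) = 0" for j
    unfolding N_def right_diff_distrib
    using i1 integrable_test_gw(2)[OF cont_\<eta> s0] integrate_by_parts_w[OF \<eta>_deriv cont_g\<eta>, of R j] supp integral_g\<eta>[of j]
    by (simp del: gw_nth)
  have c\<psi>: "continuous_on S \<psi>" for S
    using \<psi>_deriv has_derivative_continuous continuous_at_imp_continuous_on by metis
  have iA: "integrable lborel A"
  proof -
    have cc: "continuous_on UNIV (column (\<lambda>p. (\<phi> p - m) * fst (D p) $ i))" for i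
      by (intro continuous_column continuous_intros cont_\<phi> cont_D)
    have cA: "integrable lborel (\<lambda>x. \<eta> x * kinetic x +
      (g\<eta> x $ 1 * (column (\<lambda>p. (\<phi> p - m) * fst (D p) $ 1) x - c $ 1 * ((\<psi> x - m) * h x)) +
       g\<eta> x $ 2 * (column (\<lambda>p. (\<phi> p - m) * fst (D p) $ 2) x - c $ 2 * ((\<psi> x - m) * h x))))"
      unfolding kinetic_def
      by (rule integrable_square_support[where R=R])
         (use s0 s1 in \<open>auto intro!: continuous_intros cont_g\<eta>_nth cont_\<eta> cont_E cont_Ev cont_h cc c\<psi>\<close>)
    have "integrable lborel (\<lambda>x. (\<eta> x * kinetic x +
      (g\<eta> x $ 1 * (column (\<lambda>p. (\<phi> p - m) * fst (D p) $ 1) x - c $ 1 * ((\<psi> x - m) * h x)) +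
       g\<eta> x $ 2 * (column (\<lambda>p. (\<phi> p - m) * fst (D p) $ 2) x - c $ 2 * ((\<psi> x - m) * h x)))) -
       (c $ 1 * (\<eta> x * (h x * g\<psi> x $ 1)) + c $ 2 * (\<eta> x * (h x * g\<psi> x $ 2))))"
      by (intro Bochner_Integration.integrable_add Bochner_Integration.integrable_diff cA
          integrable_mult_right impI integrable_test_gw(1)[OF cont_\<eta> s0])
    then show ?thesis by (simp add: A_def[abs_def] inner_R2 algebra_simps)
  qed
  have w_col: "column (\<lambda>p. \<phi> p - m) x = w x - m + (\<psi> x - m) * h x" for x
    using column_diff[OF cont_\<phi> continuous_on_const[of _ m], of x]
    by (simp add: column_const w_def algebra_simps)
  have "\<eta> x * (kinetic x - c $ 1 * M 1 x - c $ 2 * M 2 x) +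
      (g\<eta> x $ 1 * (column (\<lambda>p. (\<phi> p - m) * fst (D p) $ 1) x - c $ 1 * column (\<lambda>p. \<phi> p - m) x) +
       g\<eta> x $ 2 * (column (\<lambda>p. (\<phi> p - m) * fst (D p) $ 2) x - c $ 2 * column (\<lambda>p. \<phi> p - m) x)) =
      A x - (c $ 1 * N 1 x + c $ 2 * N 2 x)" for x
    unfolding w_col by (simp add: A_def N_def inner_R2 algebra_simps)
  then have "(LINT x|lborel. A x - (c $ 1 * N 1 x + c $ 2 * N 2 x)) = 0"
    using energy_identity[OF \<eta>_deriv cont_g\<eta> R_pos, of m] supp by simp
  then have "(LINT x|lborel. A x) = 0" using iA iN N0 by simp
  then show ?thesis unfolding A_def .
qed

end

subsection \<open>A Poincare inequality on squares\<close>

text \<open>Cauchy-Schwarz by expanding the nonnegative integral of (f' - k)^2, where k is the mean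
  slope. The derivative is only measurable and the right-hand side may be infinite, hence the
  extended reals.\<close>

lemma increment_square_le:
  fixes f f' :: "real \<Rightarrow> real"
  assumes ab: "a \<le> b" and der: "\<And>x. (f has_real_derivative f' x) (at x)" and m: "f' \<in> borel_measurable borel"
  shows "ennreal ((f b - f a)\<^sup>2) \<le> ennreal (b - a) * (\<integral>\<^sup>+x\<in>{a..b}. ennreal ((f' x)\<^sup>2) \<partial>lborel)"
proof (cases "a = b")
  case False
  then have T: "b - a > 0" using ab by simp
  show ?thesis
  proof (cases "(\<integral>\<^sup>+x\<in>{a..b}. ennreal ((f' x)\<^sup>2) \<partial>lborel) = \<infinity>")
    case True
    then show ?thesis using T by (simp add: ennreal_mult_top)
  next
    case fin: False
    have i2: "integrable lborel (\<lambda>x. (f' x)\<^sup>2 * indicator {a..b} x)"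
    proof (rule integrableI_nonneg)
      have "(\<integral>\<^sup>+x. ennreal ((f' x)\<^sup>2 * indicator {a..b} x) \<partial>lborel) = (\<integral>\<^sup>+x\<in>{a..b}. ennreal ((f' x)\<^sup>2) \<partial>lborel)"
        by (intro nn_integral_cong) (auto simp: indicator_def)
      then show "(\<integral>\<^sup>+x. ennreal ((f' x)\<^sup>2 * indicator {a..b} x) \<partial>lborel) < \<infinity>" using fin by (simp add: less_top)
    qed (use m in auto)
    have i0: "integrable lborel (\<lambda>x. indicator {a..b} x :: real)"
      using ab by (intro integrable_real_indicator) auto
    have i1: "integrable lborel (\<lambda>x. f' x * indicator {a..b} x)"
    proof (rule Bochner_Integration.integrable_bound[OF Bochner_Integration.integrable_add[OF i0 i2]])
      show "(\<lambda>x. f' x * indicator {a..b} x) \<in> borel_measurable lborel" using m by simp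
      have "\<bar>y\<bar> \<le> 1 + y\<^sup>2" for y :: real
        by (cases "\<bar>y\<bar> \<le> 1") (use power_increasing[of 1 2 "\<bar>y\<bar>"] in \<open>auto intro: order_trans[of _ 1]\<close>)
      then show "AE x in lborel. norm (f' x * indicator {a..b} x) \<le> norm (indicator {a..b} x + (f' x)\<^sup>2 * indicator {a..b} x)"
        by (intro AE_I2) (auto simp: indicator_def)
    qed
    have "(f' has_integral (f b - f a)) {a..b}"
      using ab der by (intro fundamental_theorem_of_calculus)
        (auto intro: has_field_derivative_at_within simp flip: has_real_derivative_iff_has_vector_derivative)
    moreover have "(LINT x|lborel. f' x * indicator {a..b} x) = integral {a..b} f'"
      using set_borel_integral_eq_integral(2)[of "{a..b}" f'] i1
      by (simp add: set_integrable_def set_lebesgue_integral_def mult.commute)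
    ultimately have A: "(LINT x|lborel. f' x * indicator {a..b} x) = f b - f a" by (simp add: integral_unique)
    define k where "k = (f b - f a) / (b - a)"
    have "0 \<le> (LINT x|lborel. (f' x - k)\<^sup>2 * indicator {a..b} x)" by (intro integral_nonneg_AE) simp
    also have "(\<lambda>x. (f' x - k)\<^sup>2 * indicator {a..b} x) =
        (\<lambda>x. (f' x)\<^sup>2 * indicator {a..b} x - 2 * k * (f' x * indicator {a..b} x) + k\<^sup>2 * indicator {a..b} x)"
      by (simp add: fun_eq_iff power2_diff algebra_simps)
    also have "(LINT x|lborel. \<dots> x) = (LINT x|lborel. (f' x)\<^sup>2 * indicator {a..b} x) - 2 * k * (f b - f a) + k\<^sup>2 * (b - a)"
      using i0 i1 i2 A ab by (simp del: indicator_simps)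
    finally have "(LINT x|lborel. (f' x)\<^sup>2 * indicator {a..b} x) \<ge> 2 * k * (f b - f a) - k\<^sup>2 * (b - a)" by simp
    moreover have "2 * k * (f b - f a) - k\<^sup>2 * (b - a) = (f b - f a)\<^sup>2 / (b - a)"
    proof -
      have "2 * (d / r) * d - (d / r)\<^sup>2 * r = d\<^sup>2 / r" if "r > 0" for d r :: real
        using that by (simp add: power2_eq_square)
      then show ?thesis using T unfolding k_def by blast
    qed
    ultimately have "(f b - f a)\<^sup>2 / (b - a) \<le> (LINT x|lborel. (f' x)\<^sup>2 * indicator {a..b} x)"
      by linarith
    then have "(f b - f a)\<^sup>2 \<le> (b - a) * (LINT x|lborel. (f' x)\<^sup>2 * indicator {a..b} x)"
      using T by (simp only: pos_divide_le_eq mult.commute)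
    then have "ennreal ((f b - f a)\<^sup>2) \<le> ennreal (b - a) * ennreal (LINT x|lborel. (f' x)\<^sup>2 * indicator {a..b} x)"
      using T by (simp add: ennreal_leI flip: ennreal_mult'')
    also have "ennreal (LINT x|lborel. (f' x)\<^sup>2 * indicator {a..b} x) = (\<integral>\<^sup>+x. ennreal ((f' x)\<^sup>2 * indicator {a..b} x) \<partial>lborel)"
      using i2 by (intro nn_integral_eq_integral[symmetric]) auto
    also have "\<dots> = (\<integral>\<^sup>+x\<in>{a..b}. ennreal ((f' x)\<^sup>2) \<partial>lborel)"
      by (intro nn_integral_cong) (auto simp: indicator_def)
    finally show ?thesis .
  qed
qed simp

lemma increment_square_le_interval:
  fixes f f' :: "real \<Rightarrow> real"
  assumes st: "s \<in> {-N..N}" "t \<in> {-N..N}" and der: "\<And>x. (f has_real_derivative f' x) (at x)"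
    and m: "f' \<in> borel_measurable borel"
  shows "ennreal ((f s - f t)\<^sup>2) \<le> ennreal (2 * N) * (\<integral>\<^sup>+x\<in>{-N..N}. ennreal ((f' x)\<^sup>2) \<partial>lborel)"
proof -
  have *: "ennreal ((f b - f a)\<^sup>2) \<le> ennreal (2 * N) * (\<integral>\<^sup>+x\<in>{-N..N}. ennreal ((f' x)\<^sup>2) \<partial>lborel)"
    if "a \<in> {-N..N}" "b \<in> {-N..N}" "a \<le> b" for a b
  proof -
    have "ennreal ((f b - f a)\<^sup>2) \<le> ennreal (b - a) * (\<integral>\<^sup>+x\<in>{a..b}. ennreal ((f' x)\<^sup>2) \<partial>lborel)"
      by (rule increment_square_le[OF that(3) der m])
    also have "\<dots> \<le> ennreal (2 * N) * (\<integral>\<^sup>+x\<in>{-N..N}. ennreal ((f' x)\<^sup>2) \<partial>lborel)"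
      using that by (intro mult_mono ennreal_leI nn_integral_mono) (auto simp: indicator_def)
    finally show ?thesis .
  qed
  show ?thesis using *[of s t] *[of t s] st by (cases "s \<le> t") (simp_all add: power2_commute)
qed

abbreviation square :: "real \<Rightarrow> R2 set" where
  "square N \<equiv> {x. \<bar>x $ 1\<bar> \<le> N \<and> \<bar>x $ 2\<bar> \<le> N}"

text \<open>The reference value is a point value instead of a mean: from (s, t) a horizontal segment
  leads to a fixed vertical line, along which a vertical segment leads to (s', 0). The line is
  selected so that the vertical derivative of \<psi> has about average energy on it, since on an
  arbitrary line that energy is not controlled.\<close>

lemma poincare_square:
  fixes \<psi> :: "R2 \<Rightarrow> real"
  assumes der: "\<And>x. (\<psi> has_derivative (\<lambda>v. g x \<bullet> v)) (at x)"
    and m: "\<And>i. (\<lambda>x. g x $ i) \<in> borel_measurable borel"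
    and L2: "\<And>i. integrable lborel (\<lambda>x. (g x $ i)\<^sup>2)" and N: "N > 0"
  shows "\<exists>m. (LINT x|lborel. indicator (square N) x * (\<psi> x - m)\<^sup>2) \<le>
    8 * N\<^sup>2 * ((LINT x|lborel. (g x $ 1)\<^sup>2) + (LINT x|lborel. (g x $ 2)\<^sup>2) + 1)"
proof -
  have c\<psi>: "continuous_on UNIV \<psi>"
    using der has_derivative_continuous continuous_at_imp_continuous_on by metis
  have pm: "(\<lambda>z. plane_point (fst z) (snd z)) \<in> borel \<Otimes>\<^sub>M borel \<rightarrow>\<^sub>M borel" by measurable
  have gm2: "(\<lambda>z. g (plane_point (fst z) (snd z)) $ i) \<in> borel_measurable (borel \<Otimes>\<^sub>M borel)" for i
    using measurable_compose[OF pm m] .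
  have gm: "(\<lambda>s. g (plane_point s t) $ i) \<in> borel_measurable borel" "(\<lambda>s. g (plane_point t s) $ i) \<in> borel_measurable borel" for i t
    by (rule measurable_compose[OF _ m], measurable)+
  define G where "G i = (LINT x|lborel. (g x $ i)\<^sup>2)" for i
  have G: "(\<integral>\<^sup>+x. ennreal ((g x $ i)\<^sup>2) \<partial>lborel) = ennreal (G i)" "G i \<ge> 0" for i
    unfolding G_def using L2 by (auto intro!: nn_integral_eq_integral)
  let ?I = "{-N..N}"
  define u where "u t = (\<integral>\<^sup>+s\<in>?I. ennreal ((g (plane_point s t) $ 1)\<^sup>2) \<partial>lborel)" for t
  define vv where "vv s = (\<integral>\<^sup>+t\<in>?I. ennreal ((g (plane_point s t) $ 2)\<^sup>2) \<partial>lborel)" for s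
  have um: "u \<in> borel_measurable borel" unfolding u_def
  proof -
    have "(\<lambda>(t, s). ennreal ((g (plane_point s t) $ 1)\<^sup>2) * indicator ?I s) \<in> borel_measurable (lborel \<Otimes>\<^sub>M lborel)"
    proof -
      have "(\<lambda>z. plane_point (snd z) (fst z)) \<in> borel \<Otimes>\<^sub>M borel \<rightarrow>\<^sub>M borel" by measurable
      from measurable_compose[OF this m] have [measurable]: "(\<lambda>z. g (plane_point (snd z) (fst z)) $ 1) \<in> borel_measurable (borel \<Otimes>\<^sub>M borel)" .
      show ?thesis unfolding case_prod_unfold by measurable
    qed
    from lborel.borel_measurable_nn_integral[OF this] show "(\<lambda>t. \<integral>\<^sup>+s\<in>?I. ennreal ((g (plane_point s t) $ 1)\<^sup>2) \<partial>lborel) \<in> borel_measurable borel" by simp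
  qed
  have vm: "vv \<in> borel_measurable borel" unfolding vv_def
  proof -
    have "(\<lambda>(s, t). ennreal ((g (plane_point s t) $ 2)\<^sup>2) * indicator ?I t) \<in> borel_measurable (lborel \<Otimes>\<^sub>M lborel)"
      using gm2[of 2, measurable] unfolding case_prod_unfold by measurable
    from lborel.borel_measurable_nn_integral[OF this] show "(\<lambda>s. \<integral>\<^sup>+t\<in>?I. ennreal ((g (plane_point s t) $ 2)\<^sup>2) \<partial>lborel) \<in> borel_measurable borel" by simp
  qed
  have uI: "(\<integral>\<^sup>+t. u t \<partial>lborel) \<le> ennreal (G 1)"
  proof -
    have "(\<integral>\<^sup>+t. u t \<partial>lborel) \<le> (\<integral>\<^sup>+t. \<integral>\<^sup>+s. ennreal ((g (plane_point s t) $ 1)\<^sup>2) \<partial>lborel \<partial>lborel)"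
      unfolding u_def by (intro nn_integral_mono) (auto simp: indicator_def)
    also have "\<dots> = ennreal (G 1)"
      using nn_integral_R2(2)[of "\<lambda>x. ennreal ((g x $ 1)\<^sup>2)"] m[of 1] G(1)[of 1] by simp
    finally show ?thesis .
  qed
  have vI: "(\<integral>\<^sup>+s. vv s \<partial>lborel) \<le> ennreal (G 2)"
  proof -
    have "(\<integral>\<^sup>+s. vv s \<partial>lborel) \<le> (\<integral>\<^sup>+s. \<integral>\<^sup>+t. ennreal ((g (plane_point s t) $ 2)\<^sup>2) \<partial>lborel \<partial>lborel)"
      unfolding vv_def by (intro nn_integral_mono) (auto simp: indicator_def)
    also have "\<dots> = ennreal (G 2)"
      using nn_integral_R2(1)[of "\<lambda>x. ennreal ((g x $ 2)\<^sup>2)"] m[of 2] G(1)[of 2] by simp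
    finally show ?thesis .
  qed
  \<comment> \<open>Averaging over the vertical lines; the summand 1 makes the contradiction 2 N (G
    2 + 1) \<le> 2 N (G 2) strict.\<close>
  have "\<exists>s'\<in>?I. ennreal (2 * N) * vv s' \<le> ennreal (G 2 + 1)"
  proof (rule ccontr)
    assume "\<not> ?thesis"
    then have "ennreal (G 2 + 1) \<le> ennreal (2 * N) * vv s" if "s \<in> ?I" for s
      using that by (meson linear)
    then have "(\<integral>\<^sup>+s. ennreal (G 2 + 1) * indicator ?I s \<partial>lborel) \<le> (\<integral>\<^sup>+s. ennreal (2 * N) * vv s \<partial>lborel)"
      by (intro nn_integral_mono) (auto simp: indicator_def)
    also have "\<dots> = ennreal (2 * N) * (\<integral>\<^sup>+s. vv s \<partial>lborel)" using vm by (intro nn_integral_cmult) simp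
    also have "\<dots> \<le> ennreal (2 * N) * ennreal (G 2)" using vI by (intro mult_left_mono) auto
    also have "(\<integral>\<^sup>+s. ennreal (G 2 + 1) * indicator ?I s \<partial>lborel) = ennreal (G 2 + 1) * ennreal (2 * N)"
      using N by (simp add: nn_integral_cmult_indicator)
    finally have le: "ennreal (G 2 + 1) * ennreal (2 * N) \<le> ennreal (2 * N) * ennreal (G 2)" .
    have e1: "ennreal ((G 2 + 1) * (2 * N)) = ennreal (G 2 + 1) * ennreal (2 * N)"
      by (rule ennreal_mult'') (use N in simp)
    have e2: "ennreal (2 * N * G 2) = ennreal (2 * N) * ennreal (G 2)"
      by (rule ennreal_mult'') (rule G)
    from le have "ennreal ((G 2 + 1) * (2 * N)) \<le> ennreal (2 * N * G 2)" unfolding e1 e2 .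
    then have "(G 2 + 1) * (2 * N) \<le> 2 * N * G 2"
      using N G(2)[of 2] by (subst (asm) ennreal_le_iff) auto
    then show False using N by (simp add: algebra_simps)
  qed
  then obtain s' where s': "s' \<in> ?I" and v: "ennreal (2 * N) * vv s' \<le> ennreal (G 2 + 1)" by blast
  define m0 where "m0 = \<psi> (plane_point s' 0)"
  \<comment> \<open>The square of a sum is at most twice the sum of squares, applied to two segments
    of length at most 2 N; integration over the square of side 2 N then gives the factor 8
    N^2.\<close>
  have pt: "ennreal ((\<psi> (plane_point s t) - m0)\<^sup>2) \<le> ennreal (4 * N) * u t + 2 * ennreal (G 2 + 1)"
    if st: "s \<in> ?I" "t \<in> ?I" for s t
  proof -
    have d1: "((\<lambda>s. \<psi> (plane_point s t)) has_real_derivative g (plane_point s t) $ 1) (at s)" for s t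
    proof -
      have "((\<lambda>s. plane_point s t) has_derivative (\<lambda>v. v *\<^sub>R axis 1 1)) (at s)" by (auto intro!: derivative_eq_intros)
      from has_derivative_compose[OF this der] show ?thesis
        by (simp add: has_field_derivative_def inner_R2 mult_commute_abs)
    qed
    have d2: "((\<lambda>t. \<psi> (plane_point s t)) has_real_derivative g (plane_point s t) $ 2) (at t)" for s t
    proof -
      have "((\<lambda>t. plane_point s t) has_derivative (\<lambda>v. v *\<^sub>R axis 2 1)) (at t)" by (auto intro!: derivative_eq_intros)
      from has_derivative_compose[OF this der] show ?thesis
        by (simp add: has_field_derivative_def inner_R2 mult_commute_abs)
    qed
    have a: "ennreal ((\<psi> (plane_point s t) - \<psi> (plane_point s' t))\<^sup>2) \<le> ennreal (2 * N) * u t"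
      unfolding u_def by (rule increment_square_le_interval[OF st(1) s' d1 gm(1)])
    have b: "ennreal ((\<psi> (plane_point s' t) - m0)\<^sup>2) \<le> ennreal (2 * N) * vv s'"
      unfolding vv_def m0_def using N by (intro increment_square_le_interval[OF st(2) _ d2 gm(2)]) auto
    have "(x + y)\<^sup>2 \<le> 2 * x\<^sup>2 + 2 * y\<^sup>2" for x y :: real
      using sum_squares_bound[of x y] by (simp add: power2_sum)
    from this[of "\<psi> (plane_point s t) - \<psi> (plane_point s' t)" "\<psi> (plane_point s' t) - m0"]
    have "ennreal ((\<psi> (plane_point s t) - m0)\<^sup>2) \<le>
        ennreal (2 * (\<psi> (plane_point s t) - \<psi> (plane_point s' t))\<^sup>2 + 2 * (\<psi> (plane_point s' t) - m0)\<^sup>2)"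
      by (intro ennreal_leI) simp
    also have "\<dots> = 2 * ennreal ((\<psi> (plane_point s t) - \<psi> (plane_point s' t))\<^sup>2) + 2 * ennreal ((\<psi> (plane_point s' t) - m0)\<^sup>2)"
      by (simp add: ennreal_plus ennreal_mult'' ennreal_mult)
    also have "\<dots> \<le> 2 * (ennreal (2 * N) * u t) + 2 * ennreal (G 2 + 1)"
      by (intro add_mono mult_left_mono a order_trans[OF b v]) auto
    also have "2 * (ennreal (2 * N) * u t) = ennreal (4 * N) * u t"
      using N by (simp add: mult.assoc[symmetric]) (simp add: ennreal_mult)
    finally show ?thesis .
  qed
  have int: "integrable lborel (\<lambda>x. indicator (square N) x *\<^sub>R (\<psi> x - m0)\<^sup>2)"
    by (intro borel_integrable_compact compact_square continuous_intros continuous_on_subset[OF c\<psi>]) auto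
  have "ennreal (LINT x|lborel. indicator (square N) x * (\<psi> x - m0)\<^sup>2) =
      (\<integral>\<^sup>+x. ennreal (indicator (square N) x * (\<psi> x - m0)\<^sup>2) \<partial>lborel)"
    using int by (intro nn_integral_eq_integral[symmetric]) auto
  also have "\<dots> = (\<integral>\<^sup>+t. \<integral>\<^sup>+s. ennreal (indicator (square N) (plane_point s t) * (\<psi> (plane_point s t) - m0)\<^sup>2) \<partial>lborel \<partial>lborel)"
    using int by (intro nn_integral_R2(2)) auto
  also have "\<dots> \<le> (\<integral>\<^sup>+t. \<integral>\<^sup>+s. ((ennreal (4 * N) * u t + 2 * ennreal (G 2 + 1)) * indicator ?I t) * indicator ?I s \<partial>lborel \<partial>lborel)"
    by (intro nn_integral_mono) (auto simp: indicator_def abs_le_iff intro!: pt)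
  also have "\<dots> = (\<integral>\<^sup>+t. ((ennreal (4 * N) * u t + 2 * ennreal (G 2 + 1)) * indicator ?I t) * ennreal (2 * N) \<partial>lborel)"
    using N by (simp add: nn_integral_cmult_indicator)
  also have "\<dots> = (\<integral>\<^sup>+t. (ennreal (4 * N) * u t + 2 * ennreal (G 2 + 1)) * indicator ?I t \<partial>lborel) * ennreal (2 * N)"
    using um by (intro nn_integral_multc) simp
  also have "\<dots> \<le> (ennreal (4 * N) * ennreal (G 1) + 2 * ennreal (G 2 + 1) * ennreal (2 * N)) * ennreal (2 * N)"
  proof (intro mult_right_mono)
    have "(\<integral>\<^sup>+t. (ennreal (4 * N) * u t + 2 * ennreal (G 2 + 1)) * indicator ?I t \<partial>lborel) \<le>
       (\<integral>\<^sup>+t. ennreal (4 * N) * u t + 2 * ennreal (G 2 + 1) * indicator ?I t \<partial>lborel)"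
      by (intro nn_integral_mono) (auto simp: indicator_def)
    also have "\<dots> = ennreal (4 * N) * (\<integral>\<^sup>+t. u t \<partial>lborel) + 2 * ennreal (G 2 + 1) * ennreal (2 * N)"
      using um N by (simp add: nn_integral_add nn_integral_cmult nn_integral_cmult_indicator)
    also have "\<dots> \<le> ennreal (4 * N) * ennreal (G 1) + 2 * ennreal (G 2 + 1) * ennreal (2 * N)"
      using uI by (intro add_mono mult_left_mono) auto
    finally show "(\<integral>\<^sup>+t. (ennreal (4 * N) * u t + 2 * ennreal (G 2 + 1)) * indicator ?I t \<partial>lborel) \<le> \<dots>" .
  qed simp
  also have "\<dots> = ennreal (8 * N\<^sup>2 * (G 1 + G 2 + 1))"
  proof -
    have "ennreal (8 * N\<^sup>2 * (G 1 + G 2 + 1)) = ennreal ((4 * N * G 1 + 2 * (G 2 + 1) * (2 * N)) * (2 * N))"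
      by (rule arg_cong[where f=ennreal]) (simp add: power2_eq_square algebra_simps)
    also have "\<dots> = (ennreal (4 * N) * ennreal (G 1) + 2 * ennreal (G 2 + 1) * ennreal (2 * N)) * ennreal (2 * N)"
      using N G(2)[of 1] G(2)[of 2] by (simp add: ennreal_mult ennreal_plus del: ennreal_plus[symmetric])
    finally show ?thesis by simp
  qed
  finally have "(LINT x|lborel. indicator (square N) x * (\<psi> x - m0)\<^sup>2) \<le> 8 * N\<^sup>2 * (G 1 + G 2 + 1)"
    using G(2)[of 1] G(2)[of 2] by (subst (asm) ennreal_le_iff) auto
  then show ?thesis unfolding G_def by blast
qed

subsection \<open>Cutoffs\<close>

lemma test_function_coord_mult:
  assumes "test_function \<eta> g\<eta> H\<eta> R"
  shows "test_function (\<lambda>x. x $ l * \<eta> x) (\<lambda>x. \<eta> x *\<^sub>R axis l 1 + x $ l *\<^sub>R g\<eta> x)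
    (\<lambda>k x. axis l 1 $ k *\<^sub>R g\<eta> x + g\<eta> x $ k *\<^sub>R axis l 1 + x $ l *\<^sub>R H\<eta> k x) R"
proof -
  interpret test_function \<eta> g\<eta> H\<eta> R by fact
  have nth: "((\<lambda>x :: R2. x $ l) has_derivative (\<lambda>v. v $ l)) (at x)" for x
    by (rule bounded_linear.has_derivative[OF bounded_linear_vec_nth has_derivative_ident])
  show ?thesis
  proof
    fix x
    show "((\<lambda>x. x $ l * \<eta> x) has_derivative (\<lambda>v. (\<eta> x *\<^sub>R axis l 1 + x $ l *\<^sub>R g\<eta> x) \<bullet> v)) (at x)"
      by (rule has_derivative_eq_rhs[OF has_derivative_mult[OF nth \<eta>_deriv]])
         (simp add: fun_eq_iff inner_add_left inner_axis' algebra_simps)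
    fix k
    have "((\<lambda>x. \<eta> x * axis l 1 $ k + x $ l * g\<eta> x $ k) has_derivative
        (\<lambda>v. (g\<eta> x \<bullet> v) * axis l 1 $ k + (x $ l * (H\<eta> k x \<bullet> v) + v $ l * g\<eta> x $ k))) (at x)"
      by (intro has_derivative_add has_derivative_mult[OF nth g\<eta>_deriv] has_derivative_mult_left \<eta>_deriv)
    then show "((\<lambda>x. (\<eta> x *\<^sub>R axis l 1 + x $ l *\<^sub>R g\<eta> x) $ k) has_derivative
        (\<lambda>v. (axis l 1 $ k *\<^sub>R g\<eta> x + g\<eta> x $ k *\<^sub>R axis l 1 + x $ l *\<^sub>R H\<eta> k x) \<bullet> v)) (at x)"
      by (simp add: inner_add_left inner_axis' algebra_simps)
    show "continuous_on UNIV (\<lambda>x. axis l 1 $ k *\<^sub>R g\<eta> x + g\<eta> x $ k *\<^sub>R axis l 1 + x $ l *\<^sub>R H\<eta> k x)"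
      by (intro continuous_intros cont_g\<eta> cont_g\<eta>_nth cont_H\<eta>)
    fix j
    show "(axis l 1 $ j *\<^sub>R g\<eta> x + g\<eta> x $ j *\<^sub>R axis l 1 + x $ l *\<^sub>R H\<eta> j x) $ k =
        (axis l 1 $ k *\<^sub>R g\<eta> x + g\<eta> x $ k *\<^sub>R axis l 1 + x $ l *\<^sub>R H\<eta> k x) $ j"
      using H\<eta>_sym[of j x k] by (simp add: mult.commute)
  qed (use R_pos supp in auto)
qed

text \<open>Strict inequalities in \<open>\<theta>_outer\<close> and \<open>\<theta>_inner\<close>
  describe open sets, on which derivatives vanish along with the function being constant. The
  profile of the Littlewood-Paley decomposition is reused here as a cutoff in space.\<close>

locale smooth_bump =
  fixes \<theta> \<theta>1 \<theta>2 :: "real \<Rightarrow> real" and B :: real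
  assumes \<theta>_deriv: "\<And>x. (\<theta> has_real_derivative \<theta>1 x) (at x)"
    and \<theta>1_deriv: "\<And>x. (\<theta>1 has_real_derivative \<theta>2 x) (at x)"
    and \<theta>2_cont: "continuous_on UNIV \<theta>2"
    and \<theta>_range: "\<And>x. 0 \<le> \<theta> x" "\<And>x. \<theta> x \<le> 1"
    and \<theta>_outer: "\<And>x. 3 / 2 < \<bar>x\<bar> \<Longrightarrow> \<theta> x = 0 \<and> \<theta>1 x = 0 \<and> \<theta>2 x = 0"
    and \<theta>_inner: "\<And>x. \<bar>x\<bar> < 5 / 4 \<Longrightarrow> \<theta> x = 1 \<and> \<theta>1 x = 0"
    and \<theta>1_bound: "\<And>x. \<bar>\<theta>1 x\<bar> \<le> B"

lemma smooth_bump_of_cutoff: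
  assumes "admissible_cutoff \<theta>"
  shows "\<exists>\<theta>1 \<theta>2 B. smooth_bump \<theta> \<theta>1 \<theta>2 B"
proof -
  note a = assms[unfolded admissible_cutoff_def]
  define \<theta>1 \<theta>2 where "\<theta>1 = deriv \<theta>" and "\<theta>2 = deriv (deriv \<theta>)"
  from a have fd: "(deriv ^^ n) \<theta> field_differentiable at x" for n x by blast
  have d0: "(\<theta> has_real_derivative \<theta>1 x) (at x)" for x
    using fd[of 0 x] unfolding \<theta>1_def by (simp add: field_differentiable_derivI)
  have d1: "(\<theta>1 has_real_derivative \<theta>2 x) (at x)" for x
    using fd[of 1 x] unfolding \<theta>1_def \<theta>2_def by (simp add: field_differentiable_derivI)
  have c2: "continuous_on UNIV \<theta>2"
    using fd[of 2] unfolding \<theta>2_def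
    by (auto intro!: continuous_at_imp_continuous_on field_differentiable_imp_continuous_at simp: numeral_2_eq_2)
  have c1: "continuous_on UNIV \<theta>1" using d1 DERIV_continuous_on by blast
  have z0: "\<theta> x = 0" if "3 / 2 < \<bar>x\<bar>" for x using a that by blast
  have op: "open {x :: real. 3 / 2 < \<bar>x\<bar>}" "open {x :: real. \<bar>x\<bar> < 5 / 4}"
    by (intro open_Collect_less continuous_intros)+
  have z1: "\<theta>1 x = 0" if "3 / 2 < \<bar>x\<bar>" for x
  proof -
    have "(\<theta> has_real_derivative 0) (at x)"
      by (rule has_field_derivative_transform_within_open[OF DERIV_const[of 0] op(1)]) (use that z0 in auto)
    then show ?thesis using d0 DERIV_unique by blast
  qed
  have z2: "\<theta>2 x = 0" if "3 / 2 < \<bar>x\<bar>" for x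
  proof -
    have "(\<theta>1 has_real_derivative 0) (at x)"
      by (rule has_field_derivative_transform_within_open[OF DERIV_const[of 0] op(1)]) (use that z1 in auto)
    then show ?thesis using d1 DERIV_unique by blast
  qed
  have i0: "\<theta> x = 1" if "\<bar>x\<bar> < 5 / 4" for x using a that by (meson less_imp_le)
  have i1: "\<theta>1 x = 0" if "\<bar>x\<bar> < 5 / 4" for x
  proof -
    have "(\<theta> has_real_derivative 0) (at x)"
      by (rule has_field_derivative_transform_within_open[OF DERIV_const[of 1] op(2)]) (use that i0 in auto)
    then show ?thesis using d0 DERIV_unique by blast
  qed
  have "compact (\<theta>1 ` {-2..2})" by (intro compact_continuous_image continuous_on_subset[OF c1]) auto
  then obtain B where B: "\<And>x. x \<in> {-2..2} \<Longrightarrow> \<bar>\<theta>1 x\<bar> \<le> B"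
    using compact_imp_bounded bounded_iff by (metis image_eqI real_norm_def)
  have Bx: "\<bar>\<theta>1 x\<bar> \<le> B" for x
  proof (cases "x \<in> {-2..2}")
    case False
    then have "3 / 2 < \<bar>x\<bar>" by auto
    then show ?thesis using z1[of x] B[of 0] by (auto intro: order_trans[OF abs_ge_zero])
  qed (rule B)
  have "smooth_bump \<theta> \<theta>1 \<theta>2 B"
    by standard (use d0 d1 c2 a z0 z1 z2 i0 i1 Bx in auto)
  then show ?thesis by blast
qed

context smooth_bump
begin

text \<open>The squared radius makes the bump twice differentiable at the origin by the chain rule
  alone. The set |x|^2 \<le> (3/2) N^2, outside which the bump vanishes, lies in the square of half
  side 2 N.\<close>

definition q :: "real \<Rightarrow> R2 \<Rightarrow> real" where "q N x = (x \<bullet> x) / N\<^sup>2"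
definition bump :: "real \<Rightarrow> R2 \<Rightarrow> real" where "bump N x = \<theta> (q N x)"
definition gbump :: "real \<Rightarrow> R2 \<Rightarrow> R2" where "gbump N x = (2 / N\<^sup>2 * \<theta>1 (q N x)) *\<^sub>R x"
definition hbump :: "real \<Rightarrow> 2 \<Rightarrow> R2 \<Rightarrow> R2" where
  "hbump N k x = (4 / N\<^sup>2 / N\<^sup>2 * \<theta>2 (q N x) * x $ k) *\<^sub>R x + (2 / N\<^sup>2 * \<theta>1 (q N x)) *\<^sub>R axis k 1"

lemma q_outside: "\<bar>q N x\<bar> > 3 / 2" if "N > 0" "2 * N \<le> \<bar>x $ 1\<bar> \<or> 2 * N \<le> \<bar>x $ 2\<bar>"
proof -
  have "(2 * N)\<^sup>2 \<le> x \<bullet> x"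
  proof -
    have "(2 * N)\<^sup>2 \<le> (x $ i)\<^sup>2" if "2 * N \<le> \<bar>x $ i\<bar>" for i
      using power_mono[OF that, of 2] \<open>N > 0\<close> by simp
    then have "(2 * N)\<^sup>2 \<le> (x $ 1)\<^sup>2 \<or> (2 * N)\<^sup>2 \<le> (x $ 2)\<^sup>2" using that by blast
    moreover have "(x $ 1)\<^sup>2 \<ge> 0" "(x $ 2)\<^sup>2 \<ge> 0" by simp_all
    ultimately show ?thesis unfolding inner_R2 power2_eq_square[symmetric] by linarith
  qed
  then have "4 \<le> q N x" using that by (simp add: q_def field_simps)
  then show ?thesis by simp
qed

lemma test_function_bump:
  assumes N: "N > 0"
  shows "test_function (bump N) (gbump N) (hbump N) (2 * N)"
proof
  have qd: "(q N has_derivative (\<lambda>v. 2 / N\<^sup>2 * (x \<bullet> v))) (at x)" for x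
  proof -
    have "((\<lambda>x :: R2. 1 / N\<^sup>2 * (x \<bullet> x)) has_derivative (\<lambda>v. 1 / N\<^sup>2 * (x \<bullet> v + v \<bullet> x))) (at x)"
      by (intro has_derivative_mult_right has_derivative_inner has_derivative_ident)
    then show ?thesis by (simp add: q_def[abs_def] inner_commute)
  qed
  have nth: "((\<lambda>x :: R2. x $ k) has_derivative (\<lambda>v. v $ k)) (at x)" for x k
    by (rule bounded_linear.has_derivative[OF bounded_linear_vec_nth has_derivative_ident])
  have cq: "continuous_on UNIV (q N)" unfolding q_def[abs_def] by (intro continuous_intros) (use N in auto)
  fix x
  show "(bump N has_derivative (\<lambda>v. gbump N x \<bullet> v)) (at x)"
    unfolding bump_def[abs_def] gbump_def
    by (rule has_derivative_eq_rhs[OF has_derivative_compose[OF qd \<theta>_deriv[unfolded has_field_derivative_def]]])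
       (simp add: fun_eq_iff)
  fix k
  have d1: "((\<lambda>x. \<theta>1 (q N x)) has_derivative (\<lambda>v. \<theta>2 (q N x) * (2 / N\<^sup>2 * (x \<bullet> v)))) (at x)"
    by (rule has_derivative_compose[OF qd \<theta>1_deriv[unfolded has_field_derivative_def]])
  have "((\<lambda>x. 2 / N\<^sup>2 * \<theta>1 (q N x) * x $ k) has_derivative
      (\<lambda>v. 2 / N\<^sup>2 * \<theta>1 (q N x) * v $ k + 2 / N\<^sup>2 * (\<theta>2 (q N x) * (2 / N\<^sup>2 * (x \<bullet> v))) * x $ k)) (at x)"
    by (intro has_derivative_mult has_derivative_mult_right d1 nth)
  then show "((\<lambda>x. gbump N x $ k) has_derivative (\<lambda>v. hbump N k x \<bullet> v)) (at x)"
    unfolding gbump_def hbump_def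
    by (simp add: inner_add_left inner_axis' mult_ac) (simp add: add.commute mult_ac)?
  show "continuous_on UNIV (hbump N k)"
  proof -
    have c1: "continuous_on UNIV \<theta>1" using \<theta>1_deriv DERIV_continuous_on by blast
    show ?thesis unfolding hbump_def[abs_def]
      by (intro continuous_intros continuous_on_compose2[OF \<theta>2_cont cq] continuous_on_compose2[OF c1 cq]) auto
  qed
  fix j
  show "hbump N j x $ k = hbump N k x $ j"
    by (simp add: hbump_def axis_def)
  show "2 * N \<le> \<bar>x $ 1\<bar> \<or> 2 * N \<le> \<bar>x $ 2\<bar> \<Longrightarrow> bump N x = 0 \<and> gbump N x = 0 \<and> hbump N k x = 0"
    using q_outside[OF N, of x] \<theta>_outer[of "q N x"] by (simp add: bump_def gbump_def hbump_def)
qed (use N in simp)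

lemma B_nonneg: "B \<ge> 0" using \<theta>1_bound[of 0] by linarith

text \<open>Where the gradient is nonzero the coordinates are at most (3/2) N, while it carries a
  factor x / N^2. The second bound is free of N: a coordinate times the gradient is scale invariant,
  which supplies the dominating function for the multiplier x_l.\<close>

lemma gbump_bound:
  assumes N: "N > 0"
  shows "\<bar>gbump N x $ j\<bar> \<le> 3 * B / N" "\<bar>x $ l * gbump N x $ j\<bar> \<le> 3 * B"
proof -
  have q0: "q N x \<ge> 0" by (simp add: q_def)
  have sq: "(x $ i)\<^sup>2 \<le> x \<bullet> x" for i
    using exhaust_2[of i] by (auto simp: inner_R2 power2_eq_square)
  have both: "\<bar>gbump N x $ j\<bar> \<le> 3 * B / N \<and> \<bar>x $ l * gbump N x $ j\<bar> \<le> 3 * B"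
  proof (cases "q N x \<le> 3 / 2")
    case True
    then have xx: "x \<bullet> x \<le> 3 / 2 * N\<^sup>2" using N by (simp add: q_def field_simps)
    have xi: "\<bar>x $ i\<bar> \<le> 3 / 2 * N" for i
    proof -
      have "(x $ i)\<^sup>2 \<le> 3 / 2 * N\<^sup>2" using sq[of i] xx by simp
      also have "\<dots> \<le> (3 / 2 * N)\<^sup>2"
        unfolding power_mult_distrib by (intro mult_right_mono) (auto simp: power2_eq_square)
      finally have "(x $ i)\<^sup>2 \<le> (3 / 2 * N)\<^sup>2" .
      then show ?thesis using N abs_le_square_iff[of "x $ i" "3 / 2 * N"] by simp
    qed
    have xij: "\<bar>x $ l * x $ j\<bar> \<le> 3 / 2 * N\<^sup>2"
    proof -
      have "2 * (\<bar>x $ l\<bar> * \<bar>x $ j\<bar>) \<le> (x $ l)\<^sup>2 + (x $ j)\<^sup>2"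
        using sum_squares_bound[of "\<bar>x $ l\<bar>" "\<bar>x $ j\<bar>"] by simp
      then show ?thesis using sq[of l] sq[of j] xx by (simp add: abs_mult)
    qed
    have "\<bar>gbump N x $ j\<bar> = 2 / N\<^sup>2 * (\<bar>\<theta>1 (q N x)\<bar> * \<bar>x $ j\<bar>)" by (simp add: gbump_def abs_mult)
    also have "\<dots> \<le> 2 / N\<^sup>2 * (B * (3 / 2 * N))"
      by (intro mult_left_mono mult_mono \<theta>1_bound xi B_nonneg) auto
    also have "\<dots> = 3 * B / N" using N by (simp add: power2_eq_square)
    finally have 1: "\<bar>gbump N x $ j\<bar> \<le> 3 * B / N" .
    have "\<bar>x $ l * gbump N x $ j\<bar> = 2 / N\<^sup>2 * (\<bar>\<theta>1 (q N x)\<bar> * \<bar>x $ l * x $ j\<bar>)" by (simp add: gbump_def abs_mult)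
    also have "\<dots> \<le> 2 / N\<^sup>2 * (B * (3 / 2 * N\<^sup>2))"
      by (intro mult_left_mono mult_mono \<theta>1_bound xij B_nonneg) auto
    also have "\<dots> = 3 * B" using N by (simp add: power2_eq_square)
    finally show ?thesis using 1 by blast
  next
    case False
    then have "gbump N x = 0" using \<theta>_outer[of "q N x"] q0 by (simp add: gbump_def)
    then show ?thesis using B_nonneg N by simp
  qed
  then show "\<bar>gbump N x $ j\<bar> \<le> 3 * B / N" "\<bar>x $ l * gbump N x $ j\<bar> \<le> 3 * B" by blast+
qed

text \<open>Pointwise limits become trivial: at a fixed point the bumps are eventually equal to 1
  with gradient 0.\<close>

lemma eventually_q_small: "\<forall>\<^sub>F n in sequentially. \<bar>q (real (Suc n)) x\<bar> < 5 / 4"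
proof -
  have "(\<lambda>n. (x \<bullet> x) * ((1 / real (Suc n)) * (1 / real (Suc n)))) \<longlonglongrightarrow> (x \<bullet> x) * (0 * 0)"
    using lim_inverse_n' LIMSEQ_Suc[OF lim_inverse_n'] by (intro tendsto_intros) simp_all
  then have "(\<lambda>n. q (real (Suc n)) x) \<longlonglongrightarrow> 0" by (simp add: q_def power2_eq_square)
  from tendsto_rabs[OF this] have "(\<lambda>n. \<bar>q (real (Suc n)) x\<bar>) \<longlonglongrightarrow> 0" by simp
  from order_tendstoD(2)[OF this, of "5/4"] show ?thesis by simp
qed

lemma bump_inner: "\<bar>q N x\<bar> < 5 / 4 \<Longrightarrow> bump N x = 1 \<and> gbump N x = 0"
  using \<theta>_inner by (simp add: bump_def gbump_def)

end

subsection \<open>Integrability\<close>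

text \<open>Version with one-sided derivatives for vertical segments of a closed column, where D is
  continuous up to both ends.\<close>

lemma increment_square_le_continuous:
  fixes f f' :: "real \<Rightarrow> real"
  assumes ab: "a \<le> b" and der: "\<And>x. x \<in> {a..b} \<Longrightarrow> (f has_vector_derivative f' x) (at x within {a..b})"
    and c: "continuous_on {a..b} f'"
  shows "(f b - f a)\<^sup>2 \<le> (b - a) * integral {a..b} (\<lambda>x. (f' x)\<^sup>2)"
proof (cases "a = b")
  case False
  then have T: "b - a > 0" using ab by simp
  define k where "k = (f b - f a) / (b - a)"
  have i: "integral {a..b} f' = f b - f a"
    using fundamental_theorem_of_calculus[OF ab der] by (rule integral_unique)
  have i1: "f' integrable_on {a..b}" and i2: "(\<lambda>x. (f' x)\<^sup>2) integrable_on {a..b}"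
    using c by (auto intro!: integrable_continuous_real continuous_intros)
  have "0 \<le> integral {a..b} (\<lambda>x. (f' x - k)\<^sup>2)"
    using c by (intro integral_nonneg integrable_continuous_real continuous_intros) auto
  also have "(\<lambda>x. (f' x - k)\<^sup>2) = (\<lambda>x. (f' x)\<^sup>2 - (2 * k * f' x - k\<^sup>2))"
    by (simp add: fun_eq_iff power2_diff)
  also have "integral {a..b} \<dots> = integral {a..b} (\<lambda>x. (f' x)\<^sup>2) - (2 * k * (f b - f a) - k\<^sup>2 * (b - a))"
  proof -
    have 1: "((\<lambda>x. 2 * k * f' x) has_integral 2 * k * (f b - f a)) {a..b}"
      using integrable_integral[OF i1] unfolding i by (rule has_integral_mult_right)
    have 2: "((\<lambda>x. k\<^sup>2) has_integral k\<^sup>2 * (b - a)) {a..b}"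
      using has_integral_const_real[of "k\<^sup>2" a b] ab by (simp add: mult.commute)
    show ?thesis
      by (rule integral_unique[OF has_integral_diff[OF integrable_integral[OF i2] has_integral_diff[OF 1 2]]])
  qed
  finally have "2 * k * (f b - f a) - k\<^sup>2 * (b - a) \<le> integral {a..b} (\<lambda>x. (f' x)\<^sup>2)" by simp
  moreover have "2 * k * (f b - f a) - k\<^sup>2 * (b - a) = (f b - f a)\<^sup>2 / (b - a)"
  proof -
    have "2 * (d / r) * d - (d / r)\<^sup>2 * r = d\<^sup>2 / r" if "r > 0" for d r :: real
      using that by (simp add: power2_eq_square)
    then show ?thesis using T unfolding k_def by blast
  qed
  ultimately have "(f b - f a)\<^sup>2 / (b - a) \<le> integral {a..b} (\<lambda>x. (f' x)\<^sup>2)" by linarith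
  then show ?thesis using T by (simp only: pos_divide_le_eq mult.commute)
qed simp

lemma young_ineq:
  fixes a b d :: real assumes "d > 0"
  shows "\<bar>a\<bar> * \<bar>b\<bar> \<le> d * a\<^sup>2 + b\<^sup>2 / d"
proof -
  have "0 \<le> (d * \<bar>a\<bar> - \<bar>b\<bar>)\<^sup>2 / d" using assms by simp
  also have "\<dots> = d * a\<^sup>2 + b\<^sup>2 / d - 2 * (\<bar>a\<bar> * \<bar>b\<bar>)"
    using assms by (simp add: power2_eq_square field_simps)
  finally show ?thesis using mult_nonneg_nonneg[of "\<bar>a\<bar>" "\<bar>b\<bar>"] by linarith
qed

context steady_wave
begin

text \<open>Bridge between the gauge integral behind \<open>column\<close> and the Lebesgue integral
  in which the finite energy is stated.\<close>

lemma nn_integral_slice: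
  assumes "continuous_on (fluid_domain h) g" "\<And>p. p \<in> fluid_domain h \<Longrightarrow> 0 \<le> g p"
  shows "(\<integral>\<^sup>+y. ennreal (indicator (fluid_domain h) (x, y) *\<^sub>R g (x, y)) \<partial>lborel) = ennreal (column g x)"
proof (rule nn_integral_has_integral_lborel)
  have "(\<lambda>p. indicator (fluid_domain h) p *\<^sub>R g p) \<in> borel_measurable borel"
    by (rule borel_measurable_continuous_on_indicator[OF _ assms(1)]) (use closed_fluid_domain in auto)
  then have "(\<lambda>y. indicator (fluid_domain h) (x, y) *\<^sub>R g (x, y)) \<in> borel_measurable borel"
    by (rule measurable_compose[rotated]) (auto intro!: borel_measurable_continuous_onI continuous_intros)
  then show "(\<lambda>y. indicator (fluid_domain h) (x, y) *\<^sub>R g (x, y)) \<in> borel_measurable borel" .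
  show "0 \<le> indicator (fluid_domain h) (x, y) *\<^sub>R g (x, y)" for y
    using assms(2) by (auto simp: indicator_def)
  have "((\<lambda>y. g (x, y)) has_integral column g x) {- 1..h x}"
    unfolding column_def using slice_integrable[OF assms(1)] by (rule integrable_integral)
  then have "((\<lambda>y. if y \<in> {- 1..h x} then g (x, y) else 0) has_integral column g x) UNIV"
    by (subst has_integral_restrict_UNIV)
  moreover have "(\<lambda>y. if y \<in> {- 1..h x} then g (x, y) else 0) = (\<lambda>y. indicator (fluid_domain h) (x, y) *\<^sub>R g (x, y))"
    by (auto simp: fun_eq_iff indicator_def fluid_domain_iff)
  ultimately show "((\<lambda>y. indicator (fluid_domain h) (x, y) *\<^sub>R g (x, y)) has_integral column g x) UNIV" by simp
qed

lemma cont_kinetic: "continuous_on S kinetic"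
  unfolding kinetic_def[abs_def] by (intro continuous_intros cont_E cont_Ev)

lemma Ev_nonneg: "0 \<le> Ev x" unfolding Ev_def by (intro column_nonneg continuous_intros cont_D) auto

lemma E_diag_nonneg: "0 \<le> E k k x" unfolding E_def by (intro column_nonneg continuous_intros cont_D) auto

lemma kinetic_nonneg: "0 \<le> kinetic x"
  unfolding kinetic_def using Ev_nonneg E_diag_nonneg by (simp add: add_nonneg_nonneg)

text \<open>Tonelli identifies the plane integral of the column energies with the Dirichlet energy
  of the potential, which is finite.\<close>

lemma integrable_kinetic: "integrable lborel kinetic"
proof (rule integrableI_nonneg)
  show "kinetic \<in> borel_measurable lborel" using borel_measurable_continuous_onI[OF cont_kinetic] by simp
  show "AE x in lborel. 0 \<le> kinetic x" using kinetic_nonneg by simp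
  let ?f = "\<lambda>p. ennreal (indicator (fluid_domain h) p *\<^sub>R (norm (D p))\<^sup>2)"
  have c: "continuous_on (fluid_domain h) (\<lambda>p. (norm (D p))\<^sup>2)" by (intro continuous_intros cont_D)
  have m: "?f \<in> borel_measurable (lborel \<Otimes>\<^sub>M lborel)"
    unfolding lborel_prod
    using borel_measurable_continuous_on_indicator[OF _ c] closed_fluid_domain by simp
  have "(\<integral>\<^sup>+x. ennreal (kinetic x) \<partial>lborel) = (\<integral>\<^sup>+x. \<integral>\<^sup>+y. ?f (x, y) \<partial>lborel \<partial>lborel)"
    unfolding kinetic_eq using nn_integral_slice[OF c] by simp
  also have "\<dots> = (\<integral>\<^sup>+p. ?f p \<partial>(lborel \<Otimes>\<^sub>M lborel))" by (rule lborel.nn_integral_fst[OF m])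
  also have "\<dots> = (\<integral>\<^sup>+p\<in>fluid_domain h. ennreal ((norm (D p))\<^sup>2) \<partial>lborel)"
    unfolding lborel_prod by (intro nn_integral_cong) (auto simp: indicator_def)
  finally show "(\<integral>\<^sup>+x. ennreal (kinetic x) \<partial>lborel) < \<infinity>" using energy by simp
qed

lemma integrable_le_kinetic:
  assumes "continuous_on UNIV f" "\<And>x. \<bar>f x\<bar> \<le> kinetic x"
  shows "integrable lborel f"
  using integrable_kinetic
proof (rule Bochner_Integration.integrable_bound)
  show "f \<in> borel_measurable lborel" using borel_measurable_continuous_onI[OF assms(1)] by simp
  show "AE x in lborel. norm (f x) \<le> norm (kinetic x)" using assms(2) kinetic_nonneg by (intro AE_I2) auto
qed

lemma integrable_Ev: "integrable lborel Ev"
  using Ev_nonneg E_diag_nonneg by (intro integrable_le_kinetic cont_Ev) (simp add: kinetic_def)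

lemma E_bound: "\<bar>E k l x\<bar> \<le> kinetic x"
proof -
  have p: "\<bar>fst d $ k * fst d $ l\<bar> \<le> (norm d)\<^sup>2" for d :: "R2 \<times> real"
  proof -
    have "\<bar>fst d $ k\<bar> \<le> norm d" "\<bar>fst d $ l\<bar> \<le> norm d"
      using component_le_norm_cart norm_fst_component_le order_trans by blast+
    then show ?thesis unfolding abs_mult power2_eq_square by (intro mult_mono) auto
  qed
  have c: "continuous_on (fluid_domain h) (\<lambda>p. fst (D p) $ k * fst (D p) $ l)"
    "continuous_on (fluid_domain h) (\<lambda>p. (norm (D p))\<^sup>2)" by (intro continuous_intros cont_D)+
  have "E k l x \<le> kinetic x" unfolding E_def kinetic_eq
    by (intro column_mono c) (use p in \<open>auto simp: abs_le_iff\<close>)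
  moreover have "- E k l x \<le> kinetic x"
  proof -
    have "column (\<lambda>p. - (fst (D p) $ k * fst (D p) $ l)) x \<le> kinetic x" unfolding kinetic_eq
      by (intro column_mono c continuous_intros) (use p in \<open>auto simp: abs_le_iff\<close>)
    then show ?thesis by (simp add: E_def column_def)
  qed
  ultimately show ?thesis by simp
qed

lemma integrable_E: "integrable lborel (E k l)"
  by (intro integrable_le_kinetic cont_E E_bound)

lemma h_measurable: "h \<in> borel_measurable borel"
  by (intro borel_measurable_continuous_onI cont_h)

lemma integrable_h_g\<psi>: "integrable lborel (\<lambda>x. h x * g\<psi> x $ k)"
  using h_L2 g\<psi>_L2 g\<psi>_measurable h_measurable by (intro integrable_mult_L2) auto

text \<open>The estimate c . D \<le> (|c|^2 + |D|^2) / 2 cancels the kinetic term in Bernoulli's law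
  and leaves h \<le> |c|^2 / 2. It gives the columns a uniform height, on which the control of the
  potential by its trace depends.\<close>

lemma h_upper: "h x + 1 \<le> (norm c)\<^sup>2 / 2 + 1"
proof -
  let ?a = "D (x, h x)"
  have "c \<bullet> fst ?a \<le> norm c * norm (fst ?a)" by (rule norm_cauchy_schwarz)
  also have "\<dots> \<le> norm c * norm ?a" by (intro mult_left_mono norm_fst_component_le) auto
  also have "\<dots> \<le> ((norm c)\<^sup>2 + (norm ?a)\<^sup>2) / 2" using sum_squares_bound[of "norm c" "norm ?a"] by simp
  finally show ?thesis using bernoulli[of x] by (simp add: add_divide_distrib)
qed

text \<open>Cauchy-Schwarz along the vertical segment from the point up to the surface, where \<phi>
  equals \<psi>.\<close>

lemma potential_trace_bound:
  assumes "- 1 \<le> y" "y \<le> h x"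
  shows "(\<psi> x - \<phi> (x, y))\<^sup>2 \<le> (h x + 1) * Ev x"
proof -
  have c: "continuous_on {- 1..h x} (\<lambda>y. snd (D (x, y)))"
    using cont_slice[of "\<lambda>p. snd (D p)"] by (simp add: continuous_intros cont_D)
  have c': "continuous_on {y..h x} (\<lambda>y. snd (D (x, y)))" using c assms by (auto elim: continuous_on_subset)
  have "(\<phi> (x, h x) - \<phi> (x, y))\<^sup>2 \<le> (h x - y) * integral {y..h x} (\<lambda>y. (snd (D (x, y)))\<^sup>2)"
  proof (rule increment_square_le_continuous[OF assms(2) _ c'])
    fix z assume z: "z \<in> {y..h x}"
    have 1: "((\<lambda>z. (x, z)) has_derivative (\<lambda>s. (0, s))) (at z within {y..h x})"
      by (auto intro!: derivative_eq_intros)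
    have "((\<lambda>z. \<phi> (x, z)) has_derivative (\<lambda>s. D (x, z) \<bullet> (0, s))) (at z within {y..h x})"
      by (rule has_derivative_in_compose2[OF \<phi>_deriv _ z 1]) (use assms in \<open>auto simp: fluid_domain_iff\<close>)
    then show "((\<lambda>z. \<phi> (x, z)) has_vector_derivative snd (D (x, z))) (at z within {y..h x})"
      by (simp add: has_vector_derivative_def inner_prod_def mult.commute)
  qed
  also have "\<dots> \<le> (h x + 1) * Ev x"
  proof (rule mult_mono)
    show "integral {y..h x} (\<lambda>y. (snd (D (x, y)))\<^sup>2) \<le> Ev x"
      unfolding Ev_def column_def
    proof (rule integral_subset_le)
      show "(\<lambda>y. (snd (D (x, y)))\<^sup>2) integrable_on {y..h x}"
        by (intro integrable_continuous_real continuous_on_power c')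
      show "(\<lambda>y. (snd (D (x, y)))\<^sup>2) integrable_on {- 1..h x}"
        by (intro integrable_continuous_real continuous_on_power c)
    qed (use assms in auto)
    show "0 \<le> integral {y..h x} (\<lambda>y. (snd (D (x, y)))\<^sup>2)"
      by (intro integral_nonneg integrable_continuous_real continuous_on_power c') auto
  qed (use assms in auto)
  finally show ?thesis by (simp add: trace)
qed

text \<open>Transfers a Poincare bound from the trace \<psi> to the potential inside the fluid; the
  price is a multiple of the integrable function \<open>Ev\<close>.\<close>

lemma column_potential_square_le:
  "column (\<lambda>p. (\<phi> p - m)\<^sup>2) x \<le> 2 * (h x + 1)\<^sup>2 * Ev x + 2 * (h x + 1) * (\<psi> x - m)\<^sup>2"
proof -
  have "column (\<lambda>p. (\<phi> p - m)\<^sup>2) x \<le> column (\<lambda>p. 2 * ((h x + 1) * Ev x) + 2 * (\<psi> x - m)\<^sup>2) x"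
  proof (rule column_mono)
    fix y assume y: "- 1 \<le> y" "y \<le> h x"
    have "(a - m)\<^sup>2 \<le> 2 * (b - a)\<^sup>2 + 2 * (b - m)\<^sup>2" for a b :: real
      using zero_le_power2[of "a + m - 2 * b"] by (simp add: power2_eq_square algebra_simps)
    from this[of "\<phi> (x, y)" "\<psi> x"] potential_trace_bound[OF y]
    show "(\<phi> (x, y) - m)\<^sup>2 \<le> 2 * ((h x + 1) * Ev x) + 2 * (\<psi> x - m)\<^sup>2" by linarith
  qed (intro continuous_intros cont_\<phi>)+
  also have "\<dots> = 2 * (h x + 1)\<^sup>2 * Ev x + 2 * (h x + 1) * (\<psi> x - m)\<^sup>2"
    by (simp add: column_const power2_eq_square algebra_simps)
  finally show ?thesis .
qed

end

subsection \<open>Passage to the limit\<close>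

locale bumped_wave = steady_wave h gh \<psi> g\<psi> \<phi> D c + smooth_bump \<theta> \<theta>1 \<theta>2 B
  for h gh \<psi> g\<psi> \<phi> D c \<theta> \<theta>1 \<theta>2 B
begin

definition V :: real where "V = (LINT x|lborel. (h x)\<^sup>2)"
definition Q :: "2 \<Rightarrow> real" where "Q k = (LINT x|lborel. h x * g\<psi> x $ k)"
definition EE :: "2 \<Rightarrow> 2 \<Rightarrow> real" where "EE k l = (LINT x|lborel. E k l x)"
definition EEv :: real where "EEv = (LINT x|lborel. Ev x)"
definition K :: real where "K = (LINT x|lborel. kinetic x)"

lemma K_eq: "K = EE 1 1 + EE 2 2 + EEv"
  unfolding K_def EE_def EEv_def kinetic_def using integrable_E integrable_Ev by simp

lemma bump_abs_le: "\<bar>bump N x\<bar> \<le> 1"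
  using \<theta>_range[of "q N x"] by (simp add: bump_def)

text \<open>The multiplier is x_l times a bump. Its gradient has components bounded by 1 + 3 B for
  all radii and tends to the l-th unit vector, while the coefficients \<open>a\<close> and
  \<open>b\<close> are integrable, so dominated convergence applies.\<close>

lemma pohozaev_limit:
  "EE k l - c $ l * Q k + (if k = l then c $ 1 * Q 1 + c $ 2 * Q 2 - K / 2 - V / 2 else 0) = 0"
proof -
  define a where "a j x = E k j x - c $ j * (h x * g\<psi> x $ k)" for j x
  define b where "b x = h x * (c \<bullet> g\<psi> x) - kinetic x / 2 - (h x)\<^sup>2 / 2" for x
  define G where "G N x = bump N x *\<^sub>R axis l 1 + x $ l *\<^sub>R gbump N x" for N x
  define s where "s n x = (\<Sum>j\<in>UNIV. G (real (Suc n)) x $ j * a j x) + G (real (Suc n)) x $ k * b x" for n x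
  define f where "f x = a l x + (if k = l then 1 else 0) * b x" for x
  have ia: "integrable lborel (a j)" for j
    unfolding a_def using integrable_E integrable_h_g\<psi> by simp
  have b_eq: "b = (\<lambda>x. c $ 1 * (h x * g\<psi> x $ 1) + c $ 2 * (h x * g\<psi> x $ 2) - kinetic x / 2 - (h x)\<^sup>2 / 2)"
    by (simp add: b_def fun_eq_iff inner_R2 algebra_simps)
  have ib: "integrable lborel b"
    unfolding b_eq using integrable_h_g\<psi> integrable_kinetic h_L2 by simp
  have Gb: "\<bar>G N x $ j\<bar> \<le> 1 + 3 * B" if "N > 0" for N x j
  proof -
    have "\<bar>bump N x * axis l 1 $ j\<bar> \<le> 1" using bump_abs_le[of N x] by (simp add: axis_def)
    moreover have "\<bar>x $ l * gbump N x $ j\<bar> \<le> 3 * B" by (rule gbump_bound[OF that])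
    ultimately show ?thesis by (simp add: G_def)
  qed
  have z: "(LINT x|lborel. s n x) = 0" for n
  proof -
    interpret test_function "bump (real (Suc n))" "gbump (real (Suc n))" "hbump (real (Suc n))" "2 * real (Suc n)"
      by (rule test_function_bump) simp
    interpret T: test_function "\<lambda>x. x $ l * bump (real (Suc n)) x" "G (real (Suc n))"
      "\<lambda>k x. axis l 1 $ k *\<^sub>R gbump (real (Suc n)) x + gbump (real (Suc n)) x $ k *\<^sub>R axis l 1 + x $ l *\<^sub>R hbump (real (Suc n)) k x"
      "2 * real (Suc n)"
      unfolding G_def by (rule test_function_coord_mult) unfold_locales
    interpret tested_wave h gh \<psi> g\<psi> \<phi> D c "\<lambda>x. x $ l * bump (real (Suc n)) x" "G (real (Suc n))"
      "\<lambda>k x. axis l 1 $ k *\<^sub>R gbump (real (Suc n)) x + gbump (real (Suc n)) x $ k *\<^sub>R axis l 1 + x $ l *\<^sub>R hbump (real (Suc n)) k x"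
      "2 * real (Suc n)"
      by unfold_locales
    show ?thesis using pohozaev[of k] by (simp only: s_def a_def b_def)
  qed
  have Gm: "(\<lambda>x. G (real (Suc n)) x $ j) \<in> borel_measurable borel" for n j
  proof -
    interpret test_function "bump (real (Suc n))" "gbump (real (Suc n))" "hbump (real (Suc n))" "2 * real (Suc n)"
      by (rule test_function_bump) simp
    show ?thesis unfolding G_def
      by (intro borel_measurable_continuous_onI continuous_intros cont_\<eta> cont_g\<eta>)
  qed
  have "(\<lambda>n. LINT x|lborel. s n x) \<longlonglongrightarrow> (LINT x|lborel. f x)"
  proof (rule integral_dominated_convergence[where w="\<lambda>x. (1 + 3 * B) * (\<bar>a 1 x\<bar> + \<bar>a 2 x\<bar> + \<bar>b x\<bar>)"])
    show "f \<in> borel_measurable lborel" unfolding f_def using ia ib by auto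
    show "s n \<in> borel_measurable lborel" for n
      unfolding s_def using ia ib Gm[of n, measurable] by (simp add: sum_2)
    show "integrable lborel (\<lambda>x. (1 + 3 * B) * (\<bar>a 1 x\<bar> + \<bar>a 2 x\<bar> + \<bar>b x\<bar>))" using ia ib by simp
    show "AE x in lborel. (\<lambda>n. s n x) \<longlonglongrightarrow> f x"
    proof (rule AE_I2)
      fix x
      have "\<forall>\<^sub>F n in sequentially. s n x = f x"
        using eventually_q_small[of x]
      proof eventually_elim
        case (elim n)
        then have "G (real (Suc n)) x = axis l 1" using bump_inner by (simp add: G_def)
        then show ?case unfolding s_def f_def using exhaust_2[of l] exhaust_2[of k] by (auto simp: sum_2 axis_def)
      qed
      then show "(\<lambda>n. s n x) \<longlonglongrightarrow> f x" by (rule tendsto_eventually)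
    qed
    show "AE x in lborel. norm (s n x) \<le> (1 + 3 * B) * (\<bar>a 1 x\<bar> + \<bar>a 2 x\<bar> + \<bar>b x\<bar>)" for n
    proof (rule AE_I2)
      fix x
      have g: "\<bar>G (real (Suc n)) x $ j * t\<bar> \<le> (1 + 3 * B) * \<bar>t\<bar>" for j t
        unfolding abs_mult by (intro mult_right_mono Gb) auto
      have "\<bar>s n x\<bar> \<le> \<bar>G (real (Suc n)) x $ 1 * a 1 x\<bar> + \<bar>G (real (Suc n)) x $ 2 * a 2 x\<bar> + \<bar>G (real (Suc n)) x $ k * b x\<bar>"
        unfolding s_def sum_2 by linarith
      also have "\<dots> \<le> (1 + 3 * B) * \<bar>a 1 x\<bar> + (1 + 3 * B) * \<bar>a 2 x\<bar> + (1 + 3 * B) * \<bar>b x\<bar>"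
        by (intro add_mono g)
      finally show "norm (s n x) \<le> (1 + 3 * B) * (\<bar>a 1 x\<bar> + \<bar>a 2 x\<bar> + \<bar>b x\<bar>)"
        by (simp add: distrib_left)
    qed
  qed
  then have f0: "(LINT x|lborel. f x) = 0" by (simp add: z LIMSEQ_const_iff)
  have Ia: "(LINT x|lborel. a l x) = EE k l - c $ l * Q k"
    unfolding a_def EE_def Q_def using integrable_E integrable_h_g\<psi> by simp
  have Ib: "(LINT x|lborel. b x) = c $ 1 * Q 1 + c $ 2 * Q 2 - K / 2 - V / 2"
    unfolding b_eq Q_def K_def V_def using integrable_h_g\<psi> integrable_kinetic h_L2 by simp
  show ?thesis using f0 ia ib Ia Ib unfolding f_def by (cases "k = l") simp_all
qed

text \<open>The bump itself is the multiplier. The main term tends to K - c . Q by dominated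
  convergence. In the remainder the gradient of the bump is O(1/N), while \<phi> minus a constant
  has L^2 norm O(N) on the square by the Poincare inequality: an exact balance. Smallness comes from
  the other factors, D and h, restricted to the receding region where the gradient of the bump
  lives.\<close>

lemma energy_limit: "K = c $ 1 * Q 1 + c $ 2 * Q 2"
proof -
  define b where "b x = kinetic x - h x * (c \<bullet> g\<psi> x)" for x
  have b_eq: "b = (\<lambda>x. kinetic x - (c $ 1 * (h x * g\<psi> x $ 1) + c $ 2 * (h x * g\<psi> x $ 2)))"
    by (simp add: b_def fun_eq_iff inner_R2 algebra_simps)
  have ib: "integrable lborel b"
    unfolding b_eq using integrable_h_g\<psi> integrable_kinetic by simp
  have c\<psi>: "continuous_on S \<psi>" for S
    using \<psi>_deriv has_derivative_continuous continuous_at_imp_continuous_on by metis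
  define Gs where "Gs = (LINT x|lborel. (g\<psi> x $ 1)\<^sup>2) + (LINT x|lborel. (g\<psi> x $ 2)\<^sup>2) + 1"
  define N where "N n = real (Suc n)" for n
  have N1: "N n \<ge> 1" "N n > 0" for n by (simp_all add: N_def)
  \<comment> \<open>A separate constant for each radius, as \<psi> is not known to have a limit at
    infinity.\<close>
  have "\<exists>m. \<forall>n. (LINT x|lborel. indicator (square (2 * N n)) x * (\<psi> x - m n)\<^sup>2) \<le> 8 * (2 * N n)\<^sup>2 * Gs"
    unfolding Gs_def by (intro choice allI poincare_square[OF \<psi>_deriv g\<psi>_measurable g\<psi>_L2]) (simp add: N1)
  then obtain m where m: "\<And>n. (LINT x|lborel. indicator (square (2 * N n)) x * (\<psi> x - m n)\<^sup>2) \<le> 8 * (2 * N n)\<^sup>2 * Gs"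
    by blast
  define A where "A n j x = column (\<lambda>p. (\<phi> p - m n) * fst (D p) $ j) x" for n j x
  define Rm where "Rm n x = gbump (N n) x $ 1 * (A n 1 x - c $ 1 * ((\<psi> x - m n) * h x)) +
       gbump (N n) x $ 2 * (A n 2 x - c $ 2 * ((\<psi> x - m n) * h x))" for n x
  have cA: "continuous_on UNIV (A n j)" for n j
    unfolding A_def[abs_def] by (intro continuous_column continuous_intros cont_\<phi> cont_D)
  have bump_meas: "bump (N n) \<in> borel_measurable borel" for n
  proof -
    interpret test_function "bump (N n)" "gbump (N n)" "hbump (N n)" "2 * N n"
      by (rule test_function_bump) (rule N1)
    show ?thesis by (intro borel_measurable_continuous_onI cont_\<eta>)
  qed
  have iR: "integrable lborel (Rm n)" for n
  proof -
    interpret test_function "bump (N n)" "gbump (N n)" "hbump (N n)" "2 * N n"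
      by (rule test_function_bump) (rule N1)
    show ?thesis unfolding Rm_def[abs_def]
      by (rule integrable_square_support[where R="2 * N n"])
         (use supp in \<open>auto intro!: continuous_intros cont_g\<eta>_nth cA c\<psi> cont_h\<close>)
  qed
  have ibb: "integrable lborel (\<lambda>x. bump (N n) x * b x)" for n
  proof (rule Bochner_Integration.integrable_bound[OF ib])
    show "(\<lambda>x. bump (N n) x * b x) \<in> borel_measurable lborel" using bump_meas[of n] ib by auto
    show "AE x in lborel. norm (bump (N n) x * b x) \<le> norm (b x)"
      using bump_abs_le by (intro AE_I2) (simp add: abs_mult mult_left_le_one_le)
  qed
  have balance: "(LINT x|lborel. bump (N n) x * b x) = - (LINT x|lborel. Rm n x)" for n
  proof -
    interpret tested_wave h gh \<psi> g\<psi> \<phi> D c "bump (N n)" "gbump (N n)" "hbump (N n)" "2 * N n"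
      using test_function_bump[OF N1(2)] steady_wave_axioms by (simp add: tested_wave_def)
    have "(LINT x|lborel. bump (N n) x * b x + Rm n x) = 0"
      using energy_balance[of "m n"] by (simp only: b_def Rm_def A_def)
    then show ?thesis using iR[of n] ibb[of n] by simp
  qed
  \<comment> \<open>Off this set the gradient of the bump vanishes; every point eventually leaves
    it, so the tails \<open>\<tau> n\<close> tend to 0.\<close>
  define T where "T n = {x. 5 / 4 \<le> \<bar>q (N n) x\<bar>}" for n
  have T_meas: "T n \<in> sets borel" for n
  proof -
    have "closed (T n)" unfolding T_def q_def
      by (intro closed_Collect_le continuous_intros) (use N1[of n] in auto)
    then show ?thesis by auto
  qed
  define \<tau> where "\<tau> n = (LINT x|lborel. indicator (T n) x * (kinetic x + (h x)\<^sup>2))" for n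
  have ikh: "integrable lborel (\<lambda>x. kinetic x + (h x)\<^sup>2)" using integrable_kinetic h_L2 by simp
  have i\<tau>: "integrable lborel (\<lambda>x. indicator (T n) x * (kinetic x + (h x)\<^sup>2))" for n
    using integrable_mult_indicator[OF _ ikh, of "T n"] T_meas by simp
  have \<tau>0: "\<tau> \<longlonglongrightarrow> 0"
  proof -
    have "(\<lambda>n. LINT x|lborel. indicator (T n) x * (kinetic x + (h x)\<^sup>2)) \<longlonglongrightarrow> (LINT x|(lborel :: R2 measure). 0)"
    proof (rule integral_dominated_convergence[where w="\<lambda>x. kinetic x + (h x)\<^sup>2"])
      show "AE x in lborel. (\<lambda>n. indicator (T n) x * (kinetic x + (h x)\<^sup>2)) \<longlonglongrightarrow> 0"
      proof (rule AE_I2)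
        fix x
        have "\<forall>\<^sub>F n in sequentially. indicator (T n) x * (kinetic x + (h x)\<^sup>2) = 0"
          using eventually_q_small[of x] by eventually_elim (simp add: T_def N_def)
        then show "(\<lambda>n. indicator (T n) x * (kinetic x + (h x)\<^sup>2)) \<longlonglongrightarrow> 0" by (rule tendsto_eventually)
      qed
      show "AE x in lborel. norm (indicator (T n) x * (kinetic x + (h x)\<^sup>2)) \<le> kinetic x + (h x)\<^sup>2" for n
        using kinetic_nonneg by (intro AE_I2) (auto simp: indicator_def)
    qed (use ikh i\<tau> in auto)
    then show ?thesis by (simp add: \<tau>_def[abs_def])
  qed
  define b0 C1 where "b0 = (norm c)\<^sup>2 / 2 + 1" and "C1 = \<bar>c $ 1\<bar> + \<bar>c $ 2\<bar>"
  have b0: "b0 \<ge> 1" "0 \<le> h x + 1" "h x + 1 \<le> b0" for x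
    using h_upper[of x] h_gt[of x] by (simp_all add: b0_def)
  \<comment> \<open>The bracket dominates the coefficients that arise below:
    \<open>4 * b0\<^sup>2\<close> of \<open>Ev\<close>, \<open>4 * b0 + C1\<close> of the Poincare
    term, 2 of the kinetic energy and \<open>C1\<close> of h^2. The factor 3 B stems from the
    gradient of the bump.\<close>
  define K2 where "K2 = 3 * B * (4 * b0\<^sup>2 + 4 * b0 + 2 + C1)"
  have C1: "C1 \<ge> 0" by (simp add: C1_def)
  have K2: "K2 \<ge> 0" using B_nonneg b0(1) C1 by (simp add: K2_def)
  \<comment> \<open>Young's inequality with weight \<open>d\<close>: the Poincare term is bounded but does not vanish with \<open>N\<close>,
    the term carried by \<open>T n\<close> does; \<open>d\<close> tends to \<open>0\<close> after \<open>n\<close> has tended to infinity.\<close>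
  have pw: "\<bar>Rm n x\<bar> \<le> K2 * (d * (Ev x + indicator (square (2 * N n)) x * (\<psi> x - m n)\<^sup>2 / (N n)\<^sup>2) +
      indicator (T n) x * (kinetic x + (h x)\<^sup>2) / d)" if d: "d > 0" for n x d
  proof (cases "gbump (N n) x = 0")
    case True
    then show ?thesis using K2 d Ev_nonneg[of x] kinetic_nonneg[of x] by (simp add: Rm_def)
  next
    case False
    then have T: "x \<in> T n" using bump_inner[of "N n" x] by (force simp: T_def)
    have S: "x \<in> square (2 * N n)"
    proof (rule ccontr)
      assume "x \<notin> square (2 * N n)"
      then have "2 * N n \<le> \<bar>x $ 1\<bar> \<or> 2 * N n \<le> \<bar>x $ 2\<bar>" by auto
      from q_outside[OF N1(2) this] have "gbump (N n) x = 0" using \<theta>_outer by (simp add: gbump_def)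
      then show False using False by simp
    qed
    define P where "P = (\<psi> x - m n)\<^sup>2 / (N n)\<^sup>2"
    define M0 where "M0 = N n"
    have M0: "M0 \<ge> 1" "M0 > 0" unfolding M0_def by (rule N1)+
    have P: "P \<ge> 0" "(\<psi> x - m n)\<^sup>2 = M0\<^sup>2 * P" using M0 by (simp_all add: P_def M0_def[symmetric])
    define co where "co = column (\<lambda>p. (\<phi> p - m n)\<^sup>2) x"
    have cc: "continuous_on (fluid_domain h) (\<lambda>p. (\<phi> p - m n) * fst (D p) $ j)"
      "continuous_on (fluid_domain h) (\<lambda>p. (d / M0) * (\<phi> p - m n)\<^sup>2)"
      "continuous_on (fluid_domain h) (\<lambda>p. (M0 / d) * (norm (D p))\<^sup>2)" for j
      by (intro continuous_intros cont_\<phi> cont_D)+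
    have A: "\<bar>A n j x\<bar> \<le> (d / M0) * co + (M0 / d) * kinetic x" for j
    proof -
      have y: "\<bar>(\<phi> p - m n) * fst (D p) $ j\<bar> \<le> (d / M0) * (\<phi> p - m n)\<^sup>2 + (M0 / d) * (norm (D p))\<^sup>2" for p
      proof -
        have "\<bar>\<phi> p - m n\<bar> * \<bar>fst (D p) $ j\<bar> \<le> (d / M0) * (\<phi> p - m n)\<^sup>2 + (fst (D p) $ j)\<^sup>2 / (d / M0)"
          using d M0 by (intro young_ineq) simp
        moreover have "(fst (D p) $ j)\<^sup>2 \<le> (norm (D p))\<^sup>2"
          using component_le_norm_cart[of "fst (D p)" j] norm_fst_component_le[of "D p"]
          by (intro abs_le_square_iff[THEN iffD1]) auto
        then have "(M0 / d) * (fst (D p) $ j)\<^sup>2 \<le> (M0 / d) * (norm (D p))\<^sup>2"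
          using d M0 by (intro mult_left_mono) auto
        ultimately show ?thesis by (simp add: abs_mult mult.commute[of M0])
      qed
      have col: "column (\<lambda>p. (d / M0) * (\<phi> p - m n)\<^sup>2 + (M0 / d) * (norm (D p))\<^sup>2) x = (d / M0) * co + (M0 / d) * kinetic x"
        unfolding column_add[OF cc(2,3)] co_def kinetic_eq
        using column_cmult[of "\<lambda>_. d / M0"] column_cmult[of "\<lambda>_. M0 / d"] by simp
      have "A n j x \<le> (d / M0) * co + (M0 / d) * kinetic x"
        unfolding A_def col[symmetric]
        by (intro column_mono cc continuous_on_add) (use y in \<open>auto simp: abs_le_iff\<close>)
      moreover have "- A n j x \<le> (d / M0) * co + (M0 / d) * kinetic x"
      proof -
        have "column (\<lambda>p. - ((\<phi> p - m n) * fst (D p) $ j)) x \<le> (d / M0) * co + (M0 / d) * kinetic x"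
          unfolding col[symmetric]
          by (intro column_mono cc continuous_on_add continuous_on_minus) (use y in \<open>auto simp: abs_le_iff\<close>)
        then show ?thesis by (simp add: A_def column_def)
      qed
      ultimately show ?thesis by simp
    qed
    have H: "\<bar>(\<psi> x - m n) * h x\<bar> \<le> d * M0 * P + (M0 / d) * (h x)\<^sup>2"
    proof -
      have "\<bar>\<psi> x - m n\<bar> * \<bar>h x\<bar> \<le> (d / M0) * (\<psi> x - m n)\<^sup>2 + (h x)\<^sup>2 / (d / M0)"
        using d M0 by (intro young_ineq) simp
      moreover have "(d / M0) * (\<psi> x - m n)\<^sup>2 = d * M0 * P"
        unfolding P(2) using M0 by (simp add: power2_eq_square)
      moreover have "(h x)\<^sup>2 / (d / M0) = (M0 / d) * (h x)\<^sup>2" by simp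
      ultimately show ?thesis unfolding abs_mult by linarith
    qed
    have co: "co \<le> 2 * b0\<^sup>2 * Ev x + 2 * b0 * (M0\<^sup>2 * P)"
    proof -
      have "co \<le> 2 * (h x + 1)\<^sup>2 * Ev x + 2 * (h x + 1) * (M0\<^sup>2 * P)"
        unfolding co_def P(2)[symmetric] by (rule column_potential_square_le)
      also have "\<dots> \<le> 2 * b0\<^sup>2 * Ev x + 2 * b0 * (M0\<^sup>2 * P)"
        using b0(1) b0(2)[of x] b0(3)[of x] Ev_nonneg[of x] P by (intro add_mono mult_right_mono mult_left_mono power_mono) auto
      finally show ?thesis .
    qed
    \<comment> \<open>Since \<open>M0\<close> is at least 1, the factor 1 / \<open>M0\<close> in
      front of \<open>Ev\<close> may be raised to \<open>M0\<close>, which gives all terms the same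
      power.\<close>
    have co': "d / M0 * co \<le> M0 * (d * (2 * b0\<^sup>2 * Ev x + 2 * b0 * P))"
    proof -
      have "d / M0 * co \<le> d / M0 * (2 * b0\<^sup>2 * Ev x + 2 * b0 * (M0\<^sup>2 * P))"
        using co d M0 by (intro mult_left_mono) auto
      also have "\<dots> = d * (2 * b0\<^sup>2 * Ev x) / M0 + M0 * (d * (2 * b0 * P))"
        using M0 by (simp add: field_simps power2_eq_square)
      also have "d * (2 * b0\<^sup>2 * Ev x) / M0 \<le> M0 * (d * (2 * b0\<^sup>2 * Ev x))"
      proof -
        have nn: "0 \<le> d * (2 * b0\<^sup>2 * Ev x)" using d Ev_nonneg[of x] by simp
        have "d * (2 * b0\<^sup>2 * Ev x) / M0 \<le> d * (2 * b0\<^sup>2 * Ev x) / 1" using M0 nn by (intro divide_left_mono) auto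
        also have "\<dots> \<le> M0 * (d * (2 * b0\<^sup>2 * Ev x))" using M0 nn mult_right_mono[of 1 M0] by simp
        finally show ?thesis .
      qed
      finally show ?thesis by (simp add: algebra_simps)
    qed
    \<comment> \<open>Bounds for the two factors after division by \<open>M0\<close>; the gradient
      of the bump, at most 3 B / \<open>M0\<close>, absorbs precisely that factor.\<close>
    define X Y where "X = d * (2 * b0\<^sup>2 * Ev x + 2 * b0 * P) + kinetic x / d" and "Y = d * P + (h x)\<^sup>2 / d"
    have AX: "\<bar>A n j x\<bar> \<le> M0 * X" for j using A[of j] co' by (simp add: X_def algebra_simps)
    have HY: "\<bar>(\<psi> x - m n) * h x\<bar> \<le> M0 * Y" using H by (simp add: Y_def algebra_simps)
    have t: "\<bar>gbump M0 x $ j * (A n j x - c $ j * ((\<psi> x - m n) * h x))\<bar> \<le> 3 * B * (X + \<bar>c $ j\<bar> * Y)" for j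
    proof -
      have "\<bar>A n j x - c $ j * ((\<psi> x - m n) * h x)\<bar> \<le> \<bar>A n j x\<bar> + \<bar>c $ j * ((\<psi> x - m n) * h x)\<bar>"
        by (rule abs_triangle_ineq4)
      also have "\<dots> \<le> M0 * X + \<bar>c $ j\<bar> * (M0 * Y)"
        unfolding abs_mult[of "c $ j"] by (intro add_mono AX mult_left_mono HY) auto
      finally have 1: "\<bar>A n j x - c $ j * ((\<psi> x - m n) * h x)\<bar> \<le> M0 * (X + \<bar>c $ j\<bar> * Y)" by (simp add: algebra_simps)
      have "\<bar>gbump M0 x $ j * (A n j x - c $ j * ((\<psi> x - m n) * h x))\<bar> \<le> (3 * B / M0) * (M0 * (X + \<bar>c $ j\<bar> * Y))"
        unfolding abs_mult[of "gbump M0 x $ j"]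
        by (intro mult_mono gbump_bound 1) (use M0 B_nonneg in auto)
      also have "\<dots> = 3 * B * (X + \<bar>c $ j\<bar> * Y)" using M0 by simp
      finally show ?thesis .
    qed
    have "\<bar>Rm n x\<bar> \<le> 3 * B * (X + \<bar>c $ 1\<bar> * Y) + 3 * B * (X + \<bar>c $ 2\<bar> * Y)"
      unfolding Rm_def M0_def[symmetric] by (rule order_trans[OF abs_triangle_ineq add_mono[OF t t]])
    also have "\<dots> = 3 * B * (2 * X + C1 * Y)" by (simp add: C1_def algebra_simps)
    also have "\<dots> \<le> 3 * B * ((4 * b0\<^sup>2 + 4 * b0 + 2 + C1) * (d * (Ev x + P) + (kinetic x + (h x)\<^sup>2) / d))"
    proof (intro mult_left_mono)
      define k where "k = 4 * b0\<^sup>2 + 4 * b0 + 2 + C1"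
      have k: "4 * b0\<^sup>2 \<le> k" "4 * b0 + C1 \<le> k" "2 \<le> k" "C1 \<le> k" using b0(1) C1 by (auto simp: k_def)
      have nn: "d * Ev x \<ge> 0" "d * P \<ge> 0" "kinetic x / d \<ge> 0" "(h x)\<^sup>2 / d \<ge> 0"
        using d Ev_nonneg[of x] P kinetic_nonneg[of x] by auto
      have "2 * X + C1 * Y = 4 * b0\<^sup>2 * (d * Ev x) + (4 * b0 + C1) * (d * P) + 2 * (kinetic x / d) + C1 * ((h x)\<^sup>2 / d)"
        by (simp add: X_def Y_def algebra_simps)
      also have "\<dots> \<le> k * (d * Ev x) + k * (d * P) + k * (kinetic x / d) + k * ((h x)\<^sup>2 / d)"
        using k nn by (intro add_mono mult_right_mono) auto
      also have "\<dots> = k * (d * (Ev x + P) + (kinetic x + (h x)\<^sup>2) / d)" by (simp add: algebra_simps add_divide_distrib)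
      finally show "2 * X + C1 * Y \<le> (4 * b0\<^sup>2 + 4 * b0 + 2 + C1) * (d * (Ev x + P) + (kinetic x + (h x)\<^sup>2) / d)"
        by (simp add: k_def)
    qed (use B_nonneg in simp)
    also have "\<dots> = K2 * (d * (Ev x + P) + (kinetic x + (h x)\<^sup>2) / d)" by (simp add: K2_def)
    finally show ?thesis using T S by (simp add: P_def)
  qed
  have iS: "integrable lborel (\<lambda>x. indicator (square (2 * N n)) x * (\<psi> x - m n)\<^sup>2)" for n
  proof -
    have "integrable lborel (\<lambda>x. indicator (square (2 * N n)) x *\<^sub>R (\<psi> x - m n)\<^sup>2)"
      by (intro borel_integrable_compact compact_square continuous_intros c\<psi>)
    then show ?thesis by simp
  qed
  have bound: "\<bar>LINT x|lborel. bump (N n) x * b x\<bar> \<le> K2 * (d * (EEv + 32 * Gs) + \<tau> n / d)" if d: "d > 0" for n d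
  proof -
    have iW: "integrable lborel (\<lambda>x. K2 * (d * (Ev x + indicator (square (2 * N n)) x * (\<psi> x - m n)\<^sup>2 / (N n)\<^sup>2) +
        indicator (T n) x * (kinetic x + (h x)\<^sup>2) / d))"
      using integrable_Ev iS[of n] i\<tau>[of n] by simp
    have "\<bar>LINT x|lborel. bump (N n) x * b x\<bar> = \<bar>LINT x|lborel. Rm n x\<bar>" by (simp add: balance)
    also have "\<dots> \<le> (LINT x|lborel. \<bar>Rm n x\<bar>)" by (rule integral_abs_bound)
    also have "\<dots> \<le> (LINT x|lborel. K2 * (d * (Ev x + indicator (square (2 * N n)) x * (\<psi> x - m n)\<^sup>2 / (N n)\<^sup>2) +
        indicator (T n) x * (kinetic x + (h x)\<^sup>2) / d))"
      using iR[of n] iW pw[OF d] by (intro integral_mono) auto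
    also have "\<dots> = K2 * (d * (EEv + (LINT x|lborel. indicator (square (2 * N n)) x * (\<psi> x - m n)\<^sup>2) / (N n)\<^sup>2) + \<tau> n / d)"
      unfolding EEv_def \<tau>_def using integrable_Ev iS[of n] i\<tau>[of n] by simp
    also have "\<dots> \<le> K2 * (d * (EEv + 32 * Gs) + \<tau> n / d)"
    proof -
      \<comment> \<open>32 = 8 * 2^2: the Poincare inequality on the square of half side 2 N,
        divided by N^2.\<close>
      have "(LINT x|lborel. indicator (square (2 * N n)) x * (\<psi> x - m n)\<^sup>2) / (N n)\<^sup>2 \<le> 32 * Gs"
        using m[of n] N1(2)[of n] by (simp add: pos_divide_le_eq power_mult_distrib mult_ac)
      then show ?thesis using K2 d by (intro mult_left_mono add_right_mono add_left_mono) auto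
    qed
    finally show ?thesis .
  qed
  have lim: "(\<lambda>n. LINT x|lborel. bump (N n) x * b x) \<longlonglongrightarrow> (LINT x|lborel. b x)"
  proof (rule integral_dominated_convergence[where w="\<lambda>x. \<bar>b x\<bar>"])
    show "AE x in lborel. (\<lambda>n. bump (N n) x * b x) \<longlonglongrightarrow> b x"
    proof (rule AE_I2)
      fix x
      have "\<forall>\<^sub>F n in sequentially. bump (N n) x * b x = b x"
        using eventually_q_small[of x] by eventually_elim (simp add: N_def bump_inner)
      then show "(\<lambda>n. bump (N n) x * b x) \<longlonglongrightarrow> b x" by (rule tendsto_eventually)
    qed
    show "AE x in lborel. norm (bump (N n) x * b x) \<le> \<bar>b x\<bar>" for n
      using bump_abs_le by (intro AE_I2) (simp add: abs_mult mult_left_le_one_le)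
  qed (use ib ibb in auto)
  have Lb: "\<bar>LINT x|lborel. b x\<bar> \<le> K2 * (EEv + 32 * Gs) * d" if d: "d > 0" for d
  proof (rule LIMSEQ_le)
    show "(\<lambda>n. \<bar>LINT x|lborel. bump (N n) x * b x\<bar>) \<longlonglongrightarrow> \<bar>LINT x|lborel. b x\<bar>" by (rule tendsto_rabs[OF lim])
    have "(\<lambda>n. K2 * (d * (EEv + 32 * Gs) + \<tau> n / d)) \<longlonglongrightarrow> K2 * (d * (EEv + 32 * Gs) + 0 / d)"
      using d by (intro tendsto_intros \<tau>0) auto
    then show "(\<lambda>n. K2 * (d * (EEv + 32 * Gs) + \<tau> n / d)) \<longlonglongrightarrow> K2 * (EEv + 32 * Gs) * d"
      by (simp add: mult_ac)
    show "\<exists>n0. \<forall>n\<ge>n0. \<bar>LINT x|lborel. bump (N n) x * b x\<bar> \<le> K2 * (d * (EEv + 32 * Gs) + \<tau> n / d)"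
      using bound[OF d] by blast
  qed
  have "\<bar>LINT x|lborel. b x\<bar> \<le> 0"
  proof (rule field_le_epsilon)
    fix e :: real assume e: "e > 0"
    define W where "W = \<bar>K2 * (EEv + 32 * Gs)\<bar> + 1"
    have W: "W > 0" "K2 * (EEv + 32 * Gs) \<le> W" by (auto simp: W_def)
    have "\<bar>LINT x|lborel. b x\<bar> \<le> K2 * (EEv + 32 * Gs) * (e / W)" using e W by (intro Lb) simp
    also have "\<dots> \<le> W * (e / W)" using e W by (intro mult_right_mono) auto
    finally show "\<bar>LINT x|lborel. b x\<bar> \<le> 0 + e" using W by simp
  qed
  then have "(LINT x|lborel. b x) = 0" by simp
  then show ?thesis
    unfolding b_eq K_def Q_def using integrable_kinetic integrable_h_g\<psi> by simp
qed

end

subsection \<open>Triviality of the wave\<close>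

text \<open>The set where a continuous function is nonzero is open, and a nonempty open set is not
  negligible.\<close>

lemma continuous_AE_zero:
  fixes f :: "R2 \<Rightarrow> real"
  assumes c: "continuous_on UNIV f" and ae: "AE x in lborel. f x = 0"
  shows "f x = 0"
proof -
  have "{x. f x \<noteq> 0} = {}"
  proof (rule ccontr)
    assume ne: "{x. f x \<noteq> 0} \<noteq> {}"
    have op: "open {x. f x \<noteq> 0}" using c by (intro open_Collect_neq continuous_intros)
    have "{x. f x \<noteq> 0} \<in> null_sets lborel"
      using ae op AE_iff_null_sets[of "{x. f x \<noteq> 0}" lborel] by auto
    then have "negligible {x. f x \<noteq> 0}"
      unfolding negligible_iff_null_sets by (rule null_sets_completionI)
    then show False using open_not_negligible[OF op ne] by blast
  qed
  then show ?thesis by blast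
qed

lemma continuous_nonneg_integral_zero:
  fixes f :: "R2 \<Rightarrow> real"
  assumes c: "continuous_on UNIV f" and i: "integrable lborel f" and nn: "\<And>x. 0 \<le> f x"
    and z: "(LINT x|lborel. f x) = 0"
  shows "f x = 0"
proof (rule continuous_AE_zero[OF c])
  have "AE x in lborel. 0 \<le> f x" using nn by simp
  from integral_nonneg_eq_0_iff_AE[OF i this] show "AE x in lborel. f x = 0" using z by blast
qed

lemma not_integrable_const_lborel:
  assumes "integrable (lborel :: R2 measure) (\<lambda>x. k :: real)"
  shows "k = 0"
proof (rule ccontr)
  assume "k \<noteq> 0"
  then have "(\<integral>\<^sup>+x. ennreal (norm k) \<partial>(lborel :: R2 measure)) = \<infinity>"
    by (simp add: ennreal_mult_top emeasure_lborel_UNIV)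
  moreover have "(\<integral>\<^sup>+x. ennreal (norm k) \<partial>(lborel :: R2 measure)) < \<infinity>"
    using assms by (simp add: integrable_iff_bounded)
  ultimately show False by simp
qed

context steady_wave
begin

text \<open>A continuous nonnegative function with zero integral over a nondegenerate interval
  vanishes on it; \<open>h_gt\<close> makes the column nondegenerate.\<close>

lemma column_zero:
  assumes c: "continuous_on (fluid_domain h) g" and nn: "\<And>p. p \<in> fluid_domain h \<Longrightarrow> 0 \<le> g p"
    and z: "column g x = 0" and y: "- 1 \<le> y" "y \<le> h x"
  shows "g (x, y) = 0"
  using integral_eq_0_iff[OF cont_slice[OF c, of x] h_gt[of x]] z nn y
  by (auto simp: column_def fluid_domain_iff)

text \<open>Flattening the surface: the open layer is a continuous image of the plane times (0,
  1).\<close>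

lemma connected_interior_layer: "connected {p. - 1 < snd p \<and> snd p < h (fst p)}"
proof -
  have "{p. - 1 < snd p \<and> snd p < h (fst p)} = (\<lambda>z. (fst z, - 1 + snd z * (h (fst z) + 1))) ` (UNIV \<times> {0<..<1})"
  proof (intro set_eqI iffI)
    fix p assume p: "p \<in> {p. - 1 < snd p \<and> snd p < h (fst p)}"
    have pos: "h (fst p) + 1 > 0" using h_gt[of "fst p"] by simp
    show "p \<in> (\<lambda>z. (fst z, - 1 + snd z * (h (fst z) + 1))) ` (UNIV \<times> {0<..<1})"
      using p pos by (intro image_eqI[of _ _ "(fst p, (snd p + 1) / (h (fst p) + 1))"]) (auto simp: prod_eq_iff)
  next
    fix p assume "p \<in> (\<lambda>z. (fst z, - 1 + snd z * (h (fst z) + 1))) ` (UNIV \<times> {0<..<1})"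
    then obtain z where z: "z \<in> UNIV \<times> {0<..<1}" "p = (fst z, - 1 + snd z * (h (fst z) + 1))" by blast
    define x s where "x = fst z" and "s = snd z"
    have p: "p = (x, - 1 + s * (h x + 1))" and s: "0 < s" "s < 1"
      using z by (auto simp: x_def s_def)
    have pos: "h x + 1 > 0" using h_gt[of x] by simp
    have "0 < s * (h x + 1)" "s * (h x + 1) < 1 * (h x + 1)" using s pos by (auto intro: mult_strict_right_mono)
    then show "p \<in> {p. - 1 < snd p \<and> snd p < h (fst p)}" by (simp add: p)
  qed
  moreover have "connected \<dots>"
  proof (rule connected_continuous_image)
    show "continuous_on (UNIV \<times> {0<..<1}) (\<lambda>z :: R2 \<times> real. (fst z, - 1 + snd z * (h (fst z) + 1)))"
      by (intro continuous_intros continuous_on_compose2[OF cont_h[of UNIV]]) auto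
    show "connected ((UNIV :: R2 set) \<times> {0<..<1::real})"
      by (intro connected_Times connected_UNIV connected_Ioo)
  qed
  ultimately show ?thesis by simp
qed

lemma zero_if_kinetic_zero:
  assumes "\<And>x. kinetic x = 0" "- 1 \<le> y" "y \<le> h x"
  shows "D (x, y) = 0"
proof -
  have "(norm (D (x, y)))\<^sup>2 = 0"
    by (rule column_zero[where g="\<lambda>p. (norm (D p))\<^sup>2"])
       (use assms in \<open>auto intro!: continuous_intros cont_D simp: kinetic_eq[symmetric]\<close>)
  then show ?thesis by simp
qed

text \<open>A flow along c has a Hessian with range on the line of e = (c, 0); symmetry makes it a
  multiple of the projection onto that line, and its trace being zero kills it. So D is a constant d
  on the connected layer. Its energy per column |d|^2 (h + 1) is integrable over the plane, which is
  impossible for d \<noteq> 0 because h is square integrable.\<close>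

lemma unidirectional_flow_zero:
  assumes c: "c \<noteq> 0" and vert: "\<And>x. Ev x = 0" and perp: "\<And>x. column (\<lambda>p. (c $ 2 * fst (D p) $ 1 - c $ 1 * fst (D p) $ 2)\<^sup>2) x = 0"
  shows "kinetic x = 0"
proof -
  define U where "U = {p. - 1 < snd p \<and> snd p < h (fst p)}"
  have U: "open U" unfolding U_def
    by (intro open_Collect_conj open_Collect_less continuous_intros continuous_on_compose2[OF cont_h[of UNIV]]) auto
  have cU: "connected U" unfolding U_def by (rule connected_interior_layer)
  have D0: "snd (D p) = 0" "c $ 2 * fst (D p) $ 1 - c $ 1 * fst (D p) $ 2 = 0" if "p \<in> U" for p
  proof -
    define x y where "x = fst p" and "y = snd p"
    have p: "p = (x, y)" "- 1 \<le> y" "y \<le> h x" using that by (auto simp: x_def y_def U_def)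
    have "(snd (D (x, y)))\<^sup>2 = 0"
      by (rule column_zero[where g="\<lambda>p. (snd (D p))\<^sup>2"])
         (use p vert in \<open>auto intro!: continuous_intros cont_D simp: Ev_def[symmetric]\<close>)
    then show "snd (D p) = 0" by (simp add: p)
    have "(c $ 2 * fst (D (x, y)) $ 1 - c $ 1 * fst (D (x, y)) $ 2)\<^sup>2 = 0"
      by (rule column_zero[where g="\<lambda>p. (c $ 2 * fst (D p) $ 1 - c $ 1 * fst (D p) $ 2)\<^sup>2"])
         (use p perp in \<open>auto intro!: continuous_intros cont_D\<close>)
    then show "c $ 2 * fst (D p) $ 1 - c $ 1 * fst (D p) $ 2 = 0" by (simp add: p)
  qed
  have der0: "(D has_derivative (\<lambda>v. 0)) (at p)" if p: "p \<in> U" for p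
  proof -
    define x y where "x = fst p" and "y = snd p"
    have xy: "p = (x, y)" "- 1 < y" "y < h x" using p by (auto simp: x_def y_def U_def)
    from D_interior[OF xy(2,3)] obtain H where H: "(D has_derivative H) (at p)" and tr: "(\<Sum>b\<in>Basis. H b \<bullet> b) = 0"
      and sym: "\<And>v w. H v \<bullet> w = H w \<bullet> v" unfolding xy(1) by blast
    have lin0: "g (H v) = 0" if g: "bounded_linear g" and z: "\<And>p. p \<in> U \<Longrightarrow> g (D p) = (0::real)" for g v
    proof -
      have "((\<lambda>p. g (D p)) has_derivative (\<lambda>v. g (H v))) (at p)" by (rule bounded_linear.has_derivative[OF g H])
      moreover have "((\<lambda>p. g (D p)) has_derivative (\<lambda>v. 0)) (at p)"
        by (rule has_derivative_transform_within_open[OF has_derivative_const[of 0] U p]) (simp add: z)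
      ultimately show ?thesis by (metis has_derivative_unique)
    qed
    have s0: "snd (H v) = 0" for v by (rule lin0[OF bounded_linear_snd D0(1)])
    have p0: "c $ 2 * fst (H v) $ 1 - c $ 1 * fst (H v) $ 2 = 0" for v
    proof (rule lin0[where g="\<lambda>d. c $ 2 * fst d $ 1 - c $ 1 * fst d $ 2", OF _ D0(2)])
      show "bounded_linear (\<lambda>d :: R2 \<times> real. c $ 2 * fst d $ 1 - c $ 1 * fst d $ 2)"
        by (intro bounded_linear_sub bounded_linear_compose[OF bounded_linear_mult_right]
            bounded_linear_compose[OF bounded_linear_vec_nth] bounded_linear_fst)
    qed
    define e :: "R2 \<times> real" where "e = (c, 0)"
    define n where "n = c \<bullet> c"
    have n: "n > 0" using c by (simp add: n_def)
    \<comment> \<open>Neither a vertical component nor one across c is left in H v, so H v is its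
      own projection onto e; n is the squared length of e.\<close>
    have He: "n *\<^sub>R H v = (H v \<bullet> e) *\<^sub>R e" for v
    proof -
      have "n * fst (H v) $ 1 = (H v \<bullet> e) * c $ 1" "n * fst (H v) $ 2 = (H v \<bullet> e) * c $ 2"
        using p0[of v] by (simp_all add: n_def e_def inner_prod_def inner_R2 s0) algebra+
      then have "n *\<^sub>R fst (H v) = (H v \<bullet> e) *\<^sub>R c" by (simp add: vec_eq_iff forall_2)
      then show ?thesis by (simp add: prod_eq_iff s0 e_def)
    qed
    have Hve: "n * (H v \<bullet> e) = (H e \<bullet> e) * (e \<bullet> v)" for v
    proof -
      have "n * (H v \<bullet> e) = (n *\<^sub>R H e) \<bullet> v" using sym[of v e] by simp
      also have "\<dots> = (H e \<bullet> e) * (e \<bullet> v)" unfolding He[of e] by simp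
      finally show ?thesis .
    qed
    have ee: "e \<bullet> e = n" by (simp add: e_def n_def inner_prod_def)
    \<comment> \<open>The trace of the rank one form, multiplied by the square of n to avoid
      divisions.\<close>
    have "0 = n * (\<Sum>b\<in>Basis. H b \<bullet> b) * n" by (simp add: tr)
    also have "\<dots> = (\<Sum>b\<in>Basis. n * ((n *\<^sub>R H b) \<bullet> b))" by (simp add: sum_distrib_left mult_ac)
    also have "\<dots> = (\<Sum>b\<in>Basis. (H e \<bullet> e) * ((e \<bullet> b) * (e \<bullet> b)))"
      unfolding He using Hve by (intro sum.cong) (auto simp: mult.assoc[symmetric])
    also have "\<dots> = (H e \<bullet> e) * n"
      by (simp only: sum_distrib_left[symmetric] euclidean_inner[symmetric] ee)
    finally have "H e \<bullet> e = 0" using n by simp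
    then have "H v \<bullet> e = 0" for v using Hve[of v] n by simp
    then have "H v = 0" for v using He[of v] n by simp
    then show ?thesis using H by (metis (no_types, lifting) ext has_derivative_eq_rhs)
  qed
  define p0 where "p0 = ((0::R2), (h 0 - 1) / 2)"
  have p0: "p0 \<in> U" using h_gt[of 0] by (simp add: p0_def U_def)
  define d where "d = D p0"
  have DU: "D p = d" if "p \<in> U" for p
    unfolding d_def by (rule has_derivative_zero_unique_connected[OF U cU der0 that p0])
  \<comment> \<open>Continuity carries the constant value to the bottom and to the surface, which
    the interior argument does not reach.\<close>
  have DC: "D (x, y) = d" if "- 1 \<le> y" "y \<le> h x" for x y
  proof (rule continuous_constant_on_closure[where S="{- 1<..<h x}" and f="\<lambda>y. D (x, y)"])
    have cl: "closure {- 1<..<h x} = {- 1..h x}" using h_gt[of x] by simp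
    show "continuous_on (closure {- 1<..<h x}) (\<lambda>y. D (x, y))" unfolding cl by (rule cont_slice[OF cont_D])
    show "y \<in> closure {- 1<..<h x}" unfolding cl using that by simp
    show "D (x, y) = d" if "y \<in> {- 1<..<h x}" for y using that by (intro DU) (simp add: U_def)
  qed
  have kin: "kinetic x = (norm d)\<^sup>2 * (h x + 1)" for x
  proof -
    have "kinetic x = column (\<lambda>p. (norm d)\<^sup>2) x"
      unfolding kinetic_eq column_def by (intro integral_cong) (simp add: DC)
    then show ?thesis by (simp add: column_const)
  qed
  have "(norm d)\<^sup>2 = 0"
  proof (rule not_integrable_const_lborel)
    show "integrable (lborel :: R2 measure) (\<lambda>x. (norm d)\<^sup>2)"
    proof (rule Bochner_Integration.integrable_bound)
      \<comment> \<open>Completing the square in 2 h + 1/2 gives 1 \<le> 2 (h + 1) + 4 h^2, so that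
        this function dominates the constant |d|^2.\<close>
      show "integrable lborel (\<lambda>x. 2 * kinetic x + (norm d)\<^sup>2 * 4 * (h x)\<^sup>2)"
        using integrable_kinetic h_L2 by simp
      show "AE x in lborel. norm ((norm d)\<^sup>2) \<le> norm (2 * kinetic x + (norm d)\<^sup>2 * 4 * (h x)\<^sup>2)"
      proof (rule AE_I2)
        fix x
        have "0 \<le> (2 * h x + 1/2)\<^sup>2" by simp
        then have "1 \<le> 2 * (h x + 1) + 4 * (h x)\<^sup>2" by (simp add: power2_sum power_mult_distrib power_divide)
        then have "(norm d)\<^sup>2 * 1 \<le> (norm d)\<^sup>2 * (2 * (h x + 1) + 4 * (h x)\<^sup>2)" by (intro mult_left_mono) auto
        also have "\<dots> = 2 * kinetic x + (norm d)\<^sup>2 * 4 * (h x)\<^sup>2" by (simp add: kin algebra_simps)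
        finally show "norm ((norm d)\<^sup>2) \<le> norm (2 * kinetic x + (norm d)\<^sup>2 * 4 * (h x)\<^sup>2)" by simp
      qed
    qed simp
  qed
  then show ?thesis by (simp add: kin)
qed

end

context bumped_wave
begin

text \<open>For c \<noteq> 0 the contraction c . E c falls short of |c|^2 tr E by the integral of
  \<open>F\<close>, which is |c|^2 times the energy of the velocity component across c. The Pohozaev
  identities evaluate this deficit as - |c|^2 E_v / 2, so two nonnegative quantities add up to zero
  and both vanish.\<close>

lemma trivial_wave: "h x = 0 \<and> g\<psi> x = 0"
proof -
  \<comment> \<open>Inserting K = c . Q leaves K/2 - V/2 on the diagonal.\<close>
  have P: "EE k l - c $ l * Q k + (if k = l then K / 2 - V / 2 else 0) = 0" for k l
  proof -
    have "c $ 1 * Q 1 + c $ 2 * Q 2 - K / 2 - V / 2 = K / 2 - V / 2" using energy_limit by linarith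
    then show ?thesis using pohozaev_limit[of k l] by (simp only:)
  qed
  have V_eq: "V = EE 1 1 + EE 2 2" using P[of 1 1, simplified] P[of 2 2, simplified] energy_limit by linarith
  have V_nonneg: "V \<ge> 0" unfolding V_def by (intro integral_nonneg_AE) simp
  have kin0: "kinetic x = 0" for x
  proof (cases "c = 0")
    case True
    then have "K = 0" using energy_limit by simp
    then show ?thesis
      using continuous_nonneg_integral_zero[OF cont_kinetic integrable_kinetic kinetic_nonneg] by (simp add: K_def)
  next
    case False
    define n where "n = (c $ 1)\<^sup>2 + (c $ 2)\<^sup>2"
    have n: "n > 0"
    proof -
      have "c $ 1 \<noteq> 0 \<or> c $ 2 \<noteq> 0" using False by (auto simp: vec_eq_iff forall_2)
      then show ?thesis by (auto simp: n_def sum_power2_gt_zero_iff)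
    qed
    define F where "F = column (\<lambda>p. (c $ 2 * fst (D p) $ 1 - c $ 1 * fst (D p) $ 2)\<^sup>2)"
    have cF: "continuous_on UNIV F" unfolding F_def by (intro continuous_column continuous_intros cont_D)
    have F0: "F x \<ge> 0" for x unfolding F_def by (intro column_nonneg continuous_intros cont_D) auto
    have F_eq: "F x = (c $ 2)\<^sup>2 * E 1 1 x - 2 * c $ 1 * c $ 2 * E 1 2 x + (c $ 1)\<^sup>2 * E 2 2 x" for x
    proof -
      have c: "continuous_on (fluid_domain h) (\<lambda>p. r * (fst (D p) $ k * fst (D p) $ l))" for r k l
        by (intro continuous_intros cont_D)
      have cm: "column (\<lambda>p. r * g p) x = r * column g x" for r g x using column_cmult[of "\<lambda>_. r"] by simp
      have e: "(\<lambda>p. (c $ 2 * fst (D p) $ 1 - c $ 1 * fst (D p) $ 2)\<^sup>2) =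
         (\<lambda>p. (c $ 2)\<^sup>2 * (fst (D p) $ 1 * fst (D p) $ 1) - 2 * c $ 1 * c $ 2 * (fst (D p) $ 1 * fst (D p) $ 2) +
           (c $ 1)\<^sup>2 * (fst (D p) $ 2 * fst (D p) $ 2))"
        by (simp add: fun_eq_iff power2_eq_square algebra_simps)
      show ?thesis unfolding F_def e E_def
        by (simp only: column_add[OF continuous_on_diff[OF c c] c] column_diff[OF c c] cm)
    qed
    have iF: "integrable lborel F" unfolding F_eq[abs_def] using integrable_E by simp
    have sym: "EE 1 2 = EE 2 1" unfolding EE_def E_def by (simp add: mult.commute)
    have F_int: "(LINT x|lborel. F x) = (c $ 2)\<^sup>2 * EE 1 1 - 2 * c $ 1 * c $ 2 * EE 1 2 + (c $ 1)\<^sup>2 * EE 2 2"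
      unfolding F_eq[abs_def] EE_def using integrable_E by simp
    have "(c $ 1)\<^sup>2 * EE 1 1 + 2 * c $ 1 * c $ 2 * EE 1 2 + (c $ 2)\<^sup>2 * EE 2 2 = n * (K + V) / 2"
    proof -
      \<comment> \<open>Contraction of the four identities with c twice; the terms c_l Q_k combine
        to |c|^2 (c . Q).\<close>
      have "c $ 1 * c $ 1 * EE 1 1 + c $ 1 * c $ 2 * EE 1 2 + c $ 2 * c $ 1 * EE 2 1 + c $ 2 * c $ 2 * EE 2 2 =
        n * (c $ 1 * Q 1 + c $ 2 * Q 2) - n * (K / 2 - V / 2)"
      proof -
        have e: "EE 1 1 = c $ 1 * Q 1 - (K / 2 - V / 2)" "EE 2 2 = c $ 2 * Q 2 - (K / 2 - V / 2)"
          "EE 1 2 = c $ 2 * Q 1" "EE 2 1 = c $ 1 * Q 2"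
          using P[of 1 1, simplified] P[of 2 2, simplified] P[of 1 2, simplified] P[of 2 1, simplified] by linarith+
        show ?thesis unfolding e n_def by (simp add: power2_eq_square algebra_simps)
      qed
      also have "\<dots> = n * (K + V) / 2" unfolding energy_limit[symmetric] by (simp add: field_simps)
      finally show ?thesis using sym by (simp add: power2_eq_square)
    qed
    then have key: "(LINT x|lborel. F x) + n * EEv / 2 = 0"
      unfolding F_int using K_eq V_eq by (simp add: n_def algebra_simps add_divide_distrib)
    have nnF: "(LINT x|lborel. F x) \<ge> 0" using F0 by (intro integral_nonneg_AE) simp
    have nnE: "EEv \<ge> 0" unfolding EEv_def using Ev_nonneg by (intro integral_nonneg_AE) simp
    then have "n * EEv \<ge> 0" using n by simp
    then have z: "(LINT x|lborel. F x) = 0" "n * EEv = 0" using key nnF by linarith+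
    then have "EEv = 0" using n by simp
    then have "Ev x = 0" for x
      using continuous_nonneg_integral_zero[OF cont_Ev integrable_Ev Ev_nonneg] by (simp add: EEv_def)
    moreover have "F x = 0" for x by (rule continuous_nonneg_integral_zero[OF cF iF F0 z(1)])
    ultimately show ?thesis using unidirectional_flow_zero[OF False] by (simp add: F_def)
  qed
  have "kinetic = (\<lambda>x. 0)" using kin0 by (simp add: fun_eq_iff)
  then have "K = 0" by (simp add: K_def)
  moreover have "EEv \<ge> 0" unfolding EEv_def using Ev_nonneg by (intro integral_nonneg_AE) simp
  \<comment> \<open>From tr E + E_v = K = 0 and E_v \<ge> 0 follows V = tr E \<le> 0, while V is
    nonnegative.\<close>
  ultimately have "V = 0" using K_eq V_eq V_nonneg by simp
  then have "(h x)\<^sup>2 = 0"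
    using continuous_nonneg_integral_zero[of "\<lambda>x. (h x)\<^sup>2" x] h_L2 cont_h by (simp add: V_def continuous_on_power)
  moreover have "g\<psi> x = 0"
  proof -
    have m: "(x, h x) \<in> fluid_domain h" using h_gt[of x] by (simp add: fluid_domain_iff)
    have "D (x, h x) = 0" using zero_if_kinetic_zero[OF kin0] h_gt[of x] by simp
    then show ?thesis
      using surface_gradient[OF h_deriv \<psi>_deriv h_gt \<phi>_deriv[OF m] trace] by simp
  qed
  ultimately show ?thesis by simp
qed

end

subsection \<open>Injectivity of the Fourier transform on \<open>L\<^sup>2\<close>\<close>

lemma integral_exp_half_line:
  fixes z e :: real
  assumes e: "e > 0"
  shows "integrable lborel (\<lambda>\<xi>. indicator {0<..} \<xi> *\<^sub>R exp (- (complex_of_real e + \<i> * complex_of_real z) * complex_of_real \<xi>))"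
    and "(LINT \<xi>|lborel. indicator {0<..} \<xi> *\<^sub>R exp (- (complex_of_real e + \<i> * complex_of_real z) * complex_of_real \<xi>)) =
      1 / (complex_of_real e + \<i> * complex_of_real z)"
proof -
  define w where "w = complex_of_real e + \<i> * complex_of_real z"
  have w: "w \<noteq> 0" "Re w = e" using e by (auto simp: w_def complex_eq_iff)
  define f where "f \<xi> = exp (- w * complex_of_real \<xi>)" for \<xi> :: real
  define F where "F \<xi> = - exp (- w * complex_of_real \<xi>) / w" for \<xi> :: real
  have nf: "norm (f \<xi>) = exp (- (\<xi> * e))" for \<xi> by (simp add: f_def w mult.commute)
  have si: "set_integrable lborel {0<..} f"
    unfolding set_integrable_def
  proof (rule Bochner_Integration.integrable_bound[OF integrable_I0i_exp_mscale[OF e, unfolded set_integrable_def]])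
    have "f \<in> borel_measurable borel" unfolding f_def
      by (intro borel_measurable_continuous_onI continuous_intros)
    then show "(\<lambda>x. indicator {0<..} x *\<^sub>R f x) \<in> borel_measurable lborel" by simp
    show "AE x in lborel. norm (indicator {0<..} x *\<^sub>R f x) \<le> norm (indicator {0<..} x *\<^sub>R exp (- (x * e)))"
      by (intro AE_I2) (simp add: nf)
  qed
  then show "integrable lborel (\<lambda>\<xi>. indicator {0<..} \<xi> *\<^sub>R exp (- (complex_of_real e + \<i> * complex_of_real z) * complex_of_real \<xi>))"
    by (simp add: set_integrable_def f_def[abs_def] w_def)
  have ei: "einterval 0 \<infinity> = {0<..}" by (auto simp: einterval_def)
  have "(LBINT x=0..\<infinity>. f x) = 0 - (- 1 / w)"
  proof (rule interval_integral_FTC_integrable[where F=F])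
    show "(F has_vector_derivative f x) (at x)" for x
    proof -
      have "((\<lambda>x. exp (- w * complex_of_real x)) has_vector_derivative (- w * exp (- w * complex_of_real x))) (at x)"
        by (rule has_vector_derivative_eq_rhs, (rule derivative_intros has_vector_derivative_real_field | simp)+)
      then have "((\<lambda>x. exp (- w * complex_of_real x) / (- w)) has_vector_derivative (- w * exp (- w * complex_of_real x)) / (- w)) (at x)"
        by (rule has_vector_derivative_divide)
      then show ?thesis using w by (simp add: F_def[abs_def] f_def)
    qed
    show "isCont f x" for x unfolding f_def by (intro continuous_intros)
    show "set_integrable lborel (einterval 0 \<infinity>) f" unfolding ei by (rule si)
    have "(F \<longlongrightarrow> F 0) (at_right 0)" unfolding F_def by (intro tendsto_intros) (use w in auto)
    then show "((F \<circ> real_of_ereal) \<longlongrightarrow> - 1 / w) (at_right 0)"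
      unfolding zero_ereal_def ereal_tendsto_simps by (simp add: F_def)
    have "((\<lambda>\<xi>. exp (- (\<xi> * e)) / norm w) \<longlongrightarrow> 0) at_top"
    proof -
      have "filterlim (\<lambda>\<xi>. - (\<xi> * e)) at_bot at_top"
        using filterlim_tendsto_pos_mult_at_top[OF tendsto_const e filterlim_ident]
        unfolding filterlim_uminus_at_bot mult.commute[of e] by simp
      from filterlim_compose[OF exp_at_bot this] have "((\<lambda>\<xi>. exp (- (\<xi> * e))) \<longlongrightarrow> 0) at_top" .
      from tendsto_divide[OF this tendsto_const[of "norm w"]] show ?thesis using w by simp
    qed
    moreover have "norm (F \<xi>) = exp (- (\<xi> * e)) / norm w" for \<xi>
      using nf[of \<xi>] by (simp add: F_def f_def norm_divide)
    ultimately have "((\<lambda>\<xi>. norm (F \<xi>)) \<longlongrightarrow> 0) at_top" by simp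
    then have "(F \<longlongrightarrow> 0) at_top" by (rule tendsto_norm_zero_cancel)
    then show "((F \<circ> real_of_ereal) \<longlongrightarrow> 0) (at_left \<infinity>)" unfolding ereal_tendsto_simps .
  qed simp
  then show "(LINT \<xi>|lborel. indicator {0<..} \<xi> *\<^sub>R exp (- (complex_of_real e + \<i> * complex_of_real z) * complex_of_real \<xi>)) =
      1 / (complex_of_real e + \<i> * complex_of_real z)"
    by (simp add: interval_lebesgue_integral_def set_lebesgue_integral_def ei f_def w_def)
qed

text \<open>An exponential weight instead of a Gaussian: its transform is a sum of two elementary
  half-line integrals, and averaging the resulting kernel over its centre gives arctangents.\<close>

definition damped_wave :: "real \<Rightarrow> real \<Rightarrow> real \<Rightarrow> complex" where
  "damped_wave e p \<xi> = exp (\<i> * complex_of_real (p * \<xi>)) * complex_of_real (exp (- e * \<bar>\<xi>\<bar>))"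

text \<open>The Poisson kernel of the half plane without the normalising factor 1/pi, so that its
  total mass is pi.\<close>

definition poisson_kernel :: "real \<Rightarrow> real \<Rightarrow> real" where
  "poisson_kernel e s = e / (e\<^sup>2 + s\<^sup>2)"

lemma norm_damped_wave: "norm (damped_wave e p \<xi>) = exp (- e * \<bar>\<xi>\<bar>)"
  by (simp add: damped_wave_def norm_mult)

lemma fourier_damped_wave:
  assumes e: "e > 0"
  shows "integrable lborel (damped_wave e p)"
    and "integrable lborel (\<lambda>\<xi>. exp (- \<i> * complex_of_real (s * \<xi>)) * damped_wave e p \<xi>)"
    and "(LINT \<xi>|lborel. exp (- \<i> * complex_of_real (s * \<xi>)) * damped_wave e p \<xi>) =
      complex_of_real (2 * poisson_kernel e (s - p))"
proof -
  define g where "g z \<xi> = indicator {0<..} \<xi> *\<^sub>R exp (- (complex_of_real e + \<i> * complex_of_real z) * complex_of_real \<xi>)" for z \<xi> :: real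
  have gi: "integrable lborel (g z)" "(LINT \<xi>|lborel. g z \<xi>) = 1 / (complex_of_real e + \<i> * complex_of_real z)" for z
    unfolding g_def using integral_exp_half_line[OF e] by auto
  have gi': "integrable lborel (\<lambda>\<xi>. g z (- \<xi>))" for z
    using lborel_integrable_real_affine[OF gi(1)[of z], of "-1" 0] by simp
  have gI': "(LINT \<xi>|lborel. g z (- \<xi>)) = 1 / (complex_of_real e + \<i> * complex_of_real z)" for z
    using lborel_integral_real_affine[of "-1" "g z" 0] gi(2)[of z] by simp
  define f where "f s \<xi> = exp (- \<i> * complex_of_real (s * \<xi>)) * damped_wave e p \<xi>" for s \<xi>
  have fm: "f s \<in> borel_measurable borel" for s
    unfolding f_def damped_wave_def by (intro borel_measurable_continuous_onI continuous_intros)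
  \<comment> \<open>At \<xi> = 0 both half-line pieces vanish while the left side is 1, so the
    identity holds only off one point.\<close>
  have ae: "AE \<xi> in lborel. f s \<xi> = g (s - p) \<xi> + g (p - s) (- \<xi>)" for s
    using AE_lborel_singleton[of "0::real"]
  proof eventually_elim
    case (elim \<xi>)
    show ?case
    proof (cases "\<xi> > 0")
      case True
      then show ?thesis by (simp add: f_def g_def damped_wave_def exp_of_real[symmetric] exp_add[symmetric] algebra_simps)
    next
      case False
      then have "\<xi> < 0" using elim by simp
      then show ?thesis by (simp add: f_def g_def damped_wave_def exp_of_real[symmetric] exp_add[symmetric] algebra_simps)
    qed
  qed
  have fi: "integrable lborel (f s)" for s
  proof -
    have "(\<lambda>\<xi>. g (s - p) \<xi> + g (p - s) (- \<xi>)) \<in> borel_measurable lborel"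
      using gi(1)[of "s - p"] gi'[of "p - s"] by (intro borel_measurable_add) auto
    then show ?thesis
      using gi(1)[of "s - p"] gi'[of "p - s"] fm[of s] ae[of s]
      by (subst integrable_cong_AE[OF _ _ ae[of s]]) auto
  qed
  show "integrable lborel (\<lambda>\<xi>. exp (- \<i> * complex_of_real (s * \<xi>)) * damped_wave e p \<xi>)"
    using fi[of s] unfolding f_def[abs_def] .
  show "integrable lborel (damped_wave e p)" using fi[of 0] by (simp add: f_def[abs_def])
  have "(LINT \<xi>|lborel. f s \<xi>) = (LINT \<xi>|lborel. g (s - p) \<xi> + g (p - s) (- \<xi>))"
    using gi(1)[of "s - p"] gi'[of "p - s"] fm[of s] ae[of s] by (intro integral_cong_AE) auto
  also have "\<dots> = 1 / (complex_of_real e + \<i> * complex_of_real (s - p)) + 1 / (complex_of_real e + \<i> * complex_of_real (p - s))"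
    using gi[of "s - p"] gi'[of "p - s"] gI'[of "p - s"] by simp
  also have "\<dots> = complex_of_real (2 * poisson_kernel e (s - p))"
  proof -
    define a z where "a = complex_of_real e" and "z = complex_of_real (s - p)"
    have "a + \<i> * z \<noteq> 0" "a - \<i> * z \<noteq> 0" using e by (auto simp: a_def z_def complex_eq_iff)
    moreover have "(a + \<i> * z) * (a - \<i> * z) = a\<^sup>2 + z\<^sup>2" by (simp add: power2_eq_square algebra_simps)
    ultimately have "1 / (a + \<i> * z) + 1 / (a - \<i> * z) = 2 * a / (a\<^sup>2 + z\<^sup>2)"
      by (simp add: add_frac_eq)
    moreover have "complex_of_real (p - s) = - z" by (simp add: z_def)
    moreover have "complex_of_real (2 * poisson_kernel e (s - p)) = 2 * a / (a\<^sup>2 + z\<^sup>2)"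
      by (simp add: poisson_kernel_def a_def z_def)
    ultimately show ?thesis unfolding a_def[symmetric] z_def[symmetric] by simp
  qed
  finally show "(LINT \<xi>|lborel. exp (- \<i> * complex_of_real (s * \<xi>)) * damped_wave e p \<xi>) =
      complex_of_real (2 * poisson_kernel e (s - p))" by (simp add: f_def)
qed

lemma integral_R2_product:
  fixes \<rho> \<sigma> :: "real \<Rightarrow> 'a::{real_normed_field, banach, second_countable_topology}"
  assumes \<rho>: "integrable lborel \<rho>" and \<sigma>: "integrable lborel \<sigma>"
  shows "integrable lborel (\<lambda>x :: R2. \<rho> (x $ 1) * \<sigma> (x $ 2))"
    and "(LINT x|(lborel :: R2 measure). \<rho> (x $ 1) * \<sigma> (x $ 2)) = (LINT s|lborel. \<rho> s) * (LINT t|lborel. \<sigma> t)"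
proof -
  have [measurable]: "\<rho> \<in> borel_measurable borel" "\<sigma> \<in> borel_measurable borel" using assms by auto
  have m: "(\<lambda>x :: R2. \<rho> (x $ 1) * \<sigma> (x $ 2)) \<in> borel_measurable borel" by measurable
  have i: "integrable (lborel \<Otimes>\<^sub>M lborel) (\<lambda>z. \<rho> (fst z) * \<sigma> (snd z))"
  proof (rule lborel_pair.Fubini_integrable)
    show "integrable lborel (\<lambda>x. LINT y|lborel. norm (\<rho> (fst (x, y)) * \<sigma> (snd (x, y))))"
      using \<rho> \<sigma> by (simp add: norm_mult)
    show "AE x in lborel. integrable lborel (\<lambda>y. \<rho> (fst (x, y)) * \<sigma> (snd (x, y)))"
      using \<sigma> by simp
  qed measurable
  then show I: "integrable lborel (\<lambda>x :: R2. \<rho> (x $ 1) * \<sigma> (x $ 2))"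
    by (subst lborel_R2, subst integrable_distr_eq[OF plane_point_measurable m]) simp
  show "(LINT x|(lborel :: R2 measure). \<rho> (x $ 1) * \<sigma> (x $ 2)) = (LINT s|lborel. \<rho> s) * (LINT t|lborel. \<sigma> t)"
    unfolding integral_R2(3)[OF I] by simp
qed

text \<open>
  The products of damped waves are test functions whose Fourier transforms are Poisson kernels,
  an approximate identity.
\<close>

lemma fourier_truncation_pairing:
  fixes f :: "R2 \<Rightarrow> complex" and p :: R2
  assumes f: "integrable lborel f" and e: "e > 0"
  shows "(LINT \<xi>|lborel. fourier_integral f \<xi> * (damped_wave e (p $ 1) (\<xi> $ 1) * damped_wave e (p $ 2) (\<xi> $ 2))) =
    (LINT x|lborel. f x * complex_of_real (4 * (poisson_kernel e (x $ 1 - p $ 1) * poisson_kernel e (x $ 2 - p $ 2))))"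
proof -
  define G where "G \<xi> = damped_wave e (p $ 1) (\<xi> $ 1) * damped_wave e (p $ 2) (\<xi> $ 2)" for \<xi> :: R2
  have iG: "integrable lborel G" unfolding G_def by (intro integral_R2_product fourier_damped_wave e)
  have [measurable]: "f \<in> borel_measurable borel" "G \<in> borel_measurable borel" using f iG by auto
  have ie: "(\<lambda>z :: R2 \<times> R2. exp (- \<i> * complex_of_real (fst z \<bullet> snd z))) \<in> borel_measurable (borel \<Otimes>\<^sub>M borel)"
    unfolding borel_prod by (intro borel_measurable_continuous_onI continuous_intros)
  have i: "integrable (lborel \<Otimes>\<^sub>M lborel) (\<lambda>z. exp (- \<i> * complex_of_real (fst z \<bullet> snd z)) * f (fst z) * G (snd z))"
  proof (rule lborel_pair.Fubini_integrable)
    show "(\<lambda>z. exp (- \<i> * complex_of_real (fst z \<bullet> snd z)) * f (fst z) * G (snd z)) \<in> borel_measurable (lborel \<Otimes>\<^sub>M lborel)"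
      using ie by measurable
    show "integrable lborel (\<lambda>x. LINT y|lborel. norm (exp (- \<i> * complex_of_real (fst (x, y) \<bullet> snd (x, y))) * f (fst (x, y)) * G (snd (x, y))))"
      using f iG by (simp add: norm_mult)
    show "AE x in lborel. integrable lborel (\<lambda>y. exp (- \<i> * complex_of_real (fst (x, y) \<bullet> snd (x, y))) * f (fst (x, y)) * G (snd (x, y)))"
    proof (rule AE_I2)
      fix x :: R2
      show "integrable lborel (\<lambda>y. exp (- \<i> * complex_of_real (fst (x, y) \<bullet> snd (x, y))) * f (fst (x, y)) * G (snd (x, y)))"
      proof (rule Bochner_Integration.integrable_bound)
        show "integrable lborel (\<lambda>y. f x * G y)" using iG by simp
        have "(\<lambda>y. exp (- \<i> * complex_of_real (x \<bullet> y))) \<in> borel_measurable borel"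
          by (intro borel_measurable_continuous_onI continuous_intros)
        then show "(\<lambda>y. exp (- \<i> * complex_of_real (fst (x, y) \<bullet> snd (x, y))) * f (fst (x, y)) * G (snd (x, y))) \<in> borel_measurable lborel"
          by simp
      qed (simp add: norm_mult)
    qed
  qed
  have "(LINT \<xi>|lborel. fourier_integral f \<xi> * G \<xi>) =
      (LINT \<xi>|lborel. LINT x|lborel. exp (- \<i> * complex_of_real (x \<bullet> \<xi>)) * f x * G \<xi>)"
    by (simp add: fourier_integral_def)
  also have "\<dots> = (LINT x|lborel. LINT \<xi>|lborel. exp (- \<i> * complex_of_real (x \<bullet> \<xi>)) * f x * G \<xi>)"
    by (rule lborel_pair.Fubini_integral) (use i in \<open>simp add: case_prod_unfold\<close>)
  also have "\<dots> = (LINT x|lborel. f x * complex_of_real (4 * (poisson_kernel e (x $ 1 - p $ 1) * poisson_kernel e (x $ 2 - p $ 2))))"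
  proof (rule Bochner_Integration.integral_cong[OF refl])
    fix x :: R2
    have "(LINT \<xi>|lborel. exp (- \<i> * complex_of_real (x \<bullet> \<xi>)) * f x * G \<xi>) =
       (LINT \<xi>|(lborel :: R2 measure). f x * ((exp (- \<i> * complex_of_real (x $ 1 * \<xi> $ 1)) * damped_wave e (p $ 1) (\<xi> $ 1)) *
          (exp (- \<i> * complex_of_real (x $ 2 * \<xi> $ 2)) * damped_wave e (p $ 2) (\<xi> $ 2))))"
      by (intro Bochner_Integration.integral_cong refl)
         (simp add: G_def inner_R2 exp_add distrib_left exp_diff exp_minus field_simps)
    also have "\<dots> = f x * (complex_of_real (2 * poisson_kernel e (x $ 1 - p $ 1)) * complex_of_real (2 * poisson_kernel e (x $ 2 - p $ 2)))"
      using integral_R2_product[OF fourier_damped_wave(2)[OF e, of "x $ 1" "p $ 1"] fourier_damped_wave(2)[OF e, of "x $ 2" "p $ 2"]]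
        fourier_damped_wave(3)[OF e] by simp
    finally show "(LINT \<xi>|lborel. exp (- \<i> * complex_of_real (x \<bullet> \<xi>)) * f x * G \<xi>) =
      f x * complex_of_real (4 * (poisson_kernel e (x $ 1 - p $ 1) * poisson_kernel e (x $ 2 - p $ 2)))" by simp
  qed
  finally show ?thesis by (simp add: G_def)
qed

text \<open>The integral of the Poisson kernel over centres p in [a, b], in closed form. As e tends
  to 0 it tends to pi inside the interval and to 0 outside, which turns pairings with kernels into
  pairings with indicators of boxes.\<close>

definition poisson_average :: "real \<Rightarrow> real \<Rightarrow> real \<Rightarrow> real \<Rightarrow> real" where
  "poisson_average e a b s = arctan ((b - s) / e) - arctan ((a - s) / e)"

lemma poisson_kernel_nonneg: "e > 0 \<Longrightarrow> 0 \<le> poisson_kernel e s"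
  by (simp add: poisson_kernel_def)

lemma poisson_average_deriv:
  assumes e: "e > 0"
  shows "((\<lambda>p. arctan ((p - s) / e)) has_real_derivative poisson_kernel e (s - p)) (at p)"
proof -
  have "((\<lambda>p. arctan ((p - s) / e)) has_real_derivative (1 / e) / (1 + ((p - s) / e)\<^sup>2)) (at p)"
    using e by (auto intro!: derivative_eq_intros simp: divide_inverse)
  moreover have "(1 / e) / (1 + ((p - s) / e)\<^sup>2) = poisson_kernel e (s - p)"
  proof -
    have pos: "e\<^sup>2 + (s - p)\<^sup>2 > 0" using e by (simp add: add_pos_nonneg)
    have "1 + ((p - s) / e)\<^sup>2 = (e\<^sup>2 + (s - p)\<^sup>2) / e\<^sup>2"
      using e by (simp add: power_divide add_divide_distrib power2_commute)
    then show ?thesis using e pos by (simp add: poisson_kernel_def power2_eq_square)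
  qed
  ultimately show ?thesis by simp
qed

lemma poisson_kernel_cont: "e > 0 \<Longrightarrow> continuous_on S (poisson_kernel e)"
  unfolding poisson_kernel_def by (intro continuous_intros) (auto simp: sum_power2_eq_zero_iff)

lemma poisson_average_eq:
  assumes e: "e > 0" and ab: "a \<le> b"
  shows "integrable lborel (\<lambda>p. indicator {a..b} p * poisson_kernel e (s - p))"
    and "(LINT p|lborel. indicator {a..b} p * poisson_kernel e (s - p)) = poisson_average e a b s"
proof -
  have c: "continuous_on {a..b} (\<lambda>p. poisson_kernel e (s - p))"
    by (intro continuous_on_compose2[OF poisson_kernel_cont[OF e, of UNIV]] continuous_intros) auto
  have "integrable lborel (\<lambda>p. indicator {a..b} p *\<^sub>R poisson_kernel e (s - p))"
    by (intro borel_integrable_compact c) auto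
  then show i: "integrable lborel (\<lambda>p. indicator {a..b} p * poisson_kernel e (s - p))" by simp
  have "((\<lambda>p. poisson_kernel e (s - p)) has_integral poisson_average e a b s) {a..b}"
    unfolding poisson_average_def
    using fundamental_theorem_of_calculus[OF ab, of "\<lambda>p. arctan ((p - s) / e)" "\<lambda>p. poisson_kernel e (s - p)"]
      poisson_average_deriv[OF e]
    by (simp add: has_field_derivative_at_within flip: has_real_derivative_iff_has_vector_derivative)
  moreover have "(LINT p|lborel. indicator {a..b} p * poisson_kernel e (s - p)) = integral {a..b} (\<lambda>p. poisson_kernel e (s - p))"
    using set_borel_integral_eq_integral(2)[of "{a..b}" "\<lambda>p. poisson_kernel e (s - p)"] i
    by (simp add: set_integrable_def set_lebesgue_integral_def)
  ultimately show "(LINT p|lborel. indicator {a..b} p * poisson_kernel e (s - p)) = poisson_average e a b s"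
    by (simp add: integral_unique)
qed

text \<open>This decay puts the product of two kernels into L^2 of the plane, so that it pairs with
  a function known only to be square integrable.\<close>

lemma poisson_kernel_decay:
  assumes e: "e > 0"
  shows "\<exists>C. \<forall>s. \<bar>poisson_kernel e (s - p)\<bar> \<le> C / (1 + s\<^sup>2)"
proof (intro exI allI)
  fix s
  define C where "C = (1 + 2 * p\<^sup>2) / e\<^sup>2 + 2"
  have "s\<^sup>2 \<le> 2 * (s - p)\<^sup>2 + 2 * p\<^sup>2"
    using zero_le_power2[of "s - 2 * p"] by (simp add: power2_eq_square algebra_simps)
  then have "1 + s\<^sup>2 \<le> (1 + 2 * p\<^sup>2) + 2 * (s - p)\<^sup>2" by simp
  also have "\<dots> \<le> C * e\<^sup>2 + C * (s - p)\<^sup>2"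
  proof (rule add_mono)
    have "(1 + 2 * p\<^sup>2) / e\<^sup>2 * e\<^sup>2 = 1 + 2 * p\<^sup>2" using e by (intro nonzero_eq_divide_eq[THEN iffD1]) auto
    moreover have "C * e\<^sup>2 = (1 + 2 * p\<^sup>2) / e\<^sup>2 * e\<^sup>2 + 2 * e\<^sup>2" by (simp only: C_def distrib_right)
    ultimately show "1 + 2 * p\<^sup>2 \<le> C * e\<^sup>2" by simp
    show "2 * (s - p)\<^sup>2 \<le> C * (s - p)\<^sup>2" by (intro mult_right_mono) (auto simp: C_def)
  qed
  finally have "1 + s\<^sup>2 \<le> C * (e\<^sup>2 + (s - p)\<^sup>2)" by (simp add: distrib_left)
  moreover have "1 + s\<^sup>2 > 0" "e\<^sup>2 + (s - p)\<^sup>2 > 0" using e by (auto simp: add_pos_nonneg)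
  ultimately have "e / (e\<^sup>2 + (s - p)\<^sup>2) \<le> e * C / (1 + s\<^sup>2)"
    using e by (simp add: frac_le_eq divide_le_eq pos_le_divide_eq mult_ac)
  then show "\<bar>poisson_kernel e (s - p)\<bar> \<le> e * ((1 + 2 * p\<^sup>2) / e\<^sup>2 + 2) / (1 + s\<^sup>2)"
    using poisson_kernel_nonneg[OF e, of "s - p"] by (simp add: poisson_kernel_def C_def)
qed

text \<open>The constant is uniform in e \<le> 1, as dominated convergence for e tending to 0
  demands. Near the interval the total mass pi suffices as a bound; far away the mean value theorem
  gives b - a times one kernel value, which is at most 1 / (s - p)^2.\<close>

lemma poisson_average_decay:
  assumes ab: "a < b"
  shows "\<exists>C. \<forall>e s. 0 < e \<longrightarrow> e \<le> 1 \<longrightarrow> \<bar>poisson_average e a b s\<bar> \<le> C / (1 + s\<^sup>2)"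
proof (intro exI allI impI)
  fix e s :: real assume e: "0 < e" "e \<le> 1"
  define m where "m = \<bar>a\<bar> + \<bar>b\<bar> + 1"
  have pos: "1 + s\<^sup>2 > 0" by (simp add: add_pos_nonneg)
  show "\<bar>poisson_average e a b s\<bar> \<le> (pi * (1 + 4 * (\<bar>a\<bar> + \<bar>b\<bar> + 1)\<^sup>2) + 8 * (b - a)) / (1 + s\<^sup>2)"
  proof (cases "\<bar>s\<bar> \<le> 2 * m")
    case True
    have "\<bar>poisson_average e a b s\<bar> \<le> pi"
      using arctan_bounded[of "(b - s) / e"] arctan_bounded[of "(a - s) / e"]
      by (simp add: poisson_average_def abs_le_iff)
    moreover have "1 + s\<^sup>2 \<le> 1 + 4 * m\<^sup>2"
      using True power_mono[OF True, of 2] by (simp add: power_mult_distrib)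
    then have "pi * (1 + s\<^sup>2) \<le> pi * (1 + 4 * m\<^sup>2)" by (intro mult_left_mono) auto
    moreover have "0 \<le> 8 * (b - a)" using ab by simp
    ultimately have "\<bar>poisson_average e a b s\<bar> * (1 + s\<^sup>2) \<le> pi * (1 + 4 * m\<^sup>2) + 8 * (b - a)"
      using mult_right_mono[of "\<bar>poisson_average e a b s\<bar>" pi "1 + s\<^sup>2"] pos by linarith
    then show ?thesis using pos by (simp add: m_def pos_le_divide_eq)
  next
    case False
    obtain p where p: "a < p" "p < b" "arctan ((b - s) / e) - arctan ((a - s) / e) = (b - a) * poisson_kernel e (s - p)"
      using MVT2[OF ab, of "\<lambda>p. arctan ((p - s) / e)" "\<lambda>p. poisson_kernel e (s - p)"] poisson_average_deriv[OF e(1)]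
      by auto
    have "\<bar>p\<bar> \<le> m" using p by (auto simp: m_def)
    then have sp: "\<bar>s\<bar> / 2 \<le> \<bar>s - p\<bar>" using False by linarith
    have s1: "1 \<le> s\<^sup>2" using False by (intro one_le_power[of "\<bar>s\<bar>" 2, simplified]) (simp add: m_def)
    have "(\<bar>s\<bar> / 2)\<^sup>2 \<le> \<bar>s - p\<bar>\<^sup>2" using sp by (intro power_mono) auto
    then have sq: "s\<^sup>2 / 4 \<le> (s - p)\<^sup>2" by (simp add: power_divide)
    have spp: "(s - p)\<^sup>2 > 0" using sq s1 by linarith
    have "poisson_kernel e (s - p) \<le> 1 / (s - p)\<^sup>2"
      unfolding poisson_kernel_def using e spp by (intro frac_le) auto
    also have "\<dots> \<le> 8 / (1 + s\<^sup>2)"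
    proof -
      \<comment> \<open>The factor 8 combines |s - p| \<ge> |s| / 2 with 1 \<le> |s|^2.\<close>
      have "1 + s\<^sup>2 \<le> 8 * (s - p)\<^sup>2" using sq s1 by linarith
      then show ?thesis using spp pos by (simp add: frac_le_eq divide_le_eq pos_le_divide_eq mult_ac)
    qed
    finally have "(b - a) * poisson_kernel e (s - p) \<le> (b - a) * (8 / (1 + s\<^sup>2))" using ab by (intro mult_left_mono) auto
    also have "\<dots> \<le> (pi * (1 + 4 * m\<^sup>2) + 8 * (b - a)) / (1 + s\<^sup>2)"
      using pos by (simp add: divide_right_mono mult.commute)
    finally show ?thesis
      using p(3) poisson_kernel_nonneg[OF e(1), of "s - p"] ab by (simp add: poisson_average_def m_def abs_mult)
  qed
qed

text \<open>At the two endpoints only half the mass is captured in the limit, hence their exclusion;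
  in the plane they amount to null lines.\<close>

lemma poisson_average_limit:
  "(\<lambda>n. poisson_average (1 / real (Suc n)) a b s) \<longlonglongrightarrow> pi * indicator {a<..<b} s" if "a < b" "s \<noteq> a" "s \<noteq> b"
proof -
  have lim: "(\<lambda>n. arctan ((c - s) / (1 / real (Suc n)))) \<longlonglongrightarrow> (if s < c then pi / 2 else - (pi / 2))" if "s \<noteq> c" for c
  proof (cases "s < c")
    case True
    have "filterlim (\<lambda>n. (c - s) * real (Suc n)) at_top sequentially"
      using True by (intro filterlim_tendsto_pos_mult_at_top[OF tendsto_const]
          filterlim_compose[OF filterlim_real_sequentially filterlim_Suc]) auto
    from filterlim_compose[OF tendsto_arctan_at_top this] show ?thesis using True by simp
  next
    case False
    have "filterlim (\<lambda>n. (s - c) * real (Suc n)) at_top sequentially"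
      using False that by (intro filterlim_tendsto_pos_mult_at_top[OF tendsto_const]
          filterlim_compose[OF filterlim_real_sequentially filterlim_Suc]) auto
    from tendsto_minus[OF filterlim_compose[OF tendsto_arctan_at_top this]]
    have "(\<lambda>n. arctan (- ((s - c) * real (Suc n)))) \<longlonglongrightarrow> - (pi / 2)" by (simp add: arctan_minus)
    moreover have "- ((s - c) * real (Suc n)) = (c - s) / (1 / real (Suc n))" for n by (simp add: algebra_simps)
    ultimately show ?thesis using False by simp
  qed
  have "(\<lambda>n. poisson_average (1 / real (Suc n)) a b s) \<longlonglongrightarrow> (if s < b then pi / 2 else - (pi / 2)) - (if s < a then pi / 2 else - (pi / 2))"
    unfolding poisson_average_def using that by (intro tendsto_diff lim)
  moreover have "(if s < b then pi / 2 else - (pi / 2)) - (if s < a then pi / 2 else - (pi / 2)) = pi * indicator {a<..<b} s"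
    using that by (auto simp: indicator_def)
  ultimately show ?thesis by simp
qed

lemma integrable_inverse_square_decay: "integrable lborel (\<lambda>s :: real. 1 / (1 + s\<^sup>2))"
  using integrable_inverse_1_plus_square by (simp add: set_integrable_def einterval_eq inverse_eq_divide)

lemma integrable_product_decay:
  fixes f :: "R2 \<Rightarrow> real"
  assumes f: "f \<in> borel_measurable borel" "integrable lborel (\<lambda>x. (f x)\<^sup>2)"
    and \<rho>: "\<rho> \<in> borel_measurable borel" "\<And>s. \<bar>\<rho> s\<bar> \<le> C / (1 + s\<^sup>2)"
    and \<sigma>: "\<sigma> \<in> borel_measurable borel" "\<And>s. \<bar>\<sigma> s\<bar> \<le> C' / (1 + s\<^sup>2)"
  shows "integrable lborel (\<lambda>x. f x * (\<rho> (x $ 1) * \<sigma> (x $ 2)))"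
proof (rule integrable_mult_L2)
  have sq: "integrable lborel (\<lambda>s. (\<tau> s)\<^sup>2)"
    if t: "\<tau> \<in> borel_measurable borel" "\<And>s. \<bar>\<tau> s\<bar> \<le> c / (1 + s\<^sup>2)" for \<tau> :: "real \<Rightarrow> real" and c
  proof (rule Bochner_Integration.integrable_bound)
    show "integrable lborel (\<lambda>s :: real. c\<^sup>2 * (1 / (1 + s\<^sup>2)))" by (intro integrable_mult_right integrable_inverse_square_decay)
    show "(\<lambda>s. (\<tau> s)\<^sup>2) \<in> borel_measurable lborel" using t by simp
    show "AE s in lborel. norm ((\<tau> s)\<^sup>2) \<le> norm (c\<^sup>2 * (1 / (1 + s\<^sup>2)))"
    proof (rule AE_I2)
      fix s :: real
      have pos: "1 + s\<^sup>2 \<ge> 1" by simp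
      have "\<bar>\<tau> s\<bar>\<^sup>2 \<le> (c / (1 + s\<^sup>2))\<^sup>2" using t(2)[of s] by (intro power_mono) auto
      also have "\<dots> = c\<^sup>2 / (1 + s\<^sup>2)\<^sup>2" by (simp add: power_divide)
      also have "\<dots> \<le> c\<^sup>2 / (1 + s\<^sup>2)"
      proof (rule divide_left_mono)
        show "0 < (1 + s\<^sup>2)\<^sup>2 * (1 + s\<^sup>2)" using pos by (intro mult_pos_pos zero_less_power) linarith+
      qed (use self_le_power[OF pos, of 2] in auto)
      finally show "norm ((\<tau> s)\<^sup>2) \<le> norm (c\<^sup>2 * (1 / (1 + s\<^sup>2)))" using pos by simp
    qed
  qed
  show "integrable lborel (\<lambda>x :: R2. (\<rho> (x $ 1) * \<sigma> (x $ 2))\<^sup>2)"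
    unfolding power_mult_distrib by (intro integral_R2_product sq[OF \<rho>] sq[OF \<sigma>])
  show "(\<lambda>x :: R2. \<rho> (x $ 1) * \<sigma> (x $ 2)) \<in> borel_measurable lborel"
    using \<rho>(1)[measurable] \<sigma>(1)[measurable] by measurable
qed (use f in auto)

text \<open>Fubini over the centre p. As the kernel is nonnegative, integrating absolute values over
  p gives |f| times the average, so assumption \<open>i\<close> is exactly the absolute
  integrability that Fubini wants.\<close>

lemma integral_poisson_average_eq_0:
  fixes f :: "R2 \<Rightarrow> real"
  assumes m: "f \<in> borel_measurable borel" and e: "e > 0" and ab: "a \<le> b"
    and i: "integrable lborel (\<lambda>x. f x * poisson_average e a b (x $ k))"
    and z: "\<And>p. (LINT x|lborel. f x * poisson_kernel e (x $ k - p)) = 0"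
  shows "(LINT x|lborel. f x * poisson_average e a b (x $ k)) = 0"
proof -
  define F where "F x p = f x * (indicator {a..b} p * poisson_kernel e (x $ k - p))" for x p
  note [measurable] = m
  have pm[measurable]: "poisson_kernel e \<in> borel_measurable borel"
    by (intro borel_measurable_continuous_onI poisson_kernel_cont e)
  have int: "integrable (lborel \<Otimes>\<^sub>M lborel) (case_prod F)"
  proof (rule lborel_pair.Fubini_integrable)
    show "case_prod F \<in> borel_measurable (lborel \<Otimes>\<^sub>M lborel)"
    proof -
      have [measurable]: "(\<lambda>z :: R2 \<times> real. poisson_kernel e (fst z $ k - snd z)) \<in> borel_measurable (borel \<Otimes>\<^sub>M borel)"
        unfolding borel_prod
        by (intro borel_measurable_continuous_onI continuous_on_compose2[OF poisson_kernel_cont[OF e, of UNIV]] continuous_intros) auto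
      show ?thesis unfolding F_def case_prod_unfold by measurable
    qed
    have "(LINT p|lborel. norm (case_prod F (x, p))) = norm (f x * poisson_average e a b (x $ k))" for x
    proof -
      have "(LINT p|lborel. norm (case_prod F (x, p))) = (LINT p|lborel. \<bar>f x\<bar> * (indicator {a..b} p * poisson_kernel e (x $ k - p)))"
        by (intro Bochner_Integration.integral_cong refl) (simp add: F_def abs_mult poisson_kernel_nonneg[OF e])
      also have "\<dots> = \<bar>f x\<bar> * poisson_average e a b (x $ k)" using poisson_average_eq[OF e ab] by simp
      moreover have "0 \<le> poisson_average e a b (x $ k)"
        unfolding poisson_average_eq(2)[OF e ab, symmetric] using poisson_kernel_nonneg[OF e] by (intro integral_nonneg_AE) simp
      ultimately show ?thesis by (simp add: abs_mult)
    qed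
    then show "integrable lborel (\<lambda>x. LINT p|lborel. norm (case_prod F (x, p)))" using i by simp
    show "AE x in lborel. integrable lborel (\<lambda>p. case_prod F (x, p))"
      using poisson_average_eq(1)[OF e ab] by (simp add: F_def)
  qed
  have "(LINT x|lborel. f x * poisson_average e a b (x $ k)) = (LINT x|lborel. LINT p|lborel. F x p)"
    using poisson_average_eq[OF e ab] by (simp add: F_def)
  also have "\<dots> = (LINT p|lborel. LINT x|lborel. F x p)" by (rule lborel_pair.Fubini_integral[OF int, symmetric])
  also have "\<dots> = (LINT p|lborel. indicator {a..b} p * (LINT x|lborel. f x * poisson_kernel e (x $ k - p)))"
    by (intro Bochner_Integration.integral_cong refl) (simp add: F_def mult.left_commute flip: integral_mult_right_zero)
  also have "\<dots> = 0" by (simp add: z)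
  finally show ?thesis .
qed

lemma AE_coordinate_neq: "AE x in (lborel :: R2 measure). x $ i \<noteq> c"
proof -
  have "negligible {x :: R2. x \<bullet> axis i 1 = c}" by (rule negligible_standard_hyperplane) simp
  moreover have "{x :: R2. x \<bullet> axis i 1 = c} = {x. x $ i = c}" by (simp add: inner_axis)
  moreover have "{x :: R2. x $ i = c} \<in> sets borel"
    by (intro borel_closed closed_Collect_eq continuous_intros)
  ultimately have "{x :: R2. x $ i = c} \<in> null_sets lborel"
    by (simp add: negligible_iff_null_sets null_sets_completion_iff)
  then show ?thesis using AE_not_in by fastforce
qed

text \<open>\<open>ennreal\<close> cuts off negative values, so \<open>ennreal (f x)\<close> and
  \<open>ennreal (- f x)\<close> are the positive and negative parts of f. The measures with these
  densities agree on boxes, an intersection-stable generator of the Borel sets, hence everywhere;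
  two parts that never are positive together can only agree by vanishing.\<close>

lemma AE_zero_if_box_integrals_zero:
  fixes f :: "R2 \<Rightarrow> real"
  assumes m: "f \<in> borel_measurable borel" and i: "\<And>a b. integrable lborel (\<lambda>x. f x * indicator (box a b) x)"
    and z: "\<And>a b. (LINT x|lborel. f x * indicator (box a b) x) = 0"
  shows "AE x in lborel. f x = 0"
proof -
  note [measurable] = m
  have fin: "(\<integral>\<^sup>+x. ennreal (f x) * indicator (box a b) x \<partial>lborel) < \<infinity>"
    and eq: "(\<integral>\<^sup>+x. ennreal (f x) * indicator (box a b) x \<partial>lborel) = (\<integral>\<^sup>+x. ennreal (- f x) * indicator (box a b) x \<partial>lborel)" for a b
  proof -
    define g where "g x = f x * indicator (box a b) x" for x
    have ig: "integrable lborel g" and zg: "(LINT x|lborel. g x) = 0" using i z by (simp_all add: g_def[abs_def])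
    have e: "ennreal (g x) = ennreal (f x) * indicator (box a b) x" "ennreal (- g x) = ennreal (- f x) * indicator (box a b) x" for x
      by (simp_all add: g_def indicator_def)
    have f1: "(\<integral>\<^sup>+x. ennreal (g x) \<partial>lborel) < \<infinity>" "(\<integral>\<^sup>+x. ennreal (- g x) \<partial>lborel) < \<infinity>"
      using ig by (auto simp: real_integrable_def less_top)
    have "enn2real (\<integral>\<^sup>+x. ennreal (g x) \<partial>lborel) = enn2real (\<integral>\<^sup>+x. ennreal (- g x) \<partial>lborel)"
      using real_lebesgue_integral_def[OF ig] zg by simp
    then have "(\<integral>\<^sup>+x. ennreal (g x) \<partial>lborel) = (\<integral>\<^sup>+x. ennreal (- g x) \<partial>lborel)"
      using f1 by (metis ennreal_enn2real infinity_ennreal_def)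
    then show "(\<integral>\<^sup>+x. ennreal (f x) * indicator (box a b) x \<partial>lborel) < \<infinity>"
      "(\<integral>\<^sup>+x. ennreal (f x) * indicator (box a b) x \<partial>lborel) = (\<integral>\<^sup>+x. ennreal (- f x) * indicator (box a b) x \<partial>lborel)"
      using f1 by (simp_all add: e)
  qed
  have "density lborel (\<lambda>x. ennreal (f x)) = density lborel (\<lambda>x. ennreal (- f x))"
  proof (rule measure_eqI_generator_eq)
    let ?E = "range (\<lambda>(a, b). box a b :: R2 set)"
    show "Int_stable ?E" by (auto simp: Int_stable_def box_Int_box)
    show "?E \<subseteq> Pow UNIV" "sets (density lborel (\<lambda>x. ennreal (f x))) = sigma_sets UNIV ?E"
      "sets (density lborel (\<lambda>x. ennreal (- f x))) = sigma_sets UNIV ?E"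
      by (simp_all add: borel_eq_box)
    let ?A = "\<lambda>n::nat. box (- (real n *\<^sub>R One)) (real n *\<^sub>R One) :: R2 set"
    show "range ?A \<subseteq> ?E" "(\<Union>i. ?A i) = UNIV" unfolding UN_box_eq_UNIV by auto
    show "emeasure (density lborel (\<lambda>x. ennreal (f x))) (?A n) \<noteq> \<infinity>" for n
      using fin[of "- (real n *\<^sub>R One)" "real n *\<^sub>R One"] by (subst emeasure_density) auto
    show "emeasure (density lborel (\<lambda>x. ennreal (f x))) X = emeasure (density lborel (\<lambda>x. ennreal (- f x))) X" if "X \<in> ?E" for X
      using that eq by (auto simp: emeasure_density)
  qed
  then have "AE x in lborel. ennreal (f x) = ennreal (- f x)"
    by (subst (asm) sigma_finite_measure.density_unique_iff[OF sigma_finite_lborel]) auto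
  then show ?thesis
  proof eventually_elim
    case (elim x)
    show ?case
    proof (rule ccontr)
      assume "f x \<noteq> 0"
      then have "f x > 0 \<or> f x < 0" by auto
      then show False using elim by (auto simp: ennreal_neg ennreal_eq_0_iff)
    qed
  qed
qed

text \<open>The centres are averaged one coordinate at a time, and only then does e tend to 0. The
  product of the averages converges to the square of pi times the indicator of a box, off the lines
  through its sides.\<close>

lemma AE_zero_if_poisson_integrals_zero:
  fixes f :: "R2 \<Rightarrow> real"
  assumes f: "f \<in> borel_measurable borel" "integrable lborel (\<lambda>x. (f x)\<^sup>2)"
    and z: "\<And>e p q. e > 0 \<Longrightarrow> (LINT x|lborel. f x * (poisson_kernel e (x $ 1 - p) * poisson_kernel e (x $ 2 - q))) = 0"
  shows "AE x in lborel. f x = 0"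
proof -
  note [measurable] = f(1)
  have pm[measurable]: "poisson_kernel e \<in> borel_measurable borel" if "e > 0" for e
    by (intro borel_measurable_continuous_onI poisson_kernel_cont that)
  have am[measurable]: "poisson_average e a b \<in> borel_measurable borel" for e a b
    unfolding poisson_average_def by (intro borel_measurable_diff borel_measurable_arctan) auto
  have avg: "(LINT x|lborel. f x * (poisson_average e a b (x $ 1) * poisson_average e a' b' (x $ 2))) = 0"
    if e: "0 < e" "e \<le> 1" and ab: "a < b" "a' < b'" for e a b a' b'
  proof -
    obtain C where C: "\<And>s. \<bar>poisson_average e a b s\<bar> \<le> C / (1 + s\<^sup>2)" using poisson_average_decay[OF ab(1)] e by blast
    obtain C' where C': "\<And>s. \<bar>poisson_average e a' b' s\<bar> \<le> C' / (1 + s\<^sup>2)" using poisson_average_decay[OF ab(2)] e by blast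
    have 1: "(LINT x|lborel. (f x * poisson_kernel e (x $ 2 - q)) * poisson_average e a b (x $ 1)) = 0" for q
    proof (rule integral_poisson_average_eq_0[OF _ e(1) less_imp_le[OF ab(1)]])
      show "(\<lambda>x. f x * poisson_kernel e (x $ 2 - q)) \<in> borel_measurable borel" using pm[OF e(1), measurable] by measurable
      obtain c where c: "\<And>s. \<bar>poisson_kernel e (s - q)\<bar> \<le> c / (1 + s\<^sup>2)" using poisson_kernel_decay[OF e(1)] by blast
      have "integrable lborel (\<lambda>x. f x * (poisson_average e a b (x $ 1) * poisson_kernel e (x $ 2 - q)))"
        by (rule integrable_product_decay[OF f am C _ c]) (use pm[OF e(1), measurable] in measurable)
      then show "integrable lborel (\<lambda>x. (f x * poisson_kernel e (x $ 2 - q)) * poisson_average e a b (x $ 1))"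
        by (simp add: mult_ac)
      show "(LINT x|lborel. f x * poisson_kernel e (x $ 2 - q) * poisson_kernel e (x $ 1 - p)) = 0" for p
        using z[OF e(1), of p q] by (simp add: mult_ac)
    qed
    have "(LINT x|lborel. (f x * poisson_average e a b (x $ 1)) * poisson_average e a' b' (x $ 2)) = 0"
    proof (rule integral_poisson_average_eq_0[OF _ e(1) less_imp_le[OF ab(2)]])
      show "(\<lambda>x. f x * poisson_average e a b (x $ 1)) \<in> borel_measurable borel" by measurable
      show "integrable lborel (\<lambda>x. (f x * poisson_average e a b (x $ 1)) * poisson_average e a' b' (x $ 2))"
        using integrable_product_decay[OF f am C am C'] by (simp add: mult.assoc)
      show "(LINT x|lborel. f x * poisson_average e a b (x $ 1) * poisson_kernel e (x $ 2 - p)) = 0" for p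
        using 1[of p] by (simp add: mult_ac)
    qed
    then show ?thesis by (simp add: mult.assoc)
  qed
  have box_eq: "indicator (box u v) x = indicator {u $ 1<..<v $ 1} (x $ 1) * (indicator {u $ 2<..<v $ 2} (x $ 2) :: real)" for u v x :: R2
    by (auto simp: indicator_def mem_box Basis_R2 inner_axis)
  have box_int: "integrable lborel (\<lambda>x. f x * indicator (box u v) x)" for u v :: R2
  proof (rule integrable_mult_L2[OF _ f(2)])
    have "integrable lborel (indicator (box u v) :: R2 \<Rightarrow> real)"
      using emeasure_lborel_box_finite[of u v] by (intro integrable_real_indicator) auto
    moreover have "(\<lambda>x. (indicator (box u v) x)\<^sup>2) = (indicator (box u v) :: R2 \<Rightarrow> real)"
      by (auto simp: indicator_def fun_eq_iff)
    ultimately show "integrable lborel (\<lambda>x. (indicator (box u v) x :: real)\<^sup>2)" by simp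
  qed (use f in auto)
  have box0: "(LINT x|lborel. f x * indicator (box u v) x) = 0" for u v :: R2
  proof (cases "u $ 1 < v $ 1 \<and> u $ 2 < v $ 2")
    case True
    obtain C where C: "\<And>e s. 0 < e \<Longrightarrow> e \<le> 1 \<Longrightarrow> \<bar>poisson_average e (u $ 1) (v $ 1) s\<bar> \<le> C / (1 + s\<^sup>2)"
      using poisson_average_decay[of "u $ 1" "v $ 1"] True by blast
    obtain C' where C': "\<And>e s. 0 < e \<Longrightarrow> e \<le> 1 \<Longrightarrow> \<bar>poisson_average e (u $ 2) (v $ 2) s\<bar> \<le> C' / (1 + s\<^sup>2)"
      using poisson_average_decay[of "u $ 2" "v $ 2"] True by blast
    define en where "en n = 1 / real (Suc n)" for n
    have en: "0 < en n" "en n \<le> 1" for n by (simp_all add: en_def)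
    \<comment> \<open>The outer absolute value spares a sign condition on the decay constants C and
      C'.\<close>
    define W where "W x = \<bar>f x * (C / (1 + (x $ 1)\<^sup>2) * (C' / (1 + (x $ 2)\<^sup>2)))\<bar>" for x :: R2
    have iW: "integrable lborel W"
    proof -
      have "integrable lborel (\<lambda>x. f x * ((C / (1 + (x $ 1)\<^sup>2)) * (C' / (1 + (x $ 2)\<^sup>2))))"
        by (rule integrable_product_decay[OF f, where C="\<bar>C\<bar>" and C'="\<bar>C'\<bar>"]) (auto simp: abs_mult)
      then show ?thesis unfolding W_def[abs_def] by (rule Bochner_Integration.integrable_abs)
    qed
    have "(\<lambda>n. LINT x|lborel. f x * (poisson_average (en n) (u $ 1) (v $ 1) (x $ 1) * poisson_average (en n) (u $ 2) (v $ 2) (x $ 2)))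
        \<longlonglongrightarrow> (LINT x|lborel. f x * (pi * indicator {u $ 1<..<v $ 1} (x $ 1) * (pi * indicator {u $ 2<..<v $ 2} (x $ 2))))"
    proof (rule integral_dominated_convergence[OF _ _ iW])
      show "AE x in lborel. (\<lambda>n. f x * (poisson_average (en n) (u $ 1) (v $ 1) (x $ 1) * poisson_average (en n) (u $ 2) (v $ 2) (x $ 2)))
        \<longlonglongrightarrow> f x * (pi * indicator {u $ 1<..<v $ 1} (x $ 1) * (pi * indicator {u $ 2<..<v $ 2} (x $ 2)))"
        using AE_coordinate_neq[of 1 "u $ 1"] AE_coordinate_neq[of 1 "v $ 1"] AE_coordinate_neq[of 2 "u $ 2"] AE_coordinate_neq[of 2 "v $ 2"]
      proof eventually_elim
        case (elim x)
        then show ?case unfolding en_def using True by (intro tendsto_mult tendsto_const poisson_average_limit) auto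
      qed
      show "AE x in lborel. norm (f x * (poisson_average (en n) (u $ 1) (v $ 1) (x $ 1) * poisson_average (en n) (u $ 2) (v $ 2) (x $ 2))) \<le> W x" for n
      proof (rule AE_I2)
        fix x :: R2
        have "\<bar>poisson_average (en n) (u $ 1) (v $ 1) (x $ 1)\<bar> \<le> \<bar>C / (1 + (x $ 1)\<^sup>2)\<bar>"
          "\<bar>poisson_average (en n) (u $ 2) (v $ 2) (x $ 2)\<bar> \<le> \<bar>C' / (1 + (x $ 2)\<^sup>2)\<bar>"
          using C[OF en] C'[OF en] by (meson abs_ge_self order_trans)+
        then show "norm (f x * (poisson_average (en n) (u $ 1) (v $ 1) (x $ 1) * poisson_average (en n) (u $ 2) (v $ 2) (x $ 2))) \<le> W x"
          unfolding W_def real_norm_def abs_mult by (intro mult_left_mono mult_mono) auto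
      qed
    qed measurable
    then have "(LINT x|lborel. f x * (pi * indicator {u $ 1<..<v $ 1} (x $ 1) * (pi * indicator {u $ 2<..<v $ 2} (x $ 2)))) = 0"
      using avg[OF en] True by (simp add: LIMSEQ_const_iff)
    moreover have "(\<lambda>x. f x * (pi * indicator {u $ 1<..<v $ 1} (x $ 1) * (pi * indicator {u $ 2<..<v $ 2} (x $ 2)))) =
        (\<lambda>x. (pi * pi) * (f x * indicator (box u v) x))"
      by (simp add: box_eq fun_eq_iff mult_ac)
    ultimately show ?thesis by simp
  next
    case False
    then have "box u v = {}" by (auto simp: box_eq_empty Basis_R2 inner_axis not_less)
    then show ?thesis by simp
  qed
  show ?thesis by (rule AE_zero_if_box_integrals_zero[OF f(1) box_int box0])
qed

lemma fourier_truncation_measurable: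
  assumes "f \<in> borel_measurable borel"
  shows "fourier_integral f \<in> borel_measurable borel"
proof -
  note [measurable] = assms
  have ie[measurable]: "(\<lambda>z :: R2 \<times> R2. exp (- \<i> * complex_of_real (snd z \<bullet> fst z))) \<in> borel_measurable (borel \<Otimes>\<^sub>M borel)"
    unfolding borel_prod by (intro borel_measurable_continuous_onI continuous_intros)
  have "(\<lambda>(\<xi>, x). exp (- \<i> * complex_of_real (x \<bullet> \<xi>)) * f x) \<in> borel_measurable (lborel \<Otimes>\<^sub>M lborel)"
    unfolding case_prod_unfold by measurable
  from lborel.borel_measurable_lebesgue_integral[OF this]
  show ?thesis by (simp add: fourier_integral_def[abs_def])
qed

text \<open>Plancherel's identity is bypassed. If g is null, the transforms of the truncations of f
  tend to 0 in L^2, and so do their pairings with a bounded integrable test function. The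
  multiplication formula rewrites these as pairings of the truncations with Poisson kernels, which
  converge to the pairings of f itself. All of the latter therefore vanish.\<close>

theorem fourier_transform_injective:
  fixes f :: "R2 \<Rightarrow> real"
  assumes ft: "has_fourier_transform (\<lambda>x. complex_of_real (f x)) g" and g0: "AE \<xi> in lborel. g \<xi> = 0"
  shows "AE x in lborel. f x = 0"
proof -
  let ?f = "\<lambda>x. complex_of_real (f x)"
  from ft have sq: "square_integrable ?f" and sqg: "square_integrable g"
    and lim: "((\<lambda>R. \<integral>\<^sup>+\<xi>. ennreal ((cmod (fourier_integral (\<lambda>x. indicator (cball 0 R) x * ?f x) \<xi> - g \<xi>))\<^sup>2) \<partial>lborel) \<longlongrightarrow> 0) at_top"
    unfolding has_fourier_transform_def by auto
  have fm: "f \<in> borel_measurable borel"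
  proof -
    from sq have "?f \<in> borel_measurable borel" by (simp add: square_integrable_def)
    then have "(\<lambda>x. Re (?f x)) \<in> borel_measurable borel" by (rule measurable_compose) measurable
    then show ?thesis by simp
  qed
  note [measurable] = fm
  have f2: "integrable lborel (\<lambda>x. (f x)\<^sup>2)" using sq by (simp add: square_integrable_def)
  define fn where "fn n x = indicator (cball 0 (real n)) x * ?f x" for n x
  have fnm: "fn n \<in> borel_measurable borel" for n
    using sq unfolding fn_def square_integrable_def by (intro borel_measurable_times borel_measurable_indicator) auto
  have ifn: "integrable lborel (fn n)" for n
  proof -
    have "integrable lborel (\<lambda>x. f x * indicator (cball 0 (real n)) x)"
    proof (rule integrable_mult_L2[OF _ f2])
      have "integrable lborel (indicator (cball 0 (real n)) :: R2 \<Rightarrow> real)"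
        using emeasure_lborel_cball_finite[of "0::R2" "real n"] by (intro integrable_real_indicator) auto
      moreover have "(\<lambda>x. (indicator (cball 0 (real n)) x)\<^sup>2) = (indicator (cball 0 (real n)) :: R2 \<Rightarrow> real)"
        by (auto simp: indicator_def fun_eq_iff)
      ultimately show "integrable lborel (\<lambda>x :: R2. (indicator (cball 0 (real n)) x :: real)\<^sup>2)" by simp
    qed (use fm in \<open>auto intro!: borel_measurable_indicator\<close>)
    then have "integrable lborel (\<lambda>x. complex_of_real (f x * indicator (cball 0 (real n)) x))"
      by (rule integrable_of_real)
    moreover have "(\<lambda>x. complex_of_real (f x * indicator (cball 0 (real n)) x)) = fn n"
      by (auto simp: fn_def fun_eq_iff indicator_def)
    ultimately show ?thesis by simp
  qed
  define \<tau> where "\<tau> n = (\<integral>\<^sup>+\<xi>. ennreal ((cmod (fourier_integral (fn n) \<xi>))\<^sup>2) \<partial>lborel)" for n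
  have \<tau>: "\<tau> \<longlonglongrightarrow> 0"
  proof -
    have "(\<lambda>n. \<integral>\<^sup>+\<xi>. ennreal ((cmod (fourier_integral (fn n) \<xi> - g \<xi>))\<^sup>2) \<partial>lborel) \<longlonglongrightarrow> 0"
      using filterlim_compose[OF lim filterlim_real_sequentially] by (simp add: fn_def[abs_def])
    moreover have "(\<integral>\<^sup>+\<xi>. ennreal ((cmod (fourier_integral (fn n) \<xi> - g \<xi>))\<^sup>2) \<partial>lborel) = \<tau> n" for n
      unfolding \<tau>_def by (rule nn_integral_cong_AE) (use g0 in eventually_elim, simp)
    ultimately show ?thesis by simp
  qed
  show ?thesis
  proof (rule AE_zero_if_poisson_integrals_zero[OF fm f2])
    fix e p q :: real assume e: "e > 0"
    define P where "P = plane_point p q"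
    have P: "P $ 1 = p" "P $ 2 = q" by (simp_all add: P_def)
    define G where "G \<xi> = damped_wave e p (\<xi> $ 1) * damped_wave e q (\<xi> $ 2)" for \<xi> :: R2
    define k where "k x = poisson_kernel e (x $ 1 - p) * poisson_kernel e (x $ 2 - q)" for x :: R2
    have iG: "integrable lborel G" unfolding G_def by (intro integral_R2_product fourier_damped_wave e)
    have Gm: "G \<in> borel_measurable borel" using iG by auto
    have G1: "cmod (G \<xi>) \<le> 1" for \<xi>
      using e by (simp add: G_def norm_mult norm_damped_wave mult_le_one)
    have km: "k \<in> borel_measurable borel" unfolding k_def
    proof -
      have [measurable]: "poisson_kernel e \<in> borel_measurable borel"
        by (intro borel_measurable_continuous_onI poisson_kernel_cont e)
      show "(\<lambda>x :: R2. poisson_kernel e (x $ 1 - p) * poisson_kernel e (x $ 2 - q)) \<in> borel_measurable borel" by measurable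
    qed
    obtain c1 where c1: "\<And>s. \<bar>poisson_kernel e (s - p)\<bar> \<le> c1 / (1 + s\<^sup>2)" using poisson_kernel_decay[OF e] by blast
    obtain c2 where c2: "\<And>s. \<bar>poisson_kernel e (s - q)\<bar> \<le> c2 / (1 + s\<^sup>2)" using poisson_kernel_decay[OF e] by blast
    have pkm: "(\<lambda>s. poisson_kernel e (s - r)) \<in> borel_measurable borel" for r
      by (intro borel_measurable_continuous_onI continuous_on_compose2[OF poisson_kernel_cont[OF e, of UNIV]] continuous_intros) auto
    have ik: "integrable lborel (\<lambda>x. f x * k x)"
      unfolding k_def by (rule integrable_product_decay[OF fm f2 pkm c1 pkm c2])
    have pair: "(LINT \<xi>|lborel. fourier_integral (fn n) \<xi> * G \<xi>) = 4 * (LINT x|lborel. fn n x * complex_of_real (k x))" for n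
    proof -
      have "fn n x * complex_of_real (4 * (poisson_kernel e (x $ 1 - p) * poisson_kernel e (x $ 2 - q))) =
          4 * (fn n x * complex_of_real (k x))" for x
        by (simp add: k_def)
      then show ?thesis
        using fourier_truncation_pairing[OF ifn e, of n P]
        by (simp only: P G_def[symmetric] integral_mult_right_zero)
    qed
    have conv: "(\<lambda>n. LINT x|lborel. fn n x * complex_of_real (k x)) \<longlonglongrightarrow> (LINT x|lborel. ?f x * complex_of_real (k x))"
    proof (rule integral_dominated_convergence[where w="\<lambda>x. \<bar>f x * k x\<bar>"])
      show "AE x in lborel. (\<lambda>n. fn n x * complex_of_real (k x)) \<longlonglongrightarrow> ?f x * complex_of_real (k x)"
      proof (rule AE_I2)
        fix x :: R2
        have "\<forall>\<^sub>F n in sequentially. norm x \<le> real n"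
          using filterlim_real_sequentially unfolding filterlim_at_top by blast
        then have "\<forall>\<^sub>F n in sequentially. fn n x * complex_of_real (k x) = ?f x * complex_of_real (k x)"
          by eventually_elim (simp add: fn_def)
        then show "(\<lambda>n. fn n x * complex_of_real (k x)) \<longlonglongrightarrow> ?f x * complex_of_real (k x)" by (rule tendsto_eventually)
      qed
      show "AE x in lborel. norm (fn n x * complex_of_real (k x)) \<le> \<bar>f x * k x\<bar>" for n
        by (intro AE_I2) (auto simp: fn_def norm_mult abs_mult indicator_def)
    qed (use ik km fnm in auto)
    define L where "L = (LINT x|lborel. ?f x * complex_of_real (k x))"
    define IG where "IG = (LINT \<xi>|lborel. cmod (G \<xi>))"
    have IG: "(\<integral>\<^sup>+\<xi>. ennreal (cmod (G \<xi>)) \<partial>lborel) = ennreal IG" "IG \<ge> 0"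
      unfolding IG_def using iG by (auto intro!: nn_integral_eq_integral)
    \<comment> \<open>Young's inequality with weight d, where |G| \<le> 1 reduces |G|^2 to |G| and
      thus to an L^1 norm; n tends to infinity before d tends to 0.\<close>
    have est: "ennreal (cmod (4 * (LINT x|lborel. fn n x * complex_of_real (k x)))) \<le> ennreal d * ennreal IG + ennreal (1 / d) * \<tau> n"
      if d: "d > 0" for d n
    proof -
      have Fm: "fourier_integral (fn n) \<in> borel_measurable borel" by (rule fourier_truncation_measurable[OF fnm])
      \<comment> \<open>If the product is not integrable, its Bochner integral is 0 by default and
        the bound is trivial.\<close>
      have "ennreal (cmod (4 * (LINT x|lborel. fn n x * complex_of_real (k x)))) \<le>
          (\<integral>\<^sup>+\<xi>. ennreal (cmod (fourier_integral (fn n) \<xi> * G \<xi>)) \<partial>lborel)"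
        unfolding pair[symmetric]
      proof (cases "integrable lborel (\<lambda>\<xi>. fourier_integral (fn n) \<xi> * G \<xi>)")
        case True
        then show "ennreal (cmod (LINT \<xi>|lborel. fourier_integral (fn n) \<xi> * G \<xi>)) \<le> (\<integral>\<^sup>+\<xi>. ennreal (cmod (fourier_integral (fn n) \<xi> * G \<xi>)) \<partial>lborel)"
          by (rule integral_norm_bound_ennreal)
      qed (simp add: not_integrable_integral_eq)
      also have "\<dots> \<le> (\<integral>\<^sup>+\<xi>. ennreal d * ennreal (cmod (G \<xi>)) + ennreal (1 / d) * ennreal ((cmod (fourier_integral (fn n) \<xi>))\<^sup>2) \<partial>lborel)"
      proof (rule nn_integral_mono)
        fix \<xi>
        have "cmod (fourier_integral (fn n) \<xi> * G \<xi>) \<le> d * (cmod (G \<xi>))\<^sup>2 + (cmod (fourier_integral (fn n) \<xi>))\<^sup>2 / d"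
        proof -
          have "0 \<le> (d * cmod (G \<xi>) - cmod (fourier_integral (fn n) \<xi>))\<^sup>2 / d" using d by simp
          also have "\<dots> = d * (cmod (G \<xi>))\<^sup>2 + (cmod (fourier_integral (fn n) \<xi>))\<^sup>2 / d - 2 * (cmod (fourier_integral (fn n) \<xi>) * cmod (G \<xi>))"
            using d by (simp add: power2_eq_square field_simps)
          finally show ?thesis
            using mult_nonneg_nonneg[OF norm_ge_zero[of "fourier_integral (fn n) \<xi>"] norm_ge_zero[of "G \<xi>"]]
            unfolding norm_mult by linarith
        qed
        also have "d * (cmod (G \<xi>))\<^sup>2 \<le> d * cmod (G \<xi>)"
          using d G1[of \<xi>] by (intro mult_left_mono) (auto simp: power2_eq_square mult_left_le)
        finally have "ennreal (cmod (fourier_integral (fn n) \<xi> * G \<xi>)) \<le> ennreal (d * cmod (G \<xi>) + (1 / d) * (cmod (fourier_integral (fn n) \<xi>))\<^sup>2)"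
          by (intro ennreal_leI) simp
        also have "\<dots> = ennreal d * ennreal (cmod (G \<xi>)) + ennreal (1 / d) * ennreal ((cmod (fourier_integral (fn n) \<xi>))\<^sup>2)"
          using d by (subst ennreal_plus) (auto simp: ennreal_mult[symmetric])
        finally show "ennreal (cmod (fourier_integral (fn n) \<xi> * G \<xi>)) \<le> ennreal d * ennreal (cmod (G \<xi>)) + ennreal (1 / d) * ennreal ((cmod (fourier_integral (fn n) \<xi>))\<^sup>2)" .
      qed
      also have "\<dots> = ennreal d * ennreal IG + ennreal (1 / d) * \<tau> n"
        unfolding \<tau>_def IG(1)[symmetric] using Gm Fm by (simp add: nn_integral_add nn_integral_cmult)
      finally show ?thesis .
    qed
    have "cmod (4 * L) \<le> d * IG" if d: "d > 0" for d
    proof -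
      have "ennreal (cmod (4 * L)) \<le> ennreal d * ennreal IG"
      proof (rule LIMSEQ_le)
        show "(\<lambda>n. ennreal (cmod (4 * (LINT x|lborel. fn n x * complex_of_real (k x))))) \<longlonglongrightarrow> ennreal (cmod (4 * L))"
          unfolding L_def by (intro tendsto_ennrealI tendsto_norm tendsto_mult tendsto_const conv)
        have "(\<lambda>n. ennreal d * ennreal IG + ennreal (1 / d) * \<tau> n) \<longlonglongrightarrow> ennreal d * ennreal IG + ennreal (1 / d) * 0"
          by (intro tendsto_add tendsto_const ennreal_tendsto_cmult \<tau>) simp
        then show "(\<lambda>n. ennreal d * ennreal IG + ennreal (1 / d) * \<tau> n) \<longlonglongrightarrow> ennreal d * ennreal IG" by simp
        show "\<exists>N. \<forall>n\<ge>N. ennreal (cmod (4 * (LINT x|lborel. fn n x * complex_of_real (k x)))) \<le> ennreal d * ennreal IG + ennreal (1 / d) * \<tau> n"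
          using est[OF d] by blast
      qed
      then show ?thesis using d IG(2) by (simp add: ennreal_le_iff flip: ennreal_mult)
    qed
    then have dd: "cmod (4 * L) \<le> d * IG" if "d > 0" for d using that by blast
    have "cmod (4 * L) \<le> 0"
    proof (rule field_le_epsilon)
      fix r :: real assume r: "r > 0"
      have "cmod (4 * L) \<le> r / (IG + 1) * IG" using r IG(2) by (intro dd) simp
      also have "\<dots> \<le> r / (IG + 1) * (IG + 1)" using r IG(2) by (intro mult_left_mono) auto
      finally show "cmod (4 * L) \<le> 0 + r" using IG(2) by simp
    qed
    then have "L = 0" by simp
    moreover have "L = complex_of_real (LINT x|lborel. f x * k x)"
      unfolding L_def by (simp flip: of_real_mult integral_complex_of_real)
    ultimately show "(LINT x|lborel. f x * (poisson_kernel e (x $ 1 - p) * poisson_kernel e (x $ 2 - q))) = 0"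
      by (simp add: k_def)
  qed
qed

text \<open>For the zero function the truncation error does not depend on the radius, so its limit 0
  is its value.\<close>

lemma fourier_transform_zero:
  assumes "has_fourier_transform (\<lambda>x. 0) g"
  shows "AE \<xi> in lborel. g \<xi> = 0"
proof -
  have "((\<lambda>R :: real. \<integral>\<^sup>+\<xi>. ennreal ((cmod (g \<xi>))\<^sup>2) \<partial>lborel) \<longlongrightarrow> 0) at_top"
    using assms by (simp add: has_fourier_transform_def fourier_integral_def)
  then have "(\<integral>\<^sup>+\<xi>. ennreal ((cmod (g \<xi>))\<^sup>2) \<partial>lborel) = 0"
    using tendsto_unique[OF trivial_limit_at_top_linorder tendsto_const] by blast
  moreover have [measurable]: "g \<in> borel_measurable borel"
    using assms by (simp add: has_fourier_transform_def square_integrable_def)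
  ultimately have "AE \<xi> in lborel. ennreal ((cmod (g \<xi>))\<^sup>2) = 0"
    by (subst (asm) nn_integral_0_iff_AE) auto
  then show ?thesis by eventually_elim (simp add: ennreal_eq_0_iff)
qed

text \<open>The function m is tied to \<psi> only through its products with the coordinates. The
  product with the first coordinate is null, so m vanishes almost everywhere off the null line where
  that coordinate is 0, and the transform of f vanishes with it.\<close>

lemma Lambda_zero_of_grad_zero:
  assumes Lam: "is_Lambda \<psi> f" and grad: "\<And>x. grad \<psi> x = 0"
  shows "AE x in lborel. f x = 0"
proof -
  obtain m where m: "\<And>i. has_fourier_transform (\<lambda>x. complex_of_real (grad \<psi> x $ i)) (\<lambda>\<xi>. \<i> * complex_of_real (\<xi> $ i) * m \<xi>)"
    and f: "has_fourier_transform (\<lambda>x. complex_of_real (f x)) (\<lambda>\<xi>. complex_of_real (Lambda_symbol \<xi>) * m \<xi>)"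
    using Lam unfolding is_Lambda_def has_fourier_mod_const_def by blast
  have "AE \<xi> in lborel. \<i> * complex_of_real (\<xi> $ i) * m \<xi> = 0" for i
    using m[of i] by (intro fourier_transform_zero) (simp add: grad)
  from this[of 1] AE_coordinate_neq[of 1 0] have "AE \<xi> in lborel. complex_of_real (Lambda_symbol \<xi>) * m \<xi> = 0"
    by eventually_elim simp
  then show ?thesis by (rule fourier_transform_injective[OF f])
qed

theorem mainTheorem2:
  fixes \<theta> :: "real \<Rightarrow> real"
  assumes "admissible_cutoff \<theta>"
  shows "\<exists>\<epsilon>::real. \<epsilon> > 0 \<and>
    (\<forall>(h\<^sub>0 :: R2 \<Rightarrow> real) (\<psi>\<^sub>0 :: R2 \<Rightarrow> real) (\<Lambda>\<psi>\<^sub>0 :: R2 \<Rightarrow> real) (c :: R2).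
       traveling_wave_solution h\<^sub>0 \<psi>\<^sub>0 c \<longrightarrow>
       is_Lambda \<psi>\<^sub>0 \<Lambda>\<psi>\<^sub>0 \<longrightarrow>
       sobolev_norm (real N0 + 1 / 2) (\<lambda>x. complex_of_real (h\<^sub>0 x))
         + sobolev_norm (real N0) (\<lambda>x. complex_of_real (\<Lambda>\<psi>\<^sub>0 x))
         + (Z_norm \<theta> (\<lambda>x. complex_of_real (h\<^sub>0 x)) + Z_norm \<theta> (\<lambda>x. complex_of_real (\<Lambda>\<psi>\<^sub>0 x)))
         + (fourier_Linf_norm (\<lambda>x. complex_of_real (h\<^sub>0 x))
            + fourier_Linf_norm (\<lambda>x. complex_of_real (\<Lambda>\<psi>\<^sub>0 x)))
         \<le> ennreal \<epsilon> \<longrightarrow>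
       (\<forall>x. h\<^sub>0 x = 0) \<and> (AE x in lborel. \<Lambda>\<psi>\<^sub>0 x = 0))"
proof (intro exI[of _ "1 :: real"] conjI allI impI)
  obtain \<theta>1 \<theta>2 B where bump: "smooth_bump \<theta> \<theta>1 \<theta>2 B" using smooth_bump_of_cutoff[OF assms] by blast
  fix h\<^sub>0 \<psi>\<^sub>0 \<Lambda>\<psi>\<^sub>0 :: "R2 \<Rightarrow> real" and c :: R2
  assume sol: "traveling_wave_solution h\<^sub>0 \<psi>\<^sub>0 c" and Lam: "is_Lambda \<psi>\<^sub>0 \<Lambda>\<psi>\<^sub>0"
    and small: "sobolev_norm (real N0 + 1 / 2) (\<lambda>x. complex_of_real (h\<^sub>0 x))
         + sobolev_norm (real N0) (\<lambda>x. complex_of_real (\<Lambda>\<psi>\<^sub>0 x))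
         + (Z_norm \<theta> (\<lambda>x. complex_of_real (h\<^sub>0 x)) + Z_norm \<theta> (\<lambda>x. complex_of_real (\<Lambda>\<psi>\<^sub>0 x)))
         + (fourier_Linf_norm (\<lambda>x. complex_of_real (h\<^sub>0 x))
            + fourier_Linf_norm (\<lambda>x. complex_of_real (\<Lambda>\<psi>\<^sub>0 x)))
         \<le> ennreal 1"
  \<comment> \<open>The Sobolev norm is \<open>top\<close> outside L^2, so a finite bound on the sum
    contains the square integrability of the elevation.\<close>
  have h_L2: "square_integrable (\<lambda>x. complex_of_real (h\<^sub>0 x))"
    using small by (auto simp: sobolev_norm_def[of "real N0 + 1 / 2"] top_unique split: if_splits)
  obtain \<phi> D where "steady_wave h\<^sub>0 (grad h\<^sub>0) \<psi>\<^sub>0 (grad \<psi>\<^sub>0) \<phi> D c"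
    using steady_wave_of_solution[OF sol Lam h_L2] by blast
  then interpret bumped_wave h\<^sub>0 "grad h\<^sub>0" \<psi>\<^sub>0 "grad \<psi>\<^sub>0" \<phi> D c \<theta> \<theta>1 \<theta>2 B
    using bump by (simp add: bumped_wave_def)
  show "h\<^sub>0 x = 0" for x using trivial_wave by blast
  show "AE x in lborel. \<Lambda>\<psi>\<^sub>0 x = 0"
    by (rule Lambda_zero_of_grad_zero[OF Lam]) (use trivial_wave in blast)
qed simp

end
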